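(* Let $\beta>0$ and $0<p_1,p_2,q_1,q_2\le\infty$. Define \[ \frac{1}{\tilde p}:=\max\Big\{\frac1{p_2}-\frac1{p_1},0\Big\},\qquad \frac{1}{\tilde q}:=\max\Big\{\frac1{q_2}-\frac1{q_1},0\Big\},\qquad \sigma:=\frac{d}{2\beta}\Big(\frac1{\tilde p}+\frac1{\tilde q}\Big). \] Then there exists $C_0>0$ such that for every $t>0$ and every $f\in M^{p_1,q_1}(\mathbb R^d)$, \[ \|e^{-tH^\beta}f\|_{M^{p_2,q_2}}\le C(t)\,\|f\|_{M^{p_1,q_1}},\qquad C(t)=\begin{cases} C_0 e^{-td^\beta}, & t\ge 1,\\ C_0 t^{-\sigma}, & 0<t\le 1.\end{cases} \]
   Context: $H=-\Delta+|x|^2$ is the Hermite operator on $\mathbb R^d$. Let $\Phi_\alpha$, $\alpha\in\mathbb N^d$, be the normalized Hermite functions (an orthonormal basis of $L^2(\mathbb R^d)$ of eigenfunctions, $H\Phi_\alpha=(2|\alpha|+d)\Phi_\alpha$), and $P_kf=\sum_{|\alpha|=k}\langle f,\Phi_\alpha\rangle\Phi_\alpha$ for $f\in\mathcal S'(\mathbb R^d)$, $k\in\mathbb N$. For $\beta>0$, $t>0$, the semigroup is $e^{-tH^\beta}f=\sum_{k=0}^\infty e^{-t(2k+d)^\beta}P_kf$. For a fixed window $g\in\mathcal S(\mathbb R^d)\setminus\{0\}$, the short-time Fourier transform of $f\in\mathcal S'(\mathbb R^d)$ is $V_gf(x,\xi)=\int_{\mathbb R^d}e^{-i\xi\cdot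 y}f(y)\overline{g(y-x)}\,dy$. For $0<p,q\le\infty$, the modulation space $M^{p,q}(\mathbb R^d)$ is the set of $f\in\mathcal S'(\mathbb R^d)$ with $\|f\|_{M^{p,q}}:=\big\|\,\|V_gf(x,\xi)\|_{L^p_x}\big\|_{L^q_\xi}<\infty$ (usual modifications if $p$ or $q=\infty$); different windows give equivalent quasi-norms. *)

theory Defs
  imports "HOL-Analysis.Analysis" "HOL-Probability.Essential_Supremum"
begin

definition enn_powr :: "ennreal \<Rightarrow> real \<Rightarrow> ennreal" where
  "enn_powr a s = (if a = \<infinity> then \<infinity> else ennreal (enn2real a powr s))"

definition LpN :: "ennreal \<Rightarrow> (real^'n \<Rightarrow> ennreal) \<Rightarrow> ennreal" where
  "LpN p G = (if p = \<infinity> then esssup lborel G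
              else enn_powr (\<integral>\<^sup>+ x. enn_powr (G x) (enn2real p) \<partial>lborel) (1 / enn2real p))"

definition pdiff :: "'n::finite \<Rightarrow> (real^'n \<Rightarrow> complex) \<Rightarrow> real^'n \<Rightarrow> complex" where
  "pdiff i \<phi> x = vector_derivative (\<lambda>h::real. \<phi> (x + h *\<^sub>R axis i 1)) (at 0)"

definition pdiffs :: "'n::finite list \<Rightarrow> (real^'n \<Rightarrow> complex) \<Rightarrow> real^'n \<Rightarrow> complex" where
  "pdiffs ds \<phi> = foldr pdiff ds \<phi>"

definition schwartz :: "(real^'n::finite \<Rightarrow> complex) \<Rightarrow> bool" where
  "schwartz \<phi> \<longleftrightarrow>
     (\<forall>ds i x. (\<lambda>h::real. pdiffs ds \<phi> (x + h *\<^sub>R axis i 1)) differentiable (at 0)) \<and>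
     (\<forall>ds (N::nat). bounded (range (\<lambda>x. (1 + norm x) ^ N * norm (pdiffs ds \<phi> x))))"

definition schwartz_seminorm :: "nat \<Rightarrow> (real^'n::finite \<Rightarrow> complex) \<Rightarrow> real" where
  "schwartz_seminorm N \<phi> =
     (\<Sum>ds\<in>{ds::'n list. length ds \<le> N}. SUP x. (1 + norm x) ^ N * norm (pdiffs ds \<phi> x))"

text \<open>A tempered distribution is a linear functional on the Schwartz space which is
  continuous for the Schwartz topology (its values off the Schwartz space are irrelevant).\<close>
definition tempered :: "((real^'n::finite \<Rightarrow> complex) \<Rightarrow> complex) \<Rightarrow> bool" where
  "tempered T \<longleftrightarrow>
     (\<forall>\<phi> \<psi> a b. schwartz \<phi> \<longrightarrow> schwartz \<psi> \<longrightarrow>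
        T (\<lambda>x. a * \<phi> x + b * \<psi> x) = a * T \<phi> + b * T \<psi>) \<and>
     (\<exists>C N. \<forall>\<phi>. schwartz \<phi> \<longrightarrow> norm (T \<phi>) \<le> C * schwartz_seminorm N \<phi>)"

definition stft :: "(real^'n::finite \<Rightarrow> complex) \<Rightarrow> ((real^'n \<Rightarrow> complex) \<Rightarrow> complex)
                    \<Rightarrow> real^'n \<Rightarrow> real^'n \<Rightarrow> complex" where
  "stft g f x \<xi> = f (\<lambda>y. cis (- (\<xi> \<bullet> y)) * cnj (g (y - x)))"

definition mod_norm :: "(real^'n::finite \<Rightarrow> complex) \<Rightarrow> ennreal \<Rightarrow> ennreal
                        \<Rightarrow> ((real^'n \<Rightarrow> complex) \<Rightarrow> complex) \<Rightarrow> ennreal" where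
  "mod_norm g p q f = LpN q (\<lambda>\<xi>. LpN p (\<lambda>x. ennreal (norm (stft g f x \<xi>))))"

definition modsp :: "(real^'n::finite \<Rightarrow> complex) \<Rightarrow> ennreal \<Rightarrow> ennreal
                     \<Rightarrow> ((real^'n \<Rightarrow> complex) \<Rightarrow> complex) set" where
  "modsp g p q = {f. tempered f \<and> mod_norm g p q f < \<infinity>}"

fun hermite_poly :: "nat \<Rightarrow> real \<Rightarrow> real" where
  "hermite_poly 0 x = 1"
| "hermite_poly (Suc 0) x = 2 * x"
| "hermite_poly (Suc (Suc n)) x = 2 * x * hermite_poly (Suc n) x - 2 * real (Suc n) * hermite_poly n x"

definition hermite_fun1 :: "nat \<Rightarrow> real \<Rightarrow> real" where
  "hermite_fun1 n x = hermite_poly n x * exp (- (x\<^sup>2) / 2) / sqrt (2 ^ n * fact n * sqrt pi)"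

definition hermite_fun :: "('n::finite \<Rightarrow> nat) \<Rightarrow> real^'n \<Rightarrow> real" where
  "hermite_fun \<alpha> x = (\<Prod>i\<in>UNIV. hermite_fun1 (\<alpha> i) (x $ i))"

text \<open>e^{-tH^beta} f = sum_k e^{-t(2k+d)^beta} P_k f, as a distribution:
  phi \<mapsto> sum_k e^{-t(2k+d)^beta} sum_{|alpha|=k} <f,Phi_alpha> \<integral> Phi_alpha phi.\<close>
definition herm_semigroup :: "real \<Rightarrow> real \<Rightarrow> ((real^'n::finite \<Rightarrow> complex) \<Rightarrow> complex)
                              \<Rightarrow> ((real^'n \<Rightarrow> complex) \<Rightarrow> complex)" where
  "herm_semigroup \<beta> t f = (\<lambda>\<phi>. \<Sum>k. complex_of_real (exp (- t * (2 * real k + real CARD('n)) powr \<beta>)) *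
      (\<Sum>\<alpha>\<in>{\<alpha>::'n \<Rightarrow> nat. (\<Sum>i\<in>UNIV. \<alpha> i) = k}.
          f (\<lambda>y. complex_of_real (hermite_fun \<alpha> y)) *
          (LINT y|lborel. complex_of_real (hermite_fun \<alpha> y) * \<phi> y)))"

definition inv_exp :: "ennreal \<Rightarrow> real" where
  "inv_exp p = enn2real (1 / p)"

end

theory Submission
  imports Defs "HOL-Probability.Probability" "HOL-Computational_Algebra.Polynomial"
begin

text \<open>Against a Gaussian window the Hermite functions become monomials: the transform of
  $\Phi_\alpha$ at $w = (x, \xi)$ is, up to constants and a unimodular factor,
  $e^{-|w|^2/4} \prod_j (x_j + i \xi_j)^{\alpha_j} / \sqrt{2^{\alpha_j} \alpha_j!}$. Hence on phase
  space $e^{-tH^\beta}$ has the kernel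
  $e^{-(|w|^2+|u|^2)/4} \sum_k e^{-t(2k+d)^\beta} \zeta^k / k!$ with
  $\zeta = \frac12 \sum_j w_j \overline{u_j}$. Viewing the coefficients in $\ell^2$ of a Poisson law
  of parameter $|\zeta|$, multiplication by $|\zeta| - \zeta$ is a creation operator, whose adjoint
  is a difference operator; smoothness of the multiplier in $k$ therefore yields decay away from the
  diagonal. The kernel is at most a constant times $c\,(1+|w-u|)^{-N} (1+\tau|u|)^{-M}$, where
  $\tau = t^{1/(2\beta)}$, $c = 1$ for $t \le 1$ and $\tau = 1$, $c = e^{-td^\beta}$ for $t \ge 1$.

  So $V_g(e^{-tH^\beta}f)$ is dominated by $c\,(1+\tau|z|)^{-M}$ times an average of $|V_gf|$. As
  $|V_gf|$ is itself dominated by such averages, an inequality of Stromberg and Torchinsky type makes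
  the average bounded on mixed Lebesgue spaces also for exponents below 1. The average varies
  slowly, so Hoelder's inequality, or the embedding of larger into smaller local exponents, takes
  care of the change of exponents; the norm of the cutoff contributes
  $\tau^{-d(1/\tilde p + 1/\tilde q)} = t^{-\sigma}$.\<close>

section \<open>Weights and Lebesgue measure\<close>

text \<open>Three obstacles shape the argument. A tempered distribution acts on Schwartz functions
  only, so its interchange with a phase-space integral has to be proved in the Schwartz seminorms;
  \<open>herm_semigroup\<close> is read off from its series on wave packets. The window may be
  orthogonal to the Gaussian; it pairs nontrivially with some time-frequency shift \<open>w0\<close>
  of it, and this shift runs through all kernel estimates. The growth order of f is unknown, so the
  finiteness needed for the Stromberg-Torchinsky argument must be reached with a constant
  independent of it; hence self-domination is proved at every order n. The off-diagonal gain rests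
  on two identities: |r - z|^2 = 2 r (r - Re z) for r = |z|, whose factor r cancels the r^N that N
  creation operators cost, and 4 (s - Re \<zeta>) = |w - u|^2 for s = (|w|^2 + |u|^2)/4. For t >= 1
  the lowest eigenvalue is split off: the multiplier at t is at most exp(-(t - 1) d^\<beta>) times
  the one at 1, and absolute values suffice.\<close>

lemma weight_submult:
  fixes a b :: "'a::real_normed_vector"
  shows "1 + norm (a + b) \<le> (1 + norm a) * (1 + norm b)"
proof -
  have "norm (a + b) \<le> norm a + norm b" by (rule norm_triangle_ineq)
  moreover have "0 \<le> norm a * norm b" by simp
  moreover have "(1 + norm a) * (1 + norm b) = 1 + norm a + norm b + norm a * norm b"
    by (simp add: algebra_simps)
  ultimately show ?thesis by linarith
qed

lemma peetre:
  fixes a b :: "'a::real_normed_vector"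
  assumes "0 \<le> N"
  shows "(1 + norm a) powr (-N) \<le> (1 + norm b) powr (-N) * (1 + norm (a - b)) powr N"
proof -
  have "1 + norm b \<le> (1 + norm a) * (1 + norm (a - b))"
    using weight_submult[of a "b - a"] by (simp add: norm_minus_commute)
  then have "(1 + norm b) powr N \<le> ((1 + norm a) * (1 + norm (a - b))) powr N"
    using assms by (intro powr_mono2) auto
  also have "\<dots> = (1 + norm a) powr N * (1 + norm (a - b)) powr N"
    by (intro powr_mult)
  finally have *: "(1 + norm b) powr N \<le> (1 + norm a) powr N * (1 + norm (a - b)) powr N" .
  have "1 + norm a > 0" "1 + norm b > 0" by (smt (verit) norm_ge_zero)+
  then show ?thesis using * by (simp add: powr_minus field_simps)
qed

lemma powr_weight_antimono:
  fixes x :: "'a::real_normed_vector"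
  shows "M \<le> N \<Longrightarrow> (1 + norm x) powr (-N) \<le> (1 + norm x) powr (-M)"
  by (intro powr_mono) auto

lemma weight_powr_add:
  fixes x :: "'a::real_normed_vector"
  shows "(1 + norm x) powr a * (1 + norm x) powr b = (1 + norm x) powr (a + b)"
  by (simp add: powr_add)

text \<open>Comparison with the product of the one-dimensional functions 1/(1 + x_b^2): each factor
  1 + x_b^2 is at most (1 + norm x)^2. This asks for the exponent 2 DIM, a convention that all later
  integrability thresholds follow.\<close>

lemma integrable_weight:
  assumes "M \<ge> 2 * real DIM('a)"
  shows "integrable lborel (\<lambda>x::'a::euclidean_space. (1 + norm x) powr (-M))"
proof (rule integrableI_bounded)
  have 1: "integrable lborel (\<lambda>x::real. inverse (1 + x\<^sup>2))"
    using integrable_inverse_1_plus_square by (simp add: set_integrable_def)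
  have le: "norm ((1 + norm x) powr (-M)) \<le> (\<Prod>b\<in>Basis. inverse (1 + (x \<bullet> b)\<^sup>2))" for x :: 'a
  proof -
    have "(\<Prod>b\<in>Basis. 1 + (x \<bullet> b)\<^sup>2) \<le> (\<Prod>b\<in>(Basis::'a set). (1 + norm x)^2)"
    proof (rule prod_mono, safe)
      fix b :: 'a assume "b \<in> Basis"
      then have "(x \<bullet> b)\<^sup>2 \<le> (norm x)\<^sup>2"
        by (metis Basis_le_norm abs_ge_zero power2_abs power_mono)
      then show "1 + (x \<bullet> b)\<^sup>2 \<le> (1 + norm x)\<^sup>2" by (simp add: power2_sum add_increasing2)
    qed simp
    also have "\<dots> = (1 + norm x) ^ (2 * DIM('a))" by (simp add: power_mult)
    also have "\<dots> = (1 + norm x) powr (2 * real DIM('a))"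
      by (metis add_pos_nonneg norm_ge_zero of_nat_mult of_nat_numeral powr_realpow zero_less_one)
    also have "\<dots> \<le> (1 + norm x) powr M" using assms by (intro powr_mono) auto
    finally have *: "(\<Prod>b\<in>Basis. 1 + (x \<bullet> b)\<^sup>2) \<le> (1 + norm x) powr M" .
    have "0 < (\<Prod>b\<in>Basis. 1 + (x \<bullet> b)\<^sup>2)" by (intro prod_pos) (auto intro: add_pos_nonneg)
    then have "inverse ((1 + norm x) powr M) \<le> inverse (\<Prod>b\<in>Basis. 1 + (x \<bullet> b)\<^sup>2)"
      using * by (intro le_imp_inverse_le)
    then show ?thesis by (simp add: powr_minus prod_inversef[symmetric])
  qed
  have "(\<integral>\<^sup>+x. ennreal (norm ((1 + norm (x::'a)) powr (-M))) \<partial>lborel) \<le> (\<integral>\<^sup>+x. (\<Prod>b\<in>Basis. ennreal (inverse (1 + ((x::'a) \<bullet> b)\<^sup>2))) \<partial>lborel)"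
    by (intro nn_integral_mono, subst prod_ennreal) (auto intro!: ennreal_leI le simp del: real_norm_def)
  also have "\<dots> = (\<Prod>b\<in>(Basis::'a set). \<integral>\<^sup>+x. ennreal (inverse (1 + x\<^sup>2)) \<partial>lborel)"
    by (subst nn_integral_lborel_prod) auto
  also have "\<dots> < \<infinity>"
    using 1 by (auto simp: ennreal_prod_eq_top less_top integrable_iff_bounded power_less_top_ennreal)
  finally show "(\<integral>\<^sup>+x. ennreal (norm ((1 + norm (x::'a)) powr (-M))) \<partial>lborel) < \<infinity>" .
qed simp

lemma distr_affine:
  fixes a :: "'a::euclidean_space"
  assumes "\<bar>c\<bar> = 1"
  shows "distr lborel borel (\<lambda>x. a + c *\<^sub>R x) = lborel"
proof -
  have "c \<noteq> 0" using assms by auto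
  from lborel_affine[OF this, of a] show ?thesis using assms by (simp add: density_1)
qed

lemma lborel_integral_plus:
  fixes f :: "'a::euclidean_space \<Rightarrow> 'b::{banach,second_countable_topology}"
  assumes "f \<in> borel_measurable borel"
  shows "(\<integral>x. f (a + x) \<partial>lborel) = (\<integral>x. f x \<partial>lborel)"
  by (subst (2) lborel_distr_plus[of a, symmetric]) (use assms in \<open>simp add: integral_distr\<close>)

lemma lborel_integrable_plus:
  fixes f :: "'a::euclidean_space \<Rightarrow> 'b::{banach,second_countable_topology}"
  assumes "integrable lborel f"
  shows "integrable lborel (\<lambda>x. f (a + x))"
proof -
  have [measurable]: "f \<in> borel_measurable borel" using assms by (auto dest: borel_measurable_integrable)
  have "integrable (distr lborel borel ((+) a)) f" using assms by (simp add: lborel_distr_plus)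
  then show ?thesis by (subst (asm) integrable_distr_eq) auto
qed

lemma lborel_nn_integral_plus:
  fixes f :: "'a::euclidean_space \<Rightarrow> ennreal"
  assumes "f \<in> borel_measurable borel"
  shows "(\<integral>\<^sup>+x. f (a + x) \<partial>lborel) = (\<integral>\<^sup>+x. f x \<partial>lborel)"
  by (subst (2) lborel_distr_plus[of a, symmetric]) (use assms in \<open>simp add: nn_integral_distr\<close>)

lemma lborel_nn_integral_minus:
  fixes f :: "'a::euclidean_space \<Rightarrow> ennreal"
  assumes "f \<in> borel_measurable borel"
  shows "(\<integral>\<^sup>+x. f (a - x) \<partial>lborel) = (\<integral>\<^sup>+x. f x \<partial>lborel)"
  by (subst (2) distr_affine[of "-1" a, symmetric]) (use assms in \<open>simp_all add: nn_integral_distr\<close>)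

lemma lborel_integral_minus:
  fixes f :: "'a::euclidean_space \<Rightarrow> 'b::{banach,second_countable_topology}"
  assumes "f \<in> borel_measurable borel"
  shows "(\<integral>x. f (a - x) \<partial>lborel) = (\<integral>x. f x \<partial>lborel)"
  by (subst (2) distr_affine[of "-1" a, symmetric]) (use assms in \<open>simp_all add: integral_distr\<close>)

lemma has_vector_derivative_at_iff:
  "(f has_vector_derivative D) (at a) \<longleftrightarrow> ((\<lambda>h. (f h - f a) /\<^sub>R (h - a)) \<longlongrightarrow> D) (at (a::real))"
proof -
  have eq: "norm (f y - f a - (y - a) *\<^sub>R D) / norm (y - a) = norm ((f y - f a) /\<^sub>R (y - a) - D)"
    if "y \<noteq> a" for y
  proof -
    have "(f y - f a) /\<^sub>R (y - a) - D = (f y - f a - (y - a) *\<^sub>R D) /\<^sub>R (y - a)"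
      using that by (simp add: scaleR_diff_right)
    then show ?thesis by (simp add: divide_inverse_commute)
  qed
  have "(f has_vector_derivative D) (at a) \<longleftrightarrow>
      ((\<lambda>y. norm (f y - f a - (y - a) *\<^sub>R D) / norm (y - a)) \<longlongrightarrow> 0) (at a)"
    by (simp add: has_vector_derivative_def has_derivative_iff_norm bounded_linear_scaleR_left)
  also have "\<dots> \<longleftrightarrow> ((\<lambda>y. norm ((f y - f a) /\<^sub>R (y - a) - D)) \<longlongrightarrow> 0) (at a)"
    by (intro filterlim_cong) (auto simp: eventually_at_filter eq[unfolded real_norm_def] intro!: always_eventually)
  also have "\<dots> \<longleftrightarrow> ((\<lambda>h. (f h - f a) /\<^sub>R (h - a)) \<longlongrightarrow> D) (at a)"
    by (simp only: tendsto_norm_zero_iff Lim_null[symmetric])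
  finally show ?thesis .
qed

text \<open>The mean value inequality on [-1, 1] bounds the difference quotients by
  \<open>D\<close>, so dominated convergence applies along every null sequence of steps, and
  sequences determine the limit at 0.\<close>

lemma has_vector_derivative_integral:
  fixes k :: "'a \<Rightarrow> real \<Rightarrow> complex"
  assumes int: "\<And>h. integrable M (\<lambda>w. k w h)"
    and der: "\<And>w h. w \<in> space M \<Longrightarrow> \<bar>h\<bar> \<le> 1 \<Longrightarrow> (k w has_vector_derivative k' w h) (at h)"
    and D: "integrable M D" "\<And>w h. w \<in> space M \<Longrightarrow> \<bar>h\<bar> \<le> 1 \<Longrightarrow> norm (k' w h) \<le> D w"
  shows "((\<lambda>h. \<integral>w. k w h \<partial>M) has_vector_derivative (\<integral>w. k' w 0 \<partial>M)) (at 0)"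
    and "integrable M (\<lambda>w. k' w 0)"
proof -
  define q where "q h w = (k w h - k w 0) /\<^sub>R h" for h w
  have [measurable]: "(\<lambda>w. k w h) \<in> borel_measurable M" for h using int by auto
  have qm [measurable]: "q h \<in> borel_measurable M" for h unfolding q_def by measurable
  have ql: "(\<lambda>n. q (s n) w) \<longlonglongrightarrow> k' w 0" if "w \<in> space M" "s \<longlonglongrightarrow> 0" "\<And>n. s n \<noteq> 0" for w s
  proof -
    have "((\<lambda>h. q h w) \<longlongrightarrow> k' w 0) (at 0)"
      using der[OF that(1), of 0] by (simp add: has_vector_derivative_at_iff q_def)
    then show ?thesis using that(2,3) by (auto simp: tendsto_at_iff_sequentially o_def)
  qed
  have qb: "norm (q h w) \<le> D w" if "w \<in> space M" "\<bar>h\<bar> \<le> 1" for h w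
  proof -
    have D0: "0 \<le> D w" by (rule order_trans[OF norm_ge_zero D(2)[OF that(1), of 0]]) simp
    have "norm (k w h - k w 0) \<le> D w * norm (h - 0)"
    proof (rule differentiable_bound[where S="{-1..1}" and f'="\<lambda>h x. x *\<^sub>R k' w h"])
      show "(k w has_derivative (\<lambda>x. x *\<^sub>R k' w h)) (at h within {-1..1})" if "h \<in> {-1..1}" for h
        using der[OF \<open>w \<in> space M\<close>, of h] that by (auto simp: has_vector_derivative_def intro: has_derivative_at_withinI)
      show "onorm (\<lambda>x. x *\<^sub>R k' w h) \<le> D w" if "h \<in> {-1..1}" for h
        using D(2)[OF \<open>w \<in> space M\<close>, of h] that D0
        by (intro onorm_le) (auto simp: mult.commute[of "D w"] intro!: mult_left_mono)
    qed (use that in auto)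
    moreover have "norm (q h w) = norm (k w h - k w 0) / \<bar>h\<bar>"
      by (simp add: q_def divide_inverse_commute)
    ultimately show ?thesis using D0 by (cases "h = 0") (auto simp: pos_divide_le_eq)
  qed
  have dc: "(\<lambda>n. \<integral>w. q (s n) w \<partial>M) \<longlonglongrightarrow> (\<integral>w. k' w 0 \<partial>M)" and ik: "integrable M (\<lambda>w. k' w 0)"
    if s: "s \<longlonglongrightarrow> 0" "\<And>n. s n \<noteq> 0" "\<And>n. \<bar>s n\<bar> \<le> 1" for s
  proof -
    have m: "(\<lambda>w. k' w 0) \<in> borel_measurable M"
      by (rule borel_measurable_LIMSEQ_metric[where f="\<lambda>n. q (s n)"]) (use ql s in auto)
    show "(\<lambda>n. \<integral>w. q (s n) w \<partial>M) \<longlonglongrightarrow> (\<integral>w. k' w 0 \<partial>M)"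
      by (rule integral_dominated_convergence[where w=D]) (use m D ql qb s in auto)
    show "integrable M (\<lambda>w. k' w 0)"
      by (rule integrable_dominated_convergence[where w=D and s="\<lambda>n. q (s n)"]) (use m D ql qb s in auto)
  qed
  show "integrable M (\<lambda>w. k' w 0)"
    by (rule ik[of "\<lambda>n. inverse (real (Suc n))"], rule LIMSEQ_inverse_real_of_nat)
      (auto simp: inverse_le_1_iff)
  have qi: "(\<integral>w. q h w \<partial>M) = ((\<integral>w. k w h \<partial>M) - (\<integral>w. k w 0 \<partial>M)) /\<^sub>R h" for h
    unfolding q_def using int by simp
  have "((\<lambda>h. \<integral>w. q h w \<partial>M) \<longlongrightarrow> (\<integral>w. k' w 0 \<partial>M)) (at 0)"
  proof (subst tendsto_at_iff_sequentially, intro allI impI)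
    fix s :: "nat \<Rightarrow> real" assume s: "\<forall>i. s i \<in> UNIV - {0}" "s \<longlonglongrightarrow> 0"
    \<comment> \<open>The domination covers steps of size at most 1 only, so a given null sequence
      is used from the index \<open>N\<close> on.\<close>
    then have "\<exists>N. \<forall>n\<ge>N. norm (s n - 0) < 1" unfolding LIMSEQ_iff by (meson zero_less_one)
    then obtain N where N: "\<And>n. n \<ge> N \<Longrightarrow> \<bar>s n\<bar> < 1" by auto
    have "(\<lambda>n. \<integral>w. q (s (n + N)) w \<partial>M) \<longlonglongrightarrow> (\<integral>w. k' w 0 \<partial>M)"
      by (rule dc) (use s N in \<open>auto intro: LIMSEQ_ignore_initial_segment less_imp_le\<close>)
    then show "((\<lambda>h. \<integral>w. q h w \<partial>M) \<circ> s) \<longlonglongrightarrow> (\<integral>w. k' w 0 \<partial>M)"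
      unfolding o_def by (rule LIMSEQ_offset)
  qed
  then show "((\<lambda>h. \<integral>w. k w h \<partial>M) has_vector_derivative (\<integral>w. k' w 0 \<partial>M)) (at 0)"
    by (simp add: qi has_vector_derivative_at_iff)
qed

section \<open>Power series with a slowly varying multiplier\<close>

text \<open>Coefficient sequences for which the exponential series converges everywhere. The class
  is stable under products, shifts and multiplication by \<open>real k\<close>, hence under
  \<open>Lop\<close> and \<open>Ladj\<close>, and serves as the common summability side
  condition.\<close>

definition egrow :: "(nat \<Rightarrow> real) \<Rightarrow> bool" where
  "egrow u \<longleftrightarrow> (\<exists>A\<ge>0. \<exists>B\<ge>1. \<forall>k. \<bar>u k\<bar> \<le> A * B ^ k)"

lemma egrowI: "0 \<le> A \<Longrightarrow> 1 \<le> B \<Longrightarrow> (\<And>k. \<bar>u k\<bar> \<le> A * B ^ k) \<Longrightarrow> egrow u"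
  unfolding egrow_def by blast

lemma egrow_const: "egrow (\<lambda>_. c)"
  by (rule egrowI[of "\<bar>c\<bar>" 1]) auto

lemma egrow_bounded: "(\<And>k. \<bar>u k\<bar> \<le> B) \<Longrightarrow> egrow u"
  by (rule egrowI[of "\<bar>B\<bar>" 1]) (force intro: order_trans)+

lemma egrow_of_nat: "egrow real"
proof (rule egrowI[of 1 2])
  show "\<bar>real k\<bar> \<le> 1 * 2 ^ k" for k
    using of_nat_less_two_power[of k, where 'a=real] by simp
qed auto

lemma egrow_mult: assumes "egrow u" "egrow v" shows "egrow (\<lambda>k. u k * v k)"
proof -
  from assms obtain A B A' B' where *: "A \<ge> 0" "B \<ge> 1" "\<And>k. \<bar>u k\<bar> \<le> A * B ^ k"
     "A' \<ge> 0" "B' \<ge> 1" "\<And>k. \<bar>v k\<bar> \<le> A' * B' ^ k" unfolding egrow_def by blast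
  show ?thesis
  proof (rule egrowI[of "A * A'" "B * B'"])
    show "1 \<le> B * B'" using *(2,5) by (metis mult_mono mult_1 zero_le_one order_trans)
    show "\<bar>u k * v k\<bar> \<le> A * A' * (B * B') ^ k" for k
    proof -
      have "\<bar>u k * v k\<bar> \<le> (A * B ^ k) * (A' * B' ^ k)"
        unfolding abs_mult using * by (intro mult_mono) auto
      then show ?thesis by (simp add: power_mult_distrib ac_simps)
    qed
  qed (use * in auto)
qed

lemma egrow_add: assumes "egrow u" "egrow v" shows "egrow (\<lambda>k. u k + v k)"
proof -
  from assms obtain A B A' B' where *: "A \<ge> 0" "B \<ge> 1" "\<And>k. \<bar>u k\<bar> \<le> A * B ^ k"
     "A' \<ge> 0" "B' \<ge> 1" "\<And>k. \<bar>v k\<bar> \<le> A' * B' ^ k" unfolding egrow_def by blast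
  show ?thesis
  proof (rule egrowI[of "A + A'" "max B B'"])
    show "\<bar>u k + v k\<bar> \<le> (A + A') * max B B' ^ k" for k
    proof -
      have "A * B ^ k \<le> A * max B B' ^ k" "A' * B' ^ k \<le> A' * max B B' ^ k"
        using * by (auto intro!: mult_left_mono power_mono)
      then show ?thesis using *(3)[of k] *(6)[of k] by (simp add: algebra_simps)
    qed
  qed (use * in auto)
qed

lemma egrow_cmult: "egrow u \<Longrightarrow> egrow (\<lambda>k. c * u k)"
  by (rule egrow_mult[OF egrow_const])

lemma egrow_diff: "egrow u \<Longrightarrow> egrow v \<Longrightarrow> egrow (\<lambda>k. u k - v k)"
  using egrow_add[of u "\<lambda>k. (-1) * v k"] egrow_cmult[of v "-1"] by simp

lemma egrow_Suc: assumes "egrow u" shows "egrow (\<lambda>k. u (Suc k))"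
proof -
  from assms obtain A B where *: "A \<ge> 0" "B \<ge> 1" "\<And>k. \<bar>u k\<bar> \<le> A * B ^ k" unfolding egrow_def by blast
  show ?thesis
    by (rule egrowI[of "A * B" B]) (use * in \<open>auto simp: ac_simps dest: spec[of _ "Suc _"] intro: order_trans[OF *(3)]\<close>)
qed

lemma egrow_pred: assumes "egrow u" shows "egrow (\<lambda>k. u (k - 1))"
proof -
  from assms obtain A B where *: "A \<ge> 0" "B \<ge> 1" "\<And>k. \<bar>u k\<bar> \<le> A * B ^ k" unfolding egrow_def by blast
  have "\<bar>u (k - 1)\<bar> \<le> A * B ^ k" for k
    by (rule order_trans[OF *(3)]) (use * in \<open>auto intro!: mult_left_mono power_increasing\<close>)
  then show ?thesis using * by (intro egrowI[of A B]) auto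
qed

lemma egrow_abs: "egrow u \<Longrightarrow> egrow (\<lambda>k. \<bar>u k\<bar>)"
  unfolding egrow_def by simp

section \<open>Expectations under the Poisson law\<close>

definition pw :: "real \<Rightarrow> nat \<Rightarrow> real" where
  "pw r k = exp (-r) * r ^ k / fact k"

lemma pw_nonneg: "0 \<le> r \<Longrightarrow> 0 \<le> pw r k"
  by (simp add: pw_def)

lemma pw_Suc: "real (Suc k) * pw r (Suc k) = r * pw r k"
  by (simp add: pw_def fact_Suc field_simps del: of_nat_Suc)

lemma exp_pw: "exp r * pw r k = r ^ k / fact k"
  by (simp add: pw_def exp_minus)

definition pois :: "real \<Rightarrow> (nat \<Rightarrow> real) \<Rightarrow> real" where
  "pois r u = (\<Sum>k. u k * pw r k)"

lemma summable_pois: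
  assumes "egrow u" "0 \<le> r"
  shows "summable (\<lambda>k. u k * pw r k)"
proof -
  from assms obtain A B where *: "A \<ge> 0" "B \<ge> 1" "\<And>k. \<bar>u k\<bar> \<le> A * B ^ k" unfolding egrow_def by blast
  have "summable (\<lambda>k. (A * exp (-r)) * ((B * r) ^ k /\<^sub>R fact k))"
    by (intro summable_mult summable_exp_generic)
  then have s: "summable (\<lambda>k. A * B ^ k * (exp (-r) * r ^ k / fact k))"
    by (simp add: power_mult_distrib divide_inverse ac_simps)
  show ?thesis unfolding pw_def
  proof (rule summable_comparison_test'[OF s, of 0])
    show "norm (u k * (exp (-r) * r ^ k / fact k)) \<le> A * B ^ k * (exp (-r) * r ^ k / fact k)" for k
      using *(3)[of k] assms(2) by (auto simp: abs_mult intro!: mult_right_mono divide_right_mono)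
  qed
qed

lemma pois_mono:
  assumes "egrow u" "egrow v" "0 \<le> r" "\<And>k. u k \<le> v k"
  shows "pois r u \<le> pois r v"
  unfolding pois_def using assms
  by (intro suminf_le summable_pois) (auto intro!: mult_right_mono pw_nonneg)

lemma pois_add: "egrow u \<Longrightarrow> egrow v \<Longrightarrow> 0 \<le> r \<Longrightarrow> pois r (\<lambda>k. u k + v k) = pois r u + pois r v"
  unfolding pois_def by (subst suminf_add) (auto intro: summable_pois simp: algebra_simps)

lemma pois_cmult: "egrow u \<Longrightarrow> 0 \<le> r \<Longrightarrow> pois r (\<lambda>k. c * u k) = c * pois r u"
  unfolding pois_def by (subst suminf_mult[symmetric]) (auto intro: summable_pois simp: ac_simps)

lemma pois_diff: "egrow u \<Longrightarrow> egrow v \<Longrightarrow> 0 \<le> r \<Longrightarrow> pois r (\<lambda>k. u k - v k) = pois r u - pois r v"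
  using pois_add[of u "\<lambda>k. (-1) * v k" r] pois_cmult[of v r "-1"] egrow_cmult[of v "-1"] by simp

lemma pois_const: "0 \<le> r \<Longrightarrow> pois r (\<lambda>_. c) = c"
proof -
  have "(\<Sum>k. c * exp (-r) * (r ^ k /\<^sub>R fact k)) = c * exp (-r) * exp r"
    using suminf_mult[OF summable_exp_generic[of r], of "c * exp (-r)"] by (simp add: exp_def)
  then show ?thesis by (simp add: pois_def pw_def exp_minus divide_inverse ac_simps)
qed

text \<open>Stein-Chen identity of the Poisson law: the term at 0 vanishes, and
  \<open>pw_Suc\<close> turns the factor \<open>real k\<close> into a shift. All summation by parts
  below goes back to it.\<close>

lemma pois_shift:
  assumes "egrow w" "0 \<le> r"
  shows "pois r (\<lambda>k. real k * w k) = r * pois r (\<lambda>k. w (Suc k))"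
proof -
  let ?f = "\<lambda>k. (real k * w k) * pw r k"
  have "summable ?f" by (rule summable_pois) (auto intro: egrow_mult egrow_of_nat assms)
  then have "suminf ?f = ?f 0 + (\<Sum>k. ?f (Suc k))"
    by (subst suminf_split_head) (simp_all only: add_diff_eq add_diff_cancel_left')
  also have "(\<Sum>k. ?f (Suc k)) = (\<Sum>k. r * (w (Suc k) * pw r k))"
  proof (rule arg_cong[where f=suminf], rule ext)
    show "?f (Suc k) = r * (w (Suc k) * pw r k)" for k
    proof -
      have "?f (Suc k) = w (Suc k) * (real (Suc k) * pw r (Suc k))" by (simp only: ac_simps)
      then show ?thesis unfolding pw_Suc by (simp only: ac_simps)
    qed
  qed
  also have "\<dots> = r * pois r (\<lambda>k. w (Suc k))"
    unfolding pois_def by (rule suminf_mult[OF summable_pois[OF egrow_Suc[OF assms(1)] assms(2)]])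
  finally show ?thesis by (simp add: pois_def)
qed

text \<open>The variance of \<open>\<bar>u k\<bar>\<close> about its mean \<open>c\<close> is
  nonnegative. This leads from absolute sums, which bound the series, to the square means in which
  the operator calculus takes place.\<close>

lemma pois_abs_square:
  assumes u: "egrow u" and r: "0 \<le> r"
  shows "(pois r (\<lambda>k. \<bar>u k\<bar>))\<^sup>2 \<le> pois r (\<lambda>k. (u k)\<^sup>2)"
proof -
  define c where "c = pois r (\<lambda>k. \<bar>u k\<bar>)"
  note eg = egrow_abs[OF u] egrow_mult[OF u u] egrow_const egrow_cmult
  have "0 = pois r (\<lambda>_. 0)" using r by (simp add: pois_const)
  also have "\<dots> \<le> pois r (\<lambda>k. (u k * u k + (- 2 * c) * \<bar>u k\<bar>) + c\<^sup>2)"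
  proof (rule pois_mono)
    show "0 \<le> u k * u k + (- 2 * c) * \<bar>u k\<bar> + c\<^sup>2" for k
      using zero_le_power2[of "\<bar>u k\<bar> - c"] by (simp add: power2_eq_square algebra_simps)
  qed (intro egrow_add eg r egrow_const)+
  also have "\<dots> = (pois r (\<lambda>k. u k * u k) + (-2 * c) * c) + c\<^sup>2"
    by (simp only: pois_add[OF egrow_add[OF eg(2) egrow_cmult[OF eg(1)]] egrow_const r]
        pois_add[OF eg(2) egrow_cmult[OF eg(1)] r] pois_cmult[OF eg(1) r] pois_const[OF r] c_def)
  finally show ?thesis by (simp add: c_def power2_eq_square)
qed

text \<open>Multiplying the series \<open>Tser u z\<close> by \<open>r - z\<close> applies \<open>Lop r\<close> to the coefficients.
  \<open>Ladj r\<close> is the adjoint of \<open>Lop r\<close> for the Poisson expectation, and their commutator is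
  multiplication by \<open>r\<close>, as for creation and annihilation operators; this gives the gain in
  powers of \<open>r - z\<close>.\<close>

definition Lop :: "real \<Rightarrow> (nat \<Rightarrow> real) \<Rightarrow> nat \<Rightarrow> real" where
  "Lop r u = (\<lambda>k. r * u k - real k * u (k - 1))"

definition Ladj :: "real \<Rightarrow> (nat \<Rightarrow> real) \<Rightarrow> nat \<Rightarrow> real" where
  "Ladj r u = (\<lambda>k. r * (u k - u (Suc k)))"

lemma egrow_Lop: "egrow u \<Longrightarrow> egrow (Lop r u)"
  unfolding Lop_def by (rule egrow_diff[OF egrow_cmult egrow_mult[OF egrow_of_nat egrow_pred]])

lemma egrow_Ladj: "egrow u \<Longrightarrow> egrow (Ladj r u)"
  unfolding Ladj_def by (rule egrow_cmult[OF egrow_diff[OF _ egrow_Suc]])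

lemma egrow_Lop_pow: "egrow u \<Longrightarrow> egrow ((Lop r ^^ n) u)"
  by (induction n) (auto intro: egrow_Lop)

text \<open>\<open>pois_shift\<close> trades the factor \<open>real k\<close> of \<open>Lop\<close>
  for a shift: the predecessor of \<open>u\<close> becomes \<open>u\<close> and \<open>v\<close>
  becomes its successor shift.\<close>

lemma pois_adjoint:
  assumes "egrow u" "egrow v" "0 \<le> r"
  shows "pois r (\<lambda>k. Lop r u k * v k) = pois r (\<lambda>k. u k * Ladj r v k)"
proof -
  have 1: "egrow (\<lambda>k. u (k-1) * v k)" "egrow (\<lambda>k. r * (u k * v k))"
    "egrow (\<lambda>k. u k * v (Suc k))" "egrow (\<lambda>k. real k * (u (k-1) * v k))"
    by (rule egrow_mult[OF egrow_pred[OF assms(1)] assms(2)] egrow_cmult[OF egrow_mult[OF assms(1,2)]]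
      egrow_mult[OF assms(1) egrow_Suc[OF assms(2)]] egrow_mult[OF egrow_of_nat egrow_mult[OF egrow_pred[OF assms(1)] assms(2)]])+
  have "pois r (\<lambda>k. Lop r u k * v k) = pois r (\<lambda>k. r * (u k * v k) - real k * (u (k-1) * v k))"
    by (simp add: Lop_def algebra_simps)
  also have "\<dots> = pois r (\<lambda>k. r * (u k * v k)) - pois r (\<lambda>k. r * (u k * v (Suc k)))"
  proof -
    have "pois r (\<lambda>k. real k * (u (k-1) * v k)) = r * pois r (\<lambda>k. u (Suc k - 1) * v (Suc k))"
      by (rule pois_shift[OF 1(1) assms(3)])
    also have "\<dots> = pois r (\<lambda>k. r * (u k * v (Suc k)))"
      using pois_cmult[OF 1(3) assms(3), of r] by simp
    finally show ?thesis using pois_diff[OF 1(2) 1(4) assms(3)] by simp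
  qed
  also have "\<dots> = pois r (\<lambda>k. r * (u k * v k) - r * (u k * v (Suc k)))"
    by (rule pois_diff[OF 1(2) egrow_cmult[OF 1(3)] assms(3), symmetric])
  also have "\<dots> = pois r (\<lambda>k. u k * Ladj r v k)"
    by (simp add: Ladj_def algebra_simps)
  finally show ?thesis .
qed

text \<open>Canonical commutation relation. At 0 the truncated predecessor reads \<open>u 0\<close>,
  but \<open>Lop\<close> multiplies it by \<open>real 0\<close>, so no boundary term
  appears.\<close>

lemma Ladj_Lop: "Ladj r (Lop r u) = (\<lambda>k. Lop r (Ladj r u) k + r * u k)"
proof
  fix k show "Ladj r (Lop r u) k = Lop r (Ladj r u) k + r * u k"
    by (cases k) (simp_all add: Ladj_def Lop_def algebra_simps)
qed

lemma Lop_add: "Lop r (\<lambda>k. u k + v k) = (\<lambda>k. Lop r u k + Lop r v k)"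
  and Lop_cmult: "Lop r (\<lambda>k. c * u k) = (\<lambda>k. c * Lop r u k)"
  by (auto simp: Lop_def fun_eq_iff algebra_simps)

text \<open>Commuting \<open>Ladj r\<close> past \<open>Suc n\<close> factors \<open>Lop r\<close>
  collects one multiple of \<open>r\<close> per factor.\<close>

lemma Ladj_Lop_pow:
  "Ladj r ((Lop r ^^ Suc n) u) = (\<lambda>k. (Lop r ^^ Suc n) (Ladj r u) k + (real (Suc n) * r) * (Lop r ^^ n) u k)"
proof (induction n)
  case 0
  then show ?case by (simp add: Ladj_Lop)
next
  case (Suc n)
  have "Ladj r ((Lop r ^^ Suc (Suc n)) u) = (\<lambda>k. Lop r (Ladj r ((Lop r ^^ Suc n) u)) k + r * (Lop r ^^ Suc n) u k)"
    using Ladj_Lop[of r "(Lop r ^^ Suc n) u"] by simp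
  then show ?case unfolding Suc.IH Lop_add Lop_cmult by (simp add: fun_eq_iff algebra_simps)
qed

definition pois_square :: "real \<Rightarrow> (nat \<Rightarrow> real) \<Rightarrow> real" where
  "pois_square r u = pois r (\<lambda>k. (u k)\<^sup>2)"

text \<open>Adjointness followed by the commutation relation: the counterpart of |a* u|^2 = |a u|^2
  + r |u|^2 for creation and annihilation operators.\<close>

lemma pois_square_Lop:
  assumes "egrow u" "0 \<le> r"
  shows "pois_square r (Lop r u) = pois_square r (Ladj r u) + r * pois_square r u"
proof -
  have e1: "egrow (\<lambda>k. Lop r (Ladj r u) k * u k)"
    by (rule egrow_mult[OF egrow_Lop[OF egrow_Ladj[OF assms(1)]] assms(1)])
  have e2: "egrow (\<lambda>k. u k * u k)" by (rule egrow_mult[OF assms(1) assms(1)])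
  have "pois_square r (Lop r u) = pois r (\<lambda>k. u k * Ladj r (Lop r u) k)"
    unfolding pois_square_def power2_eq_square by (rule pois_adjoint[OF assms(1) egrow_Lop[OF assms(1)] assms(2)])
  also have "(\<lambda>k. u k * Ladj r (Lop r u) k) = (\<lambda>k. Lop r (Ladj r u) k * u k + r * (u k * u k))"
    unfolding Ladj_Lop by (simp add: algebra_simps)
  also have "pois r \<dots> = pois r (\<lambda>k. Lop r (Ladj r u) k * u k) + r * pois r (\<lambda>k. u k * u k)"
    unfolding pois_cmult[OF e2 assms(2), symmetric] by (rule pois_add[OF e1 egrow_cmult[OF e2] assms(2)])
  also have "pois r (\<lambda>k. Lop r (Ladj r u) k * u k) = pois_square r (Ladj r u)"
    unfolding pois_square_def power2_eq_square by (rule pois_adjoint[OF egrow_Ladj[OF assms(1)] assms(1) assms(2)])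
  finally show ?thesis by (simp add: pois_square_def power2_eq_square)
qed

lemma pois_square_add_le:
  assumes "egrow u" "egrow v" "0 \<le> r"
  shows "pois_square r (\<lambda>k. u k + c * v k) \<le> 2 * pois_square r u + 2 * c\<^sup>2 * pois_square r v"
proof -
  have u2: "egrow (\<lambda>k. u k * u k)" by (rule egrow_mult[OF assms(1) assms(1)])
  have v2: "egrow (\<lambda>k. v k * v k)" by (rule egrow_mult[OF assms(2) assms(2)])
  have uv: "egrow (\<lambda>k. u k + c * v k)" by (rule egrow_add[OF assms(1) egrow_cmult[OF assms(2)]])
  have "pois r (\<lambda>k. (u k + c * v k) * (u k + c * v k)) \<le> pois r (\<lambda>k. 2 * (u k * u k) + (2 * c\<^sup>2) * (v k * v k))"
  proof (rule pois_mono[OF egrow_mult[OF uv uv] egrow_add[OF egrow_cmult[OF u2] egrow_cmult[OF v2]] assms(3)])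
    show "(u k + c * v k) * (u k + c * v k) \<le> 2 * (u k * u k) + 2 * c\<^sup>2 * (v k * v k)" for k
      using zero_le_power2[of "u k - c * v k"] by (simp add: power2_eq_square algebra_simps)
  qed
  also have "\<dots> = pois r (\<lambda>k. 2 * (u k * u k)) + pois r (\<lambda>k. (2 * c\<^sup>2) * (v k * v k))"
    by (rule pois_add[OF egrow_cmult[OF u2] egrow_cmult[OF v2] assms(3)])
  also have "\<dots> = 2 * pois r (\<lambda>k. u k * u k) + (2 * c\<^sup>2) * pois r (\<lambda>k. v k * v k)"
    by (simp only: pois_cmult[OF u2 assms(3)] pois_cmult[OF v2 assms(3)])
  finally show ?thesis by (simp add: pois_square_def power2_eq_square)
qed

text \<open>Each \<open>Lop r\<close> costs only the square root of \<open>r\<close>, provided each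
  \<open>Ladj r\<close> does. By \<open>pois_square_Lop\<close> one factor \<open>Lop r\<close> is
  replaced by \<open>Ladj r\<close>, which is then commuted through the others. This lowers the
  power by one or two, whence the strong induction with two base cases. The constant depends on
  \<open>N\<close> alone.\<close>

lemma pois_square_Lop_pow_bound:
  "\<exists>C\<ge>0. \<forall>r\<ge>0. \<forall>u A. egrow u \<longrightarrow> 0 \<le> A \<longrightarrow> (\<forall>i\<le>N. pois_square r ((Ladj r ^^ i) u) \<le> A * r ^ i)
     \<longrightarrow> pois_square r ((Lop r ^^ N) u) \<le> C * A * r ^ N"
proof (induction N rule: less_induct)
  case (less N)
  consider "N = 0" | "N = Suc 0" | n where "N = Suc (Suc n)" by (metis nat.exhaust)
  then show ?case
  proof cases
    case 1 then show ?thesis by (intro exI[of _ 1]) auto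
  next
    case 2
    have "pois_square r ((Lop r ^^ N) u) \<le> 2 * A * r ^ N" if "r \<ge> 0" "egrow u" "0 \<le> A"
      "\<forall>i\<le>N. pois_square r ((Ladj r ^^ i) u) \<le> A * r ^ i" for r u A
    proof -
      have "pois_square r u \<le> A" "pois_square r (Ladj r u) \<le> A * r" using that(4)[rule_format, of 0] that(4)[rule_format, of 1] 2 by auto
      then have "r * pois_square r u \<le> r * A" using that by (intro mult_left_mono) auto
      then have "pois_square r (Ladj r u) + r * pois_square r u \<le> A * r + r * A"
        using \<open>pois_square r (Ladj r u) \<le> A * r\<close> by (rule add_mono[rotated])
      moreover have "A * r + r * A = 2 * A * r" by (simp add: algebra_simps)
      ultimately show ?thesis using that 2 by (simp add: pois_square_Lop)
    qed
    then show ?thesis by (intro exI[of _ 2]) auto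
  next
    case (3 n)
    obtain C1 where C1: "C1 \<ge> 0" "\<And>r u A. r \<ge> 0 \<Longrightarrow> egrow u \<Longrightarrow> 0 \<le> A \<Longrightarrow> (\<And>i. i\<le>Suc n \<Longrightarrow> pois_square r ((Ladj r ^^ i) u) \<le> A * r ^ i)
     \<Longrightarrow> pois_square r ((Lop r ^^ Suc n) u) \<le> C1 * A * r ^ Suc n" using less[of "Suc n"] 3 by auto
    obtain C0 where C0: "C0 \<ge> 0" "\<And>r u A. r \<ge> 0 \<Longrightarrow> egrow u \<Longrightarrow> 0 \<le> A \<Longrightarrow> (\<And>i. i\<le>n \<Longrightarrow> pois_square r ((Ladj r ^^ i) u) \<le> A * r ^ i)
     \<Longrightarrow> pois_square r ((Lop r ^^ n) u) \<le> C0 * A * r ^ n" using less[of n] 3 by auto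
    define c where "c = real (Suc n)"
    have "pois_square r ((Lop r ^^ N) u) \<le> (3 * C1 + 2 * c\<^sup>2 * C0) * A * r ^ N" if "r \<ge> 0" "egrow u" "0 \<le> A"
      "\<forall>i\<le>N. pois_square r ((Ladj r ^^ i) u) \<le> A * r ^ i" for r u A
    proof -
      have h: "pois_square r ((Ladj r ^^ i) u) \<le> A * r ^ i" if "i \<le> N" for i using \<open>\<forall>i\<le>N. _ i\<close> that by auto
      \<comment> \<open>\<open>Ladj r u\<close> satisfies the hypotheses one index lower, with
        \<open>A * r\<close> in place of \<open>A\<close>.\<close>
      have a: "pois_square r ((Lop r ^^ Suc n) (Ladj r u)) \<le> C1 * (A * r) * r ^ Suc n"
      proof (rule C1(2))
        show "pois_square r ((Ladj r ^^ i) (Ladj r u)) \<le> A * r * r ^ i" if "i \<le> Suc n" for i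
          using h[of "Suc i"] that 3 by (simp add: funpow_Suc_right del: funpow.simps)
      qed (use that egrow_Ladj in auto)
      have b: "pois_square r ((Lop r ^^ Suc n) u) \<le> C1 * A * r ^ Suc n"
        by (rule C1(2)) (use that h 3 in auto)
      have d: "pois_square r ((Lop r ^^ n) u) \<le> C0 * A * r ^ n"
        by (rule C0(2)) (use that h 3 in auto)
      have "pois_square r ((Lop r ^^ N) u) = pois_square r (Ladj r ((Lop r ^^ Suc n) u)) + r * pois_square r ((Lop r ^^ Suc n) u)"
        using pois_square_Lop[OF egrow_Lop_pow[OF that(2), where r=r and n="Suc n"] that(1)] 3 by simp
      also have "\<dots> \<le> (2 * pois_square r ((Lop r ^^ Suc n) (Ladj r u)) + 2 * (c * r)\<^sup>2 * pois_square r ((Lop r ^^ n) u))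
          + r * pois_square r ((Lop r ^^ Suc n) u)"
        unfolding Ladj_Lop_pow c_def using that
        by (intro add_mono pois_square_add_le egrow_Lop_pow egrow_Ladj order_refl)
      also have "\<dots> \<le> (2 * (C1 * (A * r) * r ^ Suc n) + 2 * (c * r)\<^sup>2 * (C0 * A * r ^ n)) + r * (C1 * A * r ^ Suc n)"
        using a b d that by (intro add_mono mult_left_mono) auto
      also have "\<dots> = (3 * C1 + 2 * c\<^sup>2 * C0) * A * r ^ N"
        unfolding 3 by (simp add: algebra_simps power2_eq_square)
      finally show ?thesis .
    qed
    then show ?thesis using C0(1) C1(1) by (intro exI[of _ "3 * C1 + 2 * c\<^sup>2 * C0"]) auto
  qed
qed

section \<open>Exponential generating series and their decay off the positive axis\<close>

definition Tser :: "(nat \<Rightarrow> real) \<Rightarrow> complex \<Rightarrow> complex" where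
  "Tser u z = (\<Sum>k. of_real (u k) * z ^ k / fact k)"

lemma norm_Tser_term: "norm (of_real (u k) * z ^ k / fact k :: complex) = \<bar>u k\<bar> * norm z ^ k / fact k"
  by (simp add: norm_mult norm_divide norm_power)

lemma summable_norm_Tser:
  assumes "egrow u"
  shows "summable (\<lambda>k. norm (of_real (u k) * z ^ k / fact k :: complex))"
proof -
  have "summable (\<lambda>k. \<bar>u k\<bar> * (exp (norm z) * pw (norm z) k))"
    using summable_mult[OF summable_pois[OF egrow_abs[OF assms], of "norm z"], of "exp (norm z)"] by (simp add: ac_simps)
  then show ?thesis unfolding norm_Tser_term exp_pw by simp
qed

lemma summable_Tser: "egrow u \<Longrightarrow> summable (\<lambda>k. of_real (u k) * z ^ k / fact k :: complex)"
  by (rule summable_norm_cancel[OF summable_norm_Tser])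

lemma suminf_norm_Tser:
  assumes "egrow u"
  shows "(\<Sum>k. \<bar>u k\<bar> * norm (z::complex) ^ k / fact k) = exp (norm z) * pois (norm z) (\<lambda>k. \<bar>u k\<bar>)"
proof -
  have "exp (norm z) * pois (norm z) (\<lambda>k. \<bar>u k\<bar>) = (\<Sum>k. exp (norm z) * (\<bar>u k\<bar> * pw (norm z) k))"
    unfolding pois_def
    by (rule suminf_mult[symmetric, OF summable_pois[OF egrow_abs[OF assms] norm_ge_zero]])
  also have "\<dots> = (\<Sum>k. \<bar>u k\<bar> * (exp (norm z) * pw (norm z) k))" by (simp add: ac_simps)
  finally show ?thesis unfolding exp_pw by simp
qed

lemma norm_Tser_le:
  assumes "egrow u"
  shows "norm (Tser u z) \<le> exp (norm z) * pois (norm z) (\<lambda>k. \<bar>u k\<bar>)"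
  unfolding suminf_norm_Tser[OF assms, symmetric] Tser_def norm_Tser_term[symmetric]
  by (rule summable_norm[OF summable_norm_Tser[OF assms]])

lemma Tser_Lop:
  assumes "egrow u"
  shows "Tser (Lop r u) z = (of_real r - z) * Tser u z"
proof -
  let ?f = "\<lambda>k. of_real (real k * u (k - 1)) * z ^ k / fact k :: complex"
  have s: "summable ?f"
    by (rule summable_Tser[OF egrow_mult[OF egrow_of_nat egrow_pred[OF assms]]])
  have "suminf ?f = ?f 0 + (\<Sum>k. ?f (Suc k))"
    by (subst suminf_split_head[OF s]) (simp only: add_diff_eq add_diff_cancel_left')
  also have "(\<Sum>k. ?f (Suc k)) = (\<Sum>k. z * (of_real (u k) * z ^ k / fact k))"
  proof (rule arg_cong[where f=suminf], rule ext)
    fix k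
    have "complex_of_real (real (Suc k) * u k) * z ^ Suc k / fact (Suc k)
       = (of_nat (Suc k) * (of_real (u k) * z * z ^ k)) / (of_nat (Suc k) * fact k)"
      by (simp add: fact_Suc ac_simps del: of_nat_Suc)
    also have "\<dots> = z * (of_real (u k) * z ^ k / fact k)"
      by (subst mult_divide_mult_cancel_left) (auto simp del: of_nat_Suc simp: ac_simps)
    finally show "?f (Suc k) = z * (of_real (u k) * z ^ k / fact k)" by simp
  qed
  also have "\<dots> = z * Tser u z"
    unfolding Tser_def by (rule suminf_mult[OF summable_Tser[OF assms]])
  finally have *: "suminf ?f = z * Tser u z" by simp
  have "Tser (Lop r u) z = (\<Sum>k. of_real r * (of_real (u k) * z ^ k / fact k) - ?f k)"
    unfolding Tser_def Lop_def by (intro arg_cong[where f=suminf] ext) (simp add: algebra_simps diff_divide_distrib)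
  also have "\<dots> = of_real r * Tser u z - suminf ?f"
    unfolding Tser_def suminf_mult[OF summable_Tser[OF assms], symmetric]
    by (rule suminf_diff[OF summable_mult[OF summable_Tser[OF assms]] s, symmetric])
  finally show ?thesis unfolding * by (simp only: left_diff_distrib)
qed

lemma Tser_Lop_pow: "egrow u \<Longrightarrow> Tser ((Lop r ^^ n) u) z = (of_real r - z) ^ n * Tser u z"
  by (induction n) (auto simp: Tser_Lop egrow_Lop_pow)

text \<open>Multiplication by the power of \<open>norm z - z\<close> applies \<open>Lop\<close> to
  the coefficients, and the absolute sum is then bounded by the square mean. The estimate stays
  squared so that \<open>norm z\<close> occurs with the integral exponent \<open>N\<close> instead
  of N/2.\<close>

lemma Tser_angular:
  "\<exists>C\<ge>0. \<forall>z u A. egrow u \<longrightarrow> 0 \<le> A \<longrightarrow> (\<forall>i\<le>N. pois_square (norm z) ((Ladj (norm z) ^^ i) u) \<le> A * norm z ^ i)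
     \<longrightarrow> (norm (of_real (norm z) - z) ^ N * norm (Tser u z))\<^sup>2 \<le> C * A * norm z ^ N * exp (norm z) ^ 2"
proof -
  obtain C where C: "C \<ge> 0" "\<And>r u A. r \<ge> 0 \<Longrightarrow> egrow u \<Longrightarrow> 0 \<le> A \<Longrightarrow> (\<And>i. i\<le>N \<Longrightarrow> pois_square r ((Ladj r ^^ i) u) \<le> A * r ^ i)
     \<Longrightarrow> pois_square r ((Lop r ^^ N) u) \<le> C * A * r ^ N" using pois_square_Lop_pow_bound[of N] by blast
  show ?thesis
  proof (intro exI[of _ C] conjI C(1) allI impI)
    fix z :: complex and u :: "nat \<Rightarrow> real" and A
    assume a: "egrow u" "0 \<le> A" "\<forall>i\<le>N. pois_square (norm z) ((Ladj (norm z) ^^ i) u) \<le> A * norm z ^ i"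
    let ?v = "(Lop (norm z) ^^ N) u"
    have ev: "egrow ?v" by (rule egrow_Lop_pow[OF a(1)])
    have "norm (of_real (norm z) - z) ^ N * norm (Tser u z) = norm (Tser ?v z)"
      by (simp add: Tser_Lop_pow[OF a(1)] norm_mult norm_power)
    also have "\<dots> \<le> exp (norm z) * pois (norm z) (\<lambda>k. \<bar>?v k\<bar>)"
      by (rule norm_Tser_le[OF ev])
    finally have "(norm (of_real (norm z) - z) ^ N * norm (Tser u z))\<^sup>2 \<le> (exp (norm z) * pois (norm z) (\<lambda>k. \<bar>?v k\<bar>))\<^sup>2"
      by (intro power_mono) auto
    also have "\<dots> \<le> exp (norm z) ^ 2 * pois_square (norm z) ?v"
      unfolding power_mult_distrib pois_square_def by (intro mult_left_mono pois_abs_square ev) auto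
    also have "\<dots> \<le> exp (norm z) ^ 2 * (C * A * norm z ^ N)"
      using a by (intro mult_left_mono C(2)) auto
    finally show "(norm (of_real (norm z) - z) ^ N * norm (Tser u z))\<^sup>2 \<le> C * A * norm z ^ N * exp (norm z) ^ 2"
      by (simp add: ac_simps)
  qed
qed

text \<open>The Poisson weight at k divided by (1 + k)^j is at most fact j / r^j times the weight at
  k + j, because fact (k + j) is at most fact j (1 + k)^j fact k. The shifted weights sum to at most
  1.\<close>

lemma pois_inverse_power:
  assumes "0 < r"
  shows "pois r (\<lambda>k. 1 / (1 + real k) ^ j) \<le> fact j / r ^ j"
proof -
  define f where "f = pw r"
  have sf: "summable f" unfolding f_def using summable_pois[of "\<lambda>_. 1" r] assms by (simp add: egrow_const)
  have f1: "suminf f = 1" using pois_const[of r 1] assms by (simp add: pois_def f_def)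
  have le: "1 / (1 + real k) ^ j * f k \<le> fact j / r ^ j * f (k + j)" for k
  proof -
    have "fact (k + j) \<le> (fact j * (1 + real k) ^ j) * fact k"
    proof (induction j)
      case (Suc j)
      have "real (k + Suc j) \<le> real (Suc j) * (1 + real k)" by (simp add: algebra_simps)
      then have "real (k + Suc j) * fact (k + j) \<le> (real (Suc j) * (1 + real k)) * ((fact j * (1 + real k) ^ j) * fact k)"
        using Suc.IH by (intro mult_mono) auto
      then show ?case by (simp add: algebra_simps)
    qed simp
    then have "1 / (1 + real k) ^ j / fact k \<le> fact j / fact (k + j)"
    proof -
      assume *: "fact (k + j) \<le> (fact j * (1 + real k) ^ j) * fact k"
      have "1 \<le> ((fact j * (1 + real k) ^ j) * fact k) / fact (k + j)"
        using * by (subst le_divide_eq_1_pos) auto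
      then have "1 \<le> (fact j / fact (k + j)) * ((1 + real k) ^ j * fact k)" by (simp add: ac_simps)
      then show ?thesis
        using mult_imp_div_pos_le[of "(1 + real k) ^ j * fact k" 1 "fact j / fact (k + j)"] by simp
    qed
    then have "exp (-r) * r ^ k * (1 / (1 + real k) ^ j / fact k) \<le> exp (-r) * r ^ k * (fact j / fact (k + j))"
      using assms by (intro mult_left_mono) auto
    then show ?thesis using assms by (simp add: f_def pw_def power_add mult.commute[of "fact j"])
  qed
  have s2: "summable (\<lambda>k. f (k + j))" using sf by (simp add: summable_iff_shift)
  have "suminf f = (\<Sum>k. f (k + j)) + (\<Sum>k<j. f k)" by (rule suminf_split_initial_segment[OF sf])
  moreover have "(\<Sum>k<j. f k) \<ge> 0" using assms by (intro sum_nonneg) (auto simp: f_def pw_nonneg)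
  ultimately have f2: "(\<Sum>k. f (k + j)) \<le> 1" using f1 by simp
  have "pois r (\<lambda>k. 1 / (1 + real k) ^ j) \<le> (\<Sum>k. fact j / r ^ j * f (k + j))"
    unfolding pois_def f_def[symmetric]
  proof (rule suminf_le)
    show "summable (\<lambda>k. 1 / (1 + real k) ^ j * f k)" unfolding f_def
      using assms by (intro summable_pois egrow_bounded[of _ 1]) auto
    show "summable (\<lambda>k. fact j / r ^ j * f (k + j))" by (rule summable_mult[OF s2])
  qed (rule le)
  also have "\<dots> = fact j / r ^ j * (\<Sum>k. f (k + j))" by (rule suminf_mult[OF s2])
  also have "\<dots> \<le> fact j / r ^ j * 1" using f2 assms by (intro mult_left_mono) auto
  finally show ?thesis by simp
qed

text \<open>The sign is chosen so that \<open>Ladj r\<close> is \<open>r\<close> times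
  \<open>Dop\<close>; powers of \<open>Ladj r\<close> are then powers of \<open>r\<close> times
  iterated differences.\<close>

definition Dop :: "(nat \<Rightarrow> real) \<Rightarrow> nat \<Rightarrow> real" where
  "Dop u = (\<lambda>k. u k - u (Suc k))"

lemma Dop_cmult: "Dop (\<lambda>k. c * u k) = (\<lambda>k. c * Dop u k)"
  by (simp add: Dop_def fun_eq_iff algebra_simps)

lemma Ladj_pow: "(Ladj r ^^ i) u = (\<lambda>k. r ^ i * (Dop ^^ i) u k)"
proof (induction i)
  case (Suc i)
  have "Ladj r v = (\<lambda>k. r * Dop v k)" for v by (simp add: Ladj_def Dop_def)
  then show ?case using Suc by (simp add: Dop_cmult ac_simps)
qed simp

text \<open>\<open>1 / h\<close> is the scale beyond which the multiplier decays rapidly; for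
  \<open>exp (- t * (2 * k + d) powr \<beta>)\<close> it is \<open>h = t powr (1 / \<beta>)\<close>.\<close>

definition symb :: "nat \<Rightarrow> nat \<Rightarrow> real \<Rightarrow> real \<Rightarrow> (nat \<Rightarrow> real) \<Rightarrow> bool" where
  "symb N M B h u \<longleftrightarrow> (\<forall>i\<le>N. \<forall>k. \<bar>(Dop ^^ i) u k\<bar> \<le> B / (1 + real k) ^ i \<and>
      \<bar>(Dop ^^ i) u k\<bar> \<le> B / (h ^ M * (1 + real k) ^ (i + M)))"

lemma symb_bounded:
  assumes "symb N M B h u" shows "\<bar>u k\<bar> \<le> B"
  using assms[unfolded symb_def, rule_format, of 0 k] by simp

lemma egrow_Dop_pow: "egrow u \<Longrightarrow> egrow ((Dop ^^ i) u)"
proof (induction i)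
  case (Suc i)
  then show ?case using egrow_diff[OF Suc.IH egrow_Suc[OF Suc.IH]] by (simp add: Dop_def)
qed simp

text \<open>The factor r^(2 i) in the square of the i-th power of \<open>Ladj r\<close> is offset by
  the negative moment of order 2 i that the symbol estimate supplies. The two bounds in
  \<open>symb\<close> give a constant and a multiple of (h r)^(-2 M); clearing denominators and
  adding produces the single factor 1 + (h r)^(2 M).\<close>

lemma symb_pois_square:
  assumes u: "symb N M B h u" and B: "0 \<le> B" and h: "0 < h" and r: "1 \<le> r" and i: "i \<le> N"
  shows "pois_square r ((Ladj r ^^ i) u) \<le> (2 * B\<^sup>2 * fact (2 * N + 2 * M) / (1 + (h * r) ^ (2 * M))) * r ^ i"
proof -
  have eu: "egrow u" using egrow_bounded symb_bounded[OF u] by blast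
  have eD: "egrow (\<lambda>k. ((Dop ^^ i) u k)\<^sup>2)"
    unfolding power2_eq_square by (intro egrow_mult egrow_Dop_pow eu)
  have eB: "egrow (\<lambda>k. 1 / (1 + real k) ^ j)" for j by (rule egrow_bounded[of _ 1]) auto
  define X where "X = pois_square r ((Ladj r ^^ i) u)"
  have X: "X = r ^ (2 * i) * pois r (\<lambda>k. ((Dop ^^ i) u k)\<^sup>2)"
    unfolding X_def pois_square_def Ladj_pow power_mult_distrib using r eD by (simp add: pois_cmult power_even_eq)
  have sq: "x\<^sup>2 \<le> y\<^sup>2" if "\<bar>x\<bar> \<le> y" for x y :: real using that abs_le_square_iff[of x y] by auto
  have "pois r (\<lambda>k. ((Dop ^^ i) u k)\<^sup>2) \<le> pois r (\<lambda>k. B\<^sup>2 * (1 / (1 + real k) ^ (2 * i)))"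
  proof (rule pois_mono)
    show "((Dop ^^ i) u k)\<^sup>2 \<le> B\<^sup>2 * (1 / (1 + real k) ^ (2 * i))" for k
      using sq[of "(Dop ^^ i) u k" "B / (1 + real k) ^ i"] u i
      by (simp add: symb_def power_divide power_even_eq)
  qed (use eD egrow_cmult[OF eB, of "B\<^sup>2" "2 * i"] r in auto)
  also have "\<dots> \<le> B\<^sup>2 * (fact (2 * i) / r ^ (2 * i))"
    using r pois_inverse_power[of r "2 * i"]
    by (subst pois_cmult[OF eB]) (auto intro!: mult_left_mono simp del: times_divide_eq_right)
  finally have "X \<le> r ^ (2 * i) * (B\<^sup>2 * (fact (2 * i) / r ^ (2 * i)))"
    unfolding X using r by (intro mult_left_mono) auto
  also have "\<dots> = B\<^sup>2 * fact (2 * i)" using r by simp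
  also have "\<dots> \<le> B\<^sup>2 * fact (2 * N + 2 * M)" using i by (intro mult_left_mono fact_mono) auto
  finally have X1: "X \<le> B\<^sup>2 * fact (2 * N + 2 * M)" .
  have "pois r (\<lambda>k. ((Dop ^^ i) u k)\<^sup>2) \<le> pois r (\<lambda>k. (B / h ^ M)\<^sup>2 * (1 / (1 + real k) ^ (2 * i + 2 * M)))"
  proof (rule pois_mono)
    show "((Dop ^^ i) u k)\<^sup>2 \<le> (B / h ^ M)\<^sup>2 * (1 / (1 + real k) ^ (2 * i + 2 * M))" for k
    proof -
      have "((Dop ^^ i) u k)\<^sup>2 \<le> (B / (h ^ M * (1 + real k) ^ (i + M)))\<^sup>2"
        using u i by (intro sq) (auto simp: symb_def)
      also have "\<dots> = (B / h ^ M)\<^sup>2 * (1 / ((1 + real k) ^ (i + M))\<^sup>2)"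
        by (simp add: power_divide power_mult_distrib)
      also have "((1 + real k) ^ (i + M))\<^sup>2 = (1 + real k) ^ (2 * i + 2 * M)"
        unfolding power_mult[symmetric] by (simp add: distrib_right mult.commute)
      finally show ?thesis .
    qed
  qed (use eD egrow_cmult[OF eB, of "(B / h ^ M)\<^sup>2" "2 * i + 2 * M"] r in auto)
  also have "\<dots> \<le> (B / h ^ M)\<^sup>2 * (fact (2 * i + 2 * M) / r ^ (2 * i + 2 * M))"
    using r pois_inverse_power[of r "2 * i + 2 * M"]
    by (subst pois_cmult[OF eB]) (auto intro!: mult_left_mono simp del: times_divide_eq_right)
  finally have "X \<le> r ^ (2 * i) * ((B / h ^ M)\<^sup>2 * (fact (2 * i + 2 * M) / r ^ (2 * i + 2 * M)))"
    unfolding X using r by (intro mult_left_mono) auto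
  also have "\<dots> = B\<^sup>2 * fact (2 * i + 2 * M) / (h * r) ^ (2 * M)"
    using r h by (simp add: power_add power_divide power_mult_distrib power_even_eq)
  also have "\<dots> \<le> B\<^sup>2 * fact (2 * N + 2 * M) / (h * r) ^ (2 * M)"
    using i r h by (intro divide_right_mono mult_left_mono fact_mono) auto
  finally have "X * (h * r) ^ (2 * M) \<le> B\<^sup>2 * fact (2 * N + 2 * M)"
    using r h by (simp add: pos_le_divide_eq)
  with X1 have "X * (1 + (h * r) ^ (2 * M)) \<le> 2 * B\<^sup>2 * fact (2 * N + 2 * M)"
    by (simp add: algebra_simps)
  moreover have "1 + (h * r) ^ (2 * M) > 0" using r h by (intro add_pos_nonneg) auto
  ultimately have "X \<le> 2 * B\<^sup>2 * fact (2 * N + 2 * M) / (1 + (h * r) ^ (2 * M))"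
    by (simp add: pos_le_divide_eq)
  also have "\<dots> \<le> (2 * B\<^sup>2 * fact (2 * N + 2 * M) / (1 + (h * r) ^ (2 * M))) * r ^ i"
    using r \<open>1 + (h * r) ^ (2 * M) > 0\<close> by (intro mult_left_mono[of 1 "r ^ i", simplified]) auto
  finally show ?thesis unfolding X_def .
qed

text \<open>The factor \<open>norm z\<close> on the right cancels the \<open>norm z ^ N\<close> lost
  in \<open>Tser_angular\<close>, so that the final gain is in \<open>norm z - Re z\<close> and
  carries no power of \<open>norm z\<close>.\<close>

lemma norm_of_real_norm_minus:
  "(norm (of_real (norm z) - z))\<^sup>2 = 2 * norm z * (norm z - Re z)"
proof -
  have "(norm (of_real (norm z) - z))\<^sup>2 = (norm z - Re z)\<^sup>2 + (Im z)\<^sup>2"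
    by (simp add: cmod_power2)
  moreover have "(norm z)\<^sup>2 = (Re z)\<^sup>2 + (Im z)\<^sup>2" by (rule cmod_power2)
  ultimately show ?thesis by (simp add: power2_eq_square algebra_simps)
qed

lemma one_add_power_le: "0 \<le> x \<Longrightarrow> (1 + x) ^ n \<le> 2 ^ n * (1 + x ^ n)" for x :: real
proof -
  assume x: "0 \<le> x"
  have "(1 + x) ^ n \<le> (2 * max 1 x) ^ n" using x by (intro power_mono) auto
  also have "\<dots> = 2 ^ n * max 1 x ^ n" by (simp add: power_mult_distrib)
  also have "\<dots> \<le> 2 ^ n * (1 + x ^ n)" using x by (intro mult_left_mono) (auto simp: max_def)
  finally show ?thesis .
qed

lemma Tser_bound_aux:
  "\<exists>C\<ge>0. \<forall>B h u z. 0 \<le> B \<longrightarrow> 0 < h \<longrightarrow> symb N M B h u \<longrightarrow> 1 \<le> norm z \<longrightarrow>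
     (norm z - Re z) ^ N * (1 + (h * norm z) ^ (2 * M)) * (norm (Tser u z))\<^sup>2 \<le> C * B\<^sup>2 * exp (norm z) ^ 2"
proof -
  obtain C where C: "C \<ge> 0" "\<And>z u A. egrow u \<Longrightarrow> 0 \<le> A \<Longrightarrow> (\<And>i. i \<le> N \<Longrightarrow> pois_square (norm z) ((Ladj (norm z) ^^ i) u) \<le> A * norm z ^ i)
     \<Longrightarrow> (norm (of_real (norm z) - z) ^ N * norm (Tser u z))\<^sup>2 \<le> C * A * norm z ^ N * exp (norm z) ^ 2"
    using Tser_angular[of N] by blast
  define C' where "C' = C * (2 * fact (2 * N + 2 * M))"
  have "(norm z - Re z) ^ N * (1 + (h * norm z) ^ (2 * M)) * (norm (Tser u z))\<^sup>2 \<le> C' * B\<^sup>2 * exp (norm z) ^ 2"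
    if B: "0 \<le> B" and h: "0 < h" and u: "symb N M B h u" and z: "1 \<le> norm z" for B h u z
  proof -
    define r where "r = norm z"
    define Y where "Y = 1 + (h * r) ^ (2 * M)"
    have Y: "Y > 0" unfolding Y_def r_def using z h by (intro add_pos_nonneg) auto
    have r: "r > 0" using z unfolding r_def by linarith
    have \<rho>: "0 \<le> r - Re z" using complex_Re_le_cmod[of z] by (simp add: r_def)
    have "(norm (of_real r - z) ^ N * norm (Tser u z))\<^sup>2 \<le> C * (2 * B\<^sup>2 * fact (2 * N + 2 * M) / Y) * r ^ N * exp r ^ 2"
      unfolding r_def
    proof (rule C(2))
      show "egrow u" using egrow_bounded symb_bounded[OF u] by blast
      show "pois_square (norm z) ((Ladj (norm z) ^^ i) u) \<le> 2 * B\<^sup>2 * fact (2 * N + 2 * M) / Y * norm z ^ i" if "i \<le> N" for i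
        using symb_pois_square[OF u B h z that] unfolding Y_def r_def .
    qed (use Y in auto)
    also have "(norm (of_real r - z) ^ N * norm (Tser u z))\<^sup>2 = (2 * r * (r - Re z)) ^ N * (norm (Tser u z))\<^sup>2"
      unfolding power_mult_distrib power_mult[symmetric] mult.commute[of N 2]
      unfolding power_mult r_def norm_of_real_norm_minus by (simp add: power_mult_distrib)
    finally have "(2 * (r - Re z)) ^ N * (norm (Tser u z))\<^sup>2 * r ^ N \<le> C' * B\<^sup>2 * exp r ^ 2 / Y * r ^ N"
      by (simp add: C'_def power_mult_distrib ac_simps)
    then have "(2 * (r - Re z)) ^ N * (norm (Tser u z))\<^sup>2 \<le> C' * B\<^sup>2 * exp r ^ 2 / Y"
      using r by (simp only: mult_le_cancel_right_pos zero_less_power)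
    then have *: "(2 * (r - Re z)) ^ N * (norm (Tser u z))\<^sup>2 * Y \<le> C' * B\<^sup>2 * exp r ^ 2"
      using Y by (simp add: pos_le_divide_eq)
    have "(r - Re z) ^ N * (norm (Tser u z))\<^sup>2 * Y \<le> (2 * (r - Re z)) ^ N * (norm (Tser u z))\<^sup>2 * Y"
      using \<rho> Y by (intro mult_right_mono power_mono) auto
    also note *
    finally show ?thesis by (simp add: Y_def r_def ac_simps)
  qed
  moreover have "C' \<ge> 0" using C(1) by (simp add: C'_def)
  ultimately show ?thesis by blast
qed

text \<open>Adding the estimates of orders \<open>N\<close> and 0 replaces the power of
  \<open>norm z - Re z\<close> by the power of 1 plus it.\<close>

lemma Tser_bound:
  "\<exists>C\<ge>0. \<forall>B h u z. 0 \<le> B \<longrightarrow> 0 < h \<longrightarrow> h \<le> 1 \<longrightarrow> symb N M B h u \<longrightarrow>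
     (1 + (norm z - Re z)) ^ N * (1 + h * norm z) ^ (2 * M) * (norm (Tser u z))\<^sup>2 \<le> C * B\<^sup>2 * exp (norm z) ^ 2"
proof -
  obtain C1 where C1: "C1 \<ge> 0" "\<And>B h u z. 0 \<le> B \<Longrightarrow> 0 < h \<Longrightarrow> symb N M B h u \<Longrightarrow> 1 \<le> norm z \<Longrightarrow>
     (norm z - Re z) ^ N * (1 + (h * norm z) ^ (2 * M)) * (norm (Tser u z))\<^sup>2 \<le> C1 * B\<^sup>2 * exp (norm z) ^ 2"
    using Tser_bound_aux[of N M] by blast
  obtain C0 where C0: "C0 \<ge> 0" "\<And>B h u z. 0 \<le> B \<Longrightarrow> 0 < h \<Longrightarrow> symb 0 M B h u \<Longrightarrow> 1 \<le> norm z \<Longrightarrow>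
     (norm z - Re z) ^ 0 * (1 + (h * norm z) ^ (2 * M)) * (norm (Tser u z))\<^sup>2 \<le> C0 * B\<^sup>2 * exp (norm z) ^ 2"
    using Tser_bound_aux[of 0 M] by blast
  \<comment> \<open>The first summand serves \<open>norm z\<close> at least 1. The second serves the
    unit disc, where \<open>1 + (norm z - Re z)\<close> is at most 3, \<open>1 + h * norm z\<close>
    is at most 2, and the series is bounded by its absolute sum.\<close>
  define C where "C = 2 ^ N * 2 ^ (2 * M) * (C0 + C1) + 3 ^ N * 2 ^ (2 * M)"
  have "(1 + (norm z - Re z)) ^ N * (1 + h * norm z) ^ (2 * M) * (norm (Tser u z))\<^sup>2 \<le> C * B\<^sup>2 * exp (norm z) ^ 2"
    if B: "0 \<le> B" and h: "0 < h" "h \<le> 1" and u: "symb N M B h u" for B h u z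
  proof -
    define r where "r = norm z"
    define t where "t = (norm (Tser u z))\<^sup>2"
    have t: "t \<ge> 0" by (simp add: t_def)
    have r0: "r \<ge> 0" by (simp add: r_def)
    have \<rho>: "0 \<le> r - Re z" using complex_Re_le_cmod[of z] by (simp add: r_def)
    have E: "0 \<le> B\<^sup>2 * exp r ^ 2" by simp
    show ?thesis
    proof (cases "1 \<le> r")
      case True
      have u0: "symb 0 M B h u" using u by (auto simp: symb_def)
      define Y where "Y = 1 + (h * r) ^ (2 * M)"
      have Y: "Y \<ge> 0" unfolding Y_def using r0 h by auto
      have "(1 + (r - Re z)) ^ N * (1 + h * r) ^ (2 * M) * t \<le> (2 ^ N * (1 + (r - Re z) ^ N)) * (2 ^ (2 * M) * Y) * t"
        unfolding Y_def using \<rho> r0 h t by (intro mult_right_mono mult_mono one_add_power_le) auto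
      also have "\<dots> = 2 ^ N * 2 ^ (2 * M) * (Y * t + (r - Re z) ^ N * Y * t)"
        by (simp add: algebra_simps)
      also have "\<dots> \<le> 2 ^ N * 2 ^ (2 * M) * (C0 * B\<^sup>2 * exp r ^ 2 + C1 * B\<^sup>2 * exp r ^ 2)"
        using C1(2)[OF B h(1) u, of z] C0(2)[OF B h(1) u0, of z] True
        by (intro mult_left_mono add_mono) (auto simp: Y_def r_def t_def)
      also have "\<dots> \<le> C * B\<^sup>2 * exp r ^ 2"
        using E by (simp add: C_def algebra_simps)
      finally show ?thesis by (simp add: r_def t_def)
    next
      case False
      have eu: "egrow u" using egrow_bounded symb_bounded[OF u] by blast
      have "norm (Tser u z) \<le> exp r * pois r (\<lambda>k. \<bar>u k\<bar>)" unfolding r_def by (rule norm_Tser_le[OF eu])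
      also have "\<dots> \<le> exp r * pois r (\<lambda>k. B)"
        using r0 symb_bounded[OF u] by (intro mult_left_mono pois_mono egrow_abs eu egrow_const) auto
      finally have "norm (Tser u z) \<le> exp r * B" using r0 by (simp add: pois_const)
      then have t2: "t \<le> (exp r * B)\<^sup>2" unfolding t_def by (intro power_mono) auto
      have "\<bar>Re z\<bar> \<le> r" unfolding r_def by (rule abs_Re_le_cmod)
      then have "1 + (r - Re z) \<le> 3" "1 + h * r \<le> 2" using False mult_le_one[of h r] h r0 by auto
      then have "(1 + (r - Re z)) ^ N * (1 + h * r) ^ (2 * M) * t \<le> 3 ^ N * 2 ^ (2 * M) * (exp r * B)\<^sup>2"
        using \<rho> r0 h t t2 by (intro mult_mono power_mono) auto
      also have "\<dots> = 3 ^ N * 2 ^ (2 * M) * (B\<^sup>2 * exp r ^ 2)" by (simp add: power_mult_distrib ac_simps)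
      also have "\<dots> \<le> C * (B\<^sup>2 * exp r ^ 2)"
        using E C0(1) C1(1) by (intro mult_right_mono) (auto simp: C_def)
      finally show ?thesis by (simp add: r_def t_def ac_simps)
    qed
  qed
  moreover have "C \<ge> 0" using C0(1) C1(1) by (simp add: C_def)
  ultimately show ?thesis by blast
qed

lemma exp_neg_power_bound: "0 \<le> x \<Longrightarrow> exp (- x) * (1 + x) ^ K \<le> exp 1 * fact K" for x :: real
proof -
  assume x: "0 \<le> x"
  have "(1 + x) ^ K / fact K \<le> exp (1 + x)"
  proof -
    have "(1 + x) ^ K /\<^sub>R fact K \<le> (\<Sum>n. (1 + x) ^ n /\<^sub>R fact n)"
      using sum_le_suminf[OF summable_exp_generic[of "1 + x"], of "{K}"] x by simp
    then show ?thesis by (simp add: exp_def divide_inverse mult.commute)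
  qed
  then have "(1 + x) ^ K \<le> exp (1 + x) * fact K" by (simp add: pos_divide_le_eq)
  then have "exp (- x) * (1 + x) ^ K \<le> exp (- x) * (exp (1 + x) * fact K)" by (intro mult_left_mono) auto
  also have "\<dots> = exp 1 * fact K" by (simp add: exp_add exp_minus)
  finally show ?thesis .
qed

text \<open>Here \<open>s\<close> is any bound for \<open>norm z\<close>. The surplus
  \<open>s - norm z\<close> enlarges the two weights by at most a power of 1 plus itself, which the
  exponential of minus the surplus absorbs. Taking the square root of \<open>Tser_bound\<close>
  halves the exponents, hence \<open>symb (2 * N)\<close>. The factors 4 fit
  \<open>zcoord_inner_bounds\<close>.\<close>

lemma Tser_kernel_bound:
  "\<exists>C\<ge>0. \<forall>B h u z s. 0 \<le> B \<longrightarrow> 0 < h \<longrightarrow> h \<le> 1 \<longrightarrow> symb (2 * N) M B h u \<longrightarrow> norm z \<le> s \<longrightarrow>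
     exp (- s) * norm (Tser u z) * (1 + 4 * (s - Re z)) ^ N * (1 + 4 * (h * s)) ^ M \<le> C * B"
proof -
  obtain C where C: "C \<ge> 0" "\<And>B h u z. 0 \<le> B \<Longrightarrow> 0 < h \<Longrightarrow> h \<le> 1 \<Longrightarrow> symb (2 * N) M B h u \<Longrightarrow>
     (1 + (norm z - Re z)) ^ (2 * N) * (1 + h * norm z) ^ (2 * M) * (norm (Tser u z))\<^sup>2 \<le> C * B\<^sup>2 * exp (norm z) ^ 2"
    using Tser_bound[of "2 * N" M] by blast
  define C' where "C' = 4 ^ N * 4 ^ M * (exp 1 * fact (N + M)) * sqrt C"
  have "exp (- s) * norm (Tser u z) * (1 + 4 * (s - Re z)) ^ N * (1 + 4 * (h * s)) ^ M \<le> C' * B"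
    if B: "0 \<le> B" and h: "0 < h" "h \<le> 1" and u: "symb (2 * N) M B h u" and s: "norm z \<le> s" for B h u z s
  proof -
    define r where "r = norm z"
    define \<rho> where "\<rho> = r - Re z"
    define \<delta> where "\<delta> = s - r"
    have \<rho>: "0 \<le> \<rho>" using complex_Re_le_cmod[of z] by (simp add: r_def \<rho>_def)
    have \<delta>: "0 \<le> \<delta>" using s by (simp add: r_def \<delta>_def)
    have r0: "r \<ge> 0" by (simp add: r_def)
    define t where "t = (1 + \<rho>) ^ N * (1 + h * r) ^ M * norm (Tser u z)"
    have "t\<^sup>2 \<le> (sqrt C * B * exp r)\<^sup>2"
      using C(2)[OF B h u, of z] C(1)
      by (simp add: t_def \<rho>_def r_def power_mult_distrib power_mult[symmetric] mult.commute)
    then have t: "t \<le> sqrt C * B * exp r"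
      by (rule power2_le_imp_le) (use B C(1) in auto)
    have t0: "0 \<le> t" unfolding t_def using \<rho> h r0 by auto
    have 1: "1 + 4 * (s - Re z) \<le> 4 * ((1 + \<delta>) * (1 + \<rho>))"
    proof -
      have "s - Re z = \<delta> + \<rho>" by (simp add: \<delta>_def \<rho>_def)
      moreover have "0 \<le> \<delta> * \<rho>" using \<delta> \<rho> by simp
      ultimately show ?thesis by (simp add: algebra_simps)
    qed
    have 2: "1 + 4 * (h * s) \<le> 4 * ((1 + \<delta>) * (1 + h * r))"
    proof -
      have "h * s = h * \<delta> + h * r" by (simp add: \<delta>_def algebra_simps)
      moreover have "h * \<delta> \<le> 1 * \<delta>" using h \<delta> by (intro mult_right_mono) auto
      moreover have "0 \<le> \<delta> * (h * r)" using \<delta> h r0 by simp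
      moreover have "(1 + \<delta>) * (1 + h * r) = 1 + \<delta> + h * r + \<delta> * (h * r)" by (simp add: algebra_simps)
      ultimately show ?thesis by linarith
    qed
    have 30: "0 \<le> s - Re z" using \<delta> \<rho> by (simp add: \<delta>_def \<rho>_def)
    have s0: "0 \<le> s" using s norm_ge_zero[of z] by linarith
    have "exp (- s) * norm (Tser u z) * (1 + 4 * (s - Re z)) ^ N * (1 + 4 * (h * s)) ^ M
      \<le> exp (- s) * norm (Tser u z) * (4 * ((1 + \<delta>) * (1 + \<rho>))) ^ N * (4 * ((1 + \<delta>) * (1 + h * r))) ^ M"
      using 1 2 30 s0 h \<delta> \<rho> by (intro mult_mono power_mono mult_left_mono) auto
    also have "\<dots> = 4 ^ N * 4 ^ M * (exp (- s) * (1 + \<delta>) ^ (N + M)) * t"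
      unfolding t_def power_mult_distrib power_add by (simp only: ac_simps)
    also have "\<dots> \<le> 4 ^ N * 4 ^ M * (exp (- s) * (1 + \<delta>) ^ (N + M)) * (sqrt C * B * exp r)"
      using t \<delta> by (intro mult_left_mono) auto
    also have "\<dots> = 4 ^ N * 4 ^ M * (exp (- \<delta>) * (1 + \<delta>) ^ (N + M)) * (sqrt C * B)"
      by (simp add: \<delta>_def exp_diff exp_minus field_simps)
    also have "\<dots> \<le> 4 ^ N * 4 ^ M * (exp 1 * fact (N + M)) * (sqrt C * B)"
      using B C(1) \<delta> by (intro mult_right_mono mult_left_mono exp_neg_power_bound) auto
    finally show ?thesis by (simp add: C'_def ac_simps)
  qed
  moreover have "C' \<ge> 0" using C(1) by (simp add: C'_def)
  ultimately show ?thesis by blast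
qed

text \<open>Without cancellation the off-diagonal gain is lost, but decay in \<open>s\<close>
  survives from the negative moments. This form controls partial sums of the kernel series and
  suffices for large times.\<close>

lemma Tser_abs_bound:
  "\<exists>C\<ge>0. \<forall>B u r s. 0 \<le> B \<longrightarrow> (\<forall>k. \<bar>u k\<bar> \<le> B / (1 + real k) ^ M) \<longrightarrow> 0 \<le> r \<longrightarrow> r \<le> s \<longrightarrow>
     exp (- s) * (exp r * pois r (\<lambda>k. \<bar>u k\<bar>)) * (1 + 4 * s) ^ M \<le> C * B"
proof -
  define C :: real where "C = 4 ^ M * (exp 1 * fact M) * (2 ^ M * (1 + fact M))"
  have "exp (- s) * (exp r * pois r (\<lambda>k. \<bar>u k\<bar>)) * (1 + 4 * s) ^ M \<le> C * B"
    if B: "0 \<le> B" and u: "\<forall>k. \<bar>u k\<bar> \<le> B / (1 + real k) ^ M" and r: "0 \<le> r" and s: "r \<le> s" for B u r s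
  proof -
    define p where "p = pois r (\<lambda>k. \<bar>u k\<bar>)"
    have uB: "\<bar>u k\<bar> \<le> B" for k
    proof -
      have "B / (1 + real k) ^ M \<le> B / 1" using B by (intro divide_left_mono) (auto intro: one_le_power)
      then show ?thesis using u[rule_format, of k] by simp
    qed
    have eu: "egrow u" by (rule egrow_bounded[OF uB])
    have p0: "0 \<le> p" unfolding p_def
      using pois_mono[of "\<lambda>_. 0" "\<lambda>k. \<bar>u k\<bar>" r] r by (simp add: pois_const egrow_const egrow_abs[OF eu])
    have p1: "p \<le> B" unfolding p_def
      using pois_mono[of "\<lambda>k. \<bar>u k\<bar>" "\<lambda>_. B" r] r uB by (simp add: pois_const egrow_const egrow_abs[OF eu])
    \<comment> \<open>\<open>pois_inverse_power\<close> needs positive \<open>r\<close>; at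
      \<open>r = 0\<close> only \<open>M = 0\<close>, where the power is 1, has content.\<close>
    have p2: "p * r ^ M \<le> B * fact M"
    proof (cases "r = 0")
      case True then show ?thesis using p1 B by (cases M) auto
    next
      case False
      have eB: "egrow (\<lambda>k. 1 / (1 + real k) ^ M)" by (rule egrow_bounded[of _ 1]) auto
      have "p \<le> pois r (\<lambda>k. B * (1 / (1 + real k) ^ M))" unfolding p_def
        using u r by (intro pois_mono egrow_abs eu egrow_cmult eB) auto
      also have "\<dots> \<le> B * (fact M / r ^ M)"
        using r False B pois_inverse_power[of r M] by (subst pois_cmult[OF eB]) (auto intro!: mult_left_mono simp del: times_divide_eq_right)
      finally show ?thesis using r False by (simp add: pos_le_divide_eq)
    qed
    have "p * (1 + r) ^ M \<le> p * (2 ^ M * (1 + r ^ M))" using p0 r by (intro mult_left_mono one_add_power_le)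
    also have "\<dots> = 2 ^ M * (p + p * r ^ M)" by (simp add: algebra_simps)
    also have "\<dots> \<le> 2 ^ M * (B + B * fact M)" using p1 p2 by (intro mult_left_mono add_mono) auto
    finally have p3: "p * (1 + r) ^ M \<le> 2 ^ M * (1 + fact M) * B" by (simp add: algebra_simps)
    define \<delta> where "\<delta> = s - r"
    have \<delta>: "0 \<le> \<delta>" using s by (simp add: \<delta>_def)
    have "1 + 4 * s \<le> 4 * ((1 + \<delta>) * (1 + r))"
    proof -
      have "(1 + \<delta>) * (1 + r) = 1 + \<delta> + r + \<delta> * r" by (simp add: algebra_simps)
      moreover have "0 \<le> \<delta> * r" using \<delta> r by simp
      ultimately show ?thesis using \<delta> r unfolding \<delta>_def by linarith
    qed
    then have "exp (- s) * (exp r * p) * (1 + 4 * s) ^ M \<le> exp (- s) * (exp r * p) * (4 * ((1 + \<delta>) * (1 + r))) ^ M"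
      using p0 r s by (intro mult_left_mono power_mono) auto
    also have "\<dots> = 4 ^ M * (exp (- \<delta>) * (1 + \<delta>) ^ M) * (p * (1 + r) ^ M)"
    proof -
      have "exp (- \<delta>) = exp (- s) * exp r" by (simp add: \<delta>_def exp_diff exp_minus divide_inverse mult.commute)
      then show ?thesis unfolding power_mult_distrib by (simp only: ac_simps)
    qed
    also have "\<dots> \<le> 4 ^ M * (exp 1 * fact M) * (2 ^ M * (1 + fact M) * B)"
      by (rule mult_mono[OF mult_left_mono[OF exp_neg_power_bound[OF \<delta>]] p3]) (use p0 r in auto)
    finally show ?thesis by (simp add: C_def p_def ac_simps)
  qed
  moreover have "C \<ge> 0" by (simp add: C_def)
  ultimately show ?thesis by blast
qed

section \<open>Derivatives and differences of the multiplier\<close>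

fun symQ :: "real \<Rightarrow> nat \<Rightarrow> real poly" where
  "symQ \<beta> 0 = 1"
| "symQ \<beta> (Suc i) = smult (- real i) (symQ \<beta> i) + smult \<beta> (pCons 0 (pderiv (symQ \<beta> i))) - smult \<beta> (pCons 0 (symQ \<beta> i))"

text \<open>The i-th x-derivative of exp(-t x^\<beta>). Since u = t x^\<beta> has x-derivative
  \<beta> u / x, every derivative is x^(-i) times a polynomial in u times exp(-u). The recursion of
  \<open>symQ\<close> is the product rule, with \<open>pCons 0\<close> as multiplication by
  u.\<close>

definition symF :: "real \<Rightarrow> real \<Rightarrow> nat \<Rightarrow> real \<Rightarrow> real" where
  "symF \<beta> t i x = x powr (- real i) * poly (symQ \<beta> i) (t * x powr \<beta>) * exp (- (t * x powr \<beta>))"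

lemma symF_deriv:
  assumes "0 < x"
  shows "(symF \<beta> t i has_real_derivative symF \<beta> t (Suc i) x) (at x)"
proof -
  define u where "u = t * x powr \<beta>"
  have 1: "x powr (- real i - 1) = x powr (- real i) / x" "x powr (- real (Suc i)) = x powr (- real i) / x" "x powr (\<beta> - 1) = x powr \<beta> / x"
    using assms by (simp_all add: powr_diff powr_minus powr_add field_simps)
  have "((\<lambda>x. x powr (- real i) * poly (symQ \<beta> i) (t * x powr \<beta>) * exp (- (t * x powr \<beta>))) has_real_derivative
      ((- real i * x powr (- real i - 1)) * poly (symQ \<beta> i) u + poly (pderiv (symQ \<beta> i)) u * (t * (\<beta> * x powr (\<beta> - 1))) * x powr (- real i)) * exp (- u)
      + (exp (- u) * - (t * (\<beta> * x powr (\<beta> - 1)))) * (x powr (- real i) * poly (symQ \<beta> i) u)) (at x)"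
    unfolding u_def using assms
    by (intro DERIV_mult DERIV_chain2[OF poly_DERIV] DERIV_fun_exp DERIV_minus DERIV_cmult has_real_derivative_powr) auto
  also have "((- real i * x powr (- real i - 1)) * poly (symQ \<beta> i) u + poly (pderiv (symQ \<beta> i)) u * (t * (\<beta> * x powr (\<beta> - 1))) * x powr (- real i)) * exp (- u)
      + (exp (- u) * - (t * (\<beta> * x powr (\<beta> - 1)))) * (x powr (- real i) * poly (symQ \<beta> i) u) = symF \<beta> t (Suc i) x"
    using assms unfolding symF_def u_def[symmetric] 1
    by (simp add: u_def[symmetric] field_simps)
  finally show ?thesis unfolding symF_def .
qed

lemma poly_abs_bound: "\<exists>C\<ge>0. \<forall>u\<ge>0. \<bar>poly p u\<bar> \<le> C * (1 + u) ^ degree p" for p :: "real poly"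
proof -
  have "\<bar>poly p u\<bar> \<le> (\<Sum>i\<le>degree p. \<bar>coeff p i\<bar>) * (1 + u) ^ degree p" if "0 \<le> u" for u
  proof -
    have "\<bar>poly p u\<bar> \<le> (\<Sum>i\<le>degree p. \<bar>coeff p i * u ^ i\<bar>)"
      unfolding poly_altdef by (rule sum_abs)
    also have "\<dots> \<le> (\<Sum>i\<le>degree p. \<bar>coeff p i\<bar> * (1 + u) ^ degree p)"
    proof (rule sum_mono)
      fix i assume "i \<in> {..degree p}"
      have "u ^ i \<le> (1 + u) ^ i" using that by (intro power_mono) auto
      also have "\<dots> \<le> (1 + u) ^ degree p" using that \<open>i \<in> _\<close> by (intro power_increasing) auto
      finally show "\<bar>coeff p i * u ^ i\<bar> \<le> \<bar>coeff p i\<bar> * (1 + u) ^ degree p"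
        using that by (simp add: abs_mult mult_left_mono)
    qed
    finally show ?thesis by (simp add: sum_distrib_right)
  qed
  then show ?thesis by (intro exI[of _ "\<Sum>i\<le>degree p. \<bar>coeff p i\<bar>"]) (auto intro: sum_nonneg)
qed

text \<open>A polynomial in u = t x^\<beta> times exp(-u) is bounded, also after multiplication by
  u^(M/\<beta>), which equals (t^(1/\<beta>) x)^M. This is the origin of the scale h =
  t^(1/\<beta>).\<close>

lemma symF_bound:
  assumes "0 < \<beta>"
  shows "\<exists>B\<ge>0. \<forall>t>0. \<forall>x>0. \<bar>symF \<beta> t i x\<bar> \<le> B / x ^ i \<and> \<bar>symF \<beta> t i x\<bar> \<le> B / ((t powr (1 / \<beta>)) ^ M * x ^ (i + M))"
proof -
  obtain C where C: "C \<ge> 0" "\<And>u. u \<ge> 0 \<Longrightarrow> \<bar>poly (symQ \<beta> i) u\<bar> \<le> C * (1 + u) ^ degree (symQ \<beta> i)"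
    using poly_abs_bound[of "symQ \<beta> i"] by blast
  define K where "K = degree (symQ \<beta> i) + nat \<lceil>real M / \<beta>\<rceil>"
  define B where "B = C * (exp 1 * fact K)"
  have "\<bar>symF \<beta> t i x\<bar> \<le> B / x ^ i \<and> \<bar>symF \<beta> t i x\<bar> \<le> B / ((t powr (1 / \<beta>)) ^ M * x ^ (i + M))"
    if t: "t > 0" and x: "x > 0" for t x
  proof -
    define u where "u = t * x powr \<beta>"
    define d where "d = degree (symQ \<beta> i)"
    have u: "u > 0" using t x by (simp add: u_def)
    have xi: "x powr (- real i) = 1 / x ^ i"
      using x by (simp add: powr_minus powr_realpow divide_inverse)
    have e: "\<bar>symF \<beta> t i x\<bar> * x ^ i = \<bar>poly (symQ \<beta> i) u\<bar> * exp (- u)"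
      unfolding symF_def u_def[symmetric] xi using x by (simp add: abs_mult)
    have pw: "u powr (real M / \<beta>) = (t powr (1 / \<beta>)) ^ M * x ^ M"
    proof -
      have "u powr (real M / \<beta>) = (t powr (1 / \<beta>)) powr real M * x powr real M"
        using assms unfolding u_def powr_mult by (simp add: powr_powr)
      then show ?thesis using t x by (simp add: powr_realpow)
    qed
    have le: "\<bar>poly (symQ \<beta> i) u\<bar> * exp (- u) * w \<le> B" if w: "0 \<le> w" "w \<le> (1 + u) ^ nat \<lceil>real M / \<beta>\<rceil>" for w
    proof -
      have "\<bar>poly (symQ \<beta> i) u\<bar> * exp (- u) * w \<le> (C * (1 + u) ^ d) * exp (- u) * (1 + u) ^ nat \<lceil>real M / \<beta>\<rceil>"
        using C(2)[of u] u w C(1) by (intro mult_mono) (auto simp: d_def)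
      also have "\<dots> = C * (exp (- u) * (1 + u) ^ K)" by (simp add: K_def d_def power_add)
      also have "\<dots> \<le> B" unfolding B_def using u C(1) by (intro mult_left_mono exp_neg_power_bound) auto
      finally show ?thesis .
    qed
    have "\<bar>symF \<beta> t i x\<bar> * x ^ i \<le> B" using le[of 1] e u by simp
    moreover have "u powr (real M / \<beta>) \<le> (1 + u) ^ nat \<lceil>real M / \<beta>\<rceil>"
    proof -
      have "u powr (real M / \<beta>) \<le> (1 + u) powr (real M / \<beta>)"
        using u assms by (intro powr_mono2) auto
      also have "\<dots> \<le> (1 + u) powr (real (nat \<lceil>real M / \<beta>\<rceil>))"
        using u assms by (intro powr_mono) (auto simp: real_nat_ceiling_ge)
      also have "\<dots> = (1 + u) ^ nat \<lceil>real M / \<beta>\<rceil>" using u by (simp add: powr_realpow)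
      finally show ?thesis .
    qed
    from le[OF powr_ge_zero this] have "\<bar>symF \<beta> t i x\<bar> * ((t powr (1 / \<beta>)) ^ M * x ^ (i + M)) \<le> B"
    proof -
      assume "\<bar>poly (symQ \<beta> i) u\<bar> * exp (- u) * u powr (real M / \<beta>) \<le> B"
      moreover have "\<bar>symF \<beta> t i x\<bar> * ((t powr (1 / \<beta>)) ^ M * x ^ (i + M)) = (\<bar>symF \<beta> t i x\<bar> * x ^ i) * u powr (real M / \<beta>)"
        unfolding pw by (simp add: power_add ac_simps)
      ultimately show ?thesis unfolding e by simp
    qed
    ultimately show ?thesis using t x by (simp add: pos_le_divide_eq)
  qed
  moreover have "B \<ge> 0" using C(1) by (simp add: B_def)
  ultimately show ?thesis by blast
qed

lemma Dop_pow_shift: "(Dop ^^ i) u k = (Dop ^^ i) (\<lambda>j. u (j + k)) 0"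
proof (induction i arbitrary: u k)
  case (Suc i)
  have "(Dop ^^ Suc i) u k = (Dop ^^ i) (Dop u) k" by (simp add: funpow_Suc_right del: funpow.simps)
  also have "\<dots> = (Dop ^^ i) (\<lambda>j. Dop u (j + k)) 0" by (rule Suc.IH)
  also have "(\<lambda>j. Dop u (j + k)) = Dop (\<lambda>j. u (j + k))" by (simp add: Dop_def fun_eq_iff)
  finally show ?case by (simp add: funpow_Suc_right del: funpow.simps)
qed simp

text \<open>One difference with step 2, the spacing of the eigenvalues, is traded for one derivative
  by the mean value theorem at the cost of a factor 2. The induction replaces the whole family
  \<open>G\<close> of successive derivatives by its difference.\<close>

lemma Dop_pow_deriv_bound:
  fixes G :: "nat \<Rightarrow> real \<Rightarrow> real"
  assumes "\<And>j x. 0 < x \<Longrightarrow> (G j has_real_derivative G (Suc j) x) (at x)"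
    and "0 < x0" "\<And>y. x0 \<le> y \<Longrightarrow> \<bar>G i y\<bar> \<le> B"
  shows "\<bar>(Dop ^^ i) (\<lambda>k. G 0 (x0 + 2 * real k)) 0\<bar> \<le> 2 ^ i * B"
  using assms
proof (induction i arbitrary: G B)
  case 0
  then show ?case by simp
next
  case (Suc i)
  define H where "H j y = G j y - G j (y + 2)" for j y
  have "\<bar>(Dop ^^ i) (\<lambda>k. H 0 (x0 + 2 * real k)) 0\<bar> \<le> 2 ^ i * (2 * B)"
  proof (rule Suc.IH)
    show "(H j has_real_derivative H (Suc j) x) (at x)" if "0 < x" for j x
    proof -
      have "((\<lambda>y. G j (y + 2)) has_real_derivative G (Suc j) (x + 2)) (at x)"
        using Suc.prems(1)[of "x + 2" j] that by (simp add: DERIV_shift add.commute)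
      then show ?thesis unfolding H_def using Suc.prems(1)[OF that, of j] by (intro DERIV_diff)
    qed
    show "\<bar>H i y\<bar> \<le> 2 * B" if y: "x0 \<le> y" for y
    proof -
      obtain z where z: "y < z" "z < y + 2" "G i (y + 2) - G i y = (y + 2 - y) * G (Suc i) z"
      proof -
        have "\<exists>z>y. z < y + 2 \<and> G i (y + 2) - G i y = (y + 2 - y) * G (Suc i) z"
          by (rule MVT2) (use Suc.prems(2) y in \<open>auto intro!: Suc.prems(1)\<close>)
        then show ?thesis using that by blast
      qed
      have "\<bar>G (Suc i) z\<bar> \<le> B" using Suc.prems(3)[of z] y z by auto
      moreover have "H i y = - (2 * G (Suc i) z)" using z(3) by (simp add: H_def)
      ultimately show ?thesis by simp
    qed
  qed (rule Suc.prems(2))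
  moreover have "Dop (\<lambda>k. G 0 (x0 + 2 * real k)) = (\<lambda>k. H 0 (x0 + 2 * real k))"
    by (simp add: Dop_def H_def fun_eq_iff algebra_simps)
  ultimately show ?case by (simp add: funpow_Suc_right del: funpow.simps)
qed

definition hmult :: "real \<Rightarrow> real \<Rightarrow> nat \<Rightarrow> nat \<Rightarrow> real" where
  "hmult \<beta> t d k = exp (- t * (2 * real k + real d) powr \<beta>)"

lemma hmult_pos: "0 < hmult \<beta> t d k"
  by (simp add: hmult_def)

text \<open>For positive \<open>d\<close> the eigenvalue 2 k + d dominates 1 + k, which turns its
  negative powers into those of \<open>symb\<close>. That \<open>B\<close> does not depend on
  \<open>t\<close> is what makes the kernel bound uniform over small times.\<close>

lemma symb_hmult:
  assumes "0 < \<beta>" "1 \<le> d"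
  shows "\<exists>B\<ge>0. \<forall>t>0. symb N M B (t powr (1 / \<beta>)) (hmult \<beta> t d)"
proof -
  have "\<forall>i. \<exists>B\<ge>0. \<forall>t>0. \<forall>x>0. \<bar>symF \<beta> t i x\<bar> \<le> B / x ^ i \<and> \<bar>symF \<beta> t i x\<bar> \<le> B / ((t powr (1 / \<beta>)) ^ M * x ^ (i + M))"
    using symF_bound[OF assms(1)] by blast
  then obtain B where B: "\<And>i. B i \<ge> 0" "\<And>i t x. t > 0 \<Longrightarrow> x > 0 \<Longrightarrow> \<bar>symF \<beta> t i x\<bar> \<le> B i / x ^ i"
     "\<And>i t x. t > 0 \<Longrightarrow> x > 0 \<Longrightarrow> \<bar>symF \<beta> t i x\<bar> \<le> B i / ((t powr (1 / \<beta>)) ^ M * x ^ (i + M))"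
    by metis
  define B' where "B' = (\<Sum>i\<le>N. 2 ^ i * B i)"
  have B': "2 ^ i * B i \<le> B'" if "i \<le> N" for i
    unfolding B'_def using that B(1) by (intro member_le_sum) auto
  have "symb N M B' (t powr (1 / \<beta>)) (hmult \<beta> t d)" if t: "t > 0" for t
    unfolding symb_def
  proof (intro allI impI)
    fix i k assume i: "i \<le> N"
    define h where "h = t powr (1 / \<beta>)"
    define x0 where "x0 = 2 * real k + real d"
    have x0: "x0 > 0" "1 + real k \<le> x0" using assms by (auto simp: x0_def)
    have h: "h > 0" using t by (simp add: h_def)
    have eq: "(Dop ^^ i) (hmult \<beta> t d) k = (Dop ^^ i) (\<lambda>j. symF \<beta> t 0 (x0 + 2 * real j)) 0"
    proof -
      have "hmult \<beta> t d (j + k) = symF \<beta> t 0 (x0 + 2 * real j)" for j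
        using x0 by (simp add: hmult_def symF_def x0_def algebra_simps)
      then show ?thesis by (subst Dop_pow_shift) simp
    qed
    have bd: "\<bar>(Dop ^^ i) (hmult \<beta> t d) k\<bar> \<le> B' / Y" if Y: "Y > 0" "\<And>y. x0 \<le> y \<Longrightarrow> \<bar>symF \<beta> t i y\<bar> \<le> B i / Y" for Y
    proof -
      have "\<bar>(Dop ^^ i) (hmult \<beta> t d) k\<bar> \<le> 2 ^ i * (B i / Y)"
        unfolding eq by (rule Dop_pow_deriv_bound[OF symF_deriv x0(1) Y(2)])
      also have "\<dots> \<le> B' / Y" using B'[OF i] Y(1) by (simp add: divide_right_mono)
      finally show ?thesis .
    qed
    show "\<bar>(Dop ^^ i) (hmult \<beta> t d) k\<bar> \<le> B' / (1 + real k) ^ i \<and>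
      \<bar>(Dop ^^ i) (hmult \<beta> t d) k\<bar> \<le> B' / ((t powr (1 / \<beta>)) ^ M * (1 + real k) ^ (i + M))"
      unfolding h_def[symmetric]
    proof (intro conjI bd)
      fix y assume y: "x0 \<le> y"
      have "\<bar>symF \<beta> t i y\<bar> \<le> B i / y ^ i" using B(2)[OF t, of y i] y x0 by auto
      also have "\<dots> \<le> B i / (1 + real k) ^ i" using y x0 B(1) by (intro divide_left_mono power_mono mult_pos_pos zero_less_power) auto
      finally show "\<bar>symF \<beta> t i y\<bar> \<le> B i / (1 + real k) ^ i" .
      have "\<bar>symF \<beta> t i y\<bar> \<le> B i / (h ^ M * y ^ (i + M))" using B(3)[OF t, of y i] y x0 by (auto simp: h_def)
      also have "\<dots> \<le> B i / (h ^ M * (1 + real k) ^ (i + M))" using y x0 B(1) h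
        by (intro divide_left_mono mult_left_mono power_mono mult_pos_pos zero_less_power) auto
      finally show "\<bar>symF \<beta> t i y\<bar> \<le> B i / (h ^ M * (1 + real k) ^ (i + M))" .
    qed (use h in auto)
  qed
  moreover have "B' \<ge> 0" unfolding B'_def using B(1) by (intro sum_nonneg) auto
  ultimately show ?thesis by blast
qed

lemma egrow_hmult: "0 \<le> t \<Longrightarrow> egrow (hmult \<beta> t d)"
  by (rule egrow_bounded[of _ 1]) (simp add: hmult_def)

lemma hmult_kernel_small:
  assumes "0 < \<beta>" "1 \<le> d"
  shows "\<exists>C\<ge>0. \<forall>t z s. 0 < t \<longrightarrow> t \<le> 1 \<longrightarrow> norm z \<le> s \<longrightarrow>
    exp (- s) * norm (Tser (hmult \<beta> t d) z) * (1 + 4 * (s - Re z)) ^ N * (1 + 4 * (t powr (1 / \<beta>) * s)) ^ M \<le> C"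
proof -
  obtain B where B: "B \<ge> 0" "\<And>t. t > 0 \<Longrightarrow> symb (2 * N) M B (t powr (1 / \<beta>)) (hmult \<beta> t d)"
    using symb_hmult[OF assms] by blast
  obtain C where C: "C \<ge> 0" "\<And>B h u z s. 0 \<le> B \<Longrightarrow> 0 < h \<Longrightarrow> h \<le> 1 \<Longrightarrow> symb (2 * N) M B h u \<Longrightarrow> norm z \<le> s \<Longrightarrow>
     exp (- s) * norm (Tser u z) * (1 + 4 * (s - Re z)) ^ N * (1 + 4 * (h * s)) ^ M \<le> C * B"
    using Tser_kernel_bound[of N M] by blast
  show ?thesis
    using assms(1) by (intro exI[of _ "C * B"] conjI allI impI C(2) B(2) mult_nonneg_nonneg B(1) C(1)) (auto simp: powr_le1)
qed

text \<open>At a fixed time only the rapid decay of the multiplier counts, so the constant may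
  depend on \<open>t\<close>. The bound serves at time 1 for the large times and, at each time, as
  the majorant in \<open>heat_series\<close>.\<close>

lemma hmult_kernel_abs:
  assumes "0 < \<beta>" "1 \<le> d" "0 < t"
  shows "\<exists>C\<ge>0. \<forall>r s. 0 \<le> r \<longrightarrow> r \<le> s \<longrightarrow>
    exp (- s) * (exp r * pois r (hmult \<beta> t d)) * (1 + 4 * s) ^ M \<le> C"
proof -
  obtain B where B: "B \<ge> 0" "\<And>t. t > 0 \<Longrightarrow> symb 0 M B (t powr (1 / \<beta>)) (hmult \<beta> t d)"
    using symb_hmult[OF assms(1,2)] by blast
  define B' where "B' = B / (t powr (1 / \<beta>)) ^ M"
  have B': "\<bar>hmult \<beta> t d k\<bar> \<le> B' / (1 + real k) ^ M" for k
    using B(2)[OF assms(3)] unfolding symb_def by (auto simp: B'_def)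
  obtain C where C: "C \<ge> 0" "\<And>B u r s. 0 \<le> B \<Longrightarrow> (\<And>k. \<bar>u k\<bar> \<le> B / (1 + real k) ^ M) \<Longrightarrow> 0 \<le> r \<Longrightarrow> r \<le> s \<Longrightarrow>
     exp (- s) * (exp r * pois r (\<lambda>k. \<bar>u k\<bar>)) * (1 + 4 * s) ^ M \<le> C * B"
    using Tser_abs_bound[of M] by blast
  have "0 \<le> B'" using B(1) by (simp add: B'_def)
  then show ?thesis using C(2)[OF _ B'] C(1) by (intro exI[of _ "C * B'"]) (auto simp: less_imp_le[OF hmult_pos])
qed

text \<open>Every eigenvalue is at least \<open>d\<close>, so the multiplier at \<open>t\<close> is
  at most exp(-(t - 1) d^\<beta>) times the multiplier at 1, and the absolute bound at time 1
  carries over with that factor.\<close>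

lemma hmult_kernel_large:
  assumes "0 < \<beta>" "1 \<le> d"
  shows "\<exists>C\<ge>0. \<forall>t z s. 1 \<le> t \<longrightarrow> norm z \<le> s \<longrightarrow>
    exp (- s) * norm (Tser (hmult \<beta> t d) z) * (1 + 4 * s) ^ M \<le> C * exp (- t * real d powr \<beta>)"
proof -
  obtain C where C: "C \<ge> 0" "\<And>r s. 0 \<le> r \<Longrightarrow> r \<le> s \<Longrightarrow>
      exp (- s) * (exp r * pois r (hmult \<beta> 1 d)) * (1 + 4 * s) ^ M \<le> C"
    using hmult_kernel_abs[OF assms zero_less_one, of M] by blast
  have "exp (- s) * norm (Tser (hmult \<beta> t d) z) * (1 + 4 * s) ^ M \<le> (exp (real d powr \<beta>) * C) * exp (- t * real d powr \<beta>)"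
    if t: "1 \<le> t" and s: "norm z \<le> s" for t z s
  proof -
    define c where "c = exp (real d powr \<beta>) * exp (- t * real d powr \<beta>)"
    have le: "hmult \<beta> t d k \<le> c * hmult \<beta> 1 d k" for k
    proof -
      have "real d powr \<beta> \<le> (2 * real k + real d) powr \<beta>" using assms by (intro powr_mono2) auto
      then have "(t - 1) * real d powr \<beta> \<le> (t - 1) * (2 * real k + real d) powr \<beta>" using t by (intro mult_left_mono) auto
      then show ?thesis unfolding c_def hmult_def exp_add[symmetric] by (simp add: algebra_simps)
    qed
    have "norm (Tser (hmult \<beta> t d) z) \<le> exp (norm z) * pois (norm z) (hmult \<beta> t d)"
      using norm_Tser_le[OF egrow_hmult, of t \<beta> d z] t by (simp add: less_imp_le[OF hmult_pos])
    also have "\<dots> \<le> exp (norm z) * pois (norm z) (\<lambda>k. c * hmult \<beta> 1 d k)"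
      using t le by (intro mult_left_mono pois_mono egrow_cmult egrow_hmult) auto
    also have "\<dots> = c * (exp (norm z) * pois (norm z) (hmult \<beta> 1 d))"
      by (subst pois_cmult) (auto intro: egrow_hmult)
    finally have "exp (- s) * norm (Tser (hmult \<beta> t d) z) * (1 + 4 * s) ^ M
       \<le> exp (- s) * (c * (exp (norm z) * pois (norm z) (hmult \<beta> 1 d))) * (1 + 4 * s) ^ M"
      using order_trans[OF norm_ge_zero s] by (intro mult_right_mono mult_left_mono) auto
    also have "\<dots> = c * (exp (- s) * (exp (norm z) * pois (norm z) (hmult \<beta> 1 d)) * (1 + 4 * s) ^ M)"
      by (simp only: ac_simps)
    also have "\<dots> \<le> c * C" using s by (intro mult_left_mono C(2)) (auto simp: c_def)
    finally show ?thesis by (simp add: c_def ac_simps)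
  qed
  then show ?thesis using C(1) by (intro exI[of _ "exp (real d powr \<beta>) * C"]) auto
qed

section \<open>Schwartz functions\<close>

text \<open>Relational form of the partial derivative: values of \<open>pdiff\<close> are computed
  by exhibiting a derivative, and differentiability comes with it.\<close>

definition has_pd :: "'n::finite \<Rightarrow> (real^'n \<Rightarrow> complex) \<Rightarrow> real^'n \<Rightarrow> complex \<Rightarrow> bool" where
  "has_pd i f x D \<longleftrightarrow> ((\<lambda>h::real. f (x + h *\<^sub>R axis i 1)) has_vector_derivative D) (at 0)"

lemma has_pd_pdiff: "has_pd i f x D \<Longrightarrow> pdiff i f x = D"
  unfolding has_pd_def pdiff_def by (rule vector_derivative_at)

lemma differentiable_iff_has_pd:
  "(\<lambda>h::real. f (x + h *\<^sub>R axis i 1)) differentiable (at 0) \<longleftrightarrow> has_pd i f x (pdiff i f x)"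
  unfolding has_pd_def pdiff_def by (simp add: vector_derivative_works)

lemma has_pdI: "has_pd i f x D \<Longrightarrow> has_pd i f x (pdiff i f x)"
  by (simp add: has_pd_pdiff)

lemma has_pd_add: "has_pd i f x D \<Longrightarrow> has_pd i g x E \<Longrightarrow> has_pd i (\<lambda>y. f y + g y) x (D + E)"
  unfolding has_pd_def by (rule has_vector_derivative_add)

lemma has_pd_mult: "has_pd i f x D \<Longrightarrow> has_pd i g x E \<Longrightarrow> has_pd i (\<lambda>y. f y * g y) x (f x * E + D * g x)"
  unfolding has_pd_def using has_vector_derivative_mult[of "\<lambda>h. f (x + h *\<^sub>R axis i 1)" D 0 UNIV "\<lambda>h. g (x + h *\<^sub>R axis i 1)" E] by simp

lemma has_pd_const: "has_pd i (\<lambda>_. c) x 0"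
  unfolding has_pd_def by (rule has_vector_derivative_const)

lemma has_pd_cmult: "has_pd i f x D \<Longrightarrow> has_pd i (\<lambda>y. c * f y) x (c * D)"
  using has_pd_mult[OF has_pd_const, of i f x D c] by simp

lemma has_pd_cnj: "has_pd i f x D \<Longrightarrow> has_pd i (\<lambda>y. cnj (f y)) x (cnj D)"
  unfolding has_pd_def by (rule bounded_linear.has_vector_derivative[OF bounded_linear_cnj])

lemma has_pd_shift: "has_pd i f (x - a) D \<Longrightarrow> has_pd i (\<lambda>y. f (y - a)) x D"
  unfolding has_pd_def by (simp add: algebra_simps)

lemma has_pd_cis: "has_pd i (\<lambda>y. cis (\<eta> \<bullet> y)) x (\<i> * of_real (\<eta> $ i) * cis (\<eta> \<bullet> x))"
proof -
  have "((\<lambda>z. exp (\<i> * (of_real (\<eta> \<bullet> x) + z * of_real (\<eta> $ i)))) has_field_derivative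
      \<i> * of_real (\<eta> $ i) * exp (\<i> * (of_real (\<eta> \<bullet> x) + of_real 0 * of_real (\<eta> $ i)))) (at (of_real 0))"
    by (auto intro!: derivative_eq_intros)
  from has_vector_derivative_real_field[OF this, of UNIV]
  show ?thesis unfolding has_pd_def by (simp add: cis_conv_exp inner_add_right inner_axis)
qed

lemma has_pd_coord: "has_pd i (\<lambda>y. of_real (y $ j)) x (if i = j then 1 else 0)"
proof -
  have "((\<lambda>h. x $ j + h * axis i 1 $ j) has_real_derivative axis i 1 $ j) (at 0)"
    by (auto intro!: derivative_eq_intros)
  then have "((\<lambda>h. complex_of_real (x $ j + h * axis i 1 $ j)) has_vector_derivative of_real (axis i 1 $ j)) (at 0)"
    by (intro has_vector_derivative_of_real) (simp add: has_real_derivative_iff_has_vector_derivative)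
  then show ?thesis unfolding has_pd_def by (cases "i = j") (auto simp: axis_def)
qed

lemma pdiffs_Nil [simp]: "pdiffs [] f = f"
  and pdiffs_Cons [simp]: "pdiffs (d # ds) f = pdiff d (pdiffs ds f)"
  and pdiffs_append: "pdiffs (ds @ es) f = pdiffs ds (pdiffs es f)"
  and pdiffs_snoc: "pdiffs (ds @ [d]) f = pdiffs ds (pdiff d f)"
  by (simp_all add: pdiffs_def)

lemma schwartz_has_pd:
  assumes "schwartz f" shows "has_pd i f x (pdiff i f x)"
proof -
  have "(\<lambda>h::real. pdiffs [] f (x + h *\<^sub>R axis i 1)) differentiable (at 0)"
    using assms unfolding schwartz_def by blast
  then show ?thesis by (simp add: differentiable_iff_has_pd)
qed

lemma schwartz_pdiffs: "schwartz f \<Longrightarrow> schwartz (pdiffs ds f)"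
  unfolding schwartz_def pdiffs_append[symmetric] by blast

lemma schwartz_pdiff: "schwartz f \<Longrightarrow> schwartz (pdiff d f)"
  using schwartz_pdiffs[of f "[d]"] by simp

lemma schwartz_bound:
  assumes "schwartz f" shows "\<exists>C\<ge>0. \<forall>x. (1 + norm x) ^ N * norm (f x) \<le> C"
proof -
  have "bounded (range (\<lambda>x. (1 + norm x) ^ N * norm (f x)))"
  proof -
    have "bounded (range (\<lambda>x. (1 + norm x) ^ N * norm (pdiffs [] f x)))"
      using assms unfolding schwartz_def by blast
    then show ?thesis by simp
  qed
  then obtain C where C: "\<And>x. norm ((1 + norm x) ^ N * norm (f x)) \<le> C" by (auto simp: bounded_iff)
  have "(1 + norm x) ^ N * norm (f x) \<le> max C 0" for x
    by (rule order_trans[OF order_trans[OF abs_ge_self C[of x, unfolded real_norm_def]] max.cobounded1])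
  then show ?thesis by (intro exI[of _ "max C 0"]) auto
qed

text \<open>Coinduction: a set closed under \<open>pdiff\<close> contains all iterated derivatives
  of its members, so differentiability and decay need to be checked for the members alone.\<close>

lemma schwartzI_class:
  assumes "f \<in> \<C>"
    and d: "\<And>f i x. f \<in> \<C> \<Longrightarrow> \<exists>D. has_pd i f x D"
    and c: "\<And>f i. f \<in> \<C> \<Longrightarrow> pdiff i f \<in> \<C>"
    and b: "\<And>f N. f \<in> \<C> \<Longrightarrow> \<exists>C. \<forall>x. (1 + norm x) ^ N * norm (f x) \<le> C"
  shows "schwartz f"
proof -
  have p: "pdiffs ds f \<in> \<C>" for ds
    by (induction ds) (use assms(1) c in auto)
  show ?thesis unfolding schwartz_def
  proof (intro conjI allI)
    show "(\<lambda>h::real. pdiffs ds f (x + h *\<^sub>R axis i 1)) differentiable (at 0)" for ds i x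
      unfolding differentiable_iff_has_pd using d[OF p] has_pdI by blast
    show "bounded (range (\<lambda>x. (1 + norm x) ^ N * norm (pdiffs ds f x)))" for ds N
    proof -
      obtain C where "\<And>x. (1 + norm x) ^ N * norm (pdiffs ds f x) \<le> C" using b[OF p] by blast
      then show ?thesis by (auto simp: bounded_iff abs_mult intro!: exI[of _ C])
    qed
  qed
qed

lemma schwartz_lincomb:
  fixes f g :: "real^'n::finite \<Rightarrow> complex"
  assumes "schwartz f" "schwartz g"
  shows "schwartz (\<lambda>y. a * f y + b * g y)"
proof -
  define \<C> :: "(real^'n \<Rightarrow> complex) set" where "\<C> = {(\<lambda>y. a * f y + b * g y) | f g. schwartz f \<and> schwartz g}"
  have pd: "has_pd i (\<lambda>y. a * f y + b * g y) x (a * pdiff i f x + b * pdiff i g x)" if "schwartz f" "schwartz g" for f g :: "real^'n \<Rightarrow> complex" and i x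
    using that by (intro has_pd_add has_pd_cmult schwartz_has_pd)
  have mem: "(\<lambda>y. a * f y + b * g y) \<in> \<C>" if "schwartz f" "schwartz g" for f g :: "real^'n \<Rightarrow> complex"
    unfolding \<C>_def by (intro CollectI exI[of _ f] exI[of _ g] conjI refl that)
  show ?thesis
  proof (rule schwartzI_class[of _ \<C>])
    show "(\<lambda>y. a * f y + b * g y) \<in> \<C>" by (rule mem) (rule assms)+
    show "\<exists>D. has_pd i F x D" if "F \<in> \<C>" for F i x
    proof -
      obtain f g where F: "F = (\<lambda>y. a * f y + b * g y)" "schwartz f" "schwartz g" using \<open>F \<in> \<C>\<close> unfolding \<C>_def by blast
      show ?thesis unfolding F(1) by (rule exI) (rule pd[OF F(2,3)])
    qed
    show "pdiff i F \<in> \<C>" if "F \<in> \<C>" for F i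
    proof -
      obtain f g where F: "F = (\<lambda>y. a * f y + b * g y)" "schwartz f" "schwartz g" using \<open>F \<in> \<C>\<close> unfolding \<C>_def by blast
      have "pdiff i F = (\<lambda>y. a * pdiff i f y + b * pdiff i g y)"
        unfolding F(1) using has_pd_pdiff[OF pd[OF F(2,3)]] by (intro ext)
      then show ?thesis using mem[OF schwartz_pdiff[OF F(2)] schwartz_pdiff[OF F(3)]] by simp
    qed
    show "\<exists>C. \<forall>x. (1 + norm x) ^ N * norm (F x) \<le> C" if "F \<in> \<C>" for F N
    proof -
      obtain f g where F: "F = (\<lambda>y. a * f y + b * g y)" "schwartz f" "schwartz g" using \<open>F \<in> \<C>\<close> unfolding \<C>_def by blast
      obtain A where A: "\<And>x. (1 + norm x) ^ N * norm (f x) \<le> A" using schwartz_bound[OF F(2), of N] by blast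
      obtain B where B: "\<And>x. (1 + norm x) ^ N * norm (g x) \<le> B" using schwartz_bound[OF F(3), of N] by blast
      have "(1 + norm x) ^ N * norm (F x) \<le> norm a * A + norm b * B" for x
      proof -
        have "(1 + norm x) ^ N * norm (F x) \<le> (1 + norm x) ^ N * (norm a * norm (f x) + norm b * norm (g x))"
          unfolding F(1) by (intro mult_left_mono norm_triangle_le) (auto simp: norm_mult)
        also have "\<dots> = norm a * ((1 + norm x) ^ N * norm (f x)) + norm b * ((1 + norm x) ^ N * norm (g x))"
          by (simp add: algebra_simps)
        also have "\<dots> \<le> norm a * A + norm b * B" by (intro add_mono mult_left_mono A B) auto
        finally show ?thesis .
      qed
      then show ?thesis by blast
    qed
  qed
qed

lemma pdiff_lincomb:
  assumes "schwartz f" "schwartz g"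
  shows "pdiff i (\<lambda>y. a * f y + b * g y) = (\<lambda>y. a * pdiff i f y + b * pdiff i g y)"
  by (intro ext has_pd_pdiff has_pd_add has_pd_cmult schwartz_has_pd assms)

lemma pdiffs_lincomb:
  assumes "schwartz f" "schwartz g"
  shows "pdiffs ds (\<lambda>y. a * f y + b * g y) = (\<lambda>y. a * pdiffs ds f y + b * pdiffs ds g y)"
  by (induction ds) (simp_all add: pdiff_lincomb schwartz_pdiffs assms)

lemma schwartz_cmult: "schwartz f \<Longrightarrow> schwartz (\<lambda>y. a * f y)"
  using schwartz_lincomb[of f f a 0] by simp

lemma schwartz_zero: "schwartz (\<lambda>_. 0)"
proof (rule schwartzI_class[of _ "{\<lambda>_. 0}"])
  show "pdiff i f \<in> {\<lambda>_. 0}" if "f \<in> {\<lambda>_. 0}" for f and i :: 'a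
    using that has_pd_pdiff[OF has_pd_const[of i 0]] by auto
qed (auto intro: has_pd_const)

lemma pdiffs_zero: "pdiffs ds (\<lambda>_. 0) = (\<lambda>_. 0)"
  by (induction ds) (auto intro!: ext has_pd_pdiff has_pd_const)

lemma schwartz_sum:
  assumes "finite I" "\<And>i. i \<in> I \<Longrightarrow> schwartz (f i)"
  shows "schwartz (\<lambda>y. \<Sum>i\<in>I. c i * f i y) \<and> (\<forall>ds. pdiffs ds (\<lambda>y. \<Sum>i\<in>I. c i * f i y) = (\<lambda>y. \<Sum>i\<in>I. c i * pdiffs ds (f i) y))"
  using assms
proof (induction rule: finite_induct)
  case empty
  then show ?case by (simp add: schwartz_zero pdiffs_zero)
next
  case (insert j I)
  then have s: "schwartz (\<lambda>y. \<Sum>i\<in>I. c i * f i y)" "schwartz (f j)"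
     "\<And>ds. pdiffs ds (\<lambda>y. \<Sum>i\<in>I. c i * f i y) = (\<lambda>y. \<Sum>i\<in>I. c i * pdiffs ds (f i) y)" by auto
  have eq: "(\<lambda>y. \<Sum>i\<in>insert j I. c i * f i y) = (\<lambda>y. c j * f j y + 1 * (\<Sum>i\<in>I. c i * f i y))"
    using insert by simp
  show ?case unfolding eq using s insert(1,2)
    by (simp only: schwartz_lincomb[OF s(2,1)] pdiffs_lincomb[OF s(2,1)]) simp
qed

lemma schwartz_cnj:
  fixes f :: "real^'n::finite \<Rightarrow> complex"
  assumes "schwartz f" shows "schwartz (\<lambda>y. cnj (f y))"
proof -
  define \<C> :: "(real^'n \<Rightarrow> complex) set" where "\<C> = {(\<lambda>y. cnj (f y)) | f. schwartz f}"
  have mem: "(\<lambda>y. cnj (f y)) \<in> \<C>" if "schwartz f" for f :: "real^'n \<Rightarrow> complex"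
    unfolding \<C>_def by (intro CollectI exI[of _ f] conjI refl that)
  show ?thesis
  proof (rule schwartzI_class[of _ \<C>])
  have pd: "has_pd i (\<lambda>y. cnj (f y)) x (cnj (pdiff i f x))" if "schwartz f" for f :: "real^'n \<Rightarrow> complex" and i x
    using that by (intro has_pd_cnj schwartz_has_pd)
  show "(\<lambda>y. cnj (f y)) \<in> \<C>" by (rule mem) (rule assms)+
  show "\<exists>D. has_pd i F x D" if "F \<in> \<C>" for F i x
    proof -
      obtain f where F: "F = (\<lambda>y. cnj (f y))" "schwartz f" using \<open>F \<in> \<C>\<close> unfolding \<C>_def by blast
      show ?thesis unfolding F(1) by (rule exI) (rule pd[OF F(2)])
    qed
  show "pdiff i F \<in> \<C>" if "F \<in> \<C>" for F i
  proof -
    obtain f where F: "F = (\<lambda>y. cnj (f y))" "schwartz f" using \<open>F \<in> \<C>\<close> unfolding \<C>_def by blast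
    have "pdiff i F = (\<lambda>y. cnj (pdiff i f y))" unfolding F(1) by (rule ext) (rule has_pd_pdiff[OF pd[OF F(2)]])
    then show ?thesis using mem[OF schwartz_pdiff[OF F(2)]] by simp
  qed
  show "\<exists>C. \<forall>x. (1 + norm x) ^ N * norm (F x) \<le> C" if "F \<in> \<C>" for F N
      proof -
    obtain f where F: "F = (\<lambda>y. cnj (f y))" "schwartz f" using \<open>F \<in> \<C>\<close> unfolding \<C>_def by blast
    then show ?thesis using schwartz_bound[OF F(2), of N] by (auto simp: F(1))
  qed
qed
qed

lemma weight_power_submult:
  fixes a b :: "'a::real_normed_vector"
  shows "(1 + norm (a + b)) ^ N \<le> (1 + norm a) ^ N * (1 + norm b) ^ N"
  unfolding power_mult_distrib[symmetric] by (intro power_mono weight_submult) auto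

lemma schwartz_shift:
  fixes f :: "real^'n::finite \<Rightarrow> complex"
  assumes "schwartz f" shows "schwartz (\<lambda>y. f (y - a))"
proof -
  define \<C> :: "(real^'n \<Rightarrow> complex) set" where "\<C> = {(\<lambda>y. f (y - a)) | f. schwartz f}"
  have mem: "(\<lambda>y. f (y - a)) \<in> \<C>" if "schwartz f" for f :: "real^'n \<Rightarrow> complex"
    unfolding \<C>_def by (intro CollectI exI[of _ f] conjI refl that)
  show ?thesis
  proof (rule schwartzI_class[of _ \<C>])
  have pd: "has_pd i (\<lambda>y. f (y - a)) x (pdiff i f (x - a))" if "schwartz f" for f :: "real^'n \<Rightarrow> complex" and i x
    using that by (intro has_pd_shift schwartz_has_pd)
  show "(\<lambda>y. f (y - a)) \<in> \<C>" by (rule mem) (rule assms)+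
  show "\<exists>D. has_pd i F x D" if "F \<in> \<C>" for F i x
    proof -
      obtain f where F: "F = (\<lambda>y. f (y - a))" "schwartz f" using \<open>F \<in> \<C>\<close> unfolding \<C>_def by blast
      show ?thesis unfolding F(1) by (rule exI) (rule pd[OF F(2)])
    qed
  show "pdiff i F \<in> \<C>" if "F \<in> \<C>" for F i
  proof -
    obtain f where F: "F = (\<lambda>y. f (y - a))" "schwartz f" using \<open>F \<in> \<C>\<close> unfolding \<C>_def by blast
    have "pdiff i F = (\<lambda>y. pdiff i f (y - a))" unfolding F(1) by (rule ext) (rule has_pd_pdiff[OF pd[OF F(2)]])
    then show ?thesis using mem[OF schwartz_pdiff[OF F(2)]] by simp
  qed
  show "\<exists>C. \<forall>x. (1 + norm x) ^ N * norm (F x) \<le> C" if "F \<in> \<C>" for F N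
  proof -
    obtain f where F: "F = (\<lambda>y. f (y - a))" "schwartz f" using \<open>F \<in> \<C>\<close> unfolding \<C>_def by blast
    obtain C where C: "\<And>x. (1 + norm x) ^ N * norm (f x) \<le> C" using schwartz_bound[OF F(2), of N] by blast
    have "(1 + norm x) ^ N * norm (F x) \<le> (1 + norm a) ^ N * C" for x
    proof -
      have "(1 + norm x) ^ N * norm (F x) \<le> ((1 + norm (x - a)) ^ N * (1 + norm a) ^ N) * norm (F x)"
        using weight_power_submult[of "x - a" a N] by (intro mult_right_mono) auto
      also have "\<dots> = (1 + norm a) ^ N * ((1 + norm (x - a)) ^ N * norm (f (x - a)))" by (simp add: F(1))
      also have "\<dots> \<le> (1 + norm a) ^ N * C" by (intro mult_left_mono C) auto
      finally show ?thesis .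
    qed
    then show ?thesis by blast
  qed
qed
qed

text \<open>The modulated Schwartz functions with frequency \<open>\<eta>\<close> are closed under
  \<open>pdiff\<close>, because the derivative of the phase is absorbed into the Schwartz
  factor.\<close>

lemma schwartz_cis:
  fixes f :: "real^'n::finite \<Rightarrow> complex"
  assumes "schwartz f" shows "schwartz (\<lambda>y. cis (\<eta> \<bullet> y) * f y)"
proof -
  define \<C> :: "(real^'n \<Rightarrow> complex) set" where "\<C> = {(\<lambda>y. cis (\<eta> \<bullet> y) * f y) | f. schwartz f}"
  have mem: "(\<lambda>y. cis (\<eta> \<bullet> y) * f y) \<in> \<C>" if "schwartz f" for f :: "real^'n \<Rightarrow> complex"
    unfolding \<C>_def by (intro CollectI exI[of _ f] conjI refl that)
  show ?thesis
  proof (rule schwartzI_class[of _ \<C>])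
  have pd: "has_pd i (\<lambda>y. cis (\<eta> \<bullet> y) * f y) x (cis (\<eta> \<bullet> x) * (\<i> * of_real (\<eta> $ i) * f x + 1 * pdiff i f x))" if "schwartz f" for f :: "real^'n \<Rightarrow> complex" and i x
    using has_pd_mult[OF has_pd_cis schwartz_has_pd[OF that], of i \<eta> x] by (simp add: algebra_simps)
  show "(\<lambda>y. cis (\<eta> \<bullet> y) * f y) \<in> \<C>" by (rule mem) (rule assms)+
  show "\<exists>D. has_pd i F x D" if "F \<in> \<C>" for F i x
    proof -
      obtain f where F: "F = (\<lambda>y. cis (\<eta> \<bullet> y) * f y)" "schwartz f" using \<open>F \<in> \<C>\<close> unfolding \<C>_def by blast
      show ?thesis unfolding F(1) by (rule exI) (rule pd[OF F(2)])
    qed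
  show "pdiff i F \<in> \<C>" if "F \<in> \<C>" for F i
  proof -
    obtain f where F: "F = (\<lambda>y. cis (\<eta> \<bullet> y) * f y)" "schwartz f" using \<open>F \<in> \<C>\<close> unfolding \<C>_def by blast
    have "pdiff i F = (\<lambda>y. cis (\<eta> \<bullet> y) * (\<i> * of_real (\<eta> $ i) * f y + 1 * pdiff i f y))" unfolding F(1) by (rule ext) (rule has_pd_pdiff[OF pd[OF F(2)]])
    moreover have "schwartz (\<lambda>y. \<i> * of_real (\<eta> $ i) * f y + 1 * pdiff i f y)"
      by (intro schwartz_lincomb schwartz_pdiff F(2))
    ultimately show ?thesis using mem by simp
  qed
  show "\<exists>C. \<forall>x. (1 + norm x) ^ N * norm (F x) \<le> C" if "F \<in> \<C>" for F N
      proof -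
    obtain f where F: "F = (\<lambda>y. cis (\<eta> \<bullet> y) * f y)" "schwartz f" using \<open>F \<in> \<C>\<close> unfolding \<C>_def by blast
    then show ?thesis using schwartz_bound[OF F(2), of N] by (auto simp: F(1) norm_mult)
  qed
  qed
qed

section \<open>Polynomials times the Gaussian, and the Hermite functions\<close>

definition gauss :: "real^'n::finite \<Rightarrow> complex" where
  "gauss y = of_real (exp (- (norm y)\<^sup>2 / 2))"

text \<open>The span of the polynomials times the Gaussian, generated by rules along which closure
  under differentiation and rapid decay go by induction.\<close>

inductive_set gauss_poly_class :: "(real^'n::finite \<Rightarrow> complex) set" where
  base: "gauss \<in> gauss_poly_class"
| add: "f \<in> gauss_poly_class \<Longrightarrow> g \<in> gauss_poly_class \<Longrightarrow> (\<lambda>y. f y + g y) \<in> gauss_poly_class"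
| scale: "f \<in> gauss_poly_class \<Longrightarrow> (\<lambda>y. c * f y) \<in> gauss_poly_class"
| coord: "f \<in> gauss_poly_class \<Longrightarrow> (\<lambda>y. of_real (y $ j) * f y) \<in> gauss_poly_class"

lemma has_pd_gauss: "has_pd i gauss x ((-1) * (of_real (x $ i) * gauss x))"
proof -
  have n: "(norm (x + h *\<^sub>R axis i 1))\<^sup>2 = (norm x)\<^sup>2 + 2 * h * x $ i + h\<^sup>2" for h :: real
  proof -
    have "(norm (x + h *\<^sub>R axis i 1))\<^sup>2 = (norm x)\<^sup>2 + (norm (h *\<^sub>R axis i (1::real)))\<^sup>2 + 2 * (x \<bullet> (h *\<^sub>R axis i 1))"
      unfolding power2_norm_eq_inner inner_add_left inner_add_right
      using inner_commute[of "h *\<^sub>R axis i 1" x] by linarith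
    then show ?thesis by (simp add: inner_axis)
  qed
  have "((\<lambda>h. exp (- ((norm x)\<^sup>2 + 2 * h * x $ i + h\<^sup>2) / 2)) has_real_derivative - (x $ i) * exp (- (norm x)\<^sup>2 / 2)) (at 0)"
    by (auto intro!: derivative_eq_intros)
  then have "((\<lambda>h. complex_of_real (exp (- ((norm x)\<^sup>2 + 2 * h * x $ i + h\<^sup>2) / 2))) has_vector_derivative of_real (- (x $ i) * exp (- (norm x)\<^sup>2 / 2))) (at 0)"
    by (intro has_vector_derivative_of_real) (simp add: has_real_derivative_iff_has_vector_derivative)
  then show ?thesis unfolding has_pd_def gauss_def n by simp
qed

lemma gauss_poly_class_pd: "f \<in> gauss_poly_class \<Longrightarrow> \<exists>F\<in>gauss_poly_class. \<forall>x. has_pd i f x (F x)"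
proof (induction rule: gauss_poly_class.induct)
  case base
  have "\<forall>x. has_pd i gauss x ((\<lambda>x. (-1) * (of_real (x $ i) * gauss x)) x)"
    by (rule allI) (rule has_pd_gauss)
  then show ?case by (rule bexI[OF _ gauss_poly_class.scale[OF gauss_poly_class.coord[OF gauss_poly_class.base]]])
next
  case (add f g)
  obtain F where F: "F \<in> gauss_poly_class" "\<And>x. has_pd i f x (F x)" using add.IH(1) by blast
  obtain G where G: "G \<in> gauss_poly_class" "\<And>x. has_pd i g x (G x)" using add.IH(2) by blast
  have "\<forall>x. has_pd i (\<lambda>y. f y + g y) x ((\<lambda>y. F y + G y) x)"
    by (rule allI) (rule has_pd_add[OF F(2) G(2)])
  then show ?case by (rule bexI[OF _ gauss_poly_class.add[OF F(1) G(1)]])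
next
  case (scale f c)
  obtain F where F: "F \<in> gauss_poly_class" "\<And>x. has_pd i f x (F x)" using scale.IH by blast
  have "\<forall>x. has_pd i (\<lambda>y. c * f y) x ((\<lambda>y. c * F y) x)"
    by (rule allI) (rule has_pd_cmult[OF F(2)])
  then show ?case by (rule bexI[OF _ gauss_poly_class.scale[OF F(1)]])
next
  case (coord f j)
  obtain F where F: "F \<in> gauss_poly_class" "\<And>x. has_pd i f x (F x)" using coord.IH by blast
  have "\<forall>x. has_pd i (\<lambda>y. of_real (y $ j) * f y) x ((\<lambda>x. of_real (x $ j) * F x + (if i = j then 1 else 0) * f x) x)"
    by (rule allI) (rule has_pd_mult[OF has_pd_coord F(2)])
  then show ?case by (rule bexI[OF _ gauss_poly_class.add[OF gauss_poly_class.coord[OF F(1)] gauss_poly_class.scale[OF coord.hyps]]])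
qed

text \<open>Multiplication by a coordinate costs one power of the weight, so the induction has to
  hold for all \<open>N\<close> at once.\<close>

lemma gauss_poly_class_bound: "f \<in> gauss_poly_class \<Longrightarrow> \<exists>C. \<forall>x. (1 + norm x) ^ N * norm (f x) \<le> C"
proof (induction arbitrary: N rule: gauss_poly_class.induct)
  case base
  have "(1 + norm x) ^ N * norm (gauss x) \<le> exp (1/2) * (exp 1 * fact N)" for x :: "real^'a"
  proof -
    have "- (norm x)\<^sup>2 / 2 \<le> 1/2 + - norm x"
      using zero_le_power2[of "norm x - 1"] by (simp add: power2_eq_square algebra_simps)
    then have "exp (- (norm x)\<^sup>2 / 2) \<le> exp (1/2) * exp (- norm x)" unfolding exp_add[symmetric] by simp
    then have "(1 + norm x) ^ N * norm (gauss x) \<le> (1 + norm x) ^ N * (exp (1/2) * exp (- norm x))"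
      by (intro mult_left_mono) (auto simp: gauss_def)
    also have "\<dots> = exp (1/2) * (exp (- norm x) * (1 + norm x) ^ N)" by (simp only: ac_simps)
    also have "\<dots> \<le> exp (1/2) * (exp 1 * fact N)" by (intro mult_left_mono exp_neg_power_bound) auto
    finally show ?thesis .
  qed
  then show ?case by blast
next
  case (add f g)
  obtain A where A: "\<And>x. (1 + norm x) ^ N * norm (f x) \<le> A" using add.IH(1)[of N] by blast
  obtain B where B: "\<And>x. (1 + norm x) ^ N * norm (g x) \<le> B" using add.IH(2)[of N] by blast
  have "(1 + norm x) ^ N * norm (f x + g x) \<le> A + B" for x
  proof -
    have "(1 + norm x) ^ N * norm (f x + g x) \<le> (1 + norm x) ^ N * (norm (f x) + norm (g x))"
      by (intro mult_left_mono norm_triangle_ineq) auto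
    then show ?thesis using A[of x] B[of x] by (simp add: distrib_left)
  qed
  then show ?case by blast
next
  case (scale f c)
  obtain A where A: "\<And>x. (1 + norm x) ^ N * norm (f x) \<le> A" using scale.IH[of N] by blast
  have "(1 + norm x) ^ N * norm (c * f x) \<le> norm c * A" for x
    using mult_left_mono[OF A[of x], of "norm c"] by (simp add: norm_mult ac_simps)
  then show ?case by blast
next
  case (coord f j)
  obtain A where A: "\<And>x. (1 + norm x) ^ Suc N * norm (f x) \<le> A" using coord.IH[of "Suc N"] by blast
  have "(1 + norm x) ^ N * norm (of_real (x $ j) * f x) \<le> A" for x
  proof -
    have "\<bar>x $ j\<bar> \<le> 1 + norm x" using component_le_norm_cart[of x j] by linarith
    then have "(1 + norm x) ^ N * (\<bar>x $ j\<bar> * norm (f x)) \<le> (1 + norm x) ^ N * ((1 + norm x) * norm (f x))"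
      by (intro mult_left_mono mult_right_mono) auto
    also have "\<dots> = (1 + norm x) ^ Suc N * norm (f x)" by (simp add: ac_simps)
    finally show ?thesis using A[of x] by (simp add: norm_mult)
  qed
  then show ?case by blast
qed

lemma schwartz_gauss_poly_class: "f \<in> gauss_poly_class \<Longrightarrow> schwartz f"
proof (rule schwartzI_class[of f gauss_poly_class])
  show "\<exists>D. has_pd i f x D" if "f \<in> gauss_poly_class" for f :: "real^'a \<Rightarrow> complex" and i x using gauss_poly_class_pd[OF that, of i] by blast
  show "pdiff i f \<in> gauss_poly_class" if "f \<in> gauss_poly_class" for f :: "real^'a \<Rightarrow> complex" and i
  proof -
    obtain F where F: "F \<in> gauss_poly_class" "\<And>x. has_pd i f x (F x)" using gauss_poly_class_pd[OF \<open>f \<in> gauss_poly_class\<close>, of i] by blast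
    have "pdiff i f = F" using has_pd_pdiff[OF F(2)] by (intro ext)
    then show ?thesis using F by simp
  qed
qed (auto intro: gauss_poly_class_bound)

lemma gauss_poly_class_hermite_poly: "f \<in> gauss_poly_class \<Longrightarrow> (\<lambda>y. of_real (hermite_poly n (y $ i)) * f y) \<in> gauss_poly_class"
proof (induction n arbitrary: f rule: less_induct)
  case (less n)
  consider "n = 0" | "n = Suc 0" | m where "n = Suc (Suc m)" by (metis nat.exhaust)
  then show ?case
  proof cases
    case 1 then show ?thesis using less.prems by simp
  next
    case 2
    then have eq: "(\<lambda>y. of_real (hermite_poly n (y $ i)) * f y) = (\<lambda>y. 2 * (of_real (y $ i) * f y))" by (simp add: fun_eq_iff)
    show ?thesis unfolding eq by (intro gauss_poly_class.scale gauss_poly_class.coord less.prems)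
  next
    case (3 m)
    then have eq: "(\<lambda>y. of_real (hermite_poly n (y $ i)) * f y) =
      (\<lambda>y. 2 * (of_real (y $ i) * (of_real (hermite_poly (Suc m) (y $ i)) * f y)) + (- 2 * of_nat (Suc m)) * (of_real (hermite_poly m (y $ i)) * f y))"
      by (simp add: fun_eq_iff algebra_simps)
    show ?thesis unfolding eq by (intro gauss_poly_class.add gauss_poly_class.scale gauss_poly_class.coord less.IH less.prems) (use 3 in auto)
  qed
qed

lemma hermite_fun_eq:
  "complex_of_real (hermite_fun \<alpha> y) = (\<Prod>i\<in>UNIV. 1 / of_real (sqrt (2 ^ \<alpha> i * fact (\<alpha> i) * sqrt pi))) * (of_real (\<Prod>i\<in>UNIV. hermite_poly (\<alpha> i) (y $ i)) * gauss y)"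
proof -
  have n: "(norm y)\<^sup>2 = (\<Sum>i\<in>UNIV. (y $ i)\<^sup>2)"
    by (simp add: norm_vec_def L2_set_def sum_nonneg)
  have e: "exp (- (norm y)\<^sup>2 / 2) = (\<Prod>i\<in>UNIV. exp (- (y $ i)\<^sup>2 / 2))"
    unfolding n by (simp add: exp_sum[symmetric] sum_negf sum_divide_distrib)
  have "hermite_fun \<alpha> y = (\<Prod>i\<in>UNIV. 1 / sqrt (2 ^ \<alpha> i * fact (\<alpha> i) * sqrt pi)) * ((\<Prod>i\<in>UNIV. hermite_poly (\<alpha> i) (y $ i)) * exp (- (norm y)\<^sup>2 / 2))"
    unfolding e hermite_fun_def hermite_fun1_def prod.distrib[symmetric] by (intro prod.cong) auto
  then show ?thesis unfolding gauss_def by simp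
qed

lemma schwartz_hermite_fun: "schwartz (\<lambda>y. complex_of_real (hermite_fun \<alpha> y))"
proof -
  have "(\<lambda>y. of_real (\<Prod>i\<in>S. hermite_poly (\<alpha> i) (y $ i)) * gauss y) \<in> gauss_poly_class" if "finite S" for S
    using that
  proof (induction rule: finite_induct)
    case empty then show ?case by (simp add: gauss_poly_class.base)
  next
    case (insert j S)
    then show ?case using gauss_poly_class_hermite_poly[OF insert.IH, of "\<alpha> j" j] by (simp add: mult.assoc)
  qed
  from gauss_poly_class.scale[OF this[of UNIV]] show ?thesis unfolding hermite_fun_eq by (intro schwartz_gauss_poly_class) auto
qed

lemma schwartz_gauss: "schwartz gauss"
  by (intro schwartz_gauss_poly_class gauss_poly_class.base)

section \<open>Differences, decay and integrability of Schwartz functions\<close>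

lemma schwartz_line_derivative:
  assumes "schwartz f"
  shows "((\<lambda>h. f (x + h *\<^sub>R axis i 1)) has_vector_derivative pdiff i f (x + h *\<^sub>R axis i 1)) (at h)"
proof -
  have "((\<lambda>k. f ((x + h *\<^sub>R axis i 1) + k *\<^sub>R axis i 1)) has_vector_derivative pdiff i f (x + h *\<^sub>R axis i 1)) (at (h - h))"
    using schwartz_has_pd[OF assms, of i "x + h *\<^sub>R axis i 1"] by (simp add: has_pd_def)
  moreover have "((\<lambda>k. k - h) has_vector_derivative 1) (at h)" by (auto intro!: derivative_eq_intros)
  ultimately have "(((\<lambda>k. f ((x + h *\<^sub>R axis i 1) + k *\<^sub>R axis i 1)) \<circ> (\<lambda>k. k - h)) has_vector_derivative 1 *\<^sub>R pdiff i f (x + h *\<^sub>R axis i 1)) (at h)"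
    by (intro vector_diff_chain_at)
  then show ?thesis by (simp add: o_def algebra_simps)
qed

text \<open>The way from \<open>b\<close> to \<open>a\<close> changes one coordinate at a time.
  Every point p on it is, coordinate by coordinate, at least as close to \<open>a\<close> as
  \<open>b\<close> is, so 1 + norm a is at most (1 + norm p) (1 + norm (a - b)) and the decay of the
  derivatives at p is available at \<open>a\<close>.\<close>

lemma schwartz_lipschitz:
  fixes f :: "real^'n::finite \<Rightarrow> complex"
  assumes "schwartz f"
  shows "\<exists>C\<ge>0. \<forall>a b. (1 + norm a) ^ N * norm (f a - f b) \<le> C * norm (a - b) * (1 + norm (a - b)) ^ N"
proof -
  have "\<forall>i. \<exists>C\<ge>0. \<forall>x. (1 + norm x) ^ N * norm (pdiff i f x) \<le> C"
    using schwartz_bound[OF schwartz_pdiff[OF assms]] by blast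
  then obtain C where C: "\<And>i. 0 \<le> C i" "\<And>i x. (1 + norm x) ^ N * norm (pdiff i f x) \<le> C i" by metis
  have "(1 + norm a) ^ N * norm (f a - f b) \<le> (\<Sum>i\<in>UNIV. C i) * norm (a - b) * (1 + norm (a - b)) ^ N" for a b
  proof -
    define E where "E = (1 + norm (a - b)) ^ N"
    define c where "c S = (\<chi> i. if i \<in> S then a $ i else b $ i)" for S
    have "(1 + norm a) ^ N * norm (f (c S) - f b) \<le> (\<Sum>i\<in>S. \<bar>a $ i - b $ i\<bar> * (C i * E))" if "finite S" for S
      using that
    proof (induction rule: finite_induct)
      case empty
      have "c {} = b" by (simp add: c_def vec_eq_iff)
      then show ?case by simp
    next
      case (insert j S)
      define h where "h = a $ j - b $ j"
      have cj: "c (insert j S) = c S + h *\<^sub>R axis j 1"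
        using insert by (auto simp: c_def h_def vec_eq_iff axis_def)
      have bd: "(1 + norm a) ^ N * norm (pdiff j f (c S + t *\<^sub>R axis j 1)) \<le> C j * E" if t: "t \<in> closed_segment 0 h" for t
      proof -
        define p where "p = c S + t *\<^sub>R axis j 1"
        have "\<bar>(a - p) $ i\<bar> \<le> \<bar>(a - b) $ i\<bar>" for i
          using t insert(2) by (auto simp: p_def c_def h_def axis_def closed_segment_eq_real_ivl split: if_splits)
        then have "norm (a - p) \<le> norm (a - b)" by (intro norm_le_componentwise_cart) auto
        then have "(1 + norm (a - p)) ^ N \<le> E" unfolding E_def by (intro power_mono) auto
        moreover have "(1 + norm a) ^ N \<le> (1 + norm p) ^ N * (1 + norm (a - p)) ^ N"
          using weight_power_submult[of p "a - p" N] by simp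
        moreover have "(1 + norm p) ^ N * (1 + norm (a - p)) ^ N \<le> (1 + norm p) ^ N * E"
          using \<open>(1 + norm (a - p)) ^ N \<le> E\<close> by (intro mult_left_mono) auto
        ultimately have "(1 + norm a) ^ N \<le> (1 + norm p) ^ N * E" by linarith
        then have "(1 + norm a) ^ N * norm (pdiff j f p) \<le> ((1 + norm p) ^ N * E) * norm (pdiff j f p)"
          by (intro mult_right_mono) auto
        also have "\<dots> = ((1 + norm p) ^ N * norm (pdiff j f p)) * E" by simp
        also have "\<dots> \<le> C j * E" by (intro mult_right_mono C) (auto simp: E_def)
        finally show ?thesis by (simp add: p_def)
      qed
      have pos: "0 < (1 + norm a) ^ N" by (intro zero_less_power) (simp add: add_pos_nonneg)
      have E0: "0 \<le> E" by (simp add: E_def)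
      have "norm (f (c S + h *\<^sub>R axis j 1) - f (c S + 0 *\<^sub>R axis j 1)) \<le> (C j * E / (1 + norm a) ^ N) * norm (h - 0)"
      proof (rule differentiable_bound[where S="closed_segment 0 h" and f'="\<lambda>t v. v *\<^sub>R pdiff j f (c S + t *\<^sub>R axis j 1)"])
        show "((\<lambda>t. f (c S + t *\<^sub>R axis j 1)) has_derivative (\<lambda>v. v *\<^sub>R pdiff j f (c S + t *\<^sub>R axis j 1))) (at t within closed_segment 0 h)" for t
          using schwartz_line_derivative[OF assms, of "c S" j t] by (auto simp: has_vector_derivative_def intro: has_derivative_at_withinI)
        show "onorm (\<lambda>v. v *\<^sub>R pdiff j f (c S + t *\<^sub>R axis j 1)) \<le> C j * E / (1 + norm a) ^ N" if "t \<in> closed_segment 0 h" for t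
        proof (rule onorm_le)
          fix v
          have "norm (pdiff j f (c S + t *\<^sub>R axis j 1)) \<le> C j * E / (1 + norm a) ^ N"
            using bd[OF that] pos by (simp add: pos_le_divide_eq mult.commute)
          then have "\<bar>v\<bar> * norm (pdiff j f (c S + t *\<^sub>R axis j 1)) \<le> \<bar>v\<bar> * (C j * E / (1 + norm a) ^ N)"
            by (intro mult_left_mono) auto
          then show "norm (v *\<^sub>R pdiff j f (c S + t *\<^sub>R axis j 1)) \<le> C j * E / (1 + norm a) ^ N * norm v" by (simp add: mult.commute)
        qed
      qed auto
      then have "(1 + norm a) ^ N * norm (f (c (insert j S)) - f (c S)) \<le> \<bar>h\<bar> * (C j * E)"
        unfolding cj using pos by (simp add: pos_le_divide_eq field_simps)
      moreover have "norm (f (c (insert j S)) - f b) \<le> norm (f (c (insert j S)) - f (c S)) + norm (f (c S) - f b)"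
        using norm_triangle_ineq[of "f (c (insert j S)) - f (c S)" "f (c S) - f b"] by simp
      then have "(1 + norm a) ^ N * norm (f (c (insert j S)) - f b) \<le> (1 + norm a) ^ N * norm (f (c (insert j S)) - f (c S)) + (1 + norm a) ^ N * norm (f (c S) - f b)"
        using pos by (simp add: distrib_left[symmetric])
      ultimately show ?case using insert by (simp add: h_def)
    qed
    from this[of UNIV] have "(1 + norm a) ^ N * norm (f a - f b) \<le> (\<Sum>i\<in>UNIV. \<bar>a $ i - b $ i\<bar> * (C i * E))"
      by (simp add: c_def)
    also have "\<dots> \<le> (\<Sum>i\<in>UNIV. norm (a - b) * (C i * E))"
      using component_le_norm_cart[of "a - b"] C(1) by (intro sum_mono mult_right_mono) (auto simp: E_def)
    also have "\<dots> = (\<Sum>i\<in>UNIV. C i) * norm (a - b) * E"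
      by (simp add: sum_distrib_left sum_distrib_right ac_simps)
    finally show ?thesis by (simp add: E_def)
  qed
  then show ?thesis using C(1) by (intro exI[of _ "\<Sum>i\<in>UNIV. C i"]) (auto intro: sum_nonneg)
qed

lemma schwartz_continuous: assumes "schwartz f" shows "continuous_on UNIV f"
proof -
  obtain C where C: "C \<ge> 0" "\<And>a b. norm (f a - f b) \<le> C * norm (a - b)"
    using schwartz_lipschitz[OF assms, of 0] by auto
  have "C-lipschitz_on UNIV f" using C by (intro lipschitz_onI) (auto simp: dist_norm)
  then show ?thesis by (rule lipschitz_on_continuous_on)
qed

lemma schwartz_measurable [measurable_dest]: "schwartz f \<Longrightarrow> f \<in> borel_measurable borel"
  by (intro borel_measurable_continuous_onI schwartz_continuous)

lemma schwartz_decay: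
  assumes "schwartz f" "0 \<le> M" shows "\<exists>C\<ge>0. \<forall>x. norm (f x) \<le> C * (1 + norm x) powr (-M)"
proof -
  obtain C where C: "C \<ge> 0" "\<And>x. (1 + norm x) ^ nat \<lceil>M\<rceil> * norm (f x) \<le> C" using schwartz_bound[OF assms(1)] by blast
  have "norm (f x) \<le> C * (1 + norm x) powr (-M)" for x
  proof -
    have p: "0 < 1 + norm x" by (simp add: add_pos_nonneg)
    have "(1 + norm x) powr M \<le> (1 + norm x) powr (real (nat \<lceil>M\<rceil>))" by (intro powr_mono) (auto simp: real_nat_ceiling_ge)
    also have "\<dots> = (1 + norm x) ^ nat \<lceil>M\<rceil>" using p by (simp add: powr_realpow)
    finally have "(1 + norm x) powr M * norm (f x) \<le> C" using C(2)[of x] by (meson mult_right_mono norm_ge_zero order_trans)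
    then show ?thesis using p by (simp add: powr_minus field_simps)
  qed
  then show ?thesis using C(1) by blast
qed

lemma integrable_decay:
  fixes f :: "'a::euclidean_space \<Rightarrow> 'b::{banach, second_countable_topology}"
  assumes "f \<in> borel_measurable borel" "\<And>x. norm (f x) \<le> C * (1 + norm x) powr (-M)" "2 * real DIM('a) \<le> M"
  shows "integrable lborel f"
  by (rule Bochner_Integration.integrable_bound[OF integrable_mult_right[OF integrable_weight[OF assms(3)], of C]])
    (use assms in \<open>auto intro!: AE_I2 intro: order_trans[OF _ abs_ge_self]\<close>)

lemma schwartz_integrable: "schwartz f \<Longrightarrow> integrable lborel f"
  for f :: "real^'n::finite \<Rightarrow> complex"
proof -
  assume f: "schwartz f"
  obtain C where "\<And>x. norm (f x) \<le> C * (1 + norm x) powr (- (2 * real DIM(real^'n)))"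
    using schwartz_decay[OF f, of "2 * real DIM(real^'n)"] by auto
  then show ?thesis using f by (intro integrable_decay) (auto dest: schwartz_measurable)
qed

section \<open>Fourier inversion and the ambiguity transform\<close>

lemma Basis_vec_real: "(Basis :: (real^'n::finite) set) = (\<lambda>i. axis i 1) ` UNIV"
  by (auto simp: Basis_vec_def)

lemma lborel_vec_prod:
  fixes f :: "'n::finite \<Rightarrow> real \<Rightarrow> complex"
  assumes int: "\<And>i. integrable lborel (f i)"
  shows "integrable lborel (\<lambda>y::real^'n. \<Prod>i\<in>UNIV. f i (y $ i))"
    and "(\<integral>y. (\<Prod>i\<in>UNIV. f i ((y::real^'n) $ i)) \<partial>lborel) = (\<Prod>i\<in>UNIV. \<integral>t. f i t \<partial>lborel)"
proof -
  interpret P: product_sigma_finite "\<lambda>_::real^'n. lborel::real measure" ..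
  let ?B = "Basis :: (real^'n) set"
  let ?S = "\<lambda>g. \<Sum>b\<in>?B. g b *\<^sub>R b"
  have [measurable]: "f i \<in> borel_measurable borel" for i
    using int[of i] by (auto dest: borel_measurable_integrable)
  have inj: "inj_on (\<lambda>i. axis i (1::real)) (UNIV :: 'n set)" by (auto simp: inj_on_def axis_eq_axis)
  have Sm: "?S \<in> (\<Pi>\<^sub>M b\<in>?B. lborel) \<rightarrow>\<^sub>M borel" by measurable
  have fm: "(\<lambda>y::real^'n. \<Prod>i\<in>UNIV. f i (y $ i)) \<in> borel_measurable borel" by measurable
  have comp: "(\<Prod>i\<in>UNIV. f i (?S g $ i)) = (\<Prod>b\<in>?B. f (axis_index b) (g b))" for g
  proof -
    have "?S g $ i = g (axis i 1)" for i
    proof -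
      have "?S g $ i = ?S g \<bullet> axis i 1" by (simp add: inner_axis)
      also have "\<dots> = g (axis i 1)" by (rule inner_sum_left_Basis) (simp add: Basis_vec_real)
      finally show ?thesis .
    qed
    then show ?thesis unfolding Basis_vec_real by (subst prod.reindex[OF inj]) simp
  qed
  have pi: "integrable (\<Pi>\<^sub>M b\<in>?B. lborel) (\<lambda>g. \<Prod>b\<in>?B. f (axis_index b) (g b))"
    by (rule P.product_integrable_prod) (auto intro: int)
  show "integrable lborel (\<lambda>y::real^'n. \<Prod>i\<in>UNIV. f i (y $ i))"
    unfolding lborel_eq[where 'a="real^'n"]
    by (subst integrable_distr_eq[OF Sm fm]) (simp only: comp pi)
  have "(\<integral>y. (\<Prod>i\<in>UNIV. f i ((y::real^'n) $ i)) \<partial>lborel) = (\<integral>g. (\<Prod>b\<in>?B. f (axis_index b) (g b)) \<partial>(\<Pi>\<^sub>M b\<in>?B. lborel))"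
    by (subst lborel_eq[where 'a="real^'n"], subst integral_distr[OF Sm fm]) (simp only: comp)
  also have "\<dots> = (\<Prod>b\<in>?B. \<integral>t. f (axis_index b) t \<partial>lborel)"
    by (rule P.product_integral_prod) (auto intro: int)
  also have "\<dots> = (\<Prod>i\<in>UNIV. \<integral>t. f i t \<partial>lborel)"
    unfolding Basis_vec_real by (subst prod.reindex[OF inj]) simp
  finally show "(\<integral>y. (\<Prod>i\<in>UNIV. f i ((y::real^'n) $ i)) \<partial>lborel) = (\<Prod>i\<in>UNIV. \<integral>t. f i t \<partial>lborel)" .
qed

text \<open>The characteristic function of the standard normal law, freed from its
  normalisation.\<close>

lemma gaussian_fourier_real:
  "integrable lborel (\<lambda>x::real. cis (a * x) * of_real (exp (- x\<^sup>2 / 2)))"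
  "(\<integral>x. cis (a * x) * of_real (exp (- x\<^sup>2 / 2)) \<partial>lborel) = of_real (sqrt (2 * pi) * exp (- a\<^sup>2 / 2))"
proof -
  have i0: "integrable lborel (\<lambda>x. std_normal_density x)" by (rule integrable_normal_density) simp
  have e: "cis (a * x) * of_real (exp (- x\<^sup>2 / 2)) = of_real (sqrt (2 * pi)) * (std_normal_density x *\<^sub>R iexp (a * x))" for x
    by (simp add: std_normal_density_def cis_conv_exp scaleR_conv_of_real)
  have "integrable lborel (\<lambda>x. std_normal_density x *\<^sub>R iexp (a * x))"
    by (rule Bochner_Integration.integrable_bound[OF i0]) (auto intro!: AE_I2)
  then show "integrable lborel (\<lambda>x::real. cis (a * x) * of_real (exp (- x\<^sup>2 / 2)))"
    unfolding e by (rule integrable_mult_right)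
  have C: "char std_normal_distribution a = (\<integral>x. std_normal_density x *\<^sub>R iexp (a * x) \<partial>lborel)"
    unfolding char_def by (subst integral_density) auto
  show "(\<integral>x. cis (a * x) * of_real (exp (- x\<^sup>2 / 2)) \<partial>lborel) = of_real (sqrt (2 * pi) * exp (- a\<^sup>2 / 2))"
    unfolding e integral_mult_right_zero C[symmetric] char_std_normal_distribution by simp
qed

lemma cis_sum: "finite S \<Longrightarrow> cis (\<Sum>i\<in>S. f i) = (\<Prod>i\<in>S. cis (f i))"
  by (induction rule: finite_induct) (auto simp: cis_mult[symmetric])

lemma norm_vec_square: "(norm (y::real^'n::finite))\<^sup>2 = (\<Sum>i\<in>UNIV. (y $ i)\<^sup>2)"
  by (simp add: norm_vec_def L2_set_def sum_nonneg)

lemma gauss_prod: "gauss y = (\<Prod>i\<in>UNIV. of_real (exp (- (y $ i)\<^sup>2 / 2)))"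
proof -
  have "exp (- (norm y)\<^sup>2 / 2) = (\<Prod>i\<in>UNIV. exp (- (y $ i)\<^sup>2 / 2))"
    unfolding norm_vec_square by (simp add: exp_sum[symmetric] sum_negf sum_divide_distrib)
  then show ?thesis by (simp add: gauss_def)
qed

lemma gaussian_fourier:
  fixes a :: "real^'n::finite"
  shows "integrable lborel (\<lambda>v. cis (v \<bullet> a) * gauss v)"
    and "(\<integral>v. cis (v \<bullet> a) * gauss v \<partial>lborel) = of_real (sqrt (2 * pi) ^ CARD('n)) * gauss a"
proof -
  have e: "cis (v \<bullet> a) * gauss v = (\<Prod>i\<in>UNIV. cis (a $ i * v $ i) * of_real (exp (- (v $ i)\<^sup>2 / 2)))" for v :: "real^'n"
    unfolding gauss_prod prod.distrib inner_vec_def by (simp add: cis_sum mult.commute)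
  show "integrable lborel (\<lambda>v. cis (v \<bullet> a) * gauss v)"
    unfolding e by (rule lborel_vec_prod(1)) (rule gaussian_fourier_real)
  show "(\<integral>v. cis (v \<bullet> a) * gauss v \<partial>lborel) = of_real (sqrt (2 * pi) ^ CARD('n)) * gauss a"
    unfolding e
  proof -
    have "(\<integral>v. (\<Prod>i\<in>UNIV. cis (a $ i * (v::real^'n) $ i) * of_real (exp (- (v $ i)\<^sup>2 / 2))) \<partial>lborel)
        = (\<Prod>i\<in>UNIV. \<integral>t. cis (a $ i * t) * of_real (exp (- t\<^sup>2 / 2)) \<partial>lborel)"
      by (rule lborel_vec_prod(2)) (rule gaussian_fourier_real(1))
    also have "\<dots> = (\<Prod>i\<in>UNIV. of_real (sqrt (2 * pi) * exp (- (a $ i)\<^sup>2 / 2)))"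
      by (simp only: gaussian_fourier_real(2))
    also have "\<dots> = of_real (sqrt (2 * pi) ^ CARD('n)) * gauss a"
      by (simp add: gauss_prod prod.distrib)
    finally show "(\<integral>v. (\<Prod>i\<in>UNIV. cis (a $ i * (v::real^'n) $ i) * of_real (exp (- (v $ i)\<^sup>2 / 2))) \<partial>lborel)
        = of_real (sqrt (2 * pi) ^ CARD('n)) * gauss a" .
  qed
qed

lemma lborel_integral_affine:
  fixes f :: "'a::euclidean_space \<Rightarrow> 'b::{banach,second_countable_topology}"
  assumes [measurable]: "f \<in> borel_measurable borel" and c: "0 < c"
  shows "(\<integral>x. f x \<partial>lborel) = c ^ DIM('a) *\<^sub>R (\<integral>x. f (t + c *\<^sub>R x) \<partial>lborel)"
  using c by (subst lborel_affine[of c t]) (simp_all add: integral_density integral_distr)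

lemma lborel_integrable_affine:
  fixes f :: "'a::euclidean_space \<Rightarrow> 'b::{banach,second_countable_topology}"
  assumes f: "integrable lborel f" and c: "0 < c"
  shows "integrable lborel (\<lambda>x. f (t + c *\<^sub>R x))"
proof -
  have [measurable]: "f \<in> borel_measurable borel" using f by (auto dest: borel_measurable_integrable)
  have "integrable (density (distr lborel borel (\<lambda>x. t + c *\<^sub>R x)) (\<lambda>_. ennreal (\<bar>c\<bar> ^ DIM('a)))) f"
    using f lborel_affine[of c t] c by simp
  then have "integrable lborel (\<lambda>x. \<bar>c\<bar> ^ DIM('a) *\<^sub>R f (t + c *\<^sub>R x))"
    by (subst (asm) integrable_density) (auto simp: integrable_distr_eq)
  from integrable_scaleR_right[OF this, of "inverse (\<bar>c\<bar> ^ DIM('a))"] show ?thesis using c by simp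
qed

lemma integrable_pair_mult:
  fixes f :: "'a::euclidean_space \<Rightarrow> complex" and g :: "'b::euclidean_space \<Rightarrow> complex"
  assumes "integrable lborel f" "integrable lborel g"
  shows "integrable (lborel \<Otimes>\<^sub>M lborel) (\<lambda>z. f (fst z) * g (snd z))"
proof (rule lborel_pair.Fubini_integrable)
  have [measurable]: "f \<in> borel_measurable borel" "g \<in> borel_measurable borel" using assms by (auto dest: borel_measurable_integrable)
  show "(\<lambda>z. f (fst z) * g (snd z)) \<in> borel_measurable (lborel \<Otimes>\<^sub>M lborel)" by measurable
qed (use assms in \<open>auto simp: norm_mult\<close>)

lemma cis_borel_measurable [measurable]: "cis \<in> borel_measurable borel"
  unfolding cis_conv_exp by (intro borel_measurable_continuous_onI continuous_intros)

text \<open>Gauss-Weierstrass summation: a flat Gaussian is inserted into the frequency integral,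
  Fubini is applied, and the transform of the Gaussian turns the inner integral into an approximate
  identity at \<open>y\<close>. Integrability of the transform gives the limit on one side,
  continuity and boundedness of \<open>F\<close> on the other.\<close>

lemma fourier_inversion:
  fixes F :: "real^'n::finite \<Rightarrow> complex"
  assumes cont: "continuous_on UNIV F" and bd: "\<And>u. norm (F u) \<le> B" and int: "integrable lborel F"
    and hat: "integrable lborel (\<lambda>\<xi>. \<integral>u. F u * cis (\<xi> \<bullet> u) \<partial>lborel)"
  shows "(\<integral>\<xi>. (\<integral>u. F u * cis (\<xi> \<bullet> u) \<partial>lborel) * cis (- (\<xi> \<bullet> y)) \<partial>lborel) = of_real ((2 * pi) ^ CARD('n)) * F y"
proof -
  define Fh where "Fh \<xi> = (\<integral>u. F u * cis (\<xi> \<bullet> u) \<partial>lborel)" for \<xi>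
  define Q where "Q = sqrt (2 * pi) ^ CARD('n)"
  have Fm [measurable]: "F \<in> borel_measurable borel" using cont by (rule borel_measurable_continuous_onI)
  have gm [measurable]: "(gauss :: real^'n \<Rightarrow> complex) \<in> borel_measurable borel" by (rule schwartz_measurable[OF schwartz_gauss])
  have gi: "integrable lborel (gauss :: real^'n \<Rightarrow> complex)" using gaussian_fourier(1)[of 0] by simp
  have g1: "norm (gauss v) \<le> 1" for v :: "real^'n" by (simp add: gauss_def)
  have gcont: "continuous_on UNIV (gauss :: real^'n \<Rightarrow> complex)" by (rule schwartz_continuous[OF schwartz_gauss])
  have Fhm [measurable]: "Fh \<in> borel_measurable borel" using hat unfolding Fh_def by (auto dest: borel_measurable_integrable)
  have Fhi: "integrable lborel Fh" using hat unfolding Fh_def .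
  define J where "J n = (\<integral>\<xi>. Fh \<xi> * cis (- (\<xi> \<bullet> y)) * gauss (inverse (real (Suc n)) *\<^sub>R \<xi>) \<partial>lborel)" for n
  have lim_inv: "(\<lambda>n. inverse (real (Suc n)) *\<^sub>R v) \<longlonglongrightarrow> 0" for v :: "real^'n"
    using tendsto_scaleR[OF LIMSEQ_inverse_real_of_nat tendsto_const[of v]] by simp
  have L1: "J \<longlonglongrightarrow> (\<integral>\<xi>. Fh \<xi> * cis (- (\<xi> \<bullet> y)) \<partial>lborel)"
    unfolding J_def
  proof (rule integral_dominated_convergence[where w="\<lambda>\<xi>. norm (Fh \<xi>)"])
    show "AE \<xi> in lborel. (\<lambda>n. Fh \<xi> * cis (- (\<xi> \<bullet> y)) * gauss (inverse (real (Suc n)) *\<^sub>R \<xi>)) \<longlonglongrightarrow> Fh \<xi> * cis (- (\<xi> \<bullet> y))"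
    proof (rule AE_I2)
      fix \<xi> :: "real^'n"
      have "(\<lambda>n. gauss (inverse (real (Suc n)) *\<^sub>R \<xi>)) \<longlonglongrightarrow> gauss (0::real^'n)"
        using continuous_on_tendsto_compose[OF gcont lim_inv[of \<xi>]] by auto
      then have "(\<lambda>n. Fh \<xi> * cis (- (\<xi> \<bullet> y)) * gauss (inverse (real (Suc n)) *\<^sub>R \<xi>)) \<longlonglongrightarrow> Fh \<xi> * cis (- (\<xi> \<bullet> y)) * gauss (0::real^'n)"
        by (intro tendsto_mult tendsto_const)
      then show "(\<lambda>n. Fh \<xi> * cis (- (\<xi> \<bullet> y)) * gauss (inverse (real (Suc n)) *\<^sub>R \<xi>)) \<longlonglongrightarrow> Fh \<xi> * cis (- (\<xi> \<bullet> y))"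
        by (simp add: gauss_def)
    qed
    show "AE \<xi> in lborel. norm (Fh \<xi> * cis (- (\<xi> \<bullet> y)) * gauss (inverse (real (Suc n)) *\<^sub>R \<xi>)) \<le> norm (Fh \<xi>)" for n
      using g1 by (auto simp: norm_mult intro!: AE_I2 mult_left_le)
    show "(\<lambda>\<xi>. Fh \<xi> * cis (- (\<xi> \<bullet> y))) \<in> borel_measurable lborel"
      by measurable
    show "(\<lambda>\<xi>. Fh \<xi> * cis (- (\<xi> \<bullet> y)) * gauss (inverse (real (Suc n)) *\<^sub>R \<xi>)) \<in> borel_measurable lborel" for n
      by measurable
  qed (use Fhi in auto)
  \<comment> \<open>The powers of \<open>s\<close> cancel: s^d comes from the transform of the
    dilated Gaussian, s^(-d) from the substitution u = y + v / s.\<close>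
  have J: "J n = of_real Q * (\<integral>v. F (y + inverse (real (Suc n)) *\<^sub>R v) * gauss v \<partial>lborel)" for n
  proof -
    define s where "s = real (Suc n)"
    have s: "0 < s" by (simp add: s_def)
    define k where "k \<xi> u = F u * cis (\<xi> \<bullet> (u - y)) * gauss (inverse s *\<^sub>R \<xi>)" for \<xi> u
    have gsi: "integrable lborel (\<lambda>\<xi>::real^'n. gauss (inverse s *\<^sub>R \<xi>))"
      using lborel_integrable_affine[OF gi, of "inverse s" 0] s by simp
    have ki: "integrable (lborel \<Otimes>\<^sub>M lborel) (case_prod k)"
    proof (rule Bochner_Integration.integrable_bound[OF integrable_pair_mult[OF gsi int]])
      have c1: "(\<lambda>z::(real^'n)\<times>(real^'n). cis (fst z \<bullet> (snd z - y))) \<in> borel_measurable (lborel \<Otimes>\<^sub>M lborel)"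
        by measurable
      have "(\<lambda>z. F (snd z) * cis (fst z \<bullet> (snd z - y)) * gauss (inverse s *\<^sub>R fst z)) \<in> borel_measurable (lborel \<Otimes>\<^sub>M lborel)"
        using c1 by measurable
      then show "case_prod k \<in> borel_measurable (lborel \<Otimes>\<^sub>M lborel)" by (simp add: k_def case_prod_beta')
    qed (auto simp: k_def norm_mult)
    have "J n = (\<integral>\<xi>. (\<integral>u. k \<xi> u \<partial>lborel) \<partial>lborel)"
    proof -
      have "Fh \<xi> * cis (- (\<xi> \<bullet> y)) * gauss (inverse s *\<^sub>R \<xi>) = (\<integral>u. k \<xi> u \<partial>lborel)" for \<xi>
      proof -
        have "k \<xi> u = (F u * cis (\<xi> \<bullet> u)) * (cis (- (\<xi> \<bullet> y)) * gauss (inverse s *\<^sub>R \<xi>))" for u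
          unfolding k_def inner_diff_right by (simp add: cis_mult[symmetric] diff_conv_add_uminus del: add_uminus_conv_diff)
        then show ?thesis unfolding Fh_def by simp
      qed
      then show ?thesis unfolding J_def s_def by simp
    qed
    also have "\<dots> = (\<integral>u. (\<integral>\<xi>. k \<xi> u \<partial>lborel) \<partial>lborel)"
      using lborel_pair.Fubini_integral[OF ki] by simp
    also have "\<dots> = (\<integral>u. of_real (s ^ CARD('n) * Q) * (F u * gauss (s *\<^sub>R (u - y))) \<partial>lborel)"
    proof (rule Bochner_Integration.integral_cong[OF refl])
      fix u
      have "(\<integral>\<xi>. k \<xi> u \<partial>lborel) = F u * (\<integral>\<xi>. cis (\<xi> \<bullet> (u - y)) * gauss (inverse s *\<^sub>R \<xi>) \<partial>lborel)"
        unfolding k_def by (simp add: mult.assoc)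
      also have "(\<integral>\<xi>. cis (\<xi> \<bullet> (u - y)) * gauss (inverse s *\<^sub>R \<xi>) \<partial>lborel)
         = s ^ CARD('n) *\<^sub>R (\<integral>v. cis ((0 + s *\<^sub>R v) \<bullet> (u - y)) * gauss (inverse s *\<^sub>R (0 + s *\<^sub>R v)) \<partial>lborel)"
      proof -
        have m: "(\<lambda>\<xi>. cis (\<xi> \<bullet> (u - y)) * gauss (inverse s *\<^sub>R \<xi>)) \<in> borel_measurable borel" by measurable
        show ?thesis using lborel_integral_affine[OF m s, of 0] by simp
      qed
      also have "\<dots> = s ^ CARD('n) *\<^sub>R (\<integral>v. cis (v \<bullet> (s *\<^sub>R (u - y))) * gauss v \<partial>lborel)"
        using s by simp
      also have "\<dots> = s ^ CARD('n) *\<^sub>R (of_real Q * gauss (s *\<^sub>R (u - y)))"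
        unfolding gaussian_fourier(2) Q_def by simp
      finally show "(\<integral>\<xi>. k \<xi> u \<partial>lborel) = of_real (s ^ CARD('n) * Q) * (F u * gauss (s *\<^sub>R (u - y)))"
        by (simp add: scaleR_conv_of_real ac_simps)
    qed
    also have "\<dots> = of_real (s ^ CARD('n) * Q) * (\<integral>u. F u * gauss (s *\<^sub>R (u - y)) \<partial>lborel)" by simp
    also have "(\<integral>u. F u * gauss (s *\<^sub>R (u - y)) \<partial>lborel) = inverse s ^ CARD('n) *\<^sub>R (\<integral>v. F (y + inverse s *\<^sub>R v) * gauss (s *\<^sub>R (y + inverse s *\<^sub>R v - y)) \<partial>lborel)"
      using lborel_integral_affine[of "\<lambda>u. F u * gauss (s *\<^sub>R (u - y))" "inverse s" y] s by simp
    also have "of_real (s ^ CARD('n) * Q) * \<dots> = of_real Q * (\<integral>v. F (y + inverse s *\<^sub>R v) * gauss v \<partial>lborel)"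
    proof -
      have g: "s *\<^sub>R (y + inverse s *\<^sub>R v - y) = v" for v :: "real^'n" using s by simp
      have e: "s ^ CARD('n) * Q * inverse s ^ CARD('n) = Q" using s by (simp add: power_inverse)
      have "complex_of_real Q = of_real (s ^ CARD('n) * Q) * of_real (inverse s ^ CARD('n))"
        by (simp only: of_real_mult[symmetric] e)
      then show ?thesis unfolding g scaleR_conv_of_real[where 'a=complex] by (simp only: mult.assoc)
    qed
    finally show ?thesis by (simp add: s_def)
  qed
  have L2: "(\<lambda>n. \<integral>v. F (y + inverse (real (Suc n)) *\<^sub>R v) * gauss v \<partial>lborel) \<longlonglongrightarrow> (\<integral>v. F y * gauss (v::real^'n) \<partial>lborel)"
  proof (rule integral_dominated_convergence[where w="\<lambda>v::real^'n. B * norm (gauss v)"])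
    show "AE v::real^'n in lborel. (\<lambda>n. F (y + inverse (real (Suc n)) *\<^sub>R v) * gauss v) \<longlonglongrightarrow> F y * gauss v"
    proof (rule AE_I2)
      fix v :: "real^'n"
      have "(\<lambda>n. y + inverse (real (Suc n)) *\<^sub>R v) \<longlonglongrightarrow> y + 0" by (intro tendsto_intros lim_inv)
      then have "(\<lambda>n. F (y + inverse (real (Suc n)) *\<^sub>R v)) \<longlonglongrightarrow> F y"
        using continuous_on_tendsto_compose[OF cont, of "\<lambda>n. y + inverse (real (Suc n)) *\<^sub>R v" y] by auto
      then show "(\<lambda>n. F (y + inverse (real (Suc n)) *\<^sub>R v) * gauss v) \<longlonglongrightarrow> F y * gauss v" by (intro tendsto_mult tendsto_const)
    qed
    show "AE v in lborel. norm (F (y + inverse (real (Suc n)) *\<^sub>R v) * gauss v) \<le> B * norm (gauss v)" for n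
      using bd by (auto simp: norm_mult intro!: AE_I2 mult_right_mono)
  qed (use gi in auto)
  have "(\<integral>v. gauss (v::real^'n) \<partial>lborel) = of_real Q"
    using gaussian_fourier(2)[of "0::real^'n"] by (simp add: gauss_def Q_def)
  then have "J \<longlonglongrightarrow> of_real Q * (F y * of_real Q)"
    unfolding J using tendsto_mult[OF tendsto_const[of "of_real Q"] L2] by simp
  from LIMSEQ_unique[OF L1 this] have "(\<integral>\<xi>. Fh \<xi> * cis (- (\<xi> \<bullet> y)) \<partial>lborel) = of_real (Q * Q) * F y"
    by simp
  \<comment> \<open>One factor \<open>Q\<close> is the constant of the Gaussian transform, the other
    the total mass of the Gaussian.\<close>
  also have "Q * Q = (2 * pi) ^ CARD('n)" unfolding Q_def power_mult_distrib[symmetric] by simp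
  finally show ?thesis by (simp add: Fh_def)
qed

section \<open>Products of Schwartz functions and integration by parts\<close>

inductive_set product_class :: "(real^'n::finite \<Rightarrow> complex) set" where
  prod: "schwartz f \<Longrightarrow> schwartz g \<Longrightarrow> (\<lambda>y. f y * g y) \<in> product_class"
| add: "f \<in> product_class \<Longrightarrow> g \<in> product_class \<Longrightarrow> (\<lambda>y. f y + g y) \<in> product_class"

lemma product_class_pd: "f \<in> product_class \<Longrightarrow> \<exists>F\<in>product_class. \<forall>x. has_pd i f x (F x)"
proof (induction rule: product_class.induct)
  case (prod f g)
  have "\<forall>x. has_pd i (\<lambda>y. f y * g y) x ((\<lambda>x. f x * pdiff i g x + pdiff i f x * g x) x)"
    by (rule allI) (rule has_pd_mult[OF schwartz_has_pd[OF prod(1)] schwartz_has_pd[OF prod(2)]])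
  then show ?case
    by (rule bexI[OF _ product_class.add[OF product_class.prod[OF prod(1) schwartz_pdiff[OF prod(2)]] product_class.prod[OF schwartz_pdiff[OF prod(1)] prod(2)]]])
next
  case (add f g)
  obtain F where F: "F \<in> product_class" "\<And>x. has_pd i f x (F x)" using add.IH(1) by blast
  obtain G where G: "G \<in> product_class" "\<And>x. has_pd i g x (G x)" using add.IH(2) by blast
  have "\<forall>x. has_pd i (\<lambda>y. f y + g y) x ((\<lambda>y. F y + G y) x)"
    by (rule allI) (rule has_pd_add[OF F(2) G(2)])
  then show ?case by (rule bexI[OF _ product_class.add[OF F(1) G(1)]])
qed

lemma product_class_bound: "f \<in> product_class \<Longrightarrow> \<exists>C. \<forall>x. (1 + norm x) ^ N * norm (f x) \<le> C"
proof (induction rule: product_class.induct)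
  case (prod f g)
  obtain A where A: "0 \<le> A" "\<And>x. (1 + norm x) ^ N * norm (f x) \<le> A" using schwartz_bound[OF prod(1), of N] by blast
  obtain B where B: "0 \<le> B" "\<And>x. (1 + norm x) ^ 0 * norm (g x) \<le> B" using schwartz_bound[OF prod(2), of 0] by blast
  have "(1 + norm x) ^ N * norm (f x * g x) \<le> A * B" for x
    using mult_mono[OF A(2)[of x] B(2)[of x] A(1)] by (simp add: norm_mult mult.assoc)
  then show ?case by blast
next
  case (add f g)
  obtain A where A: "\<And>x. (1 + norm x) ^ N * norm (f x) \<le> A" using add.IH(1) by blast
  obtain B where B: "\<And>x. (1 + norm x) ^ N * norm (g x) \<le> B" using add.IH(2) by blast
  have "(1 + norm x) ^ N * norm (f x + g x) \<le> A + B" for x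
  proof -
    have "(1 + norm x) ^ N * norm (f x + g x) \<le> (1 + norm x) ^ N * (norm (f x) + norm (g x))"
      by (intro mult_left_mono norm_triangle_ineq) auto
    then show ?thesis using A[of x] B[of x] by (simp add: distrib_left)
  qed
  then show ?case by blast
qed

lemma schwartz_mult:
  fixes f g :: "real^'n::finite \<Rightarrow> complex"
  assumes "schwartz f" "schwartz g" shows "schwartz (\<lambda>y. f y * g y)"
proof (rule schwartzI_class[of _ product_class])
  show "(\<lambda>y. f y * g y) \<in> product_class" by (rule product_class.prod[OF assms])
  show "\<exists>D. has_pd i f x D" if "f \<in> product_class" for f :: "real^'n \<Rightarrow> complex" and i x using product_class_pd[OF that, of i] by blast
  show "pdiff i f \<in> product_class" if "f \<in> product_class" for f :: "real^'n \<Rightarrow> complex" and i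
  proof -
    obtain F where F: "F \<in> product_class" "\<And>x. has_pd i f x (F x)" using product_class_pd[OF \<open>f \<in> product_class\<close>, of i] by blast
    have "pdiff i f = F" using has_pd_pdiff[OF F(2)] by (intro ext)
    then show ?thesis using F by simp
  qed
qed (rule product_class_bound)

text \<open>By translation invariance the integral of \<open>f (w + h *\<^sub>R axis i 1)\<close>
  does not depend on \<open>h\<close>; it is differentiated at 0 under the integral sign. Peetre's
  inequality supplies the majorant, since a step of length at most 1 changes the weight by at most
  2^m.\<close>

lemma schwartz_integral_pdiff:
  fixes f :: "real^'n::finite \<Rightarrow> complex"
  assumes f: "schwartz f"
  shows "(\<integral>y. pdiff i f y \<partial>lborel) = 0"
proof -
  define m where "m = 2 * real DIM(real^'n)"
  obtain C where C: "0 \<le> C" "\<And>y. norm (pdiff i f y) \<le> C * (1 + norm y) powr (-m)"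
    using schwartz_decay[OF schwartz_pdiff[OF f], of m i] by (auto simp: m_def)
  have "((\<lambda>h. \<integral>w. f (w + h *\<^sub>R axis i 1) \<partial>lborel) has_vector_derivative (\<integral>w. pdiff i f (w + 0 *\<^sub>R axis i 1) \<partial>lborel)) (at 0)"
  proof (rule has_vector_derivative_integral[where D="\<lambda>w. (C * 2 powr m) * (1 + norm w) powr (-m)"])
    show "integrable lborel (\<lambda>w. f (w + h *\<^sub>R axis i 1))" for h
      using lborel_integrable_plus[OF schwartz_integrable[OF f], of "h *\<^sub>R axis i 1"] by (simp add: add.commute)
    show "((\<lambda>h. f (w + h *\<^sub>R axis i 1)) has_vector_derivative pdiff i f (w + h *\<^sub>R axis i 1)) (at h)" for w h
      by (rule schwartz_line_derivative[OF f])
    show "integrable lborel (\<lambda>w::real^'n. (C * 2 powr m) * (1 + norm w) powr (-m))"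
      by (intro integrable_mult_right integrable_weight) (simp add: m_def)
    show "norm (pdiff i f (w + h *\<^sub>R axis i 1)) \<le> (C * 2 powr m) * (1 + norm w) powr (-m)" if h: "\<bar>h\<bar> \<le> 1" for w h
    proof -
      have "(1 + norm (w + h *\<^sub>R axis i 1)) powr (-m) \<le> (1 + norm w) powr (-m) * (1 + norm (w + h *\<^sub>R axis i 1 - w)) powr m"
        by (rule peetre) (simp add: m_def)
      also have "\<dots> \<le> (1 + norm w) powr (-m) * 2 powr m"
        using h by (intro mult_left_mono powr_mono2) (auto simp: m_def)
      finally have "C * (1 + norm (w + h *\<^sub>R axis i 1)) powr (-m) \<le> C * ((1 + norm w) powr (-m) * 2 powr m)"
        using C(1) by (intro mult_left_mono)
      then show ?thesis using C(2)[of "w + h *\<^sub>R axis i 1"] by (simp add: ac_simps)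
    qed
  qed
  moreover have "(\<lambda>h. \<integral>w. f (w + h *\<^sub>R axis i 1) \<partial>lborel) = (\<lambda>h. \<integral>w. f w \<partial>lborel)"
  proof
    show "(\<integral>w. f (w + h *\<^sub>R axis i 1) \<partial>lborel) = (\<integral>w. f w \<partial>lborel)" for h
      using lborel_integral_plus[OF schwartz_measurable[OF f], of "h *\<^sub>R axis i 1"] by (simp add: add.commute)
  qed
  ultimately have "((\<lambda>h::real. \<integral>w. f w \<partial>lborel) has_vector_derivative (\<integral>w. pdiff i f w \<partial>lborel)) (at 0)" by simp
  from vector_derivative_unique_at[OF this has_vector_derivative_const] show ?thesis .
qed

text \<open>In terms of the short-time Fourier transform, \<open>ambig \<phi> \<gamma> x \<xi>\<close> is
  $V_{\bar\gamma}\phi(x, -\xi)$.\<close>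

definition ambig :: "(real^'n::finite \<Rightarrow> complex) \<Rightarrow> (real^'n \<Rightarrow> complex) \<Rightarrow> real^'n \<Rightarrow> real^'n \<Rightarrow> complex" where
  "ambig \<phi> \<gamma> x \<xi> = (\<integral>y. \<phi> y * \<gamma> (y - x) * cis (\<xi> \<bullet> y) \<partial>lborel)"

section \<open>Decay, continuity and inversion of the ambiguity transform\<close>

lemma schwartz_ambig_integrand:
  "schwartz \<phi> \<Longrightarrow> schwartz \<gamma> \<Longrightarrow> schwartz (\<lambda>y. \<phi> y * \<gamma> (y - x) * cis (\<xi> \<bullet> y))"
  using schwartz_cis[OF schwartz_mult[OF _ schwartz_shift], of \<phi> \<gamma> \<xi> x] by (simp add: mult.commute)

text \<open>The derivative of the integrand has integral 0. It falls on \<open>\<phi>\<close>, on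
  the shifted \<open>\<gamma>\<close> or on the phase, and the phase contributes the frequency
  factor.\<close>

lemma ambig_by_parts:
  assumes "schwartz \<phi>" "schwartz \<gamma>"
  shows "of_real (\<xi> $ i) * ambig \<phi> \<gamma> x \<xi> = \<i> * (ambig (pdiff i \<phi>) \<gamma> x \<xi> + ambig \<phi> (pdiff i \<gamma>) x \<xi>)"
proof -
  note s = assms schwartz_pdiff[OF assms(1)] schwartz_pdiff[OF assms(2)]
  let ?f = "\<lambda>y. \<phi> y * \<gamma> (y - x) * cis (\<xi> \<bullet> y)"
  have "pdiff i ?f = (\<lambda>y. (\<phi> y * \<gamma> (y - x)) * (\<i> * of_real (\<xi> $ i) * cis (\<xi> \<bullet> y)) + (\<phi> y * pdiff i \<gamma> (y - x) + pdiff i \<phi> y * \<gamma> (y - x)) * cis (\<xi> \<bullet> y))"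
    by (intro ext has_pd_pdiff has_pd_mult has_pd_cis has_pd_shift schwartz_has_pd assms)
  also have "\<dots> = (\<lambda>y. \<i> * of_real (\<xi> $ i) * ?f y + (\<phi> y * pdiff i \<gamma> (y - x) * cis (\<xi> \<bullet> y) + pdiff i \<phi> y * \<gamma> (y - x) * cis (\<xi> \<bullet> y)))"
    by (simp add: fun_eq_iff algebra_simps)
  finally have "0 = (\<integral>y. \<i> * of_real (\<xi> $ i) * ?f y + (\<phi> y * pdiff i \<gamma> (y - x) * cis (\<xi> \<bullet> y) + pdiff i \<phi> y * \<gamma> (y - x) * cis (\<xi> \<bullet> y)) \<partial>lborel)"
    using schwartz_integral_pdiff[OF schwartz_ambig_integrand[OF assms], of i x \<xi>] by simp
  also have "\<dots> = \<i> * of_real (\<xi> $ i) * ambig \<phi> \<gamma> x \<xi> + (ambig \<phi> (pdiff i \<gamma>) x \<xi> + ambig (pdiff i \<phi>) \<gamma> x \<xi>)"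
    unfolding ambig_def
    using schwartz_integrable[OF schwartz_ambig_integrand[OF s(1,2)]] schwartz_integrable[OF schwartz_ambig_integrand[OF s(1,4)]]
      schwartz_integrable[OF schwartz_ambig_integrand[OF s(3,2)]] by simp
  finally have "\<i> * (\<i> * of_real (\<xi> $ i) * ambig \<phi> \<gamma> x \<xi> + (ambig \<phi> (pdiff i \<gamma>) x \<xi> + ambig (pdiff i \<phi>) \<gamma> x \<xi>)) = 0" by simp
  then have "- (of_real (\<xi> $ i) * ambig \<phi> \<gamma> x \<xi>) + \<i> * (ambig \<phi> (pdiff i \<gamma>) x \<xi> + ambig (pdiff i \<phi>) \<gamma> x \<xi>) = 0"
    by (simp add: distrib_left mult.assoc[symmetric])
  then show ?thesis by (simp add: add.commute)
qed

text \<open>Each factor of frequency is traded for a derivative of \<open>\<phi>\<close> or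
  \<open>\<gamma>\<close>, so the induction runs over all pairs of Schwartz functions. The sum of
  the moduli of the coordinates is used because the extra factor then splits into terms to which
  \<open>ambig_by_parts\<close> applies. Decay in \<open>x\<close> comes in the base case from 1 +
  norm x being at most (1 + norm y) (1 + norm (y - x)).\<close>

lemma ambig_decay_aux:
  fixes \<phi> \<gamma> :: "real^'n::finite \<Rightarrow> complex"
  assumes M: "0 \<le> M"
  shows "schwartz \<phi> \<Longrightarrow> schwartz \<gamma> \<Longrightarrow> \<exists>C\<ge>0. \<forall>x \<xi>. (1 + (\<Sum>i\<in>UNIV. \<bar>\<xi> $ i\<bar>)) ^ N * norm (ambig \<phi> \<gamma> x \<xi>) \<le> C * (1 + norm x) powr (-M)"
proof (induction N arbitrary: \<phi> \<gamma>)
  case 0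
  define m where "m = 2 * real DIM(real^'n)"
  obtain A where A: "0 \<le> A" "\<And>y. norm (\<phi> y) \<le> A * (1 + norm y) powr (- (M + m))"
    using schwartz_decay[OF 0(1), of "M + m"] M by (auto simp: m_def)
  obtain B where B: "0 \<le> B" "\<And>y. norm (\<gamma> y) \<le> B * (1 + norm y) powr (- M)"
    using schwartz_decay[OF 0(2) M] by auto
  define W where "W = (\<integral>y. (1 + norm (y::real^'n)) powr (-m) \<partial>lborel)"
  have Wi: "integrable lborel (\<lambda>y::real^'n. (1 + norm y) powr (-m))" by (rule integrable_weight) (simp add: m_def)
  have W0: "0 \<le> W" unfolding W_def by simp
  have "norm (ambig \<phi> \<gamma> x \<xi>) \<le> A * B * W * (1 + norm x) powr (-M)" for x \<xi>
  proof -
    have "norm (ambig \<phi> \<gamma> x \<xi>) \<le> (\<integral>y. norm (\<phi> y * \<gamma> (y - x) * cis (\<xi> \<bullet> y)) \<partial>lborel)"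
      unfolding ambig_def by (rule integral_norm_bound)
    also have "\<dots> \<le> (\<integral>y. A * B * (1 + norm x) powr (-M) * (1 + norm (y::real^'n)) powr (-m) \<partial>lborel)"
    proof (rule Bochner_Integration.integral_mono)
      show "integrable lborel (\<lambda>y. norm (\<phi> y * \<gamma> (y - x) * cis (\<xi> \<bullet> y)))"
        using schwartz_integrable[OF schwartz_ambig_integrand[OF 0]] by simp
      show "integrable lborel (\<lambda>y::real^'n. A * B * (1 + norm x) powr (-M) * (1 + norm y) powr (-m))" using Wi by simp
      fix y
      have w: "(1 + norm y) powr (-M) * (1 + norm (y - x)) powr (-M) \<le> (1 + norm x) powr (-M)"
      proof -
        have "0 < 1 + norm x" by (simp add: add_pos_nonneg)
        moreover have "1 + norm x \<le> (1 + norm y) * (1 + norm (y - x))"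
          using weight_submult[of y "x - y"] by (simp add: norm_minus_commute)
        ultimately have "((1 + norm y) * (1 + norm (y - x))) powr (-M) \<le> (1 + norm x) powr (-M)"
          using M by (intro powr_mono2') auto
        then show ?thesis by (simp add: powr_mult)
      qed
      have "norm (\<phi> y * \<gamma> (y - x) * cis (\<xi> \<bullet> y)) \<le> (A * (1 + norm y) powr (- (M + m))) * (B * (1 + norm (y - x)) powr (- M))"
        using A B by (auto simp: norm_mult intro!: mult_mono)
      also have "\<dots> = A * B * ((1 + norm y) powr (-M) * (1 + norm (y - x)) powr (-M)) * (1 + norm y) powr (-m)"
        using weight_powr_add[of y "-M" "-m"] by simp
      also have "\<dots> \<le> A * B * (1 + norm x) powr (-M) * (1 + norm y) powr (-m)"
        using A(1) B(1) w by (intro mult_right_mono mult_left_mono) auto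
      finally show "norm (\<phi> y * \<gamma> (y - x) * cis (\<xi> \<bullet> y)) \<le> A * B * (1 + norm x) powr (-M) * (1 + norm y) powr (-m)" .
    qed
    also have "\<dots> = A * B * W * (1 + norm x) powr (-M)" by (simp add: W_def)
    finally show ?thesis .
  qed
  then show ?case using A(1) B(1) W0 by (intro exI[of _ "A * B * W"]) auto
next
  case (Suc N)
  define S where "S \<xi> = (\<Sum>i\<in>UNIV. \<bar>\<xi> $ i\<bar>)" for \<xi> :: "real^'n"
  have S0: "0 \<le> S \<xi>" for \<xi> unfolding S_def by (rule sum_nonneg) auto
  obtain C0 where C0: "0 \<le> C0" "\<And>x \<xi>. (1 + S \<xi>) ^ N * norm (ambig \<phi> \<gamma> x \<xi>) \<le> C0 * (1 + norm x) powr (-M)"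
    using Suc.IH[OF Suc.prems] unfolding S_def by blast
  have "\<forall>i. \<exists>C\<ge>0. \<forall>x \<xi>. (1 + S \<xi>) ^ N * norm (ambig (pdiff i \<phi>) \<gamma> x \<xi>) \<le> C * (1 + norm x) powr (-M)"
    using Suc.IH[OF schwartz_pdiff[OF Suc.prems(1)] Suc.prems(2)] unfolding S_def by blast
  then obtain C1 where C1: "\<And>i. 0 \<le> C1 i" "\<And>i x \<xi>. (1 + S \<xi>) ^ N * norm (ambig (pdiff i \<phi>) \<gamma> x \<xi>) \<le> C1 i * (1 + norm x) powr (-M)"
    by metis
  have "\<forall>i. \<exists>C\<ge>0. \<forall>x \<xi>. (1 + S \<xi>) ^ N * norm (ambig \<phi> (pdiff i \<gamma>) x \<xi>) \<le> C * (1 + norm x) powr (-M)"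
    using Suc.IH[OF Suc.prems(1) schwartz_pdiff[OF Suc.prems(2)]] unfolding S_def by blast
  then obtain C2 where C2: "\<And>i. 0 \<le> C2 i" "\<And>i x \<xi>. (1 + S \<xi>) ^ N * norm (ambig \<phi> (pdiff i \<gamma>) x \<xi>) \<le> C2 i * (1 + norm x) powr (-M)"
    by metis
  define C where "C = C0 + (\<Sum>i\<in>UNIV. C1 i + C2 i)"
  have "(1 + S \<xi>) ^ Suc N * norm (ambig \<phi> \<gamma> x \<xi>) \<le> C * (1 + norm x) powr (-M)" for x \<xi>
  proof -
    have i: "\<bar>\<xi> $ i\<bar> * norm (ambig \<phi> \<gamma> x \<xi>) \<le> norm (ambig (pdiff i \<phi>) \<gamma> x \<xi>) + norm (ambig \<phi> (pdiff i \<gamma>) x \<xi>)" for i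
    proof -
      have "\<bar>\<xi> $ i\<bar> * norm (ambig \<phi> \<gamma> x \<xi>) = norm (of_real (\<xi> $ i) * ambig \<phi> \<gamma> x \<xi>)" by (simp add: norm_mult)
      also have "\<dots> = norm (ambig (pdiff i \<phi>) \<gamma> x \<xi> + ambig \<phi> (pdiff i \<gamma>) x \<xi>)"
        unfolding ambig_by_parts[OF Suc.prems] by (simp add: norm_mult)
      also have "\<dots> \<le> norm (ambig (pdiff i \<phi>) \<gamma> x \<xi>) + norm (ambig \<phi> (pdiff i \<gamma>) x \<xi>)" by (rule norm_triangle_ineq)
      finally show ?thesis .
    qed
    have "(1 + S \<xi>) ^ Suc N * norm (ambig \<phi> \<gamma> x \<xi>) = (1 + S \<xi>) ^ N * norm (ambig \<phi> \<gamma> x \<xi>) + (1 + S \<xi>) ^ N * (\<Sum>i\<in>UNIV. \<bar>\<xi> $ i\<bar> * norm (ambig \<phi> \<gamma> x \<xi>))"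
      by (simp add: S_def algebra_simps sum_distrib_right sum_distrib_left)
    also have "\<dots> \<le> C0 * (1 + norm x) powr (-M) + (1 + S \<xi>) ^ N * (\<Sum>i\<in>UNIV. norm (ambig (pdiff i \<phi>) \<gamma> x \<xi>) + norm (ambig \<phi> (pdiff i \<gamma>) x \<xi>))"
      using S0 by (intro add_mono C0(2) mult_left_mono sum_mono i) auto
    also have "(1 + S \<xi>) ^ N * (\<Sum>i\<in>UNIV. norm (ambig (pdiff i \<phi>) \<gamma> x \<xi>) + norm (ambig \<phi> (pdiff i \<gamma>) x \<xi>))
       = (\<Sum>i\<in>UNIV. (1 + S \<xi>) ^ N * norm (ambig (pdiff i \<phi>) \<gamma> x \<xi>) + (1 + S \<xi>) ^ N * norm (ambig \<phi> (pdiff i \<gamma>) x \<xi>))"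
      by (simp add: sum_distrib_left distrib_left)
    also have "C0 * (1 + norm x) powr (-M) + \<dots> \<le> C0 * (1 + norm x) powr (-M) + (\<Sum>i\<in>UNIV. C1 i * (1 + norm x) powr (-M) + C2 i * (1 + norm x) powr (-M))"
      by (intro add_mono sum_mono C1(2) C2(2) order_refl)
    also have "\<dots> = C * (1 + norm x) powr (-M)" by (simp add: C_def algebra_simps sum_distrib_right sum_distrib_left)
    finally show ?thesis .
  qed
  moreover have "0 \<le> C" unfolding C_def using C0(1) C1(1) C2(1) by (intro add_nonneg_nonneg sum_nonneg)
  ultimately show ?case unfolding S_def by blast
qed

lemma ambig_decay:
  fixes \<phi> \<gamma> :: "real^'n::finite \<Rightarrow> complex"
  assumes "schwartz \<phi>" "schwartz \<gamma>" and M: "0 \<le> M"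
  shows "\<exists>C\<ge>0. \<forall>x \<xi>. norm (ambig \<phi> \<gamma> x \<xi>) \<le> C * (1 + norm x) powr (-M) * (1 + norm \<xi>) powr (-M)"
proof -
  define N where "N = nat \<lceil>M\<rceil>"
  obtain C where C: "0 \<le> C" "\<And>x \<xi>. (1 + (\<Sum>i\<in>UNIV. \<bar>\<xi> $ i\<bar>)) ^ N * norm (ambig \<phi> \<gamma> x \<xi>) \<le> C * (1 + norm x) powr (-M)"
    using ambig_decay_aux[OF M assms(1,2), of N] by blast
  have "norm (ambig \<phi> \<gamma> x \<xi>) \<le> C * (1 + norm x) powr (-M) * (1 + norm \<xi>) powr (-M)" for x \<xi>
  proof -
    have p: "0 < 1 + norm \<xi>" by (simp add: add_pos_nonneg)
    have "(1 + norm \<xi>) powr M \<le> (1 + norm \<xi>) powr real N" by (intro powr_mono) (auto simp: N_def real_nat_ceiling_ge)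
    also have "\<dots> = (1 + norm \<xi>) ^ N" using p by (simp add: powr_realpow)
    also have "\<dots> \<le> (1 + (\<Sum>i\<in>UNIV. \<bar>\<xi> $ i\<bar>)) ^ N" using norm_le_l1_cart[of \<xi>] by (intro power_mono) auto
    finally have "(1 + norm \<xi>) powr M * norm (ambig \<phi> \<gamma> x \<xi>) \<le> (1 + (\<Sum>i\<in>UNIV. \<bar>\<xi> $ i\<bar>)) ^ N * norm (ambig \<phi> \<gamma> x \<xi>)"
      by (intro mult_right_mono) auto
    then have "(1 + norm \<xi>) powr M * norm (ambig \<phi> \<gamma> x \<xi>) \<le> C * (1 + norm x) powr (-M)" using C(2)[of \<xi> x] by linarith
    then have "(1 + norm \<xi>) powr (-M) * ((1 + norm \<xi>) powr M * norm (ambig \<phi> \<gamma> x \<xi>)) \<le> (1 + norm \<xi>) powr (-M) * (C * (1 + norm x) powr (-M))"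
      by (intro mult_left_mono) auto
    moreover have e: "(1 + norm \<xi>) powr (-M) * (1 + norm \<xi>) powr M = 1"
      unfolding weight_powr_add using p by simp
    ultimately have "norm (ambig \<phi> \<gamma> x \<xi>) \<le> (1 + norm \<xi>) powr (-M) * (C * (1 + norm x) powr (-M))"
      unfolding mult.assoc[symmetric] e by simp
    then show ?thesis by (simp only: ac_simps)
  qed
  then show ?thesis using C(1) by blast
qed

lemma ambig_decay_pair:
  fixes \<phi> \<gamma> :: "real^'n::finite \<Rightarrow> complex"
  assumes "schwartz \<phi>" "schwartz \<gamma>" and M: "0 \<le> M"
  shows "\<exists>C\<ge>0. \<forall>z. norm (ambig \<phi> \<gamma> (fst z) (snd z)) \<le> C * (1 + norm z) powr (-M)"
proof -
  obtain C where C: "0 \<le> C" "\<And>x \<xi>. norm (ambig \<phi> \<gamma> x \<xi>) \<le> C * (1 + norm x) powr (-M) * (1 + norm \<xi>) powr (-M)"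
    using ambig_decay[OF assms] by blast
  have "norm (ambig \<phi> \<gamma> (fst z) (snd z)) \<le> C * (1 + norm z) powr (-M)" for z
  proof -
    have p: "0 < 1 + norm z" by (simp add: add_pos_nonneg)
    have "norm z \<le> norm (fst z) + norm (snd z)" by (metis norm_Pair_le prod.collapse)
    moreover have "0 \<le> norm (fst z) * norm (snd z)" by simp
    moreover have "(1 + norm (fst z)) * (1 + norm (snd z)) = 1 + norm (fst z) + norm (snd z) + norm (fst z) * norm (snd z)"
      by (simp add: algebra_simps)
    ultimately have "1 + norm z \<le> (1 + norm (fst z)) * (1 + norm (snd z))" by linarith
    then have "((1 + norm (fst z)) * (1 + norm (snd z))) powr (-M) \<le> (1 + norm z) powr (-M)"
      using p M by (intro powr_mono2') auto
    then have "C * ((1 + norm (fst z)) powr (-M) * (1 + norm (snd z)) powr (-M)) \<le> C * (1 + norm z) powr (-M)"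
      using C(1) by (intro mult_left_mono) (auto simp: powr_mult)
    then show ?thesis using C(2)[of "fst z" "snd z"] by (simp add: mult.assoc)
  qed
  then show ?thesis using C(1) by blast
qed

lemma ambig_continuous:
  fixes \<phi> \<gamma> :: "real^'n::finite \<Rightarrow> complex"
  assumes "schwartz \<phi>" "schwartz \<gamma>"
  shows "continuous_on UNIV (\<lambda>z. ambig \<phi> \<gamma> (fst z) (snd z))"
  unfolding continuous_on_sequentially o_def
proof (intro allI ballI impI, elim conjE)
  fix s :: "nat \<Rightarrow> (real^'n) \<times> (real^'n)" and z
  assume s: "s \<longlonglongrightarrow> z"
  obtain B where B: "\<And>y. norm (\<gamma> y) \<le> B" using schwartz_bound[OF assms(2), of 0] by auto
  have [measurable]: "\<phi> \<in> borel_measurable borel" "\<gamma> \<in> borel_measurable borel"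
    using assms by (auto intro: schwartz_measurable)
  have m: "(\<lambda>y. \<phi> y * \<gamma> (y - x) * cis (\<xi> \<bullet> y)) \<in> borel_measurable lborel" for x \<xi>
    using schwartz_measurable[OF schwartz_ambig_integrand[OF assms]] by simp
  show "(\<lambda>n. ambig \<phi> \<gamma> (fst (s n)) (snd (s n))) \<longlonglongrightarrow> ambig \<phi> \<gamma> (fst z) (snd z)"
    unfolding ambig_def
  proof (rule integral_dominated_convergence[OF m m, where w="\<lambda>y. norm (\<phi> y) * B"])
    show "integrable lborel (\<lambda>y. norm (\<phi> y) * B)" using schwartz_integrable[OF assms(1)] by simp
    show "AE y in lborel. norm (\<phi> y * \<gamma> (y - fst (s n)) * cis (snd (s n) \<bullet> y)) \<le> norm (\<phi> y) * B" for n
      using B by (auto simp: norm_mult intro!: AE_I2 mult_left_mono)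
    show "AE y in lborel. (\<lambda>n. \<phi> y * \<gamma> (y - fst (s n)) * cis (snd (s n) \<bullet> y)) \<longlonglongrightarrow> \<phi> y * \<gamma> (y - fst z) * cis (snd z \<bullet> y)"
    proof (rule AE_I2)
      fix y
      have "(\<lambda>n. \<gamma> (y - fst (s n))) \<longlonglongrightarrow> \<gamma> (y - fst z)"
        by (rule continuous_on_tendsto_compose[OF schwartz_continuous[OF assms(2)]]) (auto intro!: tendsto_intros s)
      moreover have "(\<lambda>n. cis (snd (s n) \<bullet> y)) \<longlonglongrightarrow> cis (snd z \<bullet> y)"
        unfolding cis_conv_exp by (intro tendsto_intros s)
      ultimately show "(\<lambda>n. \<phi> y * \<gamma> (y - fst (s n)) * cis (snd (s n) \<bullet> y)) \<longlonglongrightarrow> \<phi> y * \<gamma> (y - fst z) * cis (snd z \<bullet> y)"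
        by (intro tendsto_mult tendsto_const)
    qed
  qed
qed

text \<open>The test function on which \<open>stft\<close> evaluates a distribution:
  \<open>stft g T x \<xi> = T (wpack g x \<xi>)\<close>. The pairing with a distribution is
  bilinear, whence the conjugate and the sign of the phase.\<close>

definition wpack :: "(real^'n::finite \<Rightarrow> complex) \<Rightarrow> real^'n \<Rightarrow> real^'n \<Rightarrow> real^'n \<Rightarrow> complex" where
  "wpack g x \<xi> y = cis (- (\<xi> \<bullet> y)) * cnj (g (y - x))"

lemma ambig_inversion:
  fixes \<phi> \<gamma> g :: "real^'n::finite \<Rightarrow> complex"
  assumes s: "schwartz \<phi>" "schwartz \<gamma>" "schwartz g"
  shows "integrable lborel (\<lambda>z. wpack g (fst z) (snd z) y * ambig \<phi> \<gamma> (fst z) (snd z))"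
    and "(\<integral>z. wpack g (fst z) (snd z) y * ambig \<phi> \<gamma> (fst z) (snd z) \<partial>lborel) = of_real ((2 * pi) ^ CARD('n)) * (\<integral>u. cnj (g u) * \<gamma> u \<partial>lborel) * \<phi> y"
proof -
  let ?Z = "\<lambda>z. wpack g (fst z) (snd z) y * ambig \<phi> \<gamma> (fst z) (snd z)"
  define m where "m = 2 * real DIM((real^'n) \<times> (real^'n))"
  obtain B where B: "0 \<le> B" "\<And>y. norm (g y) \<le> B" using schwartz_bound[OF s(3), of 0] by auto
  obtain C where C: "0 \<le> C" "\<And>z. norm (ambig \<phi> \<gamma> (fst z) (snd z)) \<le> C * (1 + norm z) powr (-m)"
    using ambig_decay_pair[OF s(1,2), of m] by (auto simp: m_def)
  have contw: "continuous_on UNIV (\<lambda>z. wpack g (fst z) (snd z) y)"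
    unfolding wpack_def cis_conv_exp
    by (intro continuous_intros continuous_on_compose2[OF schwartz_continuous[OF s(3)]]) auto
  have zm: "?Z \<in> borel_measurable borel"
    by (intro borel_measurable_continuous_onI continuous_on_mult contw ambig_continuous s)
  have zb: "norm (?Z z) \<le> (B * C) * (1 + norm z) powr (-m)" for z
    using mult_mono[OF B(2)[of "y - fst z"] C(2)[of z] B(1)] by (simp add: norm_mult wpack_def mult.assoc)
  show int: "integrable lborel ?Z"
    by (rule integrable_decay[OF zm zb]) (simp add: m_def)
  have inner: "(\<integral>\<xi>. ?Z (x, \<xi>) \<partial>lborel) = of_real ((2 * pi) ^ CARD('n)) * \<phi> y * (cnj (g (y - x)) * \<gamma> (y - x))" for x
  proof -
    define m' where "m' = 2 * real DIM(real^'n)"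
    obtain D where D: "\<And>x \<xi>. norm (ambig \<phi> \<gamma> x \<xi>) \<le> D * (1 + norm x) powr (-m') * (1 + norm \<xi>) powr (-m')"
      using ambig_decay[OF s(1,2), of m'] by (auto simp: m'_def)
    have sp: "schwartz (\<lambda>u. \<phi> u * \<gamma> (u - x))" by (rule schwartz_mult[OF s(1) schwartz_shift[OF s(2)]])
    obtain E where E: "\<And>u. norm (\<phi> u * \<gamma> (u - x)) \<le> E" using schwartz_bound[OF sp, of 0] by auto
    have am: "(\<lambda>\<xi>. ambig \<phi> \<gamma> x \<xi>) \<in> borel_measurable borel"
    proof (rule borel_measurable_continuous_onI)
      show "continuous_on UNIV (\<lambda>\<xi>. ambig \<phi> \<gamma> x \<xi>)"
        using continuous_on_compose2[OF ambig_continuous[OF s(1,2)], of UNIV "\<lambda>\<xi>. (x, \<xi>)"] by (simp add: continuous_on_Pair continuous_on_const continuous_on_id)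
    qed
    have hat: "integrable lborel (\<lambda>\<xi>. \<integral>u. \<phi> u * \<gamma> (u - x) * cis (\<xi> \<bullet> u) \<partial>lborel)"
      unfolding ambig_def[symmetric]
      by (rule integrable_decay[OF am D]) (simp add: m'_def)
    have "(\<integral>\<xi>. ambig \<phi> \<gamma> x \<xi> * cis (- (\<xi> \<bullet> y)) \<partial>lborel) = of_real ((2 * pi) ^ CARD('n)) * (\<phi> y * \<gamma> (y - x))"
      using fourier_inversion[OF schwartz_continuous[OF sp] E schwartz_integrable[OF sp] hat, of y] by (simp add: ambig_def)
    moreover have "(\<integral>\<xi>. ?Z (x, \<xi>) \<partial>lborel) = cnj (g (y - x)) * (\<integral>\<xi>. ambig \<phi> \<gamma> x \<xi> * cis (- (\<xi> \<bullet> y)) \<partial>lborel)"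
    proof -
      have "?Z (x, \<xi>) = cnj (g (y - x)) * (ambig \<phi> \<gamma> x \<xi> * cis (- (\<xi> \<bullet> y)))" for \<xi>
        by (simp add: wpack_def)
      then have "(\<integral>\<xi>. ?Z (x, \<xi>) \<partial>lborel) = (\<integral>\<xi>. cnj (g (y - x)) * (ambig \<phi> \<gamma> x \<xi> * cis (- (\<xi> \<bullet> y))) \<partial>lborel)" by (simp only:)
      also have "\<dots> = cnj (g (y - x)) * (\<integral>\<xi>. ambig \<phi> \<gamma> x \<xi> * cis (- (\<xi> \<bullet> y)) \<partial>lborel)"
        by (rule integral_mult_right_zero)
      finally show ?thesis .
    qed
    ultimately show ?thesis by (simp add: ac_simps)
  qed
  have "(\<integral>z. ?Z z \<partial>lborel) = (\<integral>x. (\<integral>\<xi>. ?Z (x, \<xi>) \<partial>lborel) \<partial>lborel)"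
    using lborel_pair.integral_fst'[of ?Z] int by (simp add: lborel_prod)
  also have "\<dots> = of_real ((2 * pi) ^ CARD('n)) * \<phi> y * (\<integral>x. cnj (g (y - x)) * \<gamma> (y - x) \<partial>lborel)"
    unfolding inner by simp
  also have "(\<integral>x. cnj (g (y - x)) * \<gamma> (y - x) \<partial>lborel) = (\<integral>u. cnj (g u) * \<gamma> u \<partial>lborel)"
    by (rule lborel_integral_minus[of "\<lambda>u. cnj (g u) * \<gamma> u"]) (rule schwartz_measurable[OF schwartz_mult[OF schwartz_cnj[OF s(3)] s(2)]])
  finally show "(\<integral>z. ?Z z \<partial>lborel) = of_real ((2 * pi) ^ CARD('n)) * (\<integral>u. cnj (g u) * \<gamma> u \<partial>lborel) * \<phi> y"
    by (simp add: ac_simps)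
qed

section \<open>Hermite functions against a Gaussian window\<close>

text \<open>Multinomial theorem for divided powers. An index over \<open>insert j S\<close> splits
  into its value at \<open>j\<close> and an index over \<open>S\<close>; the requirement to vanish
  off \<open>S\<close> keeps the index sets finite.\<close>

lemma multinomial_exp:
  fixes a :: "'n \<Rightarrow> complex"
  assumes "finite S"
  shows "finite {\<alpha>::'n \<Rightarrow> nat. (\<forall>i. i \<notin> S \<longrightarrow> \<alpha> i = 0) \<and> (\<Sum>i\<in>S. \<alpha> i) = k} \<and>
    (\<Sum>\<alpha>\<in>{\<alpha>::'n \<Rightarrow> nat. (\<forall>i. i \<notin> S \<longrightarrow> \<alpha> i = 0) \<and> (\<Sum>i\<in>S. \<alpha> i) = k}. \<Prod>i\<in>S. a i ^ \<alpha> i / fact (\<alpha> i)) = (\<Sum>i\<in>S. a i) ^ k / fact k"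
  using assms
proof (induction S arbitrary: k rule: finite_induct)
  case empty
  have e: "{\<alpha>::'n \<Rightarrow> nat. (\<forall>i. i \<notin> {} \<longrightarrow> \<alpha> i = 0) \<and> (\<Sum>i\<in>{}. \<alpha> i) = k} = (if k = 0 then {\<lambda>_. 0} else {})"
    by (auto simp: fun_eq_iff)
  show ?case unfolding e by (cases k) auto
next
  case (insert j S)
  define A where "A S k = {\<alpha>::'n \<Rightarrow> nat. (\<forall>i. i \<notin> S \<longrightarrow> \<alpha> i = 0) \<and> (\<Sum>i\<in>S. \<alpha> i) = k}" for S k
  have IH: "finite (A S k)" "(\<Sum>\<alpha>\<in>A S k. \<Prod>i\<in>S. a i ^ \<alpha> i / fact (\<alpha> i)) = (\<Sum>i\<in>S. a i) ^ k / fact k" for k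
    using insert.IH[of k] unfolding A_def by blast+
  have up: "(\<Sum>i\<in>S. (\<alpha>(j := m)) i) = (\<Sum>i\<in>S. \<alpha> i)" for \<alpha> :: "'n \<Rightarrow> nat" and m
    using insert.hyps(2) by (intro sum.cong) auto
  have upp: "(\<Prod>i\<in>S. a i ^ (\<alpha>(j := m)) i / fact ((\<alpha>(j := m)) i)) = (\<Prod>i\<in>S. a i ^ \<alpha> i / fact (\<alpha> i))" for \<alpha> :: "'n \<Rightarrow> nat" and m
    using insert.hyps(2) by (intro prod.cong) auto
  have mem1: "\<alpha>(j := m) \<in> A (insert j S) k" if "m \<le> k" "\<alpha> \<in> A S (k - m)" for \<alpha> m
    using that insert.hyps up[of \<alpha> m] by (auto simp: A_def)
  have mem2: "\<alpha> j \<le> k \<and> \<alpha>(j := 0) \<in> A S (k - \<alpha> j)" if "\<alpha> \<in> A (insert j S) k" for \<alpha>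
    using that insert.hyps up[of \<alpha> 0] by (auto simp: A_def)
  have "A (insert j S) k = (\<lambda>(m, \<alpha>). \<alpha>(j := m)) ` (SIGMA m:{..k}. A S (k - m))"
  proof (intro equalityI subsetI)
    fix \<alpha> assume "\<alpha> \<in> A (insert j S) k"
    then show "\<alpha> \<in> (\<lambda>(m, \<alpha>). \<alpha>(j := m)) ` (SIGMA m:{..k}. A S (k - m))"
      using mem2[of \<alpha>] by (intro image_eqI[of _ _ "(\<alpha> j, \<alpha>(j := 0))"]) auto
  next
    fix \<alpha> assume "\<alpha> \<in> (\<lambda>(m, \<alpha>). \<alpha>(j := m)) ` (SIGMA m:{..k}. A S (k - m))"
    then show "\<alpha> \<in> A (insert j S) k" using mem1 by auto
  qed
  moreover have "finite (SIGMA m:{..k}. A S (k - m))" using IH(1) by auto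
  ultimately have fin: "finite (A (insert j S) k)" by simp
  have "(\<Sum>\<alpha>\<in>A (insert j S) k. \<Prod>i\<in>insert j S. a i ^ \<alpha> i / fact (\<alpha> i))
     = (\<Sum>(m, \<alpha>)\<in>(SIGMA m:{..k}. A S (k - m)). a j ^ m / fact m * (\<Prod>i\<in>S. a i ^ \<alpha> i / fact (\<alpha> i)))"
  proof (rule sum.reindex_bij_witness[where i="\<lambda>(m, \<alpha>). \<alpha>(j := m)" and j="\<lambda>\<alpha>. (\<alpha> j, \<alpha>(j := 0))"])
    fix \<alpha> assume \<alpha>: "\<alpha> \<in> A (insert j S) k"
    show "(case (\<alpha> j, \<alpha>(j := 0)) of (m, \<alpha>) \<Rightarrow> \<alpha>(j := m)) = \<alpha>" by simp
    show "(\<alpha> j, \<alpha>(j := 0)) \<in> (SIGMA m:{..k}. A S (k - m))" using mem2[OF \<alpha>] by auto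
    show "(case (\<alpha> j, \<alpha>(j := 0)) of (m, \<alpha>) \<Rightarrow> a j ^ m / fact m * (\<Prod>i\<in>S. a i ^ \<alpha> i / fact (\<alpha> i))) = (\<Prod>i\<in>insert j S. a i ^ \<alpha> i / fact (\<alpha> i))"
      using insert.hyps upp[of \<alpha> 0] by simp
  next
    fix b assume b: "b \<in> (SIGMA m:{..k}. A S (k - m))"
    then obtain m \<alpha> where b': "b = (m, \<alpha>)" "m \<le> k" "\<alpha> \<in> A S (k - m)" by auto
    have "\<alpha> j = 0" using b'(3) insert.hyps by (auto simp: A_def)
    then show "((case b of (m, \<alpha>) \<Rightarrow> \<alpha>(j := m)) j, (case b of (m, \<alpha>) \<Rightarrow> \<alpha>(j := m))(j := 0)) = b"
      using b' by (auto simp: fun_eq_iff)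
    show "(case b of (m, \<alpha>) \<Rightarrow> \<alpha>(j := m)) \<in> A (insert j S) k" using b' mem1 by auto
  qed
  also have "\<dots> = (\<Sum>m\<le>k. a j ^ m / fact m * ((\<Sum>i\<in>S. a i) ^ (k - m) / fact (k - m)))"
  proof -
    have "(\<Sum>(m, \<alpha>)\<in>(SIGMA m:{..k}. A S (k - m)). a j ^ m / fact m * (\<Prod>i\<in>S. a i ^ \<alpha> i / fact (\<alpha> i)))
       = (\<Sum>m\<le>k. \<Sum>\<alpha>\<in>A S (k - m). a j ^ m / fact m * (\<Prod>i\<in>S. a i ^ \<alpha> i / fact (\<alpha> i)))"
      using IH(1) by (intro sum.Sigma[symmetric]) auto
    also have "\<dots> = (\<Sum>m\<le>k. a j ^ m / fact m * ((\<Sum>i\<in>S. a i) ^ (k - m) / fact (k - m)))"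
      unfolding sum_distrib_left[symmetric] IH(2) ..
    finally show ?thesis .
  qed
  also have "\<dots> = (\<Sum>m\<le>k. (of_nat (k choose m) * a j ^ m * (\<Sum>i\<in>S. a i) ^ (k - m)) / fact k)"
    by (intro sum.cong) (auto simp: binomial_fact)
  also have "\<dots> = (a j + (\<Sum>i\<in>S. a i)) ^ k / fact k"
    by (simp add: binomial_ring sum_divide_distrib)
  finally show ?case using fin insert.hyps by (simp add: A_def)
qed

lemma multinomial_UNIV:
  fixes a :: "'n::finite \<Rightarrow> complex"
  shows "finite {\<alpha>::'n \<Rightarrow> nat. (\<Sum>i\<in>UNIV. \<alpha> i) = k}"
    and "(\<Sum>\<alpha>\<in>{\<alpha>::'n \<Rightarrow> nat. (\<Sum>i\<in>UNIV. \<alpha> i) = k}. \<Prod>i\<in>UNIV. a i ^ \<alpha> i / fact (\<alpha> i)) = (\<Sum>i\<in>UNIV. a i) ^ k / fact k"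
  using multinomial_exp[of "UNIV :: 'n set" k a] by simp_all

section \<open>Hermite polynomials and creation operators\<close>

lemma hermite_poly_rec: "hermite_poly (Suc n) x = 2 * x * hermite_poly n x - 2 * real n * hermite_poly (n - 1) x"
  by (cases n) simp_all

lemma hermite_poly_deriv: "(hermite_poly n has_real_derivative 2 * real n * hermite_poly (n - 1) x) (at x)"
proof (induction n rule: less_induct)
  case (less n)
  consider "n = 0" | "n = Suc 0" | m where "n = Suc (Suc m)" by (metis nat.exhaust)
  then show ?case
  proof cases
    case 1
    have "hermite_poly 0 = (\<lambda>_. 1)" by (simp add: fun_eq_iff)
    then show ?thesis using 1 by simp
  next
    case 2
    have "hermite_poly (Suc 0) = (\<lambda>x. 2 * x)" by (simp add: fun_eq_iff)
    then show ?thesis using 2 by (auto intro!: derivative_eq_intros)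
  next
    case (3 m)
    have eq: "hermite_poly n = (\<lambda>x. 2 * x * hermite_poly (Suc m) x - 2 * real (Suc m) * hermite_poly m x)"
      using 3 by (simp add: fun_eq_iff)
    have d1: "(hermite_poly (Suc m) has_real_derivative 2 * real (Suc m) * hermite_poly m x) (at x)"
      using less[of "Suc m"] 3 by simp
    have d0: "(hermite_poly m has_real_derivative 2 * real m * hermite_poly (m - 1) x) (at x)"
      using less[of m] 3 by simp
    have "((\<lambda>x. 2 * x * hermite_poly (Suc m) x - 2 * real (Suc m) * hermite_poly m x) has_real_derivative
       (2 * hermite_poly (Suc m) x + (2 * real (Suc m) * hermite_poly m x) * (2 * x)) - 2 * real (Suc m) * (2 * real m * hermite_poly (m - 1) x)) (at x)"
    proof -
      have "((\<lambda>x::real. 2 * x) has_real_derivative 2) (at x)" by (auto intro!: derivative_eq_intros)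
      from DERIV_diff[OF DERIV_mult[OF this d1] DERIV_cmult[OF d0, of "2 * real (Suc m)"]] show ?thesis .
    qed
    moreover have "(2 * hermite_poly (Suc m) x + (2 * real (Suc m) * hermite_poly m x) * (2 * x)) - 2 * real (Suc m) * (2 * real m * hermite_poly (m - 1) x)
       = 2 * hermite_poly (Suc m) x + 2 * real (Suc m) * (2 * x * hermite_poly m x - 2 * real m * hermite_poly (m - 1) x)"
      by (simp add: algebra_simps)
    ultimately show ?thesis using 3 unfolding eq hermite_poly_rec[symmetric] by (simp add: algebra_simps)
  qed
qed

definition hermite_gauss :: "('n::finite \<Rightarrow> nat) \<Rightarrow> real^'n \<Rightarrow> complex" where
  "hermite_gauss \<alpha> y = of_real (\<Prod>i\<in>UNIV. hermite_poly (\<alpha> i) (y $ i)) * gauss y"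

lemma schwartz_hermite_gauss: "schwartz (hermite_gauss \<alpha>)"
proof -
  have "(\<lambda>y. of_real (\<Prod>i\<in>S. hermite_poly (\<alpha> i) (y $ i)) * gauss y) \<in> gauss_poly_class" if "finite S" for S
    using that
  proof (induction rule: finite_induct)
    case empty then show ?case by (simp add: gauss_poly_class.base)
  next
    case (insert j S)
    then show ?case using gauss_poly_class_hermite_poly[OF insert.IH, of "\<alpha> j" j] by (simp add: mult.assoc)
  qed
  from schwartz_gauss_poly_class[OF this[of UNIV]] show ?thesis by (simp add: hermite_gauss_def[abs_def])
qed

lemma has_pd_coord_fun:
  assumes "(f has_real_derivative D) (at (x $ i))"
  shows "has_pd i (\<lambda>y. complex_of_real (f (y $ i))) x (of_real D)"
proof -
  have "((\<lambda>h. f (x $ i + h)) has_real_derivative D) (at 0)"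
    using assms DERIV_shift[of f D 0 "x $ i"] by (simp add: add.commute)
  then have "((\<lambda>h. complex_of_real (f (x $ i + h))) has_vector_derivative of_real D) (at 0)"
    by (intro has_vector_derivative_of_real) (simp add: has_real_derivative_iff_has_vector_derivative)
  then show ?thesis unfolding has_pd_def by (simp add: axis_def)
qed

text \<open>The creation operator y_i - d/dy_i raises the i-th index: the derivative of the Gaussian
  doubles the term with y_i, and the derivative of the polynomial supplies the other term of
  \<open>hermite_poly_rec\<close>. The factor \<open>P\<close> does not involve the i-th
  coordinate.\<close>

lemma hermite_gauss_ladder: "of_real (y $ i) * hermite_gauss \<alpha> y - pdiff i (hermite_gauss \<alpha>) y = hermite_gauss (\<alpha>(i := Suc (\<alpha> i))) y"
proof -
  define P where "P y = (\<Prod>j\<in>UNIV - {i}. hermite_poly (\<alpha> j) (y $ j))" for y :: "real^'a"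
  have sp: "hermite_gauss \<beta> y = of_real (hermite_poly (\<beta> i) (y $ i)) * (of_real (P y) * gauss y)" if "\<And>j. j \<noteq> i \<Longrightarrow> \<beta> j = \<alpha> j" for \<beta> y
  proof -
    have "(\<Prod>j\<in>UNIV. hermite_poly (\<beta> j) (y $ j)) = hermite_poly (\<beta> i) (y $ i) * (\<Prod>j\<in>UNIV - {i}. hermite_poly (\<beta> j) (y $ j))"
      by (rule prod.remove) auto
    also have "(\<Prod>j\<in>UNIV - {i}. hermite_poly (\<beta> j) (y $ j)) = P y"
      unfolding P_def using that by (intro prod.cong) auto
    finally show ?thesis by (simp add: hermite_gauss_def)
  qed
  have hga: "hermite_gauss \<alpha> = (\<lambda>y. of_real (hermite_poly (\<alpha> i) (y $ i)) * (of_real (P y) * gauss y))"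
    by (rule ext, rule sp) simp
  have Pd: "has_pd i (\<lambda>y. of_real (P y)) y 0"
  proof -
    have "P (y + h *\<^sub>R axis i 1) = P y" for h
      unfolding P_def by (intro prod.cong) (auto simp: axis_def)
    then show ?thesis unfolding has_pd_def by simp
  qed
  have "has_pd i (\<lambda>y. of_real (hermite_poly (\<alpha> i) (y $ i)) * (of_real (P y) * gauss y)) y
     (of_real (hermite_poly (\<alpha> i) (y $ i)) * (of_real (P y) * ((-1) * (of_real (y $ i) * gauss y)) + 0 * gauss y)
       + of_real (2 * real (\<alpha> i) * hermite_poly (\<alpha> i - 1) (y $ i)) * (of_real (P y) * gauss y))"
    by (rule has_pd_mult[OF has_pd_coord_fun[OF hermite_poly_deriv] has_pd_mult[OF Pd has_pd_gauss]])
  then have "has_pd i (hermite_gauss \<alpha>) y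
     (of_real (hermite_poly (\<alpha> i) (y $ i)) * (of_real (P y) * ((-1) * (of_real (y $ i) * gauss y)) + 0 * gauss y)
       + of_real (2 * real (\<alpha> i) * hermite_poly (\<alpha> i - 1) (y $ i)) * (of_real (P y) * gauss y))"
    unfolding hga .
  from has_pd_pdiff[OF this] have "pdiff i (hermite_gauss \<alpha>) y = - (of_real (y $ i) * hermite_gauss \<alpha> y) + of_real (2 * real (\<alpha> i) * hermite_poly (\<alpha> i - 1) (y $ i)) * (of_real (P y) * gauss y)"
    by (simp add: sp[of \<alpha>])
  moreover have "hermite_gauss (\<alpha>(i := Suc (\<alpha> i))) y = of_real (2 * (y $ i) * hermite_poly (\<alpha> i) (y $ i) - 2 * real (\<alpha> i) * hermite_poly (\<alpha> i - 1) (y $ i)) * (of_real (P y) * gauss y)"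
    by (subst sp) (auto simp: hermite_poly_rec)
  moreover have "of_real (2 * (y $ i) * hermite_poly (\<alpha> i) (y $ i)) * (of_real (P y) * gauss y) = 2 * (of_real (y $ i) * hermite_gauss \<alpha> y)"
    by (simp add: sp[of \<alpha>])
  moreover have "p = - a + b \<Longrightarrow> h = c - b \<Longrightarrow> c = 2 * a \<Longrightarrow> a - p = h" for a b c h p :: complex by simp
  ultimately show ?thesis unfolding of_real_diff left_diff_distrib by blast
qed

section \<open>Hermite functions in phase space\<close>

definition zcoord :: "(real^'n::finite) \<times> (real^'n) \<Rightarrow> 'n \<Rightarrow> complex" where
  "zcoord w i = Complex (fst w $ i) (snd w $ i)"

text \<open>y_i times the shifted Gaussian is x_i times it minus its i-th derivative. The creation
  operator therefore becomes x_i minus the two terms of \<open>ambig_by_parts\<close>, which add up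
  to -i \<xi>_i.\<close>

lemma ambig_hermite_gauss_Suc:
  "ambig (hermite_gauss (\<alpha>(i := Suc (\<alpha> i)))) gauss (fst w) (snd w) = zcoord w i * ambig (hermite_gauss \<alpha>) gauss (fst w) (snd w)"
proof -
  define x where "x = fst w"
  define \<xi> where "\<xi> = snd w"
  have pg: "pdiff i gauss = (\<lambda>y. (-1) * (of_real (y $ i) * gauss y))"
    by (intro ext has_pd_pdiff has_pd_gauss)
  note s = schwartz_hermite_gauss[of \<alpha>] schwartz_gauss schwartz_pdiff[OF schwartz_hermite_gauss[of \<alpha>], of i]
  have i0: "integrable lborel (\<lambda>y. hermite_gauss \<alpha> y * gauss (y - x) * cis (\<xi> \<bullet> y))"
    by (rule schwartz_integrable[OF schwartz_ambig_integrand[OF s(1,2)]])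
  have i1: "integrable lborel (\<lambda>y. pdiff i (hermite_gauss \<alpha>) y * gauss (y - x) * cis (\<xi> \<bullet> y))"
    by (rule schwartz_integrable[OF schwartz_ambig_integrand[OF s(3,2)]])
  have i2: "integrable lborel (\<lambda>y. hermite_gauss \<alpha> y * pdiff i gauss (y - x) * cis (\<xi> \<bullet> y))"
    by (rule schwartz_integrable[OF schwartz_ambig_integrand[OF s(1) schwartz_pdiff[OF s(2)]]])
  have "ambig (hermite_gauss (\<alpha>(i := Suc (\<alpha> i)))) gauss x \<xi> =
     (\<integral>y. of_real (x $ i) * (hermite_gauss \<alpha> y * gauss (y - x) * cis (\<xi> \<bullet> y)) - hermite_gauss \<alpha> y * pdiff i gauss (y - x) * cis (\<xi> \<bullet> y) - pdiff i (hermite_gauss \<alpha>) y * gauss (y - x) * cis (\<xi> \<bullet> y) \<partial>lborel)"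
    unfolding ambig_def hermite_gauss_ladder[symmetric] pg
    by (intro Bochner_Integration.integral_cong refl) (simp add: algebra_simps)
  also have "\<dots> = of_real (x $ i) * ambig (hermite_gauss \<alpha>) gauss x \<xi> - ambig (hermite_gauss \<alpha>) (pdiff i gauss) x \<xi> - ambig (pdiff i (hermite_gauss \<alpha>)) gauss x \<xi>"
    unfolding ambig_def using i0 i1 i2 by simp
  also have "\<dots> = of_real (x $ i) * ambig (hermite_gauss \<alpha>) gauss x \<xi> - (ambig (pdiff i (hermite_gauss \<alpha>)) gauss x \<xi> + ambig (hermite_gauss \<alpha>) (pdiff i gauss) x \<xi>)" by simp
  also have "ambig (pdiff i (hermite_gauss \<alpha>)) gauss x \<xi> + ambig (hermite_gauss \<alpha>) (pdiff i gauss) x \<xi> = - \<i> * (of_real (\<xi> $ i) * ambig (hermite_gauss \<alpha>) gauss x \<xi>)"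
    unfolding ambig_by_parts[OF s(1,2)] by simp
  also have "of_real (x $ i) * ambig (hermite_gauss \<alpha>) gauss x \<xi> - (- \<i> * (of_real (\<xi> $ i) * ambig (hermite_gauss \<alpha>) gauss x \<xi>)) = zcoord w i * ambig (hermite_gauss \<alpha>) gauss x \<xi>"
  proof -
    have "zcoord w i = of_real (x $ i) + \<i> * of_real (\<xi> $ i)" by (simp add: zcoord_def x_def \<xi>_def complex_eq_iff)
    then show ?thesis by (simp add: algebra_simps)
  qed
  finally show ?thesis by (simp only: x_def \<xi>_def)
qed

lemma ambig_hermite_gauss:
  "ambig (hermite_gauss \<alpha>) gauss (fst w) (snd w) = (\<Prod>i\<in>UNIV. zcoord w i ^ \<alpha> i) * ambig gauss gauss (fst w) (snd w)"
proof (induction "\<Sum>i\<in>UNIV. \<alpha> i" arbitrary: \<alpha>)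
  case 0
  then have \<alpha>: "\<alpha> = (\<lambda>_. 0)" by (auto simp: fun_eq_iff)
  have "hermite_gauss \<alpha> = gauss" by (simp add: hermite_gauss_def[abs_def] \<alpha>)
  then show ?case by (simp add: \<alpha>)
next
  case (Suc k)
  have "\<not> (\<forall>i. \<alpha> i = 0)"
  proof
    assume "\<forall>i. \<alpha> i = 0"
    then have "(\<Sum>i\<in>UNIV. \<alpha> i) = 0" by simp
    then show False using Suc(2) by linarith
  qed
  then obtain i where i: "\<alpha> i \<noteq> 0" by blast
  define \<beta> where "\<beta> = \<alpha>(i := \<alpha> i - 1)"
  have \<alpha>: "\<alpha> = \<beta>(i := Suc (\<beta> i))" using i unfolding \<beta>_def by (intro ext) auto
  have "(\<Sum>j\<in>UNIV. \<alpha> j) = \<alpha> i + (\<Sum>j\<in>UNIV - {i}. \<alpha> j)" "(\<Sum>j\<in>UNIV. \<beta> j) = \<beta> i + (\<Sum>j\<in>UNIV - {i}. \<beta> j)"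
    by (rule sum.remove[OF finite_class.finite_UNIV UNIV_I])+
  moreover have "(\<Sum>j\<in>UNIV - {i}. \<alpha> j) = (\<Sum>j\<in>UNIV - {i}. \<beta> j)" by (intro sum.cong) (auto simp: \<beta>_def)
  moreover have "\<alpha> i = Suc (\<beta> i)" using i by (simp add: \<beta>_def)
  ultimately have k: "k = (\<Sum>j\<in>UNIV. \<beta> j)" using Suc(2) by linarith
  have "(\<Prod>j\<in>UNIV. zcoord w j ^ \<alpha> j) = zcoord w i ^ \<alpha> i * (\<Prod>j\<in>UNIV - {i}. zcoord w j ^ \<alpha> j)" "(\<Prod>j\<in>UNIV. zcoord w j ^ \<beta> j) = zcoord w i ^ \<beta> i * (\<Prod>j\<in>UNIV - {i}. zcoord w j ^ \<beta> j)"
    by (rule prod.remove[OF finite_class.finite_UNIV UNIV_I])+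
  moreover have "(\<Prod>j\<in>UNIV - {i}. zcoord w j ^ \<alpha> j) = (\<Prod>j\<in>UNIV - {i}. zcoord w j ^ \<beta> j)" by (intro prod.cong) (auto simp: \<beta>_def)
  moreover have "zcoord w i ^ \<alpha> i = zcoord w i * zcoord w i ^ \<beta> i" using i unfolding \<beta>_def by (cases "\<alpha> i") simp_all
  ultimately have p: "(\<Prod>j\<in>UNIV. zcoord w j ^ \<alpha> j) = zcoord w i * (\<Prod>j\<in>UNIV. zcoord w j ^ \<beta> j)" by (simp only: mult.assoc)
  have "ambig (hermite_gauss \<alpha>) gauss (fst w) (snd w) = zcoord w i * ambig (hermite_gauss \<beta>) gauss (fst w) (snd w)"
    unfolding ambig_hermite_gauss_Suc[of \<beta> i w, folded \<alpha>] ..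
  then show ?case unfolding Suc(1)[OF k] p by (simp only: mult.assoc)
qed

text \<open>Moving the origin to the midpoint x/2 turns the product of the two Gaussians into
  exp(-|x|^2/4) times one Gaussian, whose transform is known. The shift itself contributes just a
  phase.\<close>

lemma ambig_gauss_norm:
  fixes w :: "(real^'n::finite) \<times> (real^'n)"
  shows "norm (ambig gauss gauss (fst w) (snd w)) = sqrt pi ^ CARD('n) * exp (- (norm w)\<^sup>2 / 4)"
proof -
  define x where "x = fst w"
  define \<xi> where "\<xi> = snd w"
  have gm [measurable]: "(gauss :: real^'n \<Rightarrow> complex) \<in> borel_measurable borel" by (rule schwartz_measurable[OF schwartz_gauss])
  have e: "gauss ((1/2) *\<^sub>R x + u) * gauss ((1/2) *\<^sub>R x + u - x) * cis (\<xi> \<bullet> ((1/2) *\<^sub>R x + u))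
     = (of_real (exp (- (norm x)\<^sup>2 / 4)) * cis ((\<xi> \<bullet> x) / 2)) * (gauss (sqrt 2 *\<^sub>R u) * cis (u \<bullet> \<xi>))" for u
  proof -
    have "(norm ((1/2) *\<^sub>R x + u))\<^sup>2 + (norm ((1/2) *\<^sub>R x + u - x))\<^sup>2 = (norm x)\<^sup>2 / 2 + 2 * (norm u)\<^sup>2"
    proof -
      have "(1/2) *\<^sub>R x + u - x = u - (1/2) *\<^sub>R x" by (simp add: vec_eq_iff)
      then show ?thesis unfolding power2_norm_eq_inner
        by (simp add: inner_add_left inner_add_right inner_diff_left inner_diff_right inner_commute)
    qed
    then have "exp (- (norm ((1/2) *\<^sub>R x + u))\<^sup>2 / 2) * exp (- (norm ((1/2) *\<^sub>R x + u - x))\<^sup>2 / 2) = exp (- (norm x)\<^sup>2 / 4) * exp (- (norm (sqrt 2 *\<^sub>R u))\<^sup>2 / 2)"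
      unfolding exp_add[symmetric] by (simp add: power_mult_distrib)
    then have "gauss ((1/2) *\<^sub>R x + u) * gauss ((1/2) *\<^sub>R x + u - x) = of_real (exp (- (norm x)\<^sup>2 / 4)) * gauss (sqrt 2 *\<^sub>R u)"
      unfolding gauss_def of_real_mult[symmetric] by simp
    moreover have "cis (\<xi> \<bullet> ((1/2) *\<^sub>R x + u)) = cis ((\<xi> \<bullet> x) / 2) * cis (u \<bullet> \<xi>)"
      by (simp add: cis_mult inner_add_right inner_commute)
    ultimately show ?thesis by (simp only: ac_simps)
  qed
  have m: "(\<lambda>y. gauss y * gauss (y - x) * cis (\<xi> \<bullet> y)) \<in> borel_measurable borel" by measurable
  have "ambig gauss gauss x \<xi> = (\<integral>u. gauss ((1/2) *\<^sub>R x + u) * gauss ((1/2) *\<^sub>R x + u - x) * cis (\<xi> \<bullet> ((1/2) *\<^sub>R x + u)) \<partial>lborel)"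
    unfolding ambig_def by (rule lborel_integral_plus[OF m, symmetric])
  also have "\<dots> = (of_real (exp (- (norm x)\<^sup>2 / 4)) * cis ((\<xi> \<bullet> x) / 2)) * (\<integral>u. gauss (sqrt 2 *\<^sub>R u) * cis (u \<bullet> \<xi>) \<partial>lborel)"
    unfolding e by simp
  also have "(\<integral>u. gauss (sqrt 2 *\<^sub>R u) * cis (u \<bullet> \<xi>) \<partial>lborel) = of_real (sqrt pi ^ CARD('n)) * gauss ((1 / sqrt 2) *\<^sub>R \<xi>)"
  proof -
    have m2: "(\<lambda>u. gauss (sqrt 2 *\<^sub>R u) * cis (u \<bullet> \<xi>)) \<in> borel_measurable borel" by measurable
    have "(\<integral>u. gauss (sqrt 2 *\<^sub>R u) * cis (u \<bullet> \<xi>) \<partial>lborel) = (1 / sqrt 2) ^ CARD('n) *\<^sub>R (\<integral>v. cis (v \<bullet> ((1 / sqrt 2) *\<^sub>R \<xi>)) * gauss v \<partial>lborel)"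
      using lborel_integral_affine[OF m2, of "1 / sqrt 2" 0] by (simp add: mult.commute)
    also have "\<dots> = of_real ((1 / sqrt 2) ^ CARD('n) * sqrt (2 * pi) ^ CARD('n)) * gauss ((1 / sqrt 2) *\<^sub>R \<xi>)"
      unfolding gaussian_fourier(2) scaleR_conv_of_real[where 'a=complex] of_real_mult by (simp only: mult.assoc)
    also have "(1 / sqrt 2) ^ CARD('n) * sqrt (2 * pi) ^ CARD('n) = sqrt pi ^ CARD('n)"
      unfolding power_mult_distrib[symmetric] by (simp add: real_sqrt_mult)
    finally show ?thesis .
  qed
  finally have "norm (ambig gauss gauss x \<xi>) = exp (- (norm x)\<^sup>2 / 4) * (sqrt pi ^ CARD('n) * exp (- (norm \<xi>)\<^sup>2 / 4))"
  proof -
    have g: "norm (gauss ((1 / sqrt 2) *\<^sub>R \<xi>)) = exp (- (norm \<xi>)\<^sup>2 / 4)"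
      unfolding gauss_def norm_of_real by (simp add: power_mult_distrib power_divide)
    assume "ambig gauss gauss x \<xi> = of_real (exp (- (norm x)\<^sup>2 / 4)) * cis ((\<xi> \<bullet> x) / 2) * (of_real (sqrt pi ^ CARD('n)) * gauss ((1 / sqrt 2) *\<^sub>R \<xi>))"
    then show ?thesis by (simp add: norm_mult norm_power g)
  qed
  moreover have "(norm w)\<^sup>2 = (norm x)\<^sup>2 + (norm \<xi>)\<^sup>2" unfolding x_def \<xi>_def by (simp add: norm_prod_def)
  moreover have "exp (- (norm x)\<^sup>2 / 4) * exp (- (norm \<xi>)\<^sup>2 / 4) = exp (- ((norm x)\<^sup>2 + (norm \<xi>)\<^sup>2) / 4)"
    unfolding exp_add[symmetric] by (simp add: field_simps)
  ultimately show ?thesis unfolding x_def[symmetric] \<xi>_def[symmetric] by simp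
qed

definition hermite_cfun :: "('n::finite \<Rightarrow> nat) \<Rightarrow> real^'n \<Rightarrow> complex" where
  "hermite_cfun \<alpha> = (\<lambda>y. complex_of_real (hermite_fun \<alpha> y))"

definition hcoef :: "('n::finite \<Rightarrow> nat) \<Rightarrow> (real^'n) \<times> (real^'n) \<Rightarrow> complex" where
  "hcoef \<alpha> w = ambig (hermite_cfun \<alpha>) gauss (fst w) (snd w)"

definition zcoord_inner :: "(real^'n::finite) \<times> (real^'n) \<Rightarrow> (real^'n) \<times> (real^'n) \<Rightarrow> complex" where
  "zcoord_inner w u = (\<Sum>i\<in>UNIV. zcoord w i * cnj (zcoord u i)) / 2"

lemma schwartz_hermite_cfun: "schwartz (hermite_cfun \<alpha>)"
  unfolding hermite_cfun_def by (rule schwartz_hermite_fun)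

lemma hcoef_eq:
  "hcoef \<alpha> w = (\<Prod>i\<in>UNIV. zcoord w i ^ \<alpha> i / of_real (sqrt (2 ^ \<alpha> i * fact (\<alpha> i) * sqrt pi))) * ambig gauss gauss (fst w) (snd w)"
proof -
  have "hermite_cfun \<alpha> = (\<lambda>y. (\<Prod>i\<in>UNIV. 1 / of_real (sqrt (2 ^ \<alpha> i * fact (\<alpha> i) * sqrt pi))) * hermite_gauss \<alpha> y)"
    unfolding hermite_cfun_def hermite_gauss_def hermite_fun_eq ..
  then have "hcoef \<alpha> w = (\<Prod>i\<in>UNIV. 1 / of_real (sqrt (2 ^ \<alpha> i * fact (\<alpha> i) * sqrt pi))) * ambig (hermite_gauss \<alpha>) gauss (fst w) (snd w)"
    unfolding hcoef_def ambig_def by (simp add: mult.assoc)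
  then show ?thesis unfolding ambig_hermite_gauss mult.assoc[symmetric] prod.distrib[symmetric] by simp
qed

text \<open>The kernel of the projection P_k in phase space. The normalising constants turn every
  product into divided powers of half the coordinate products, and the multinomial theorem sums
  these.\<close>

lemma hcoef_sum:
  fixes w u :: "(real^'n::finite) \<times> (real^'n)"
  shows "(\<Sum>\<alpha>\<in>{\<alpha>::'n \<Rightarrow> nat. (\<Sum>i\<in>UNIV. \<alpha> i) = k}. hcoef \<alpha> w * cnj (hcoef \<alpha> u))
    = (ambig gauss gauss (fst w) (snd w) * cnj (ambig gauss gauss (fst u) (snd u)) / of_real (sqrt pi ^ CARD('n))) * (zcoord_inner w u ^ k / fact k)"
proof -
  define A where "A = ambig gauss gauss (fst w) (snd w) * cnj (ambig gauss gauss (fst u) (snd u))"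
  have "hcoef \<alpha> w * cnj (hcoef \<alpha> u) = (A / of_real (sqrt pi ^ CARD('n))) * (\<Prod>i\<in>UNIV. (zcoord w i * cnj (zcoord u i) / 2) ^ \<alpha> i / fact (\<alpha> i))" for \<alpha> :: "'n \<Rightarrow> nat"
  proof -
    have f: "zcoord w i ^ \<alpha> i / of_real (sqrt (2 ^ \<alpha> i * fact (\<alpha> i) * sqrt pi)) * cnj (zcoord u i ^ \<alpha> i / of_real (sqrt (2 ^ \<alpha> i * fact (\<alpha> i) * sqrt pi)))
       = (zcoord w i * cnj (zcoord u i) / 2) ^ \<alpha> i / fact (\<alpha> i) * (1 / of_real (sqrt pi))" for i
    proof -
      define q where "q = 2 ^ \<alpha> i * fact (\<alpha> i) * sqrt pi"
      have q: "complex_of_real (sqrt q) * of_real (sqrt q) = of_real q"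
        unfolding of_real_mult[symmetric] by (simp add: q_def)
      have "zcoord w i ^ \<alpha> i / of_real (sqrt q) * cnj (zcoord u i ^ \<alpha> i / of_real (sqrt q)) = (zcoord w i ^ \<alpha> i * cnj (zcoord u i) ^ \<alpha> i) / of_real q"
        unfolding q[symmetric] by simp
      also have "\<dots> = (zcoord w i * cnj (zcoord u i) / 2) ^ \<alpha> i / fact (\<alpha> i) * (1 / of_real (sqrt pi))"
        by (simp add: q_def power_mult_distrib power_divide)
      finally show ?thesis by (simp add: q_def)
    qed
    have "hcoef \<alpha> w * cnj (hcoef \<alpha> u) = A * (\<Prod>i\<in>UNIV. zcoord w i ^ \<alpha> i / of_real (sqrt (2 ^ \<alpha> i * fact (\<alpha> i) * sqrt pi)) * cnj (zcoord u i ^ \<alpha> i / of_real (sqrt (2 ^ \<alpha> i * fact (\<alpha> i) * sqrt pi))))"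
      unfolding hcoef_eq A_def prod.distrib complex_cnj_mult cnj_prod by (simp only: ac_simps)
    also have "\<dots> = A * ((\<Prod>i\<in>UNIV. (zcoord w i * cnj (zcoord u i) / 2) ^ \<alpha> i / fact (\<alpha> i)) * (\<Prod>i\<in>(UNIV::'n set). 1 / of_real (sqrt pi)))"
      unfolding f prod.distrib ..
    also have "(\<Prod>i\<in>(UNIV::'n set). 1 / complex_of_real (sqrt pi)) = 1 / of_real (sqrt pi ^ CARD('n))"
      by (simp add: power_divide)
    finally show ?thesis by simp
  qed
  then have "(\<Sum>\<alpha>\<in>{\<alpha>::'n \<Rightarrow> nat. (\<Sum>i\<in>UNIV. \<alpha> i) = k}. hcoef \<alpha> w * cnj (hcoef \<alpha> u))
     = (A / of_real (sqrt pi ^ CARD('n))) * (\<Sum>\<alpha>\<in>{\<alpha>::'n \<Rightarrow> nat. (\<Sum>i\<in>UNIV. \<alpha> i) = k}. \<Prod>i\<in>UNIV. (zcoord w i * cnj (zcoord u i) / 2) ^ \<alpha> i / fact (\<alpha> i))"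
    by (simp add: sum_distrib_left)
  also have "\<dots> = (A / of_real (sqrt pi ^ CARD('n))) * ((\<Sum>i\<in>UNIV. zcoord w i * cnj (zcoord u i) / 2) ^ k / fact k)"
    unfolding multinomial_UNIV(2) ..
  also have "(\<Sum>i\<in>UNIV. zcoord w i * cnj (zcoord u i) / 2) = zcoord_inner w u"
    by (simp add: zcoord_inner_def sum_divide_distrib)
  finally show ?thesis by (simp add: A_def)
qed

text \<open>Arithmetic-geometric mean for the first part, polarisation for the second. Together they
  explain the choice of \<open>s\<close>: the two Gaussian prefactors multiply to exp(-s), and the
  defect of the real part from \<open>s\<close> is a quarter of the squared distance.\<close>

lemma zcoord_inner_bounds:
  fixes w u :: "(real^'n::finite) \<times> (real^'n)"
  defines "s \<equiv> ((norm w)\<^sup>2 + (norm u)\<^sup>2) / 4"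
  shows "norm (zcoord_inner w u) \<le> s" and "4 * (s - Re (zcoord_inner w u)) = (norm (w - u))\<^sup>2"
proof -
  have n2: "(norm v)\<^sup>2 = (\<Sum>i\<in>UNIV. (norm (zcoord v i))\<^sup>2)" for v :: "(real^'n) \<times> (real^'n)"
  proof -
    have "(norm v)\<^sup>2 = (norm (fst v))\<^sup>2 + (norm (snd v))\<^sup>2" by (simp add: norm_prod_def)
    then show ?thesis unfolding norm_vec_square sum.distrib[symmetric] by (simp add: zcoord_def cmod_power2)
  qed
  have "norm (zcoord_inner w u) \<le> (\<Sum>i\<in>UNIV. norm (zcoord w i) * norm (zcoord u i)) / 2"
    unfolding zcoord_inner_def by (simp add: norm_divide) (rule order_trans[OF norm_sum], simp add: norm_mult)
  also have "\<dots> \<le> (\<Sum>i\<in>UNIV. ((norm (zcoord w i))\<^sup>2 + (norm (zcoord u i))\<^sup>2) / 2) / 2"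
  proof (intro divide_right_mono sum_mono)
    fix i show "norm (zcoord w i) * norm (zcoord u i) \<le> ((norm (zcoord w i))\<^sup>2 + (norm (zcoord u i))\<^sup>2) / 2"
      using sum_squares_bound[of "norm (zcoord w i)" "norm (zcoord u i)"] by simp
  qed simp
  also have "\<dots> = s" by (simp add: s_def n2[of w] n2[of u] sum.distrib sum_divide_distrib[symmetric])
  finally show "norm (zcoord_inner w u) \<le> s" .
  have zd: "zcoord (w - u) i = zcoord w i - zcoord u i" for i by (simp add: zcoord_def complex_eq_iff)
  have "(norm (w - u))\<^sup>2 = (\<Sum>i\<in>UNIV. (norm (zcoord w i))\<^sup>2 + (norm (zcoord u i))\<^sup>2 - 2 * Re (zcoord w i * cnj (zcoord u i)))"
    unfolding n2[of "w - u"] zd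
  proof (intro sum.cong refl)
    fix i show "(norm (zcoord w i - zcoord u i))\<^sup>2 = (norm (zcoord w i))\<^sup>2 + (norm (zcoord u i))\<^sup>2 - 2 * Re (zcoord w i * cnj (zcoord u i))"
      unfolding cmod_power2 by (simp add: power2_eq_square algebra_simps)
  qed
  also have "\<dots> = (norm w)\<^sup>2 + (norm u)\<^sup>2 - 4 * Re (zcoord_inner w u)"
  proof -
    have "4 * Re (zcoord_inner w u) = 2 * (\<Sum>i\<in>UNIV. Re (zcoord w i * cnj (zcoord u i)))"
      unfolding zcoord_inner_def by (simp only: Re_divide_numeral Re_sum)
    then show ?thesis unfolding n2[of w] n2[of u] by (simp only: sum.distrib sum_subtractf sum_distrib_left[symmetric])
  qed
  finally show "4 * (s - Re (zcoord_inner w u)) = (norm (w - u))\<^sup>2" by (simp add: s_def)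
qed

section \<open>Tempered distributions and wave packets\<close>

definition wpk :: "(real^'n::finite \<Rightarrow> complex) \<Rightarrow> (real^'n) \<times> (real^'n) \<Rightarrow> real^'n \<Rightarrow> complex" where
  "wpk g z = wpack g (fst z) (snd z)"

lemma wpk_eq: "wpk g z y = cis (snd z \<bullet> (- y)) * cnj (g (y - fst z))"
  by (simp add: wpk_def wpack_def)

lemma wpk_eq': "wpk g z = (\<lambda>y. cis (- snd z \<bullet> y) * cnj (g (y - fst z)))"
  by (simp add: wpk_def wpack_def fun_eq_iff)

lemma schwartz_wpk: "schwartz g \<Longrightarrow> schwartz (wpk g z)"
  unfolding wpk_eq' by (intro schwartz_cis schwartz_cnj schwartz_shift)

lemma pdiff_wpk:
  assumes "schwartz g"
  shows "pdiff i (wpk g z) = (\<lambda>y. (- \<i> * of_real (snd z $ i)) * wpk g z y + 1 * wpk (pdiff i g) z y)"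
proof
  fix y
  have "has_pd i (wpk g z) y (cis (- snd z \<bullet> y) * cnj (pdiff i g (y - fst z)) + \<i> * of_real ((- snd z) $ i) * cis (- snd z \<bullet> y) * cnj (g (y - fst z)))"
    unfolding wpk_eq' by (intro has_pd_mult has_pd_cis has_pd_shift has_pd_cnj schwartz_has_pd assms)
  from has_pd_pdiff[OF this]
  show "pdiff i (wpk g z) y = (- \<i> * of_real (snd z $ i)) * wpk g z y + 1 * wpk (pdiff i g) z y"
    by (simp add: wpk_eq')
qed

text \<open>Derivatives are peeled off at the inner end, where \<open>pdiff\<close> acts on the
  packet itself: it yields the frequency times the same packet plus the packet of the differentiated
  window. Inductions therefore run over all windows.\<close>

lemma pdiffs_wpk_snoc:
  assumes "schwartz g"
  shows "pdiffs (ds @ [i]) (wpk g z) = (\<lambda>y. (- \<i> * of_real (snd z $ i)) * pdiffs ds (wpk g z) y + 1 * pdiffs ds (wpk (pdiff i g) z) y)"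
  unfolding pdiffs_snoc pdiff_wpk[OF assms]
  by (intro pdiffs_lincomb schwartz_wpk schwartz_pdiff assms)

lemma cis_lipschitz: "norm (cis a - cis b) \<le> \<bar>a - b\<bar>"
proof -
  have "norm (iexp (a - b) - 1) \<le> \<bar>a - b\<bar>" using iexp_approx1[of "a - b" 0] by simp
  moreover have "cis a - cis b = cis b * (iexp (a - b) - 1)"
    by (simp add: cis_conv_exp algebra_simps exp_add[symmetric])
  ultimately show ?thesis by (simp add: norm_mult)
qed

text \<open>Required of all derivatives, these bounds make the packet a continuous function of
  \<open>z\<close> with values in the Schwartz space, with polynomial growth in every
  seminorm.\<close>

definition weighted_lip :: "nat \<Rightarrow> ('z::real_normed_vector \<Rightarrow> real^'n::finite \<Rightarrow> complex) \<Rightarrow> nat \<Rightarrow> real \<Rightarrow> bool" where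
  "weighted_lip N F K C \<longleftrightarrow> 0 \<le> C \<and> (\<forall>z y. (1 + norm y) ^ N * norm (F z y) \<le> C * (1 + norm z) ^ K) \<and>
     (\<forall>z z' y. (1 + norm y) ^ N * norm (F z y - F z' y) \<le> C * (1 + norm z + norm z') ^ K * norm (z - z'))"

lemma wlipD:
  assumes "weighted_lip N F K C"
  shows "0 \<le> C" "(1 + norm y) ^ N * norm (F z y) \<le> C * (1 + norm z) ^ K"
    "(1 + norm y) ^ N * norm (F z y - F z' y) \<le> C * (1 + norm z + norm z') ^ K * norm (z - z')"
  using assms unfolding weighted_lip_def by blast+

lemma norm_fst_snd_le: "norm (fst z) \<le> norm z" "norm (snd z) \<le> norm z"
  using norm_fst_le[of "fst z" "snd z"] norm_snd_le[of "snd z" "fst z"] by simp_all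

lemma weighted_lip_mono:
  fixes F :: "'z::real_normed_vector \<Rightarrow> real^'n::finite \<Rightarrow> complex"
  assumes "weighted_lip N F K C" "K \<le> K'" "C \<le> C'" shows "weighted_lip N F K' C'"
proof -
  have p1: "(1 + norm z) ^ K \<le> (1 + norm z) ^ K'" for z :: 'z
    using assms by (intro power_increasing) auto
  have p2: "(1 + norm z + norm z') ^ K \<le> (1 + norm z + norm z') ^ K'" for z z' :: 'z
    using assms by (intro power_increasing) (auto simp: add.assoc)
  have "(1 + norm y) ^ N * norm (F z y) \<le> C' * (1 + norm z) ^ K'" for z y
    by (rule order_trans[of _ "C * (1 + norm z) ^ K"]) (use assms p1[of z] wlipD[OF assms(1)] in \<open>auto intro!: mult_mono\<close>)
  moreover have "(1 + norm y) ^ N * norm (F z y - F z' y) \<le> C' * (1 + norm z + norm z') ^ K' * norm (z - z')" for z z' y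
    by (rule order_trans[of _ "C * (1 + norm z + norm z') ^ K * norm (z - z')"]) (use assms p2[of z z'] wlipD[OF assms(1)] in \<open>auto intro!: mult_mono mult_right_mono\<close>)
  ultimately show ?thesis using assms by (auto simp: weighted_lip_def)
qed

lemma weighted_lip_add:
  fixes F G :: "'z::real_normed_vector \<Rightarrow> real^'n::finite \<Rightarrow> complex"
  assumes "weighted_lip N F K C" "weighted_lip N G L D"
  shows "weighted_lip N (\<lambda>z y. F z y + G z y) (max K L) (C + D)"
proof -
  let ?M = "max K L"
  have f: "weighted_lip N F ?M C" and g: "weighted_lip N G ?M D" using weighted_lip_mono[OF assms(1), of ?M C] weighted_lip_mono[OF assms(2), of ?M D] by auto
  have "(1 + norm y) ^ N * norm (F z y + G z y) \<le> (C + D) * (1 + norm z) ^ ?M" for z y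
  proof -
    have "(1 + norm y) ^ N * norm (F z y + G z y) \<le> (1 + norm y) ^ N * norm (F z y) + (1 + norm y) ^ N * norm (G z y)"
      unfolding distrib_left[symmetric] by (intro mult_left_mono norm_triangle_ineq) auto
    also have "\<dots> \<le> C * (1 + norm z) ^ ?M + D * (1 + norm z) ^ ?M"
      by (intro add_mono wlipD[OF f] wlipD[OF g])
    finally show ?thesis by (simp add: distrib_right)
  qed
  moreover have "(1 + norm y) ^ N * norm ((F z y + G z y) - (F z' y + G z' y)) \<le> (C + D) * (1 + norm z + norm z') ^ ?M * norm (z - z')" for z z' y
  proof -
    have e: "(F z y + G z y) - (F z' y + G z' y) = (F z y - F z' y) + (G z y - G z' y)" by simp
    have "(1 + norm y) ^ N * norm ((F z y + G z y) - (F z' y + G z' y)) \<le> (1 + norm y) ^ N * norm (F z y - F z' y) + (1 + norm y) ^ N * norm (G z y - G z' y)"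
      unfolding distrib_left[symmetric] e by (intro mult_left_mono norm_triangle_ineq) auto
    also have "\<dots> \<le> C * (1 + norm z + norm z') ^ ?M * norm (z - z') + D * (1 + norm z + norm z') ^ ?M * norm (z - z')"
      by (intro add_mono wlipD[OF f] wlipD[OF g])
    finally show ?thesis by (simp add: distrib_right)
  qed
  ultimately show ?thesis using assms by (auto simp: weighted_lip_def)
qed

text \<open>Meant for the frequency coordinates, which are bounded by \<open>norm z\<close> and vary
  by at most the distance; each costs one power of growth.\<close>

lemma weighted_lip_mult:
  fixes F :: "'z::real_normed_vector \<Rightarrow> real^'n::finite \<Rightarrow> complex"
  assumes F: "weighted_lip N F K C"
    and a: "\<And>z. norm (a z) \<le> norm z" "\<And>z z'. norm (a z - a z') \<le> norm (z - z')"
  shows "weighted_lip N (\<lambda>z y. a z * F z y) (Suc K) (2 * C)"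
proof -
  have C: "0 \<le> C" using F by (simp add: weighted_lip_def)
  have b: "(1 + norm y) ^ N * norm (F z y) \<le> C * (1 + norm z) ^ K" for z y using F by (auto simp: weighted_lip_def)
  have l: "(1 + norm y) ^ N * norm (F z y - F z' y) \<le> C * (1 + norm z + norm z') ^ K * norm (z - z')" for z z' y using F by (auto simp: weighted_lip_def)
  have "(1 + norm y) ^ N * norm (a z * F z y) \<le> 2 * C * (1 + norm z) ^ Suc K" for z y
  proof -
    have "norm (a z) * ((1 + norm y) ^ N * norm (F z y)) \<le> (1 + norm z) * (C * (1 + norm z) ^ K)"
      by (rule mult_mono) (use a(1)[of z] b[of y z] in auto)
    moreover have "0 \<le> C * (1 + norm z) ^ Suc K" using C by auto
    ultimately show ?thesis by (simp add: norm_mult mult_ac)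
  qed
  moreover have "(1 + norm y) ^ N * norm (a z * F z y - a z' * F z' y) \<le> 2 * C * (1 + norm z + norm z') ^ Suc K * norm (z - z')" for z z' y
  proof -
    let ?w = "1 + norm z + norm z'"
    have e: "a z * F z y - a z' * F z' y = a z * (F z y - F z' y) + (a z - a z') * F z' y" by (simp add: algebra_simps)
    have "norm (a z * F z y - a z' * F z' y) \<le> norm (a z) * norm (F z y - F z' y) + norm (a z - a z') * norm (F z' y)"
      unfolding e by (rule order_trans[OF norm_triangle_ineq]) (simp add: norm_mult)
    then have "(1 + norm y) ^ N * norm (a z * F z y - a z' * F z' y) \<le> (1 + norm y) ^ N * (norm (a z) * norm (F z y - F z' y) + norm (a z - a z') * norm (F z' y))"
      by (intro mult_left_mono) auto
    also have "\<dots> = norm (a z) * ((1 + norm y) ^ N * norm (F z y - F z' y)) + norm (a z - a z') * ((1 + norm y) ^ N * norm (F z' y))"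
      by (simp add: algebra_simps)
    also have "\<dots> \<le> ?w * (C * ?w ^ K * norm (z - z')) + norm (z - z') * (C * ?w ^ Suc K)"
    proof (rule add_mono[OF mult_mono mult_mono])
      show "norm (a z) \<le> ?w" using a(1)[of z] by (simp add: add_increasing2)
      show "(1 + norm y) ^ N * norm (F z y - F z' y) \<le> C * ?w ^ K * norm (z - z')" by (rule l)
      have "(1 + norm z') ^ K \<le> ?w ^ K" by (intro power_mono) auto
      also have "\<dots> \<le> ?w ^ Suc K" by (intro power_increasing) (auto simp: add.assoc)
      finally have "C * (1 + norm z') ^ K \<le> C * ?w ^ Suc K" using C by (rule mult_left_mono)
      with b[of y z'] show "(1 + norm y) ^ N * norm (F z' y) \<le> C * ?w ^ Suc K" by linarith
    qed (use a C in \<open>auto simp: add_nonneg_nonneg\<close>)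
    finally show ?thesis by (simp add: algebra_simps)
  qed
  ultimately show ?thesis using C by (auto simp: weighted_lip_def)
qed

text \<open>Three constants enter: \<open>A\<close> for the size, \<open>L\<close> for the change of
  the translation, and \<open>B\<close>, with one more power of the weight, for the change of the
  phase, which is at most norm (z - z') times norm y. Moving the weight from \<open>y\<close> to
  \<open>y - fst z\<close> costs powers of 1 + norm z.\<close>

lemma weighted_lip_wpk:
  fixes g :: "real^'n::finite \<Rightarrow> complex"
  assumes "schwartz g"
  shows "\<exists>K C. weighted_lip N (wpk g) K C"
proof -
  obtain A where A: "0 \<le> A" "\<And>y. (1 + norm y) ^ N * norm (g y) \<le> A" using schwartz_bound[OF assms] by blast
  obtain B where B: "0 \<le> B" "\<And>y. (1 + norm y) ^ Suc N * norm (g y) \<le> B" using schwartz_bound[OF assms] by blast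
  obtain L where L: "0 \<le> L" "\<And>a b. (1 + norm a) ^ N * norm (g a - g b) \<le> L * norm (a - b) * (1 + norm (a - b)) ^ N"
    using schwartz_lipschitz[OF assms] by blast
  have sh: "(1 + norm y) ^ M * c \<le> (1 + norm x) ^ M * D" if "(1 + norm (y - x)) ^ M * c \<le> D" "0 \<le> c" for x y :: "real^'n" and M c D
  proof -
    have "(1 + norm y) ^ M * c \<le> ((1 + norm x) ^ M * (1 + norm (y - x)) ^ M) * c"
      using weight_power_submult[of x "y - x" M] that by (intro mult_right_mono) auto
    also have "\<dots> \<le> (1 + norm x) ^ M * D" unfolding mult.assoc using that by (intro mult_left_mono) auto
    finally show ?thesis .
  qed
  have nf: "norm (fst z) \<le> norm z" "norm (snd z) \<le> norm z" for z :: "(real^'n) \<times> (real^'n)"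
    by (rule norm_fst_snd_le)+
  define K where "K = 2 * N + 1"
  define C where "C = A + B + L"
  have "(1 + norm y) ^ N * norm (wpk g z y) \<le> C * (1 + norm z) ^ K" for z y
  proof -
    have "(1 + norm y) ^ N * norm (wpk g z y) \<le> (1 + norm (fst z)) ^ N * A"
      unfolding wpk_eq by (simp add: norm_mult) (rule sh, use A in auto)
    also have "\<dots> \<le> (1 + norm z) ^ K * C"
    proof (rule mult_mono)
      have "(1 + norm (fst z)) ^ N \<le> (1 + norm z) ^ N" using nf by (intro power_mono) auto
      also have "\<dots> \<le> (1 + norm z) ^ K" by (intro power_increasing) (auto simp: K_def)
      finally show "(1 + norm (fst z)) ^ N \<le> (1 + norm z) ^ K" .
    qed (use A B L in \<open>auto simp: C_def\<close>)
    finally show ?thesis by (simp add: mult.commute)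
  qed
  moreover have "(1 + norm y) ^ N * norm (wpk g z y - wpk g z' y) \<le> C * (1 + norm z + norm z') ^ K * norm (z - z')" for z z' y
  proof -
    let ?w = "1 + norm z + norm z'"
    define u where "u = y - fst z"
    define u' where "u' = y - fst z'"
    have d: "norm (u - u') \<le> norm (z - z')" "norm (snd z - snd z') \<le> norm (z - z')"
      using nf(1)[of "z' - z"] nf(2)[of "z - z'"] by (auto simp: u_def u'_def norm_minus_commute)
    have e: "wpk g z y - wpk g z' y = cis (snd z \<bullet> (- y)) * cnj (g u - g u') + (cis (snd z \<bullet> (- y)) - cis (snd z' \<bullet> (- y))) * cnj (g u')"
      by (simp add: wpk_eq u_def u'_def algebra_simps)
    have "norm (wpk g z y - wpk g z' y) \<le> norm (g u - g u') + norm (cis (snd z \<bullet> (- y)) - cis (snd z' \<bullet> (- y))) * norm (g u')"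
      unfolding e by (rule order_trans[OF norm_triangle_ineq]) (simp add: norm_mult flip: complex_cnj_diff)
    also have "norm (cis (snd z \<bullet> (- y)) - cis (snd z' \<bullet> (- y))) \<le> norm (z - z') * (1 + norm y)"
    proof -
      have "norm (cis (snd z \<bullet> (- y)) - cis (snd z' \<bullet> (- y))) \<le> \<bar>(snd z - snd z') \<bullet> (- y)\<bar>"
        by (rule order_trans[OF cis_lipschitz]) (simp add: inner_diff_left)
      also have "\<dots> \<le> norm (snd z - snd z') * norm y" using Cauchy_Schwarz_ineq2[of "snd z - snd z'" "- y"] by simp
      also have "\<dots> \<le> norm (z - z') * (1 + norm y)" using d by (intro mult_mono) auto
      finally show ?thesis .
    qed
    finally have "norm (wpk g z y - wpk g z' y) \<le> norm (g u - g u') + norm (z - z') * ((1 + norm y) * norm (g u'))" by (simp add: mult_right_mono mult.assoc)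
    then have "(1 + norm y) ^ N * norm (wpk g z y - wpk g z' y) \<le> (1 + norm y) ^ N * (norm (g u - g u') + norm (z - z') * ((1 + norm y) * norm (g u')))"
      by (intro mult_left_mono) auto
    also have "\<dots> = (1 + norm y) ^ N * norm (g u - g u') + norm (z - z') * ((1 + norm y) ^ Suc N * norm (g u'))"
      by (simp add: algebra_simps)
    also have "\<dots> \<le> (1 + norm (fst z)) ^ N * (L * norm (u - u') * (1 + norm (u - u')) ^ N) + norm (z - z') * ((1 + norm (fst z')) ^ Suc N * B)"
    proof (intro add_mono mult_left_mono sh)
      show "(1 + norm (y - fst z)) ^ N * norm (g u - g u') \<le> L * norm (u - u') * (1 + norm (u - u')) ^ N"
        using L(2)[of u u'] by (simp only: u_def)
      show "(1 + norm (y - fst z')) ^ Suc N * norm (g u') \<le> B" using B(2)[of u'] by (simp only: u'_def)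
    qed auto
    also have "\<dots> \<le> ?w ^ N * (L * norm (z - z') * ?w ^ N) + norm (z - z') * (?w ^ Suc N * B)"
    proof -
      have z: "norm (z - z') \<le> norm z + norm z'" by (rule norm_triangle_ineq4)
      have 1: "(1 + norm (fst z)) ^ N \<le> ?w ^ N" using nf(1)[of z] by (intro power_mono) (auto simp: add_increasing2)
      have 2: "(1 + norm (fst z')) ^ Suc N \<le> ?w ^ Suc N" using nf(1)[of z'] by (intro power_mono) (auto simp: add_increasing)
      have 3: "(1 + norm (u - u')) ^ N \<le> ?w ^ N" using d z by (intro power_mono) auto
      show ?thesis using 1 2 3 d L B by (intro add_mono mult_mono) (auto intro!: mult_nonneg_nonneg)
    qed
    also have "\<dots> = (L * ?w ^ (2 * N) + B * ?w ^ Suc N) * norm (z - z')"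
      by (simp add: algebra_simps power_add[symmetric] mult_2_right)
    also have "\<dots> \<le> (C * ?w ^ K) * norm (z - z')"
    proof (intro mult_right_mono)
      have w: "1 \<le> ?w" by (simp add: add.assoc)
      have "?w ^ (2 * N) \<le> ?w ^ K" "?w ^ Suc N \<le> ?w ^ K" using w by (intro power_increasing; simp add: K_def)+
      then have "L * ?w ^ (2 * N) + B * ?w ^ Suc N \<le> L * ?w ^ K + B * ?w ^ K" using L B by (intro add_mono mult_left_mono) auto
      also have "\<dots> \<le> C * ?w ^ K" unfolding distrib_right[symmetric] using A w by (intro mult_right_mono) (auto simp: C_def)
      finally show "L * ?w ^ (2 * N) + B * ?w ^ Suc N \<le> C * ?w ^ K" .
    qed simp
    finally show ?thesis .
  qed
  moreover have "0 \<le> C" using A B L by (simp add: C_def)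
  ultimately have "weighted_lip N (wpk g) K C" unfolding weighted_lip_def by blast
  then show ?thesis by blast
qed

lemma weighted_lip_pdiffs_wpk:
  fixes g :: "real^'n::finite \<Rightarrow> complex"
  shows "schwartz g \<Longrightarrow> \<exists>K C. weighted_lip N (\<lambda>z. pdiffs ds (wpk g z)) K C"
proof (induction ds arbitrary: g rule: rev_induct)
  case Nil
  then show ?case using weighted_lip_wpk[of g N] by simp
next
  case (snoc i ds)
  obtain K C where 1: "weighted_lip N (\<lambda>z. pdiffs ds (wpk g z)) K C" using snoc.IH[OF snoc.prems] by blast
  obtain L D where 2: "weighted_lip N (\<lambda>z. pdiffs ds (wpk (pdiff i g) z)) L D" using snoc.IH[OF schwartz_pdiff[OF snoc.prems]] by blast
  have c: "\<bar>snd z $ i\<bar> \<le> norm z" for z :: "(real^'n) \<times> (real^'n)"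
    by (rule order_trans[OF component_le_norm_cart norm_fst_snd_le(2)])
  have "weighted_lip N (\<lambda>z y. (- \<i> * of_real (snd z $ i)) * pdiffs ds (wpk g z) y) (Suc K) (2 * C)"
  proof (rule weighted_lip_mult[OF 1])
    show "norm (- \<i> * complex_of_real (snd z $ i)) \<le> norm z" for z :: "(real^'n) \<times> (real^'n)"
      using c[of z] by (simp add: norm_mult)
    show "norm (- \<i> * complex_of_real (snd z $ i) - - \<i> * complex_of_real (snd z' $ i)) \<le> norm (z - z')" for z z' :: "(real^'n) \<times> (real^'n)"
    proof -
      have e: "- \<i> * complex_of_real (snd z $ i) - - \<i> * complex_of_real (snd z' $ i) = - \<i> * of_real (snd (z - z') $ i)"
        by (simp add: algebra_simps)
      show ?thesis unfolding e using c[of "z - z'"] by (simp only: norm_mult norm_minus_cancel norm_ii norm_of_real mult_1)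
    qed
  qed
  from weighted_lip_add[OF this 2] show ?case unfolding pdiffs_wpk_snoc[OF snoc.prems] by (auto simp del: of_real_minus)
qed

text \<open>An upper bound in place of a supremum, so that estimates combine without boundedness
  side conditions. As in \<open>schwartz_seminorm\<close>, \<open>N\<close> is both the order and
  the exponent of the weight.\<close>

definition seminorms_le :: "nat \<Rightarrow> (real^'n::finite \<Rightarrow> complex) \<Rightarrow> real \<Rightarrow> bool" where
  "seminorms_le N \<phi> A \<longleftrightarrow> (\<forall>ds y. length ds \<le> N \<longrightarrow> (1 + norm y) ^ N * norm (pdiffs ds \<phi> y) \<le> A)"

lemma seminorms_le_nonneg: "seminorms_le N \<phi> A \<Longrightarrow> 0 \<le> A"
proof -
  assume "seminorms_le N \<phi> A"
  then have "(1 + norm (0::real^'a)) ^ N * norm (pdiffs [] \<phi> 0) \<le> A" unfolding seminorms_le_def by (metis list.size(3) zero_le)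
  then show ?thesis by (rule order_trans[rotated]) simp
qed

lemma seminorms_le_mono: "seminorms_le N \<phi> A \<Longrightarrow> A \<le> B \<Longrightarrow> seminorms_le N \<phi> B"
  unfolding seminorms_le_def by (blast intro: order_trans)

lemma seminorms_le_lincomb:
  assumes "schwartz f" "schwartz g" "seminorms_le N f A" "seminorms_le N g B"
  shows "seminorms_le N (\<lambda>y. a * f y + b * g y) (norm a * A + norm b * B)"
  unfolding seminorms_le_def
proof (intro allI impI)
  fix ds :: "'a list" and y :: "real^'a" assume l: "length ds \<le> N"
  have "norm (a * pdiffs ds f y + b * pdiffs ds g y) \<le> norm a * norm (pdiffs ds f y) + norm b * norm (pdiffs ds g y)"
    by (rule order_trans[OF norm_triangle_ineq]) (simp add: norm_mult)
  then have "(1 + norm y) ^ N * norm (pdiffs ds (\<lambda>y. a * f y + b * g y) y) \<le> (1 + norm y) ^ N * (norm a * norm (pdiffs ds f y) + norm b * norm (pdiffs ds g y))"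
    unfolding pdiffs_lincomb[OF assms(1,2)] by (intro mult_left_mono) auto
  also have "\<dots> = norm a * ((1 + norm y) ^ N * norm (pdiffs ds f y)) + norm b * ((1 + norm y) ^ N * norm (pdiffs ds g y))"
    by (simp add: algebra_simps)
  also have "\<dots> \<le> norm a * A + norm b * B" using assms(3,4) l unfolding seminorms_le_def by (intro add_mono mult_left_mono) auto
  finally show "(1 + norm y) ^ N * norm (pdiffs ds (\<lambda>y. a * f y + b * g y) y) \<le> norm a * A + norm b * B" .
qed

lemma seminorms_le_wpk:
  fixes g :: "real^'n::finite \<Rightarrow> complex"
  assumes g: "schwartz g"
  shows "\<exists>K C. 0 \<le> C \<and> (\<forall>z. seminorms_le N (wpk g z) (C * (1 + norm z) ^ K)) \<and>
    (\<forall>z z'. seminorms_le N (\<lambda>y. wpk g z y - wpk g z' y) (C * (1 + norm z + norm z') ^ K * norm (z - z')))"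
proof -
  define D where "D = {ds :: 'n list. length ds \<le> N}"
  have fin: "finite D" using finite_lists_length_le[of "UNIV :: 'n set" N] by (simp add: D_def)
  obtain K C where KC: "\<And>ds. weighted_lip N (\<lambda>z. pdiffs ds (wpk g z)) (K ds) (C ds)"
    using weighted_lip_pdiffs_wpk[OF g, of N] by metis
  have C0: "0 \<le> C ds" for ds by (rule wlipD(1)[OF KC])
  define K' where "K' = (\<Sum>ds\<in>D. K ds)"
  define C' where "C' = (\<Sum>ds\<in>D. C ds)"
  have W: "weighted_lip N (\<lambda>z. pdiffs ds (wpk g z)) K' C'" if "length ds \<le> N" for ds
  proof (rule weighted_lip_mono[OF KC])
    show "K ds \<le> K'" unfolding K'_def using fin that by (intro member_le_sum) (auto simp: D_def)
    show "C ds \<le> C'" unfolding C'_def using fin that C0 by (intro member_le_sum) (auto simp: D_def)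
  qed
  have "seminorms_le N (wpk g z) (C' * (1 + norm z) ^ K')" for z
    unfolding seminorms_le_def by (intro allI impI wlipD(2)[OF W])
  moreover have "seminorms_le N (\<lambda>y. wpk g z y - wpk g z' y) (C' * (1 + norm z + norm z') ^ K' * norm (z - z'))" for z z'
  proof -
    have e: "pdiffs ds (\<lambda>y. wpk g z y - wpk g z' y) = (\<lambda>y. pdiffs ds (wpk g z) y - pdiffs ds (wpk g z') y)" for ds
      using pdiffs_lincomb[OF schwartz_wpk[OF g, of z] schwartz_wpk[OF g, of z'], of ds 1 "-1"] by simp
    show ?thesis unfolding seminorms_le_def e by (intro allI impI wlipD(3)[OF W])
  qed
  moreover have "0 \<le> C'" unfolding C'_def by (intro sum_nonneg C0)
  ultimately show ?thesis by blast
qed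

text \<open>The number of derivative lists of length at most \<open>N\<close> is finite, which turns
  the sum in \<open>schwartz_seminorm\<close> into a multiple of one common bound.\<close>

lemma tempered_bound:
  fixes T :: "(real^'n::finite \<Rightarrow> complex) \<Rightarrow> complex"
  assumes "tempered T"
  shows "\<exists>N C. 0 \<le> C \<and> (\<forall>\<phi> A. schwartz \<phi> \<longrightarrow> seminorms_le N \<phi> A \<longrightarrow> norm (T \<phi>) \<le> C * A)"
proof -
  obtain C N where C: "\<And>\<phi>. schwartz \<phi> \<Longrightarrow> norm (T \<phi>) \<le> C * schwartz_seminorm N \<phi>"
    using assms unfolding tempered_def by blast
  define D where "D = {ds :: 'n list. length ds \<le> N}"
  have "norm (T \<phi>) \<le> (\<bar>C\<bar> * card D) * A" if "schwartz \<phi>" "seminorms_le N \<phi> A" for \<phi> A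
  proof -
    have sup: "(SUP x. (1 + norm x) ^ N * norm (pdiffs ds \<phi> x)) \<le> A" "0 \<le> (SUP x. (1 + norm x) ^ N * norm (pdiffs ds \<phi> x))" if "ds \<in> D" for ds
    proof -
      have b: "(1 + norm x) ^ N * norm (pdiffs ds \<phi> x) \<le> A" for x using \<open>seminorms_le N \<phi> A\<close> that by (auto simp: seminorms_le_def D_def)
      show "(SUP x. (1 + norm x) ^ N * norm (pdiffs ds \<phi> x)) \<le> A" by (rule cSUP_least) (use b in auto)
      show "0 \<le> (SUP x. (1 + norm x) ^ N * norm (pdiffs ds \<phi> x))"
        by (rule order_trans[OF _ cSUP_upper[of 0]]) (use b in \<open>auto intro!: bdd_aboveI2\<close>)
    qed
    have "schwartz_seminorm N \<phi> \<le> card D * A" "0 \<le> schwartz_seminorm N \<phi>"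
      unfolding schwartz_seminorm_def D_def[symmetric] using sup by (auto intro!: sum_nonneg sum_bounded_above)
    then have "\<bar>C\<bar> * schwartz_seminorm N \<phi> \<le> \<bar>C\<bar> * (card D * A)" "C * schwartz_seminorm N \<phi> \<le> \<bar>C\<bar> * schwartz_seminorm N \<phi>"
      by (auto intro!: mult_left_mono mult_right_mono)
    then show ?thesis using C[OF that(1)] by (simp add: mult.assoc)
  qed
  then show ?thesis by (intro exI[of _ N] exI[of _ "\<bar>C\<bar> * card D"]) auto
qed

lemma tempered_lincomb:
  "tempered T \<Longrightarrow> schwartz \<phi> \<Longrightarrow> schwartz \<psi> \<Longrightarrow> T (\<lambda>x. a * \<phi> x + b * \<psi> x) = a * T \<phi> + b * T \<psi>"
  unfolding tempered_def by blast

lemma tempered_cmult: "tempered T \<Longrightarrow> schwartz \<phi> \<Longrightarrow> T (\<lambda>x. a * \<phi> x) = a * T \<phi>"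
  using tempered_lincomb[of T \<phi> \<phi> a 0] by simp

lemma tempered_diff: "tempered T \<Longrightarrow> schwartz \<phi> \<Longrightarrow> schwartz \<psi> \<Longrightarrow> T (\<lambda>x. \<phi> x - \<psi> x) = T \<phi> - T \<psi>"
  using tempered_lincomb[of T \<phi> \<psi> 1 "-1"] by simp

lemma tempered_sum:
  assumes T: "tempered T" and I: "finite I" "\<And>i. i \<in> I \<Longrightarrow> schwartz (f i)"
  shows "T (\<lambda>y. \<Sum>i\<in>I. c i * f i y) = (\<Sum>i\<in>I. c i * T (f i))"
  using I
proof (induction rule: finite_induct)
  case empty
  then show ?case using tempered_cmult[OF T schwartz_zero, of 0] by simp
next
  case (insert j I)
  have "schwartz (\<lambda>y. \<Sum>i\<in>I. c i * f i y)" using schwartz_sum[of I f c] insert by blast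
  then show ?case using insert tempered_lincomb[OF T, of "f j" "\<lambda>y. \<Sum>i\<in>I. c i * f i y" "c j" 1] by simp
qed


section \<open>Interchanging a distribution with an integral\<close>

lemma simple_function_integral:
  fixes h :: "'z \<Rightarrow> complex"
  assumes fm: "finite_measure M" and s: "simple_function M s" and sp: "space M = UNIV"
  shows "integrable M (\<lambda>z. h (s z))"
    and "(\<integral>z. h (s z) \<partial>M) = (\<Sum>v\<in>range s. of_real (measure M (s -` {v})) * h v)"
proof -
  interpret finite_measure M by fact
  have fin: "finite (range s)" using s sp by (simp add: simple_function_def)
  have ms: "s -` {v} \<in> sets M" if "v \<in> range s" for v
    using s sp that by (auto simp: simple_function_def)
  have eq: "h (s z) = (\<Sum>v\<in>range s. indicator (s -` {v}) z *\<^sub>R h v)" for z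
  proof -
    have "(\<Sum>v\<in>range s. indicator (s -` {v}) z *\<^sub>R h v) = (\<Sum>v\<in>range s. if v = s z then h v else 0)"
      by (intro sum.cong) (auto simp: indicator_def)
    then show ?thesis using fin by simp
  qed
  have i: "integrable M (\<lambda>z. indicator (s -` {v}) z *\<^sub>R h v)" if "v \<in> range s" for v
    using ms[OF that] by (intro integrable_scaleR_left integrable_real_indicator) (auto simp: less_top[symmetric])
  show "integrable M (\<lambda>z. h (s z))" unfolding eq by (intro Bochner_Integration.integrable_sum i)
  have "(\<integral>z. h (s z) \<partial>M) = (\<Sum>v\<in>range s. \<integral>z. indicator (s -` {v}) z *\<^sub>R h v \<partial>M)"
    unfolding eq by (rule Bochner_Integration.integral_sum) (rule i)
  also have "\<dots> = (\<Sum>v\<in>range s. of_real (measure M (s -` {v})) * h v)"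
  proof (rule sum.cong[OF refl])
    fix v assume v: "v \<in> range s"
    have "integrable M (indicator (s -` {v}) :: _ \<Rightarrow> real)" using ms[OF v] by (intro integrable_real_indicator) (auto simp: less_top[symmetric])
    then show "(\<integral>z. indicator (s -` {v}) z *\<^sub>R h v \<partial>M) = of_real (measure M (s -` {v})) * h v"
      using ms[OF v] sp by (simp add: scaleR_conv_of_real)
  qed
  finally show "(\<integral>z. h (s z) \<partial>M) = (\<Sum>v\<in>range s. of_real (measure M (s -` {v})) * h v)" .
qed

lemma continuous_modulus:
  fixes h :: "'z::euclidean_space \<Rightarrow> complex"
  assumes a: "continuous_on UNIV (\<lambda>p. a (fst p) (snd p))" "\<And>z. a z z = (0::real)"
    and h: "\<And>z z'. norm (h z - h z') \<le> c * a z z'"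
  shows "continuous_on UNIV h"
  unfolding continuous_on_sequentially o_def
proof (intro allI ballI impI, elim conjE)
  fix s :: "nat \<Rightarrow> 'z" and z assume s: "s \<longlonglongrightarrow> z"
  have "(\<lambda>n. a (s n) z) \<longlonglongrightarrow> a z z"
    using continuous_on_tendsto_compose[OF a(1) tendsto_Pair[OF s tendsto_const[of z]]] by simp
  then have "(\<lambda>n. c * a (s n) z) \<longlonglongrightarrow> c * 0" unfolding a(2) by (rule tendsto_mult_left)
  then have "(\<lambda>n. h (s n) - h z) \<longlonglongrightarrow> 0"
    by (intro Lim_null_comparison[OF always_eventually[OF allI[OF h]]]) simp
  then show "(\<lambda>n. h (s n)) \<longlonglongrightarrow> h z" by (simp add: LIM_zero_iff)
qed

text \<open>The integral over \<open>z\<close> is approximated by finite sums along simple functions converging to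
  the identity, and the approximation holds in every Schwartz seminorm.\<close>

lemma tempered_exchange:
  fixes G :: "'z::euclidean_space \<Rightarrow> real^'n::finite \<Rightarrow> complex"
  assumes fm: "finite_measure \<nu>" and sets: "sets \<nu> = sets borel" and T: "tempered T"
    and Gs: "\<And>z. schwartz (G z)"
    and bd: "\<And>N. \<exists>A. \<forall>z. seminorms_le N (G z) A"
    and md: "\<And>N. \<exists>a. continuous_on UNIV (\<lambda>p. a (fst p) (snd p)) \<and> (\<forall>z. a z z = 0) \<and> (\<forall>z z'. seminorms_le N (\<lambda>y. G z y - G z' y) (a z z'))"
    and Ps: "schwartz \<Phi>" and P: "\<And>ds y. pdiffs ds \<Phi> y = (\<integral>z. pdiffs ds (G z) y \<partial>\<nu>)"
  shows "integrable \<nu> (\<lambda>z. T (G z))" "T \<Phi> = (\<integral>z. T (G z) \<partial>\<nu>)"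
proof -
  interpret finite_measure \<nu> by fact
  have sp: "space \<nu> = UNIV" using sets_eq_imp_space_eq[OF sets] by simp
  have bm [measurable_cong]: "sets \<nu> = sets borel" by fact
  obtain N C where C: "0 \<le> C" "\<And>\<phi> A. schwartz \<phi> \<Longrightarrow> seminorms_le N \<phi> A \<Longrightarrow> norm (T \<phi>) \<le> C * A"
    using tempered_bound[OF T] by blast
  obtain A where A: "\<And>z. seminorms_le N (G z) A" using bd by blast
  obtain a where a: "continuous_on UNIV (\<lambda>p. a (fst p) (snd p))" "\<And>z. a z z = 0" "\<And>z z'. seminorms_le N (\<lambda>y. G z y - G z' y) (a z z')"
    using md[of N] by blast
  have a0: "0 \<le> a z z'" for z z' by (rule seminorms_le_nonneg[OF a(3)])
  have A0: "0 \<le> A" by (rule seminorms_le_nonneg[OF A])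
  \<comment> \<open>The modulus \<open>a\<close> may be unbounded; truncation at
    \<open>2 * A\<close>, which bounds every difference, makes it usable in dominated
    convergence.\<close>
  have a2: "seminorms_le N (\<lambda>y. G z y - G z' y) (min (2 * A) (a z z'))" for z z'
  proof -
    have "seminorms_le N (\<lambda>y. 1 * G z y + (-1) * G z' y) (norm (1::complex) * A + norm (-1::complex) * A)"
      by (rule seminorms_le_lincomb[OF Gs Gs A A])
    then have "seminorms_le N (\<lambda>y. G z y - G z' y) (2 * A)" by simp
    with a(3)[of z z'] show ?thesis by (simp add: min_def)
  qed
  have am: "(\<lambda>p. a (fst p) (snd p)) \<in> borel_measurable borel" using a(1) by (rule borel_measurable_continuous_onI)
  have pd: "pdiffs ds (\<lambda>y. f y - g y) = (\<lambda>y. pdiffs ds f y - pdiffs ds g y)" if "schwartz f" "schwartz g" for f g :: "real^'n \<Rightarrow> complex" and ds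
    using pdiffs_lincomb[OF that, of ds 1 "-1"] by simp
  have VL: "norm (T (G z) - T (G z')) \<le> C * a z z'" for z z'
    unfolding tempered_diff[OF T Gs Gs, symmetric]
    using C(2)[OF _ a(3), of z z'] schwartz_lincomb[OF Gs Gs, of 1 z "-1" z'] by simp
  have Vc: "continuous_on UNIV (\<lambda>z. T (G z))" by (rule continuous_modulus[OF a(1,2) VL])
  then have Vm [measurable]: "(\<lambda>z. T (G z)) \<in> borel_measurable borel" by (rule borel_measurable_continuous_onI)
  have Vb: "norm (T (G z)) \<le> C * A" for z by (rule C(2)[OF Gs A])
  show int: "integrable \<nu> (\<lambda>z. T (G z))"
    by (rule integrable_const_bound[of _ "C * A"]) (use Vb in auto)
  \<comment> \<open>Simple functions converging pointwise to the identity; \<open>R n\<close> is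
    then a finite linear combination of the functions \<open>G v\<close>, to which linearity of
    \<open>T\<close> applies.\<close>
  obtain s where s: "\<And>i. simple_function \<nu> (s i)" "\<And>z. (\<lambda>i. s i z) \<longlonglongrightarrow> z"
    using borel_measurable_implies_sequence_metric[of "\<lambda>z. z" \<nu> 0] sp by auto
  have sm [measurable]: "s i \<in> borel_measurable borel" for i
    using borel_measurable_simple_function[OF s(1)[of i]] by measurable
  define R where "R n y = (\<Sum>v\<in>range (s n). of_real (measure \<nu> (s n -` {v})) * G v y)" for n y
  have fin: "finite (range (s n))" for n using s(1)[of n] sp by (simp add: simple_function_def)
  have Rs: "schwartz (R n)" and Rp: "pdiffs ds (R n) y = (\<integral>z. pdiffs ds (G (s n z)) y \<partial>\<nu>)" for n ds y
    using schwartz_sum[OF fin[of n] Gs, of "\<lambda>v. of_real (measure \<nu> (s n -` {v}))"] simple_function_integral(2)[OF fm s(1) sp, of "\<lambda>v. pdiffs ds (G v) y" n]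
    by (simp_all add: R_def[abs_def])
  have RT: "T (R n) = (\<integral>z. T (G (s n z)) \<partial>\<nu>)" for n
    using tempered_sum[OF T fin[of n] Gs, of "\<lambda>v. of_real (measure \<nu> (s n -` {v}))"] simple_function_integral(2)[OF fm s(1) sp, of "\<lambda>v. T (G v)" n]
    by (simp add: R_def[abs_def])
  have mm [measurable]: "(\<lambda>z. min (2 * A) (a (s n z) z)) \<in> borel_measurable \<nu>" for n
  proof -
    have "(\<lambda>z. (s n z, z)) \<in> borel_measurable borel" by measurable
    from measurable_compose[OF this am] have "(\<lambda>z. a (s n z) z) \<in> borel_measurable \<nu>" by simp
    then show ?thesis by measurable
  qed
  \<comment> \<open>The mean modulus between \<open>s n z\<close> and \<open>z\<close>: it bounds
    the seminorm of the error of \<open>R n\<close> and tends to 0.\<close>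
  define e where "e n = (\<integral>z. min (2 * A) (a (s n z) z) \<partial>\<nu>)" for n
  have ei: "integrable \<nu> (\<lambda>z. min (2 * A) (a (s n z) z))" for n
    by (rule integrable_const_bound[of _ "2 * A"]) (use a0 A0 in auto)
  have "e \<longlonglongrightarrow> (\<integral>z. 0 \<partial>\<nu>)"
    unfolding e_def
  proof (rule integral_dominated_convergence[where w="\<lambda>_. 2 * A"])
    show "AE z in \<nu>. (\<lambda>n. min (2 * A) (a (s n z) z)) \<longlonglongrightarrow> 0"
    proof (rule AE_I2)
      fix z
      have "(\<lambda>n. a (s n z) z) \<longlonglongrightarrow> a z z"
        using continuous_on_tendsto_compose[OF a(1) tendsto_Pair[OF s(2)[of z] tendsto_const[of z]]] by simp
      then have "(\<lambda>n. min (2 * A) (a (s n z) z)) \<longlonglongrightarrow> min (2 * A) 0" unfolding a(2) by (intro tendsto_min tendsto_const)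
      then show "(\<lambda>n. min (2 * A) (a (s n z) z)) \<longlonglongrightarrow> 0" using A0 by (simp add: min_absorb2)
    qed
  qed (use a0 A0 in auto)
  then have e0: "e \<longlonglongrightarrow> 0" by simp
  have SR: "seminorms_le N (\<lambda>y. R n y - \<Phi> y) (e n)" for n
    unfolding seminorms_le_def
  proof (intro allI impI)
    fix ds :: "'n list" and y :: "real^'n" assume l: "length ds \<le> N"
    have lb: "norm (pdiffs ds (G z) y - pdiffs ds (G z') y) \<le> 1 * min (2 * A) (a z z')" for z z'
    proof -
      have "1 * norm (pdiffs ds (G z) y - pdiffs ds (G z') y) \<le> (1 + norm y) ^ N * norm (pdiffs ds (G z) y - pdiffs ds (G z') y)"
        by (intro mult_right_mono one_le_power) auto
      also have "\<dots> \<le> min (2 * A) (a z z')" using a2[of z z'] l unfolding seminorms_le_def pd[OF Gs Gs] by blast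
      finally show ?thesis by simp
    qed
    have "continuous_on UNIV (\<lambda>z. pdiffs ds (G z) y)"
      by (rule continuous_modulus[OF a(1,2), of _ 1]) (use lb in \<open>auto intro: order_trans\<close>)
    then have hm [measurable]: "(\<lambda>z. pdiffs ds (G z) y) \<in> borel_measurable borel" by (rule borel_measurable_continuous_onI)
    have hi: "integrable \<nu> (\<lambda>z. pdiffs ds (G z) y)"
    proof (rule integrable_const_bound[of _ "A"])
      have "1 * norm (pdiffs ds (G z) y) \<le> (1 + norm y) ^ N * norm (pdiffs ds (G z) y)" for z
        by (intro mult_right_mono one_le_power) auto
      moreover have "(1 + norm y) ^ N * norm (pdiffs ds (G z) y) \<le> A" for z using A[of z] l unfolding seminorms_le_def by blast
      ultimately show "AE z in \<nu>. norm (pdiffs ds (G z) y) \<le> A" by (intro AE_I2) (auto intro: order_trans)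
    qed simp
    have si: "integrable \<nu> (\<lambda>z. pdiffs ds (G (s n z)) y)" by (rule simple_function_integral(1)[OF fm s(1) sp])
    have "pdiffs ds (\<lambda>y. R n y - \<Phi> y) y = (\<integral>z. pdiffs ds (G (s n z)) y - pdiffs ds (G z) y \<partial>\<nu>)"
      unfolding pd[OF Rs Ps] Rp P using si hi by simp
    then have "(1 + norm y) ^ N * norm (pdiffs ds (\<lambda>y. R n y - \<Phi> y) y) \<le> (1 + norm y) ^ N * (\<integral>z. norm (pdiffs ds (G (s n z)) y - pdiffs ds (G z) y) \<partial>\<nu>)"
      by (auto intro!: mult_left_mono)
    also have "\<dots> = (\<integral>z. (1 + norm y) ^ N * norm (pdiffs ds (G (s n z)) y - pdiffs ds (G z) y) \<partial>\<nu>)" by simp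
    also have "\<dots> \<le> e n" unfolding e_def
    proof (rule integral_mono)
      show "integrable \<nu> (\<lambda>z. (1 + norm y) ^ N * norm (pdiffs ds (G (s n z)) y - pdiffs ds (G z) y))"
        using si hi by auto
      show "(1 + norm y) ^ N * norm (pdiffs ds (G (s n z)) y - pdiffs ds (G z) y) \<le> min (2 * A) (a (s n z) z)" for z
        using a2[of "s n z" z] l unfolding seminorms_le_def pd[OF Gs Gs] by blast
    qed (rule ei)
    finally show "(1 + norm y) ^ N * norm (pdiffs ds (\<lambda>y. R n y - \<Phi> y) y) \<le> e n" .
  qed
  have nb: "norm (T (R n) - T \<Phi>) \<le> C * e n" for n
    unfolding tempered_diff[OF T Rs Ps, symmetric]
    using C(2)[OF _ SR, of n] schwartz_lincomb[OF Rs Ps, of 1 n "-1"] by simp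
  have "(\<lambda>n. C * e n) \<longlonglongrightarrow> 0" using tendsto_mult_left[OF e0, of C] by simp
  then have "(\<lambda>n. T (R n) - T \<Phi>) \<longlonglongrightarrow> 0"
    by (rule Lim_null_comparison[rotated]) (auto intro!: always_eventually nb)
  then have 1: "(\<lambda>n. T (R n)) \<longlonglongrightarrow> T \<Phi>" by (simp add: LIM_zero_iff)
  have "(\<lambda>n. \<integral>z. T (G (s n z)) \<partial>\<nu>) \<longlonglongrightarrow> (\<integral>z. T (G z) \<partial>\<nu>)"
  proof (rule integral_dominated_convergence[where w="\<lambda>_. C * A"])
    show "AE z in \<nu>. (\<lambda>n. T (G (s n z))) \<longlonglongrightarrow> T (G z)"
      using continuous_on_tendsto_compose[OF Vc s(2)] by auto
  qed (use Vb in auto)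
  then have "(\<lambda>n. T (R n)) \<longlonglongrightarrow> (\<integral>z. T (G z) \<partial>\<nu>)" unfolding RT .
  from LIMSEQ_unique[OF 1 this] show "T \<Phi> = (\<integral>z. T (G z) \<partial>\<nu>)" .
qed

section \<open>Reconstruction from the short-time Fourier transform\<close>

abbreviation amb :: "(real^'n::finite \<Rightarrow> complex) \<Rightarrow> (real^'n \<Rightarrow> complex) \<Rightarrow> (real^'n) \<times> (real^'n) \<Rightarrow> complex" where
  "amb \<phi> \<gamma> z \<equiv> ambig \<phi> \<gamma> (fst z) (snd z)"

lemma continuous_weighted_lip:
  fixes F :: "'z::euclidean_space \<Rightarrow> real^'n::finite \<Rightarrow> complex"
  assumes "weighted_lip N F K C" shows "continuous_on UNIV (\<lambda>z. F z y)"
proof (rule continuous_modulus)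
  show "continuous_on UNIV (\<lambda>p :: 'z \<times> 'z. (1 + norm (fst p) + norm (snd p)) ^ K * norm (fst p - snd p))"
    by (intro continuous_intros)
  show "norm (F z y - F z' y) \<le> C * ((1 + norm z + norm z') ^ K * norm (z - z'))" for z z'
  proof -
    have "1 * norm (F z y - F z' y) \<le> (1 + norm y) ^ N * norm (F z y - F z' y)"
      by (intro mult_right_mono one_le_power) auto
    also have "\<dots> \<le> C * (1 + norm z + norm z') ^ K * norm (z - z')" by (rule wlipD(3)[OF assms])
    finally show ?thesis by (simp add: mult.assoc)
  qed
qed simp

lemma wpk_amb_integrable:
  fixes g \<phi> \<gamma> :: "real^'n::finite \<Rightarrow> complex"
  assumes g: "schwartz g" and s: "schwartz \<phi>" "schwartz \<gamma>"
  shows "integrable lborel (\<lambda>z. pdiffs ds (wpk g z) y * amb \<phi> \<gamma> z)"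
proof -
  define m where "m = 2 * real DIM((real^'n) \<times> (real^'n))"
  obtain K C where W: "weighted_lip 0 (\<lambda>z. pdiffs ds (wpk g z)) K C" using weighted_lip_pdiffs_wpk[OF g] by blast
  obtain D where D: "0 \<le> D" "\<And>z. norm (amb \<phi> \<gamma> z) \<le> D * (1 + norm z) powr (-(real K + m))"
    using ambig_decay_pair[OF s, of "real K + m"] by (auto simp: m_def)
  show ?thesis
  proof (rule integrable_decay[where C="C * D" and M=m])
    show "(\<lambda>z. pdiffs ds (wpk g z) y * amb \<phi> \<gamma> z) \<in> borel_measurable borel"
      by (intro borel_measurable_continuous_onI continuous_on_mult ambig_continuous s continuous_weighted_lip[OF W])
    show "norm (pdiffs ds (wpk g z) y * amb \<phi> \<gamma> z) \<le> C * D * (1 + norm z) powr (- m)" for z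
    proof -
      have p: "0 < 1 + norm z" by (simp add: add_pos_nonneg)
      have "norm (pdiffs ds (wpk g z) y) \<le> C * (1 + norm z) powr real K"
        using wlipD(2)[OF W, of y z] p by (simp add: powr_realpow)
      then have "norm (pdiffs ds (wpk g z) y) * norm (amb \<phi> \<gamma> z) \<le> (C * (1 + norm z) powr real K) * (D * (1 + norm z) powr (-(real K + m)))"
        using D wlipD(1)[OF W] by (intro mult_mono) auto
      also have "\<dots> = C * D * ((1 + norm z) powr real K * (1 + norm z) powr (-(real K + m)))" by simp
      also have "\<dots> = C * D * (1 + norm z) powr (- m)" unfolding powr_add[symmetric] by simp
      finally show ?thesis by (simp add: norm_mult)
    qed
  qed (simp add: m_def)
qed

text \<open>Differentiating a wave packet brings down \<open>\<xi>\<close>, which integration by parts in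
  \<open>ambig\<close> turns back into a derivative of \<open>\<phi>\<close>; no differentiation under the integral is needed.\<close>

lemma wpk_amb_integral:
  fixes g \<phi> \<gamma> :: "real^'n::finite \<Rightarrow> complex"
  shows "schwartz g \<Longrightarrow> schwartz \<phi> \<Longrightarrow> schwartz \<gamma> \<Longrightarrow>
    (\<integral>z. pdiffs ds (wpk g z) y * amb \<phi> \<gamma> z \<partial>lborel) = of_real ((2 * pi) ^ CARD('n)) * (\<integral>u. cnj (g u) * \<gamma> u \<partial>lborel) * pdiffs ds \<phi> y"
proof (induction ds arbitrary: g \<phi> \<gamma> rule: rev_induct)
  case Nil
  then show ?case using ambig_inversion(2)[of \<phi> \<gamma> g y] by (simp add: wpk_def)
next
  case (snoc i ds)
  note s = snoc.prems
  note sd = schwartz_pdiff[OF s(1), of i] schwartz_pdiff[OF s(2), of i] schwartz_pdiff[OF s(3), of i]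
  let ?c = "complex_of_real ((2 * pi) ^ CARD('n))"
  \<comment> \<open>A derivative falling on \<open>\<gamma>\<close> or on \<open>g\<close> changes
    the constant in the formula; the two changes cancel because the derivative of
    \<open>cnj (g u) * \<gamma> u\<close> has integral 0.\<close>
  have by_parts: "(\<integral>u. cnj (g u) * pdiff i \<gamma> u \<partial>lborel) + (\<integral>u. cnj (pdiff i g u) * \<gamma> u \<partial>lborel) = 0"
  proof -
    have "pdiff i (\<lambda>u. cnj (g u) * \<gamma> u) = (\<lambda>u. cnj (g u) * pdiff i \<gamma> u + cnj (pdiff i g u) * \<gamma> u)"
      by (intro ext has_pd_pdiff has_pd_mult has_pd_cnj schwartz_has_pd s)
    moreover have "integrable lborel (\<lambda>u. cnj (g u) * pdiff i \<gamma> u)" "integrable lborel (\<lambda>u. cnj (pdiff i g u) * \<gamma> u)"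
      by (intro schwartz_integrable schwartz_mult schwartz_cnj s sd)+
    ultimately show ?thesis
      using schwartz_integral_pdiff[OF schwartz_mult[OF schwartz_cnj[OF s(1)] s(3)], of i] by simp
  qed
  have e: "pdiffs (ds @ [i]) (wpk g z) y * amb \<phi> \<gamma> z
     = pdiffs ds (wpk g z) y * amb (pdiff i \<phi>) \<gamma> z + pdiffs ds (wpk g z) y * amb \<phi> (pdiff i \<gamma>) z + pdiffs ds (wpk (pdiff i g) z) y * amb \<phi> \<gamma> z" for z
  proof -
    have "pdiffs (ds @ [i]) (wpk g z) y * amb \<phi> \<gamma> z
      = pdiffs ds (wpk g z) y * (- \<i> * (of_real (snd z $ i) * amb \<phi> \<gamma> z)) + pdiffs ds (wpk (pdiff i g) z) y * amb \<phi> \<gamma> z"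
      unfolding pdiffs_wpk_snoc[OF s(1)] by (simp add: algebra_simps)
    also have "- \<i> * (of_real (snd z $ i) * amb \<phi> \<gamma> z) = amb (pdiff i \<phi>) \<gamma> z + amb \<phi> (pdiff i \<gamma>) z"
      unfolding ambig_by_parts[OF s(2,3)] by simp
    finally show ?thesis by (simp add: distrib_left)
  qed
  have "(\<integral>z. pdiffs (ds @ [i]) (wpk g z) y * amb \<phi> \<gamma> z \<partial>lborel)
    = (\<integral>z. pdiffs ds (wpk g z) y * amb (pdiff i \<phi>) \<gamma> z \<partial>lborel) + (\<integral>z. pdiffs ds (wpk g z) y * amb \<phi> (pdiff i \<gamma>) z \<partial>lborel)
      + (\<integral>z. pdiffs ds (wpk (pdiff i g) z) y * amb \<phi> \<gamma> z \<partial>lborel)"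
    unfolding e
    using wpk_amb_integrable[OF s(1) sd(2) s(3), of ds y] wpk_amb_integrable[OF s(1,2) sd(3), of ds y] wpk_amb_integrable[OF sd(1) s(2,3), of ds y]
    by simp
  also have "\<dots> = ?c * (\<integral>u. cnj (g u) * \<gamma> u \<partial>lborel) * pdiffs ds (pdiff i \<phi>) y
     + ?c * ((\<integral>u. cnj (g u) * pdiff i \<gamma> u \<partial>lborel) + (\<integral>u. cnj (pdiff i g u) * \<gamma> u \<partial>lborel)) * pdiffs ds \<phi> y"
    unfolding snoc.IH[OF s(1) sd(2) s(3)] snoc.IH[OF s(1,2) sd(3)] snoc.IH[OF sd(1) s(2,3)] by (simp only: algebra_simps)
  finally show ?case unfolding by_parts by (simp only: pdiffs_snoc mult_zero_right mult_zero_left add_0_right)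
qed

text \<open>The bounds of \<open>seminorms_le_wpk\<close> pushed through the continuity of
  \<open>T\<close>. Continuity provides measurability of the transform, polynomial growth the a
  priori bound for \<open>maximal_inequality\<close>.\<close>

lemma wpk_tempered:
  fixes g :: "real^'n::finite \<Rightarrow> complex"
  assumes g: "schwartz g" and T: "tempered T"
  shows "continuous_on UNIV (\<lambda>z. T (wpk g z))" and "\<exists>A\<ge>0. \<exists>K::nat. \<forall>z. norm (T (wpk g z)) \<le> A * (1 + norm z) ^ K"
proof -
  obtain N C where C: "0 \<le> C" "\<And>\<phi> A. schwartz \<phi> \<Longrightarrow> seminorms_le N \<phi> A \<Longrightarrow> norm (T \<phi>) \<le> C * A"
    using tempered_bound[OF T] by blast
  obtain K D where D: "0 \<le> D" "\<And>z. seminorms_le N (wpk g z) (D * (1 + norm z) ^ K)"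
    "\<And>z z'. seminorms_le N (\<lambda>y. wpk g z y - wpk g z' y) (D * (1 + norm z + norm z') ^ K * norm (z - z'))"
    using seminorms_le_wpk[OF g, of N] by blast
  note sw = schwartz_wpk[OF g]
  show "continuous_on UNIV (\<lambda>z. T (wpk g z))"
  proof (rule continuous_modulus)
    show "continuous_on UNIV (\<lambda>p :: ((real^'n) \<times> (real^'n)) \<times> _. D * (1 + norm (fst p) + norm (snd p)) ^ K * norm (fst p - snd p))"
      by (intro continuous_intros)
    show "norm (T (wpk g z) - T (wpk g z')) \<le> C * (D * (1 + norm z + norm z') ^ K * norm (z - z'))" for z z'
      unfolding tempered_diff[OF T sw sw, symmetric]
      using C(2)[OF _ D(3), of z z'] schwartz_lincomb[OF sw sw, of 1 z "-1" z'] by simp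
  qed simp
  have "norm (T (wpk g z)) \<le> (C * D) * (1 + norm z) ^ K" for z
    using C(2)[OF sw D(2), of z] by (simp add: mult.assoc)
  then show "\<exists>A\<ge>0. \<exists>K::nat. \<forall>z. norm (T (wpk g z)) \<le> A * (1 + norm z) ^ K"
    using C(1) D(1) by (intro exI[of _ "C * D"] conjI exI[of _ K]) auto
qed

text \<open>\<open>tempered_exchange\<close> wants a finite measure, so Lebesgue measure is replaced
  by the density (1 + norm z)^(-m) and \<open>c\<close> carries the reciprocal factor. As
  \<open>amb \<phi> \<gamma>\<close> decays faster than any power, \<open>c\<close> still absorbs
  the polynomial growth of the packets in every seminorm.\<close>

lemma stft_reconstruction:
  fixes g \<phi> \<gamma> :: "real^'n::finite \<Rightarrow> complex"
  assumes T: "tempered T" and s: "schwartz g" "schwartz \<phi>" "schwartz \<gamma>"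
  shows "integrable lborel (\<lambda>z. T (wpk g z) * amb \<phi> \<gamma> z)"
    and "of_real ((2 * pi) ^ CARD('n)) * (\<integral>u. cnj (g u) * \<gamma> u \<partial>lborel) * T \<phi> = (\<integral>z. T (wpk g z) * amb \<phi> \<gamma> z \<partial>lborel)"
proof -
  define \<kappa> where "\<kappa> = of_real ((2 * pi) ^ CARD('n)) * (\<integral>u. cnj (g u) * \<gamma> u \<partial>lborel)"
  define m where "m = 2 * real DIM((real^'n) \<times> (real^'n))"
  define \<nu> where "\<nu> = density lborel (\<lambda>z::(real^'n) \<times> (real^'n). ennreal ((1 + norm z) powr (- m)))"
  define c where "c z = amb \<phi> \<gamma> z * of_real ((1 + norm z) powr m)" for z
  define G where "G z y = c z * wpk g z y" for z y
  have p: "0 < 1 + norm z" for z :: "(real^'n) \<times> (real^'n)" by (simp add: add_pos_nonneg)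
  have wm [measurable]: "(\<lambda>z::(real^'n) \<times> (real^'n). (1 + norm z) powr (- m)) \<in> borel_measurable borel" by measurable
  have wi: "integrable lborel (\<lambda>z::(real^'n) \<times> (real^'n). (1 + norm z) powr (- m))" by (rule integrable_weight) (simp add: m_def)
  have fm: "finite_measure \<nu>"
  proof (rule finite_measureI)
    have "emeasure \<nu> (space \<nu>) = (\<integral>\<^sup>+z. ennreal ((1 + norm (z::(real^'n) \<times> (real^'n))) powr (- m)) \<partial>lborel)"
      unfolding \<nu>_def by (subst emeasure_density) auto
    also have "\<dots> < \<infinity>" using wi by (simp add: integrable_iff_bounded)
    finally show "emeasure \<nu> (space \<nu>) \<noteq> \<infinity>" by simp
  qed
  have sets: "sets \<nu> = sets borel" by (simp add: \<nu>_def)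
  have cc: "continuous_on UNIV c" unfolding c_def
    by (intro continuous_intros ambig_continuous s) (use p in \<open>auto simp: less_imp_neq[symmetric]\<close>)
  have cw: "(1 + norm z) powr (- m) *\<^sub>R (c z * h) = h * amb \<phi> \<gamma> z" for z h
  proof -
    have "complex_of_real ((1 + norm z) powr (- m)) * of_real ((1 + norm z) powr m) = 1"
      unfolding of_real_mult[symmetric] powr_add[symmetric] using p[of z] by simp
    then show ?thesis unfolding scaleR_conv_of_real[where 'a=complex] c_def by (simp add: mult_ac)
  qed
  have dens: "integrable \<nu> (\<lambda>z. c z * h z) \<longleftrightarrow> integrable lborel (\<lambda>z. h z * amb \<phi> \<gamma> z)" "(\<integral>z. c z * h z \<partial>\<nu>) = (\<integral>z. h z * amb \<phi> \<gamma> z \<partial>lborel)"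
    if "h \<in> borel_measurable borel" for h
  proof -
    have hm: "(\<lambda>z. c z * h z) \<in> borel_measurable lborel" using that borel_measurable_continuous_onI[OF cc] by simp
    show "integrable \<nu> (\<lambda>z. c z * h z) \<longleftrightarrow> integrable lborel (\<lambda>z. h z * amb \<phi> \<gamma> z)"
      unfolding \<nu>_def by (subst integrable_density[OF hm]) (simp_all add: cw)
    show "(\<integral>z. c z * h z \<partial>\<nu>) = (\<integral>z. h z * amb \<phi> \<gamma> z \<partial>lborel)"
      unfolding \<nu>_def by (subst integral_density[OF hm]) (simp_all add: cw)
  qed
  have cb: "\<exists>B\<ge>0. \<forall>z. norm (c z) * (1 + norm z) ^ K \<le> B" for K
  proof -
    obtain D where D: "0 \<le> D" "\<And>z. norm (amb \<phi> \<gamma> z) \<le> D * (1 + norm z) powr (-(real K + m))"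
      using ambig_decay_pair[OF s(2,3), of "real K + m"] by (auto simp: m_def)
    have "norm (c z) * (1 + norm z) ^ K \<le> D" for z
    proof -
      have "norm (c z) * (1 + norm z) ^ K = norm (amb \<phi> \<gamma> z) * ((1 + norm z) powr m * (1 + norm z) powr real K)"
        using p[of z] by (simp add: c_def norm_mult powr_realpow)
      also have "\<dots> \<le> (D * (1 + norm z) powr (-(real K + m))) * ((1 + norm z) powr m * (1 + norm z) powr real K)"
        by (intro mult_right_mono D) auto
      also have "\<dots> = D" unfolding mult.assoc powr_add[symmetric] using p[of z] by simp
      finally show ?thesis .
    qed
    then show ?thesis using D(1) by blast
  qed
  note sw = schwartz_wpk[OF s(1)]
  have Gs: "schwartz (G z)" for z unfolding G_def by (intro schwartz_cmult sw)
  have Gp: "pdiffs ds (G z) y = c z * pdiffs ds (wpk g z) y" for ds z y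
    using pdiffs_lincomb[OF sw[of z] sw[of z], of ds "c z" 0] by (simp add: G_def[abs_def])
  have sm: "(\<lambda>z. pdiffs ds (wpk g z) y) \<in> borel_measurable borel" for ds y
    using weighted_lip_pdiffs_wpk[OF s(1), of 0 ds] by (auto intro: borel_measurable_continuous_onI continuous_weighted_lip)
  have bdG: "\<exists>A. \<forall>z. seminorms_le N (G z) A" for N
    proof -
      obtain K D where D: "0 \<le> D" "\<And>z. seminorms_le N (wpk g z) (D * (1 + norm z) ^ K)" using seminorms_le_wpk[OF s(1), of N] by blast
      obtain B where B: "\<And>z. norm (c z) * (1 + norm z) ^ K \<le> B" using cb by blast
      have "seminorms_le N (G z) (D * B)" for z
      proof (rule seminorms_le_mono)
        show "seminorms_le N (G z) (norm (c z) * (D * (1 + norm z) ^ K))"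
          using seminorms_le_lincomb[OF sw sw D(2)[of z] D(2)[of z], of "c z" 0] by (simp add: G_def[abs_def])
        show "norm (c z) * (D * (1 + norm z) ^ K) \<le> D * B" using mult_left_mono[OF B[of z] D(1)] by (simp add: mult_ac)
      qed
      then show ?thesis by blast
    qed
  have mdG: "\<exists>a. continuous_on UNIV (\<lambda>p. a (fst p) (snd p)) \<and> (\<forall>z. a z z = 0) \<and> (\<forall>z z'. seminorms_le N (\<lambda>y. G z y - G z' y) (a z z'))" for N
    proof -
      obtain K D where D: "0 \<le> D" "\<And>z. seminorms_le N (wpk g z) (D * (1 + norm z) ^ K)"
        "\<And>z z'. seminorms_le N (\<lambda>y. wpk g z y - wpk g z' y) (D * (1 + norm z + norm z') ^ K * norm (z - z'))"
        using seminorms_le_wpk[OF s(1), of N] by blast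
      define a where "a z z' = norm (c z) * (D * (1 + norm z + norm z') ^ K * norm (z - z')) + norm (c z - c z') * (D * (1 + norm z') ^ K)" for z z'
      have "seminorms_le N (\<lambda>y. G z y - G z' y) (a z z')" for z z'
      proof -
        have e: "(\<lambda>y. G z y - G z' y) = (\<lambda>y. c z * (wpk g z y - wpk g z' y) + (c z - c z') * wpk g z' y)"
          by (simp add: fun_eq_iff G_def algebra_simps)
        have sd: "schwartz (\<lambda>y. wpk g z y - wpk g z' y)" using schwartz_lincomb[OF sw sw, of 1 z "-1" z'] by simp
        show ?thesis unfolding e a_def by (rule seminorms_le_lincomb[OF sd sw D(3) D(2)])
      qed
      moreover have "continuous_on UNIV (\<lambda>p. a (fst p) (snd p))"
        unfolding a_def by (intro continuous_intros continuous_on_compose2[OF cc]) auto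
      moreover have "a z z = 0" for z by (simp add: a_def)
      ultimately show ?thesis by blast
    qed
  have kP: "schwartz (\<lambda>y. \<kappa> * \<phi> y)" by (intro schwartz_cmult s)
  have PG: "pdiffs ds (\<lambda>y. \<kappa> * \<phi> y) y = (\<integral>z. pdiffs ds (G z) y \<partial>\<nu>)" for ds y
      unfolding Gp dens(2)[OF sm] wpk_amb_integral[OF s] \<kappa>_def[symmetric]
      using pdiffs_lincomb[OF s(2) s(2), of ds \<kappa> 0] by simp
  note ex = tempered_exchange[OF fm sets T Gs bdG mdG kP PG]
  have TG: "T (G z) = c z * T (wpk g z)" for z unfolding G_def[abs_def] by (rule tempered_cmult[OF T sw])
  have Vm: "(\<lambda>z. T (wpk g z)) \<in> borel_measurable borel" by (intro borel_measurable_continuous_onI wpk_tempered s T)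
  show "integrable lborel (\<lambda>z. T (wpk g z) * amb \<phi> \<gamma> z)"
    using ex(1) unfolding TG dens(1)[OF Vm] .
  have "T (\<lambda>y. \<kappa> * \<phi> y) = (\<integral>z. T (wpk g z) * amb \<phi> \<gamma> z \<partial>lborel)" using ex(2) unfolding TG dens(2)[OF Vm] .
  then show "of_real ((2 * pi) ^ CARD('n)) * (\<integral>u. cnj (g u) * \<gamma> u \<partial>lborel) * T \<phi> = (\<integral>z. T (wpk g z) * amb \<phi> \<gamma> z \<partial>lborel)"
    unfolding tempered_cmult[OF T s(2)] by (simp only: \<kappa>_def)
qed

text \<open>Makes \<open>stft_reconstruction\<close> available for integration against a Hermite
  function, as needed in \<open>herm_semigroup_formula\<close>. The seminorm of order 0
  suffices.\<close>

lemma tempered_integral: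
  fixes h :: "real^'n::finite \<Rightarrow> complex"
  assumes h: "schwartz h" shows "tempered (\<lambda>\<phi>. \<integral>y. h y * \<phi> y \<partial>lborel)"
  unfolding tempered_def
proof (intro conjI allI impI exI)
  fix \<phi> \<psi> :: "real^'n \<Rightarrow> complex" and a b assume s: "schwartz \<phi>" "schwartz \<psi>"
  have "integrable lborel (\<lambda>y. h y * \<phi> y)" "integrable lborel (\<lambda>y. h y * \<psi> y)"
    by (intro schwartz_integrable schwartz_mult s h)+
  moreover have "h y * (a * \<phi> y + b * \<psi> y) = a * (h y * \<phi> y) + b * (h y * \<psi> y)" for y by (simp add: algebra_simps)
  ultimately show "(\<integral>y. h y * (a * \<phi> y + b * \<psi> y) \<partial>lborel) = a * (\<integral>y. h y * \<phi> y \<partial>lborel) + b * (\<integral>y. h y * \<psi> y \<partial>lborel)"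
    by simp
next
  fix \<phi> :: "real^'n \<Rightarrow> complex" assume s: "schwartz \<phi>"
  obtain B where B: "\<And>y. norm (\<phi> y) \<le> B" using schwartz_bound[OF s, of 0] by auto
  have ds: "{ds :: 'n list. length ds \<le> 0} = {[]}" by auto
  have sup: "norm (\<phi> y) \<le> schwartz_seminorm 0 \<phi>" for y
    unfolding schwartz_seminorm_def ds using B by (auto intro!: cSUP_upper bdd_aboveI2)
  have i: "integrable lborel (\<lambda>y. norm (h y))" using schwartz_integrable[OF h] by auto
  have "norm (\<integral>y. h y * \<phi> y \<partial>lborel) \<le> (\<integral>y. norm (h y * \<phi> y) \<partial>lborel)" by (rule integral_norm_bound)
  also have "\<dots> \<le> (\<integral>y. norm (h y) * schwartz_seminorm 0 \<phi> \<partial>lborel)"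
  proof (rule integral_mono)
    show "integrable lborel (\<lambda>y. norm (h y * \<phi> y))" by (intro integrable_norm schwartz_integrable schwartz_mult h s)
  qed (use i sup in \<open>auto simp: norm_mult intro!: mult_left_mono\<close>)
  also have "\<dots> = (\<integral>y. norm (h y) \<partial>lborel) * schwartz_seminorm 0 \<phi>" by simp
  finally show "norm (\<integral>y. h y * \<phi> y \<partial>lborel) \<le> (\<integral>y. norm (h y) \<partial>lborel) * schwartz_seminorm 0 \<phi>" .
qed

section \<open>Mixed norms\<close>

lemma enn_powr_top [simp]: "enn_powr \<infinity> s = \<infinity>" "enn_powr top s = top"
  by (simp_all add: enn_powr_def)

lemma enn_powr_0 [simp]: "enn_powr 0 s = 0"
  by (simp add: enn_powr_def)

lemma enn_powr_ennreal: "0 \<le> x \<Longrightarrow> enn_powr (ennreal x) s = ennreal (x powr s)"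
  by (simp add: enn_powr_def)

lemma enn_powr_1 [simp]: "enn_powr a 1 = a"
  by (cases a) (auto simp: enn_powr_ennreal)

lemma enn_powr_mono: "a \<le> b \<Longrightarrow> 0 \<le> s \<Longrightarrow> enn_powr a s \<le> enn_powr b s"
  by (cases a; cases b) (auto simp: enn_powr_ennreal top_unique intro!: ennreal_leI powr_mono2)

lemma enn_powr_mult: "0 < s \<Longrightarrow> enn_powr (a * b) s = enn_powr a s * enn_powr b s"
proof (cases a; cases b)
  fix x y assume *: "0 < s" "a = ennreal x" "0 \<le> x" "b = ennreal y" "0 \<le> y"
  then show ?thesis by (simp add: enn_powr_ennreal ennreal_mult[symmetric] powr_mult)
next
  fix x assume *: "0 < s" "a = ennreal x" "0 \<le> x" "b = \<top>"
  then show ?thesis by (cases "x = 0") (auto simp: enn_powr_ennreal ennreal_mult_top)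
next
  fix x assume *: "0 < s" "b = ennreal x" "0 \<le> x" "a = \<top>"
  then show ?thesis by (cases "x = 0") (auto simp: enn_powr_ennreal ennreal_top_mult)
qed auto

lemma enn_powr_powr: "enn_powr (enn_powr a s) t = enn_powr a (s * t)"
  by (cases a) (auto simp: enn_powr_ennreal powr_powr)

lemma enn_powr_add: "enn_powr a (s + t) = enn_powr a s * enn_powr a t"
  by (cases a) (auto simp: enn_powr_ennreal powr_add ennreal_mult[symmetric])

lemma enn_powr_inverse: "s \<noteq> 0 \<Longrightarrow> enn_powr (enn_powr a s) (1 / s) = a" "s \<noteq> 0 \<Longrightarrow> enn_powr (enn_powr a (1 / s)) s = a"
  by (simp_all add: enn_powr_powr)

lemma enn_powr_measurable [measurable]: "f \<in> borel_measurable M \<Longrightarrow> (\<lambda>x. enn_powr (f x) s) \<in> borel_measurable M"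
proof -
  assume [measurable]: "f \<in> borel_measurable M"
  have "(\<lambda>x. enn2real (f x) powr s) \<in> borel_measurable M" by measurable
  then show ?thesis unfolding enn_powr_def by measurable
qed

lemma LpN_top: "LpN \<infinity> G = esssup lborel G"
  by (simp add: LpN_def)

lemma LpN_fin: "p \<noteq> \<infinity> \<Longrightarrow> LpN p G = enn_powr (\<integral>\<^sup>+ x. enn_powr (G x) (enn2real p) \<partial>lborel) (1 / enn2real p)"
  by (simp add: LpN_def)

lemma enn2real_pos: "0 < p \<Longrightarrow> p \<noteq> \<infinity> \<Longrightarrow> 0 < enn2real p"
  by (simp add: enn2real_positive_iff less_top)

lemma LpN_mono:
  assumes "G \<in> borel_measurable borel" "\<And>x. G x \<le> H x" "0 < p"
  shows "LpN p G \<le> LpN p H"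
proof (cases "p = \<infinity>")
  case True
  then show ?thesis using assms unfolding True LpN_top by (intro esssup_mono) auto
next
  case False
  then show ?thesis using assms enn2real_pos[OF assms(3) False]
    by (auto simp: LpN_fin intro!: enn_powr_mono nn_integral_mono)
qed

lemma LpN_cmult_le:
  assumes [measurable]: "G \<in> borel_measurable borel" and "0 < p"
  shows "LpN p (\<lambda>x. c * G x) \<le> c * LpN p G"
proof (cases "p = \<infinity>")
  case True
  show ?thesis unfolding True LpN_top
  proof (rule esssup_I)
    show "AE x in lborel. c * G x \<le> c * esssup lborel G"
      using esssup_AE[of G lborel] by eventually_elim (rule mult_left_mono, auto)
  qed simp
next
  case False
  note pos = enn2real_pos[OF assms(2) False]
  show ?thesis unfolding LpN_fin[OF False] using pos
    by (simp add: enn_powr_mult nn_integral_cmult enn_powr_powr)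
qed

text \<open>For infinite \<open>p\<close> the essential supremum is at most \<open>c\<close> exactly
  when the indicator of exceeding \<open>c\<close> integrates to 0, a condition that is measurable
  in the parameter by Tonelli.\<close>

lemma LpN_measurable:
  fixes G :: "'b::euclidean_space \<Rightarrow> real^'n::finite \<Rightarrow> ennreal"
  assumes [measurable]: "(\<lambda>z. G (fst z) (snd z)) \<in> borel_measurable (borel \<Otimes>\<^sub>M borel)"
  shows "(\<lambda>\<xi>. LpN p (G \<xi>)) \<in> borel_measurable borel"
proof (cases "p = \<infinity>")
  case False
  have "(\<lambda>z. G (fst z) (snd z)) \<in> borel_measurable (borel \<Otimes>\<^sub>M lborel)" using assms by simp
  then have "(\<lambda>z. enn_powr (G (fst z) (snd z)) (enn2real p)) \<in> borel_measurable (borel \<Otimes>\<^sub>M lborel)" by measurable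
  then have [measurable]: "(\<lambda>\<xi>. \<integral>\<^sup>+ x. enn_powr (G \<xi> x) (enn2real p) \<partial>lborel) \<in> borel_measurable borel"
    using lborel.borel_measurable_nn_integral_fst[of "\<lambda>z. enn_powr (G (fst z) (snd z)) (enn2real p)" borel] by simp
  show ?thesis unfolding LpN_fin[OF False] by measurable
next
  case True
  show ?thesis unfolding True LpN_top
  proof (rule borel_measurableI_le)
    fix c
    have Gm: "G \<xi> \<in> borel_measurable lborel" for \<xi>
      using measurable_compose[OF measurable_Pair1'[of \<xi> borel borel] assms] by simp
    have "(\<lambda>z. indicator {x. c < x} (G (fst z) (snd z)) :: ennreal) \<in> borel_measurable (borel \<Otimes>\<^sub>M lborel)"
    proof -
      have [measurable]: "(\<lambda>z. G (fst z) (snd z)) \<in> borel_measurable (borel \<Otimes>\<^sub>M lborel)" using assms by simp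
      show ?thesis by measurable
    qed
    then have [measurable]: "(\<lambda>\<xi>. \<integral>\<^sup>+ x. indicator {x. c < x} (G \<xi> x) \<partial>lborel) \<in> borel_measurable borel"
      using lborel.borel_measurable_nn_integral_fst[of "\<lambda>z. indicator {x. c < x} (G (fst z) (snd z))" borel] by simp
    have "esssup lborel (G \<xi>) \<le> c \<longleftrightarrow> (\<integral>\<^sup>+ x. indicator {x. c < x} (G \<xi> x) \<partial>lborel) = 0" for \<xi>
    proof -
      have "esssup lborel (G \<xi>) \<le> c \<longleftrightarrow> (AE x in lborel. G \<xi> x \<le> c)"
        using esssup_AE[of "G \<xi>" lborel] esssup_I[OF Gm, of \<xi> c] by (auto elim!: eventually_mono)
      also have "\<dots> \<longleftrightarrow> (\<integral>\<^sup>+ x. indicator {x. c < x} (G \<xi> x) \<partial>lborel) = 0"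
        using Gm[of \<xi>] by (subst nn_integral_0_iff_AE) (auto simp: indicator_def not_less)
      finally show ?thesis .
    qed
    then have "{\<xi> \<in> space borel. esssup lborel (G \<xi>) \<le> c} = {\<xi> \<in> space borel. (\<integral>\<^sup>+ x. indicator {x. c < x} (G \<xi> x) \<partial>lborel) = 0}"
      by simp
    also have "\<dots> \<in> sets borel" by measurable
    finally show "{\<xi> \<in> space borel. esssup lborel (G \<xi>) \<le> c} \<in> sets borel" .
  qed
qed

lemma LpN_translate_le:
  assumes [measurable]: "G \<in> borel_measurable borel"
  shows "LpN p (\<lambda>x. G (x - a)) \<le> LpN p G"
proof (cases "p = \<infinity>")
  case False
  have "(\<integral>\<^sup>+ x. enn_powr (G (-a + x)) (enn2real p) \<partial>lborel) = (\<integral>\<^sup>+ x. enn_powr (G x) (enn2real p) \<partial>lborel)"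
    by (rule lborel_nn_integral_plus) simp
  then show ?thesis by (simp add: LpN_fin[OF False])
next
  case True
  have "AE x in distr lborel borel ((+) (-a)). G x \<le> esssup lborel G"
    unfolding lborel_distr_plus by (rule esssup_AE)
  then have "AE x in lborel. G (- a + x) \<le> esssup lborel G"
    by (subst (asm) AE_distr_iff) auto
  then show ?thesis unfolding True LpN_top by (intro esssup_I) auto
qed

section \<open>Jensen and Minkowski inequalities\<close>

lemma powr_tangent:
  fixes y K s :: real
  assumes "0 \<le> y" "0 < K" "1 < s"
  shows "s * K powr (s - 1) * y \<le> y powr s + (s - 1) * K powr s"
proof (cases "y = 0")
  case True
  then show ?thesis using assms by simp
next
  case False
  have "(y powr s) powr (1/s) * (K powr s) powr (1 - 1/s) \<le> 1/s * y powr s + (1 - 1/s) * K powr s"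
    using assms False by (intro Youngs_inequality_0) auto
  then have "y * K powr (s - 1) \<le> 1/s * y powr s + (1 - 1/s) * K powr s"
    using assms by (simp add: powr_powr right_diff_distrib)
  then have "s * (y * K powr (s - 1)) \<le> s * (1/s * y powr s + (1 - 1/s) * K powr s)"
    using assms by (intro mult_left_mono) auto
  also have "\<dots> = y powr s + (s - 1) * K powr s" using assms by (simp add: field_simps)
  finally show ?thesis by (simp add: ac_simps)
qed

text \<open>The tangent inequality \<open>powr_tangent\<close> is integrated with \<open>K\<close>
  the mean value A / S'. Beforehand the tangent at 1 shows that a finite integral of the s-th power
  forces a finite integral of \<open>y\<close>.\<close>

lemma nn_integral_Jensen_powr:
  assumes [measurable]: "y \<in> borel_measurable M" and S: "emeasure M (space M) < \<infinity>" and s: "1 < s"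
  shows "enn_powr (\<integral>\<^sup>+x. y x \<partial>M) s \<le> enn_powr (emeasure M (space M)) (s - 1) * (\<integral>\<^sup>+x. enn_powr (y x) s \<partial>M)"
proof (cases "(\<integral>\<^sup>+x. y x \<partial>M) = 0")
  case True then show ?thesis by simp
next
  case A0: False
  define I where "I = (\<integral>\<^sup>+x. enn_powr (y x) s \<partial>M)"
  obtain S' where S': "emeasure M (space M) = ennreal S'" "0 \<le> S'" using S by (cases "emeasure M (space M)") auto
  have "S' \<noteq> 0"
  proof
    assume "S' = 0"
    then have "AE x in M. y x = 0" using S' by (intro emeasure_0_AE) simp
    then show False using A0 by (simp add: nn_integral_0_iff_AE)
  qed
  then have S'0: "0 < S'" using S' by simp
  have tg: "ennreal (s * K powr (s - 1)) * y x \<le> enn_powr (y x) s + ennreal ((s - 1) * K powr s)" if "0 < K" for K x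
  proof (cases "y x")
    case (real r)
    then show ?thesis using powr_tangent[of r K s] that s
      by (simp add: enn_powr_ennreal ennreal_mult[symmetric] ennreal_plus[symmetric] del: ennreal_plus)
  qed simp
  have int: "ennreal (s * K powr (s - 1)) * (\<integral>\<^sup>+x. y x \<partial>M) \<le> I + ennreal ((s - 1) * K powr s * S')" if "0 < K" for K
  proof -
    have "ennreal (s * K powr (s - 1)) * (\<integral>\<^sup>+x. y x \<partial>M) \<le> (\<integral>\<^sup>+x. enn_powr (y x) s + ennreal ((s - 1) * K powr s) \<partial>M)"
      using tg[OF that] by (subst nn_integral_cmult[symmetric]) (auto intro: nn_integral_mono)
    also have "\<dots> = I + ennreal ((s - 1) * K powr s * S')"
      using s S' by (subst nn_integral_add) (auto simp: I_def ennreal_mult)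
    finally show ?thesis .
  qed
  show ?thesis
  proof (cases "I = \<infinity>")
    case True
    then show ?thesis using S'0 by (simp add: I_def[symmetric] S' enn_powr_ennreal ennreal_mult_top)
  next
    case False
    then obtain i where i: "I = ennreal i" "0 \<le> i" by (cases I) auto
    have "(\<integral>\<^sup>+x. y x \<partial>M) \<noteq> \<infinity>"
    proof
      assume "(\<integral>\<^sup>+x. y x \<partial>M) = \<infinity>"
      with int[of 1] s show False by (auto simp: i ennreal_mult_top top_unique)
    qed
    then obtain A where A: "(\<integral>\<^sup>+x. y x \<partial>M) = ennreal A" "0 < A"
      using A0 by (cases "\<integral>\<^sup>+x. y x \<partial>M") (auto simp: less_le)
    define K where "K = A / S'"
    have K: "0 < K" using A S'0 by (simp add: K_def)
    have "ennreal (s * K powr (s - 1) * A) \<le> ennreal (i + (s - 1) * K powr s * S')"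
      using int[OF K] s K i A S'0 by (simp add: ennreal_mult[symmetric] ennreal_plus[symmetric] del: ennreal_plus)
    then have "s * K powr (s - 1) * A \<le> i + (s - 1) * K powr s * S'"
      using s i S'0 by (subst (asm) ennreal_le_iff) auto
    moreover have "K powr (s - 1) * A = K powr s * S'"
      using K S'0 A(2) by (simp add: powr_diff K_def)
    ultimately have "s * (K powr s * S') \<le> i + (s - 1) * (K powr s * S')" by (simp add: mult.assoc)
    moreover have "(s - 1) * (K powr s * S') = s * (K powr s * S') - K powr s * S'"
      by (simp add: left_diff_distrib)
    ultimately have *: "K powr s * S' \<le> i" by linarith
    have "A powr s = (K * S') powr s" using S'0 by (simp add: K_def)
    also have "\<dots> = S' powr (s - 1) * (K powr s * S')" using S'0 K by (simp add: powr_mult powr_diff)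
    also have "\<dots> \<le> S' powr (s - 1) * i" using * by (intro mult_left_mono) auto
    finally show ?thesis using A i S' by (simp add: I_def[symmetric] enn_powr_ennreal ennreal_mult[symmetric] ennreal_leI)
  qed
qed

text \<open>Jensen takes the place of duality. Let A be the norm of the slice and B a strictly
  positive majorant of it with almost the same integral S; then u = B w, where the slices of w have
  norm at most 1. Jensen for the measure with density B, followed by Tonelli, bounds the s-th power
  of the left side by S^(s - 1) times S.\<close>

lemma Minkowski_integral:
  fixes u :: "'a::euclidean_space \<Rightarrow> 'b \<Rightarrow> ennreal"
  assumes m: "(\<lambda>z. u (fst z) (snd z)) \<in> borel_measurable (lborel \<Otimes>\<^sub>M M)" and fin: "emeasure M (space M) < \<infinity>" and s: "1 \<le> s"
  shows "enn_powr (\<integral>\<^sup>+x. enn_powr (\<integral>\<^sup>+v. u x v \<partial>M) s \<partial>lborel) (1 / s) \<le> (\<integral>\<^sup>+v. enn_powr (\<integral>\<^sup>+x. enn_powr (u x v) s \<partial>lborel) (1 / s) \<partial>M)"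
proof -
  interpret M: finite_measure M using fin by (intro finite_measureI) simp
  interpret P: pair_sigma_finite lborel M ..
  note m[measurable]
  have m': "(\<lambda>(x, v). u x v) \<in> borel_measurable (lborel \<Otimes>\<^sub>M M)" using m by (simp add: case_prod_beta)
  show ?thesis
  proof (cases "s = 1")
    case True
    then show ?thesis using P.Fubini'[OF m'] by simp
  next
    case False
    with s have s1: "1 < s" by simp
    have um [measurable]: "u x \<in> borel_measurable M" for x
      using measurable_compose[OF measurable_Pair1'[of x lborel M] m] by simp
    have um' [measurable]: "(\<lambda>x. u x v) \<in> borel_measurable lborel" if "v \<in> space M" for v
      using measurable_compose[OF measurable_Pair2'[of v M lborel] m] that by simp
    have ms: "(\<lambda>(x, v). enn_powr (u x v) s) \<in> borel_measurable (lborel \<Otimes>\<^sub>M M)"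
      using m by (simp add: case_prod_beta)
    define A where "A v = enn_powr (\<integral>\<^sup>+x. enn_powr (u x v) s \<partial>lborel) (1 / s)" for v
    have "(\<lambda>z. enn_powr (u (snd z) (fst z)) s) \<in> borel_measurable (M \<Otimes>\<^sub>M lborel)"
      using measurable_compose[OF measurable_pair_swap' m] by (simp add: split_beta)
    from lborel.borel_measurable_nn_integral_fst[OF this]
    have [measurable]: "(\<lambda>v. \<integral>\<^sup>+x. enn_powr (u x v) s \<partial>lborel) \<in> borel_measurable M" by simp
    have Am [measurable]: "A \<in> borel_measurable M" unfolding A_def by measurable
    have As: "enn_powr (A v) s = (\<integral>\<^sup>+x. enn_powr (u x v) s \<partial>lborel)" for v
      using s1 by (simp add: A_def enn_powr_inverse)
    show ?thesis unfolding A_def[symmetric]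
    proof (cases "(\<integral>\<^sup>+v. A v \<partial>M) = \<infinity>")
      case False
      then have AE_A: "AE v in M. A v \<noteq> \<infinity>" by (intro nn_integral_PInf_AE) auto
      show "enn_powr (\<integral>\<^sup>+x. enn_powr (\<integral>\<^sup>+v. u x v \<partial>M) s \<partial>lborel) (1 / s) \<le> (\<integral>\<^sup>+v. A v \<partial>M)"
      proof (rule ennreal_le_epsilon)
        fix e :: real assume e: "0 < e"
        \<comment> \<open>Keeps the denominator \<open>B\<close> positive; over the finite measure
          it adds at most \<open>e\<close> to the integral.\<close>
        define \<epsilon> where "\<epsilon> = e / (1 + measure M (space M))"
        have \<epsilon>: "0 < \<epsilon>" using e by (auto simp: \<epsilon>_def intro!: divide_pos_pos add_pos_nonneg)
        define B where "B v = enn2real (A v) + \<epsilon>" for v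
        have Bp: "0 < B v" for v using \<epsilon> by (simp add: B_def add_nonneg_pos)
        have Bm [measurable]: "B \<in> borel_measurable M" unfolding B_def by measurable
        define N where "N = density M (\<lambda>v. ennreal (B v))"
        define S where "S = (\<integral>\<^sup>+v. ennreal (B v) \<partial>M)"
        have NS: "emeasure N (space N) = S" unfolding N_def S_def
          by (subst emeasure_density) (auto intro!: nn_integral_cong simp: indicator_def)
        have "S = (\<integral>\<^sup>+v. A v + ennreal \<epsilon> \<partial>M)" unfolding S_def
          by (rule nn_integral_cong_AE) (use AE_A \<epsilon> in \<open>auto simp: B_def ennreal_enn2real_if less_top elim!: eventually_mono\<close>)
        also have "\<dots> = (\<integral>\<^sup>+v. A v \<partial>M) + ennreal \<epsilon> * emeasure M (space M)"
          by (subst nn_integral_add) auto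
        also have "ennreal \<epsilon> * emeasure M (space M) \<le> ennreal e"
        proof -
          have "\<epsilon> * measure M (space M) \<le> e" unfolding \<epsilon>_def using e by (simp add: divide_simps add_pos_nonneg)
          then show ?thesis using \<epsilon> by (simp add: M.emeasure_eq_measure ennreal_mult[symmetric] ennreal_leI)
        qed
        finally have S_le: "S \<le> (\<integral>\<^sup>+v. A v \<partial>M) + ennreal e" by (simp add: add_left_mono)
        then have S_fin: "S < \<infinity>" using False by (auto simp: less_top[symmetric] top_unique)
        define w where "w x v = ennreal (1 / B v) * u x v" for x v
        have wm [measurable]: "w x \<in> borel_measurable M" for x unfolding w_def by measurable
        have wN: "w x \<in> borel_measurable N" for x unfolding N_def by simp
        have uw: "u x v = ennreal (B v) * w x v" for x v
          using Bp[of v] by (simp add: w_def mult.assoc[symmetric] ennreal_mult[symmetric] less_imp_le)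
        have wm2: "(\<lambda>(x, v). ennreal (B v) * enn_powr (w x v) s) \<in> borel_measurable (lborel \<Otimes>\<^sub>M M)"
          unfolding w_def by (simp add: case_prod_beta)
        have "(\<integral>\<^sup>+x. enn_powr (\<integral>\<^sup>+v. u x v \<partial>M) s \<partial>lborel) \<le> (\<integral>\<^sup>+x. enn_powr S (s - 1) * (\<integral>\<^sup>+v. ennreal (B v) * enn_powr (w x v) s \<partial>M) \<partial>lborel)"
        proof (rule nn_integral_mono)
          fix x
          have "(\<integral>\<^sup>+v. u x v \<partial>M) = (\<integral>\<^sup>+v. w x v \<partial>N)" unfolding uw N_def by (subst nn_integral_density) auto
          moreover have "(\<integral>\<^sup>+v. ennreal (B v) * enn_powr (w x v) s \<partial>M) = (\<integral>\<^sup>+v. enn_powr (w x v) s \<partial>N)"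
            unfolding N_def by (subst nn_integral_density) auto
          ultimately show "enn_powr (\<integral>\<^sup>+v. u x v \<partial>M) s \<le> enn_powr S (s - 1) * (\<integral>\<^sup>+v. ennreal (B v) * enn_powr (w x v) s \<partial>M)"
            using nn_integral_Jensen_powr[OF wN _ s1, of x] NS S_fin by simp
        qed
        also have "\<dots> = enn_powr S (s - 1) * (\<integral>\<^sup>+x. (\<integral>\<^sup>+v. ennreal (B v) * enn_powr (w x v) s \<partial>M) \<partial>lborel)"
          using M.borel_measurable_nn_integral_fst[OF wm2] by (intro nn_integral_cmult) auto
        also have "(\<integral>\<^sup>+x. (\<integral>\<^sup>+v. ennreal (B v) * enn_powr (w x v) s \<partial>M) \<partial>lborel) = (\<integral>\<^sup>+v. (\<integral>\<^sup>+x. ennreal (B v) * enn_powr (w x v) s \<partial>lborel) \<partial>M)"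
          using P.Fubini'[OF wm2] by simp
        also have "\<dots> \<le> S" unfolding S_def
        proof (rule nn_integral_mono_AE)
          show "AE v in M. (\<integral>\<^sup>+x. ennreal (B v) * enn_powr (w x v) s \<partial>lborel) \<le> ennreal (B v)"
            using AE_A AE_space
          proof eventually_elim
            case (elim v)
            then obtain a where a: "A v = ennreal a" "0 \<le> a" by (cases "A v") auto
            have [measurable]: "(\<lambda>x. u x v) \<in> borel_measurable lborel" by (rule um') (use elim in simp)
            have "(\<integral>\<^sup>+x. ennreal (B v) * enn_powr (w x v) s \<partial>lborel) = ennreal (B v) * (ennreal ((1 / B v) powr s) * enn_powr (A v) s)"
              unfolding w_def As using s1 Bp[of v]
              by (simp add: enn_powr_mult enn_powr_ennreal nn_integral_cmult less_imp_le)
            also have "\<dots> = ennreal (B v * ((1 / B v) powr s * a powr s))"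
              using a Bp[of v] by (simp add: enn_powr_ennreal ennreal_mult[symmetric])
            also have "(1 / B v) powr s * a powr s = (1 / B v * a) powr s" by (rule powr_mult[symmetric])
            also have "(1 / B v * a) powr s \<le> 1"
              using a Bp[of v] s1 \<epsilon> by (intro powr_le1) (auto simp: B_def divide_le_eq_1)
            finally show ?case using Bp[of v] by (simp add: mult_left_mono ennreal_leI order_trans)
          qed
        qed
        also have "enn_powr S (s - 1) * S = enn_powr S s"
          using enn_powr_add[of S "s - 1" 1] by simp
        finally have "(\<integral>\<^sup>+x. enn_powr (\<integral>\<^sup>+v. u x v \<partial>M) s \<partial>lborel) \<le> enn_powr S s" by (simp add: mult_left_mono)
        then have "enn_powr (\<integral>\<^sup>+x. enn_powr (\<integral>\<^sup>+v. u x v \<partial>M) s \<partial>lborel) (1 / s) \<le> enn_powr (enn_powr S s) (1 / s)"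
          using s1 by (intro enn_powr_mono) auto
        also have "\<dots> = S" using s1 by (simp add: enn_powr_inverse)
        also note S_le
        finally show "enn_powr (\<integral>\<^sup>+x. enn_powr (\<integral>\<^sup>+v. u x v \<partial>M) s \<partial>lborel) (1 / s) \<le> (\<integral>\<^sup>+v. A v \<partial>M) + ennreal e" .
      qed
    qed simp
  qed
qed

text \<open>For finite \<open>p\<close> this is Minkowski in the exponent p / r, which is at least
  1. For infinite \<open>p\<close> the bound by the essential supremum of the slice holds almost
  everywhere in the product, and the order of the two almost-everywhere statements is then
  exchanged; this uses measurability of the slice norms.\<close>

lemma Minkowski_LpN:
  fixes F :: "real^'n::finite \<Rightarrow> 'b \<Rightarrow> ennreal"
  assumes m: "(\<lambda>z. F (fst z) (snd z)) \<in> borel_measurable (lborel \<Otimes>\<^sub>M M)" and fin: "emeasure M (space M) < \<infinity>"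
    and r: "0 < r" "ennreal r \<le> p"
    and Lm: "(\<lambda>v. LpN p (\<lambda>x. F x v)) \<in> borel_measurable M"
  shows "LpN p (\<lambda>x. enn_powr (\<integral>\<^sup>+v. enn_powr (F x v) r \<partial>M) (1 / r))
     \<le> enn_powr (\<integral>\<^sup>+v. enn_powr (LpN p (\<lambda>x. F x v)) r \<partial>M) (1 / r)"
proof -
  interpret M: finite_measure M using fin by (intro finite_measureI) simp
  interpret P: pair_sigma_finite lborel M ..
  interpret P': pair_sigma_finite M lborel ..
  note m[measurable] Lm[measurable]
  have mr: "(\<lambda>(x, v). enn_powr (F x v) r) \<in> borel_measurable (lborel \<Otimes>\<^sub>M M)"
    using m by (simp add: case_prod_beta)
  have [measurable]: "(\<lambda>x. \<integral>\<^sup>+v. enn_powr (F x v) r \<partial>M) \<in> borel_measurable lborel"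
    using M.borel_measurable_nn_integral_fst[OF mr] by simp
  show ?thesis
  proof (cases "p = \<infinity>")
    case False
    define s where "s = enn2real p / r"
    have p: "r \<le> enn2real p" using r False by (metis enn2real_mono enn2real_ennreal less_imp_le less_top infinity_ennreal_def)
    have s: "1 \<le> s" using p r by (simp add: s_def)
    have rs: "r * s = enn2real p" using r by (simp add: s_def)
    have ir: "1 / enn2real p = (1 / s) * (1 / r)" using r by (simp add: s_def)
    have "LpN p (\<lambda>x. enn_powr (\<integral>\<^sup>+v. enn_powr (F x v) r \<partial>M) (1 / r))
       = enn_powr (enn_powr (\<integral>\<^sup>+x. enn_powr (\<integral>\<^sup>+v. enn_powr (F x v) r \<partial>M) s \<partial>lborel) (1 / s)) (1 / r)"
      unfolding LpN_fin[OF False] enn_powr_powr ir rs[symmetric] using r by (simp add: mult.commute)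
    also have "\<dots> \<le> enn_powr (\<integral>\<^sup>+v. enn_powr (\<integral>\<^sup>+x. enn_powr (enn_powr (F x v) r) s \<partial>lborel) (1 / s) \<partial>M) (1 / r)"
      using r mr by (intro enn_powr_mono Minkowski_integral fin s) (auto simp: case_prod_beta)
    also have "\<dots> = enn_powr (\<integral>\<^sup>+v. enn_powr (LpN p (\<lambda>x. F x v)) r \<partial>M) (1 / r)"
      unfolding LpN_fin[OF False] enn_powr_powr ir rs[symmetric] using r by (simp add: mult.assoc)
    finally show ?thesis .
  next
    case True
    have mv: "(\<lambda>z. F (snd z) (fst z)) \<in> borel_measurable (M \<Otimes>\<^sub>M lborel)"
      using measurable_compose[OF measurable_pair_swap' m] by (simp add: split_beta)
    have s1: "{z \<in> space (M \<Otimes>\<^sub>M lborel). F (snd z) (fst z) \<le> esssup lborel (\<lambda>x. F x (fst z))} \<in> sets (M \<Otimes>\<^sub>M lborel)"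
      using mv Lm[unfolded True LpN_top] by measurable
    have s2: "AE v in M. AE x in lborel. F (snd (v, x)) (fst (v, x)) \<le> esssup lborel (\<lambda>x'. F x' (fst (v, x)))"
      by (auto intro!: AE_I2 simp: esssup_AE)
    have "AE z in M \<Otimes>\<^sub>M lborel. F (snd z) (fst z) \<le> esssup lborel (\<lambda>x. F x (fst z))"
      by (rule P'.AE_pair_measure[where P="\<lambda>z. F (snd z) (fst z) \<le> esssup lborel (\<lambda>x. F x (fst z))", OF s1 s2])
    then have "AE z in lborel \<Otimes>\<^sub>M M. F (fst z) (snd z) \<le> esssup lborel (\<lambda>x. F x (snd z))"
    proof -
      have "{z \<in> space (lborel \<Otimes>\<^sub>M M). F (fst z) (snd z) \<le> esssup lborel (\<lambda>x. F x (snd z))} \<in> sets (lborel \<Otimes>\<^sub>M M)"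
        using m Lm[unfolded True LpN_top] by measurable
      then show "AE z in lborel \<Otimes>\<^sub>M M. F (fst z) (snd z) \<le> esssup lborel (\<lambda>x. F x (snd z))"
        if "AE z in M \<Otimes>\<^sub>M lborel. F (snd z) (fst z) \<le> esssup lborel (\<lambda>x. F x (fst z))"
        using that by (subst P.distr_pair_swap, subst AE_distr_iff[OF measurable_pair_swap']) (auto simp: split_beta)
    qed
    then have "AE x in lborel. AE v in M. F x v \<le> esssup lborel (\<lambda>x. F x v)"
      by (auto dest: P.AE_pair)
    then have "AE x in lborel. enn_powr (\<integral>\<^sup>+v. enn_powr (F x v) r \<partial>M) (1 / r) \<le> enn_powr (\<integral>\<^sup>+v. enn_powr (LpN p (\<lambda>x. F x v)) r \<partial>M) (1 / r)"
    proof eventually_elim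
      case (elim x)
      show ?case using r unfolding True LpN_top
        by (intro enn_powr_mono nn_integral_mono_AE) (use elim in \<open>auto elim!: eventually_mono intro!: enn_powr_mono\<close>)
    qed
    then show ?thesis by (subst True, subst LpN_top) (intro esssup_I, auto)
  qed
qed

lemma inv_exp_top [simp]: "inv_exp \<infinity> = 0" "inv_exp top = 0"
  by (simp_all add: inv_exp_def)

lemma inv_exp_fin: "0 < p \<Longrightarrow> p \<noteq> \<infinity> \<Longrightarrow> inv_exp p = 1 / enn2real p"
  unfolding inv_exp_def using enn2real_pos[of p]
  by (cases p) (auto simp: divide_ennreal[symmetric] ennreal_1[symmetric] simp del: ennreal_1)

section \<open>Scaled cutoffs and slowly varying functions\<close>

lemma nn_integral_scale:
  fixes f :: "'a::euclidean_space \<Rightarrow> ennreal"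
  assumes [measurable]: "f \<in> borel_measurable borel" and s: "0 < s"
  shows "(\<integral>\<^sup>+x. f (s *\<^sub>R x) \<partial>lborel) = ennreal (s powr (- real DIM('a))) * (\<integral>\<^sup>+x. f x \<partial>lborel)"
proof -
  have "(\<integral>\<^sup>+x. f x \<partial>lborel) = ennreal (s ^ DIM('a)) * (\<integral>\<^sup>+x. f (s *\<^sub>R x) \<partial>lborel)"
    using s by (subst lborel_affine[of s 0]) (simp_all add: nn_integral_density nn_integral_distr nn_integral_cmult)
  then have "ennreal (s powr (- real DIM('a))) * (\<integral>\<^sup>+x. f x \<partial>lborel)
     = ennreal (s powr (- real DIM('a)) * s ^ DIM('a)) * (\<integral>\<^sup>+x. f (s *\<^sub>R x) \<partial>lborel)"
    using s by (simp add: mult.assoc[symmetric] ennreal_mult)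
  also have "s powr (- real DIM('a)) * s ^ DIM('a) = 1"
    using s by (simp add: powr_minus powr_realpow)
  finally show ?thesis by simp
qed

lemma nn_integral_weight:
  assumes "M \<ge> 2 * real DIM('a)"
  shows "\<exists>C>0. (\<integral>\<^sup>+x. ennreal ((1 + norm (x::'a::euclidean_space)) powr (-M)) \<partial>lborel) = ennreal C"
proof -
  have "(\<integral>\<^sup>+x. ennreal ((1 + norm (x::'a)) powr (-M)) \<partial>lborel) \<noteq> \<infinity>"
    using integrable_weight[OF assms] by (auto simp: integrable_iff_bounded less_top)
  then obtain C where C: "(\<integral>\<^sup>+x. ennreal ((1 + norm (x::'a)) powr (-M)) \<partial>lborel) = ennreal C" "0 \<le> C"
    by (cases "\<integral>\<^sup>+x. ennreal ((1 + norm (x::'a)) powr (-M)) \<partial>lborel") auto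
  have "(\<integral>\<^sup>+x. ennreal ((1 + norm (x::'a)) powr (-M)) \<partial>lborel) \<noteq> 0"
  proof
    assume "(\<integral>\<^sup>+x. ennreal ((1 + norm (x::'a)) powr (-M)) \<partial>lborel) = 0"
    then have "AE x::'a in lborel. ennreal ((1 + norm x) powr (-M)) = 0" by (subst (asm) nn_integral_0_iff_AE) auto
    then have "AE x::'a in lborel. False"
    proof eventually_elim
      case (elim x)
      have "0 < 1 + norm x" by (simp add: add_pos_nonneg)
      then have "0 < (1 + norm x) powr (-M)" by simp
      with elim show ?case by (simp add: ennreal_eq_0_iff)
    qed
    then show False by (simp add: eventually_False ae_filter_eq_bot_iff)
  qed
  then show ?thesis using C by (intro exI[of _ C]) (auto simp: less_le)
qed

text \<open>By dilation. This power of \<open>s\<close> is the only source of the singularity in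
  t.\<close>

lemma nn_integral_scaled_weight:
  assumes "M \<ge> 2 * real DIM('a)"
  shows "\<exists>C>0. \<forall>s>0. (\<integral>\<^sup>+x. ennreal ((1 + s * norm (x::'a::euclidean_space)) powr (-M)) \<partial>lborel) = ennreal (C * s powr (- real DIM('a)))"
proof -
  obtain C where C: "C > 0" "(\<integral>\<^sup>+x. ennreal ((1 + norm (x::'a)) powr (-M)) \<partial>lborel) = ennreal C"
    using nn_integral_weight[OF assms] by blast
  have "(\<integral>\<^sup>+x. ennreal ((1 + s * norm (x::'a)) powr (-M)) \<partial>lborel) = ennreal (C * s powr (- real DIM('a)))" if "s > 0" for s
    using nn_integral_scale[of "\<lambda>x::'a. ennreal ((1 + norm x) powr (-M))" s] that C
    by (simp add: ennreal_mult[symmetric] mult.commute)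
  then show ?thesis using C(1) by blast
qed

text \<open>The moderate weights of time-frequency analysis, with a polynomial control function;
  \<open>locavg\<close> produces them.\<close>

definition moderate :: "real \<Rightarrow> ('a::real_normed_vector \<Rightarrow> ennreal) \<Rightarrow> bool" where
  "moderate K \<Phi> \<longleftrightarrow> (\<forall>x v. \<Phi> (x + v) \<le> ennreal ((1 + norm v) powr K) * \<Phi> x)"

text \<open>On the unit ball about \<open>x\<close> the value at \<open>x\<close> exceeds the other
  values by at most the factor 2^K, so it is controlled by the average over that ball.\<close>

lemma moderate_pointwise_bound:
  fixes \<Phi> :: "real^'n::finite \<Rightarrow> ennreal"
  assumes [measurable]: "\<Phi> \<in> borel_measurable borel" and mod: "moderate K \<Phi>" and K: "0 \<le> K" and p: "0 < p" "p \<noteq> \<infinity>"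
  shows "\<Phi> x \<le> ennreal (2 powr K / measure lborel (ball 0 1 :: (real^'n) set) powr (1 / enn2real p)) * LpN p \<Phi>"
proof -
  note pos = enn2real_pos[OF p]
  define q where "q = enn2real p"
  define b where "b = measure lborel (ball 0 1 :: (real^'n) set)"
  have b: "b > 0" unfolding b_def using content_ball_pos[of 1 "0::real^'n"] by simp
  have bx: "emeasure lborel (ball x 1) = ennreal b"
  proof -
    have "measure lborel (ball x 1) = b" unfolding b_def using content_ball_conv_unit_ball[of 1 x] by simp
    then show ?thesis by (subst emeasure_eq_ennreal_measure) (use emeasure_bounded_finite[of "ball x 1"] in auto)
  qed
  have le: "enn_powr (\<Phi> x) q * indicator (ball x 1) y \<le> ennreal ((2 powr K) powr q) * enn_powr (\<Phi> y) q" for y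
  proof (cases "y \<in> ball x 1")
    case True
    then have n: "norm (x - y) \<le> 1" by (simp add: dist_norm)
    have "\<Phi> x \<le> ennreal ((1 + norm (x - y)) powr K) * \<Phi> y"
      using mod[unfolded moderate_def, rule_format, of y "x - y"] by simp
    also have "\<dots> \<le> ennreal (2 powr K) * \<Phi> y"
      using n K by (intro mult_right_mono ennreal_leI powr_mono2) auto
    finally have "enn_powr (\<Phi> x) q \<le> enn_powr (ennreal (2 powr K) * \<Phi> y) q"
      using pos by (intro enn_powr_mono) (auto simp: q_def)
    then show ?thesis using True pos by (simp add: enn_powr_mult q_def enn_powr_ennreal)
  qed simp
  have "enn_powr (\<Phi> x) q * ennreal b = (\<integral>\<^sup>+y. enn_powr (\<Phi> x) q * indicator (ball x 1) y \<partial>lborel)"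
    by (subst nn_integral_cmult_indicator) (auto simp: bx)
  also have "\<dots> \<le> (\<integral>\<^sup>+y. ennreal ((2 powr K) powr q) * enn_powr (\<Phi> y) q \<partial>lborel)"
    by (intro nn_integral_mono le)
  also have "\<dots> = ennreal ((2 powr K) powr q) * enn_powr (LpN p \<Phi>) q"
    unfolding LpN_fin[OF p(2)] q_def[symmetric] using pos by (simp add: nn_integral_cmult enn_powr_inverse q_def)
  finally have "enn_powr (enn_powr (\<Phi> x) q * ennreal b) (1/q) \<le> enn_powr (ennreal ((2 powr K) powr q) * enn_powr (LpN p \<Phi>) q) (1/q)"
    using pos by (intro enn_powr_mono) (auto simp: q_def)
  then have *: "\<Phi> x * ennreal (b powr (1/q)) \<le> ennreal (2 powr K) * LpN p \<Phi>"
    using pos b by (simp add: enn_powr_mult q_def enn_powr_inverse enn_powr_ennreal powr_powr)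
  have "\<Phi> x = ennreal (1 / b powr (1/q)) * (\<Phi> x * ennreal (b powr (1/q)))"
    using b by (simp add: mult.left_commute[of _ "\<Phi> x"] ennreal_mult[symmetric])
  also have "\<dots> \<le> ennreal (1 / b powr (1/q)) * (ennreal (2 powr K) * LpN p \<Phi>)"
    by (intro mult_left_mono *) auto
  also have "\<dots> = ennreal (2 powr K / b powr (1/q)) * LpN p \<Phi>"
    by (simp add: mult.assoc[symmetric] ennreal_mult[symmetric])
  finally show ?thesis by (simp add: q_def b_def)
qed

text \<open>The pointwise bound settles infinite \<open>p2\<close>. For finite \<open>p2\<close> the
  surplus power of \<open>\<Phi>\<close> is estimated by that bound, and the norm with exponent
  \<open>p1\<close> remains.\<close>

lemma moderate_embedding:
  assumes p: "0 < p1" "0 < p2" "p1 \<le> p2" and K: "0 \<le> K"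
  shows "\<exists>C>0. \<forall>\<Phi> :: real^'n::finite \<Rightarrow> ennreal. \<Phi> \<in> borel_measurable borel \<longrightarrow> moderate K \<Phi> \<longrightarrow>
     LpN p2 \<Phi> \<le> ennreal C * LpN p1 \<Phi>"
proof (cases "p1 = p2")
  case True
  then show ?thesis by (intro exI[of _ 1]) auto
next
  case False
  with p have lt: "p1 < p2" by simp
  then have fin1: "p1 \<noteq> \<infinity>" by (metis infinity_ennreal_def not_less top_greatest)
  note pos1 = enn2real_pos[OF p(1) fin1]
  define C where "C = 2 powr K / measure lborel (ball 0 1 :: (real^'n) set) powr (1 / enn2real p1)"
  have C: "C > 0" unfolding C_def using content_ball_pos[of 1 "0::real^'n"] by (auto intro!: divide_pos_pos)
  have pw: "\<Phi> x \<le> ennreal C * LpN p1 \<Phi>" if "\<Phi> \<in> borel_measurable borel" "moderate K \<Phi>" for \<Phi> :: "real^'n \<Rightarrow> ennreal" and x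
    unfolding C_def by (rule moderate_pointwise_bound[OF that K p(1) fin1])
  show ?thesis
  proof (cases "p2 = \<infinity>")
    case True
    have "LpN p2 \<Phi> \<le> ennreal C * LpN p1 \<Phi>" if "\<Phi> \<in> borel_measurable borel" "moderate K \<Phi>" for \<Phi> :: "real^'n \<Rightarrow> ennreal"
      unfolding True LpN_top using pw[OF that] that by (intro esssup_I) auto
    then show ?thesis using C by blast
  next
    case fin2: False
    note pos2 = enn2real_pos[OF p(2) fin2]
    define a where "a = enn2real p1"
    define b where "b = enn2real p2"
    have ab: "0 < a" "a < b" using lt pos1 pos2 fin1 fin2 unfolding a_def b_def
      by (cases p1; cases p2; auto simp: ennreal_less_iff)+
    define D where "D = C powr ((b - a) / b)"
    have D: "D > 0" using C by (simp add: D_def)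
    have "LpN p2 \<Phi> \<le> ennreal D * LpN p1 \<Phi>" if \<Phi>: "\<Phi> \<in> borel_measurable borel" "moderate K \<Phi>" for \<Phi> :: "real^'n \<Rightarrow> ennreal"
    proof -
      note \<Phi>(1)[measurable]
      define L where "L = LpN p1 \<Phi>"
      have La: "enn_powr L a = (\<integral>\<^sup>+x. enn_powr (\<Phi> x) a \<partial>lborel)"
        unfolding L_def LpN_fin[OF fin1] a_def[symmetric] using ab by (simp add: enn_powr_inverse)
      have "(\<integral>\<^sup>+x. enn_powr (\<Phi> x) b \<partial>lborel) \<le> (\<integral>\<^sup>+x. enn_powr (ennreal C * L) (b - a) * enn_powr (\<Phi> x) a \<partial>lborel)"
      proof (rule nn_integral_mono)
        fix x
        have "enn_powr (\<Phi> x) b = enn_powr (\<Phi> x) (b - a) * enn_powr (\<Phi> x) a"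
          unfolding enn_powr_add[symmetric] by simp
        also have "\<dots> \<le> enn_powr (ennreal C * L) (b - a) * enn_powr (\<Phi> x) a"
          using ab pw[OF \<Phi>] by (intro mult_right_mono enn_powr_mono) (auto simp: L_def)
        finally show "enn_powr (\<Phi> x) b \<le> enn_powr (ennreal C * L) (b - a) * enn_powr (\<Phi> x) a" .
      qed
      also have "\<dots> = enn_powr (ennreal C * L) (b - a) * enn_powr L a"
        by (subst nn_integral_cmult) (auto simp: La)
      also have "\<dots> = ennreal (C powr (b - a)) * enn_powr L b"
        using ab C enn_powr_add[of L "b - a" a] by (simp add: enn_powr_mult enn_powr_ennreal mult.assoc)
      finally have "LpN p2 \<Phi> \<le> enn_powr (ennreal (C powr (b - a)) * enn_powr L b) (1 / b)"
        unfolding LpN_fin[OF fin2] b_def[symmetric] using ab by (intro enn_powr_mono) auto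
      also have "\<dots> = ennreal D * L"
        using ab C by (simp add: enn_powr_mult enn_powr_ennreal enn_powr_inverse powr_powr D_def)
      finally show ?thesis by (simp add: L_def)
    qed
    then show ?thesis using D by blast
  qed
qed

text \<open>For p1 at most p2 the cutoff is dropped and \<open>moderate_embedding\<close> applies.
  Otherwise Hoelder's inequality is used in the form of Jensen for the measure with density W, the
  p2-th power of the cutoff: its mass is a multiple of s^(-d), raised to the power 1/p2 -
  1/p1.\<close>

lemma weighted_LpN_bound:
  assumes p: "0 < p1" "0 < p2" and K: "0 \<le> K"
    and M: "0 \<le> M" "p2 \<noteq> \<infinity> \<Longrightarrow> 2 * real CARD('n) \<le> M * enn2real p2"
  shows "\<exists>C>0. \<forall>s. \<forall>\<Phi> :: real^'n::finite \<Rightarrow> ennreal. 0 < s \<longrightarrow> \<Phi> \<in> borel_measurable borel \<longrightarrow> moderate K \<Phi> \<longrightarrow>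
     LpN p2 (\<lambda>x. ennreal ((1 + s * norm x) powr (-M)) * \<Phi> x)
       \<le> ennreal (C * s powr (- (real CARD('n) * max (inv_exp p2 - inv_exp p1) 0))) * LpN p1 \<Phi>"
proof (cases "p1 \<le> p2")
  case True
  obtain C where C: "C > 0" "\<And>\<Phi> :: real^'n \<Rightarrow> ennreal. \<Phi> \<in> borel_measurable borel \<Longrightarrow> moderate K \<Phi> \<Longrightarrow> LpN p2 \<Phi> \<le> ennreal C * LpN p1 \<Phi>"
    using moderate_embedding[OF p True K] by blast
  have "inv_exp p2 \<le> inv_exp p1"
  proof (cases "p2 = \<infinity>")
    case True then show ?thesis by (simp add: inv_exp_def)
  next
    case fin2: False
    then have fin1: "p1 \<noteq> \<infinity>" using True by (auto simp: top_unique)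
    show ?thesis unfolding inv_exp_fin[OF p(1) fin1] inv_exp_fin[OF p(2) fin2]
      using enn2real_pos[OF p(1) fin1] fin2 True by (intro divide_left_mono enn2real_mono mult_pos_pos enn2real_pos p) (auto simp: less_top)
  qed
  then have m: "max (inv_exp p2 - inv_exp p1) 0 = 0" by simp
  have "LpN p2 (\<lambda>x. ennreal ((1 + s * norm x) powr (-M)) * \<Phi> x) \<le> ennreal C * LpN p1 \<Phi>"
    if "0 < s" and \<Phi>[measurable]: "\<Phi> \<in> borel_measurable borel" and "moderate K \<Phi>" for s and \<Phi> :: "real^'n \<Rightarrow> ennreal"
  proof -
    have "LpN p2 (\<lambda>x. ennreal ((1 + s * norm x) powr (-M)) * \<Phi> x) \<le> LpN p2 \<Phi>"
    proof (rule LpN_mono)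
      fix x :: "real^'n"
      have "(1 + s * norm x) powr (-M) \<le> 1 powr (-M)"
        using that(1) M by (intro powr_mono2') auto
      then have "ennreal ((1 + s * norm x) powr (-M)) * \<Phi> x \<le> 1 * \<Phi> x"
        by (intro mult_right_mono) auto
      then show "ennreal ((1 + s * norm x) powr (-M)) * \<Phi> x \<le> \<Phi> x" by simp
    qed (use p in auto)
    also have "\<dots> \<le> ennreal C * LpN p1 \<Phi>" by (rule C(2)) (use that in auto)
    finally show ?thesis .
  qed
  then show ?thesis using C(1) by (intro exI[of _ C]) (auto simp: m)
next
  case False
  then have lt: "p2 < p1" by simp
  then have fin2: "p2 \<noteq> \<infinity>" by (metis infinity_ennreal_def not_less top_greatest)
  define b where "b = enn2real p2"
  have b: "0 < b" using enn2real_pos[OF p(2) fin2] by (simp add: b_def)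
  have "2 * real DIM(real^'n) \<le> M * b" using M(2)[OF fin2] by (simp add: b_def)
  from nn_integral_scaled_weight[OF this] obtain C where
    C: "C > 0" "\<And>s. s > 0 \<Longrightarrow> (\<integral>\<^sup>+x. ennreal ((1 + s * norm (x::real^'n)) powr (- (M * b))) \<partial>lborel) = ennreal (C * s powr (- real CARD('n)))"
    by auto
  define e where "e = inv_exp p2 - inv_exp p1"
  define D where "D = C powr e"
  have D: "D > 0" using C by (simp add: D_def)
  have Wpow: "enn_powr (ennreal ((1 + s * norm x) powr (-M))) b = ennreal ((1 + s * norm x) powr (- (M * b)))" for s and x :: "real^'n"
    by (simp add: enn_powr_ennreal powr_powr)
  have main: "LpN p2 (\<lambda>x. ennreal ((1 + s * norm x) powr (-M)) * \<Phi> x) \<le> ennreal (D * s powr (- (real CARD('n) * e))) * LpN p1 \<Phi>"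
    if s: "0 < s" and \<Phi>[measurable]: "\<Phi> \<in> borel_measurable borel" for s and \<Phi> :: "real^'n \<Rightarrow> ennreal"
  proof -
    define W where "W x = ennreal ((1 + s * norm x) powr (- (M * b)))" for x :: "real^'n"
    have Wm [measurable]: "W \<in> borel_measurable borel" unfolding W_def by measurable
    define S where "S = C * s powr (- real CARD('n))"
    have S: "0 < S" using C s by (simp add: S_def)
    have WS: "(\<integral>\<^sup>+x. W x \<partial>lborel) = ennreal S" unfolding W_def S_def by (rule C(2)[OF s])
    have Se: "S powr e = D * s powr (- (real CARD('n) * e))"
      unfolding S_def D_def by (simp add: powr_mult powr_powr)
    have eq: "LpN p2 (\<lambda>x. ennreal ((1 + s * norm x) powr (-M)) * \<Phi> x) = enn_powr (\<integral>\<^sup>+x. W x * enn_powr (\<Phi> x) b \<partial>lborel) (1 / b)"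
      unfolding LpN_fin[OF fin2] b_def[symmetric] W_def using b by (simp add: enn_powr_mult Wpow)
    show ?thesis
    proof (cases "p1 = \<infinity>")
      case True
      have "(\<integral>\<^sup>+x. W x * enn_powr (\<Phi> x) b \<partial>lborel) \<le> (\<integral>\<^sup>+x. W x * enn_powr (esssup lborel \<Phi>) b \<partial>lborel)"
      proof (rule nn_integral_mono_AE)
        show "AE x in lborel. W x * enn_powr (\<Phi> x) b \<le> W x * enn_powr (esssup lborel \<Phi>) b"
          using esssup_AE[of \<Phi> lborel] by eventually_elim (use b in \<open>auto intro!: mult_left_mono enn_powr_mono\<close>)
      qed
      also have "\<dots> = ennreal S * enn_powr (esssup lborel \<Phi>) b"
        by (subst nn_integral_multc) (auto simp: WS)
      finally have "LpN p2 (\<lambda>x. ennreal ((1 + s * norm x) powr (-M)) * \<Phi> x) \<le> enn_powr (ennreal S * enn_powr (esssup lborel \<Phi>) b) (1 / b)"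
        unfolding eq using b by (intro enn_powr_mono) auto
      also have "\<dots> = ennreal (S powr (1 / b)) * esssup lborel \<Phi>"
        using b S by (simp add: enn_powr_mult enn_powr_ennreal enn_powr_inverse)
      also have "1 / b = e" unfolding e_def True using inv_exp_fin[OF p(2) fin2] by (simp add: b_def)
      finally show ?thesis unfolding Se True LpN_top .
    next
      case fin1: False
      define a where "a = enn2real p1"
      have ab: "b < a" using lt fin1 fin2 unfolding a_def b_def by (cases p1; cases p2) (auto simp: ennreal_less_iff)
      define r where "r = a / b"
      have r: "1 < r" using ab b by (simp add: r_def)
      define N where "N = density lborel W"
      have NS: "emeasure N (space N) = ennreal S"
        unfolding N_def by (subst emeasure_density) (auto simp: WS)
      have "enn_powr (\<integral>\<^sup>+x. W x * enn_powr (\<Phi> x) b \<partial>lborel) r = enn_powr (\<integral>\<^sup>+x. enn_powr (\<Phi> x) b \<partial>N) r"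
        unfolding N_def by (subst nn_integral_density) auto
      also have "\<dots> \<le> enn_powr (ennreal S) (r - 1) * (\<integral>\<^sup>+x. enn_powr (enn_powr (\<Phi> x) b) r \<partial>N)"
        using nn_integral_Jensen_powr[of "\<lambda>x. enn_powr (\<Phi> x) b" N r] r by (simp add: NS) (simp add: N_def)
      also have "(\<integral>\<^sup>+x. enn_powr (enn_powr (\<Phi> x) b) r \<partial>N) = (\<integral>\<^sup>+x. W x * enn_powr (\<Phi> x) a \<partial>lborel)"
        unfolding N_def using b by (subst nn_integral_density) (auto simp: enn_powr_powr r_def)
      also have "\<dots> \<le> (\<integral>\<^sup>+x. 1 * enn_powr (\<Phi> x) a \<partial>lborel)"
      proof (intro nn_integral_mono mult_right_mono)
        fix x :: "real^'n"
        have "(1 + s * norm x) powr (- (M * b)) \<le> 1 powr (- (M * b))"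
          using s M b by (intro powr_mono2') auto
        then show "W x \<le> 1" by (simp add: W_def)
      qed simp
      also have "\<dots> = enn_powr (LpN p1 \<Phi>) a"
        unfolding LpN_fin[OF fin1] a_def[symmetric] using ab b by (simp add: enn_powr_inverse)
      finally have "enn_powr (\<integral>\<^sup>+x. W x * enn_powr (\<Phi> x) b \<partial>lborel) r \<le> enn_powr (ennreal S) (r - 1) * enn_powr (LpN p1 \<Phi>) a"
        by (simp add: mult_left_mono)
      then have "enn_powr (enn_powr (\<integral>\<^sup>+x. W x * enn_powr (\<Phi> x) b \<partial>lborel) r) (1 / a) \<le> enn_powr (enn_powr (ennreal S) (r - 1) * enn_powr (LpN p1 \<Phi>) a) (1 / a)"
        using ab b by (intro enn_powr_mono) auto
      also have "enn_powr (enn_powr (\<integral>\<^sup>+x. W x * enn_powr (\<Phi> x) b \<partial>lborel) r) (1 / a) = enn_powr (\<integral>\<^sup>+x. W x * enn_powr (\<Phi> x) b \<partial>lborel) (1 / b)"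
        using ab b by (simp add: enn_powr_powr r_def)
      also have "enn_powr (enn_powr (ennreal S) (r - 1) * enn_powr (LpN p1 \<Phi>) a) (1 / a) = ennreal (S powr ((r - 1) * (1 / a))) * LpN p1 \<Phi>"
        using ab b S by (simp add: enn_powr_mult enn_powr_ennreal enn_powr_inverse powr_powr)
      also have "(r - 1) * (1 / a) = e"
        unfolding e_def inv_exp_fin[OF p(1) fin1] inv_exp_fin[OF p(2) fin2] a_def[symmetric] b_def[symmetric] r_def
        using ab b by (simp add: field_simps)
      finally show ?thesis unfolding eq Se .
    qed
  qed
  have "0 \<le> e"
  proof (cases "p1 = \<infinity>")
    case True then show ?thesis using inv_exp_fin[OF p(2) fin2] b by (simp add: e_def b_def)
  next
    case fin1: False
    have "b < enn2real p1" using lt fin1 fin2 unfolding b_def by (cases p1; cases p2) (auto simp: ennreal_less_iff)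
    then show ?thesis unfolding e_def inv_exp_fin[OF p(1) fin1] inv_exp_fin[OF p(2) fin2] b_def[symmetric]
      using b by (simp add: divide_left_mono)
  qed
  then have "max (inv_exp p2 - inv_exp p1) 0 = e" by (simp add: e_def)
  then show ?thesis using D main by (intro exI[of _ D]) auto
qed

section \<open>A Stromberg-Torchinsky inequality\<close>

lemma powr_weight_sum_le:
  fixes a b :: "'a::real_normed_vector"
  assumes "0 \<le> N"
  shows "(1 + norm a) powr (-N) * (1 + norm b) powr (-N) \<le> (1 + norm (a + b)) powr (-N)"
proof -
  have "0 < 1 + norm (a + b)" by (simp add: add_pos_nonneg)
  then have "((1 + norm a) * (1 + norm b)) powr (-N) \<le> (1 + norm (a + b)) powr (-N)"
    using weight_submult[of a b] assms by (intro powr_mono2') auto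
  then show ?thesis by (simp add: powr_mult)
qed

text \<open>Let S be the supremum of F w (1 + norm (z - w))^(-N). Inside the average only the r-th
  power of F is kept; the remaining power is at most that of S (1 + norm (z - u))^N, which gives S
  at most C S^(1 - r) J. Division by S^(1 - r) needs S finite, which is the hypothesis
  \<open>bdd\<close>.\<close>

lemma maximal_inequality_aux:
  fixes F :: "'a::euclidean_space \<Rightarrow> real"
  assumes [measurable]: "F \<in> borel_measurable borel" and F0: "\<And>z. 0 \<le> F z"
    and bdd: "bdd_above (range (\<lambda>w. F w * (1 + norm (z - w)) powr (-N)))"
    and rep: "\<And>z. ennreal (F z) \<le> ennreal C * (\<integral>\<^sup>+w. ennreal (F w * (1 + norm (z - w)) powr (-N)) \<partial>lborel)"
    and C: "1 \<le> C" and N: "0 \<le> N" and r: "0 < r" "r \<le> 1"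
  shows "ennreal (F z powr r) \<le> ennreal C * (\<integral>\<^sup>+u. ennreal (F u powr r * (1 + norm (z - u)) powr (- (N * r))) \<partial>lborel)"
proof -
  define S where "S = (SUP w. F w * (1 + norm (z - w)) powr (-N))"
  define J where "J = (\<integral>\<^sup>+u. ennreal (F u powr r * (1 + norm (z - u)) powr (- (N * r))) \<partial>lborel)"
  have wS: "F w * (1 + norm (z - w)) powr (-N) \<le> S" for w
    unfolding S_def using bdd by (intro cSUP_upper) auto
  have FzS: "F z \<le> S" using wS[of z] by simp
  have S0: "0 \<le> S" using FzS F0[of z] by simp
  show ?thesis unfolding J_def[symmetric]
  proof (cases "J = \<infinity> \<or> S = 0")
    case True
    then show "ennreal (F z powr r) \<le> ennreal C * J"
      using C FzS F0[of z] by (auto simp: ennreal_mult_top)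
  next
    case False
    then obtain j where j: "J = ennreal j" "0 \<le> j" by (cases J) auto
    have Spos: "0 < S" using False S0 by simp
    have FuS: "F u \<le> S * (1 + norm (z - u)) powr N" for u
    proof -
      have "0 < 1 + norm (z - u)" by (simp add: add_pos_nonneg)
      then have "F u = (F u * (1 + norm (z - u)) powr (-N)) * (1 + norm (z - u)) powr N"
        by (simp add: powr_minus)
      also have "\<dots> \<le> S * (1 + norm (z - u)) powr N" using wS[of u] by (intro mult_right_mono) auto
      finally show ?thesis .
    qed
    have pt: "F u * (1 + norm (w - u)) powr (-N) * (1 + norm (z - w)) powr (-N)
      \<le> S powr (1 - r) * (F u powr r * (1 + norm (z - u)) powr (- (N * r)))" for u w
    proof (cases "F u = 0")
      case False
      have "F u = F u powr r * F u powr (1 - r)" using False F0[of u] by (simp add: powr_add[symmetric])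
      also have "\<dots> \<le> F u powr r * (S * (1 + norm (z - u)) powr N) powr (1 - r)"
        using r F0[of u] FuS by (intro mult_left_mono powr_mono2) auto
      also have "\<dots> = F u powr r * (S powr (1 - r) * (1 + norm (z - u)) powr (N * (1 - r)))"
        by (simp add: powr_mult powr_powr)
      finally have 1: "F u \<le> F u powr r * (S powr (1 - r) * (1 + norm (z - u)) powr (N * (1 - r)))" .
      have 2: "(1 + norm (w - u)) powr (-N) * (1 + norm (z - w)) powr (-N) \<le> (1 + norm (z - u)) powr (-N)"
        using powr_weight_sum_le[OF N, of "w - u" "z - w"] by simp
      have "F u * ((1 + norm (w - u)) powr (-N) * (1 + norm (z - w)) powr (-N))
         \<le> (F u powr r * (S powr (1 - r) * (1 + norm (z - u)) powr (N * (1 - r)))) * (1 + norm (z - u)) powr (-N)"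
        using F0[of u] by (intro mult_mono 1 2) auto
      also have "\<dots> = F u powr r * S powr (1 - r) * ((1 + norm (z - u)) powr (N * (1 - r)) * (1 + norm (z - u)) powr (-N))"
        by (simp only: ac_simps)
      also have "(1 + norm (z - u)) powr (N * (1 - r)) * (1 + norm (z - u)) powr (-N) = (1 + norm (z - u)) powr (- (N * r))"
        unfolding weight_powr_add by (simp add: algebra_simps)
      finally show ?thesis by (simp add: ac_simps)
    qed simp
    have "F w * (1 + norm (z - w)) powr (-N) \<le> C * S powr (1 - r) * j" for w
    proof -
      have "ennreal (F w * (1 + norm (z - w)) powr (-N)) = ennreal (F w) * ennreal ((1 + norm (z - w)) powr (-N))"
        using F0 by (simp add: ennreal_mult)
      also have "\<dots> \<le> (ennreal C * (\<integral>\<^sup>+u. ennreal (F u * (1 + norm (w - u)) powr (-N)) \<partial>lborel)) * ennreal ((1 + norm (z - w)) powr (-N))"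
        by (intro mult_right_mono rep) auto
      also have "\<dots> = ennreal C * (\<integral>\<^sup>+u. ennreal (F u * (1 + norm (w - u)) powr (-N) * (1 + norm (z - w)) powr (-N)) \<partial>lborel)"
        using F0 by (simp add: mult.assoc nn_integral_multc[symmetric] ennreal_mult[symmetric])
      also have "\<dots> \<le> ennreal C * (\<integral>\<^sup>+u. ennreal (S powr (1 - r)) * ennreal (F u powr r * (1 + norm (z - u)) powr (- (N * r))) \<partial>lborel)"
        using pt by (intro mult_left_mono nn_integral_mono) (auto simp: ennreal_mult[symmetric] intro!: ennreal_leI)
      also have "\<dots> = ennreal C * (ennreal (S powr (1 - r)) * J)"
        unfolding J_def by (subst nn_integral_cmult) auto
      also have "\<dots> = ennreal (C * S powr (1 - r) * j)"
        using C j by (simp add: ennreal_mult[symmetric] mult.assoc)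
      finally show ?thesis using C j by (subst (asm) ennreal_le_iff) auto
    qed
    then have "S \<le> C * S powr (1 - r) * j" unfolding S_def by (intro cSUP_least) auto
    then have "S powr r * S powr (1 - r) \<le> (C * j) * S powr (1 - r)"
      using Spos by (simp add: powr_add[symmetric] ac_simps)
    then have "S powr r \<le> C * j" using Spos by simp
    moreover have "F z powr r \<le> S powr r" using FzS F0[of z] r by (intro powr_mono2) auto
    ultimately show "ennreal (F z powr r) \<le> ennreal C * J"
      using C j by (simp add: ennreal_mult[symmetric] ennreal_leI)
  qed
qed

text \<open>Finiteness of the supremum is bootstrapped. At an order L above the growth exponent it
  is clear; the inequality obtained there bounds the supremum of order N when the right side is
  finite, and the auxiliary lemma is applied again at order N. The second round replaces C L by C N,
  a constant independent of the growth of F.\<close>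

lemma maximal_inequality:
  fixes F :: "'a::euclidean_space \<Rightarrow> real"
  assumes Fm [measurable]: "F \<in> borel_measurable borel" and F0: "\<And>z. 0 \<le> F z"
    and grow: "\<And>z. F z \<le> A * (1 + norm z) powr K"
    and rep: "\<And>n z. 0 \<le> n \<Longrightarrow> ennreal (F z) \<le> ennreal (C n) * (\<integral>\<^sup>+w. ennreal (F w * (1 + norm (z - w)) powr (-n)) \<partial>lborel)"
    and C: "\<And>n. 1 \<le> C n" and N: "0 \<le> N" and r: "0 < r" "r \<le> 1"
  shows "ennreal (F z powr r) \<le> ennreal (C N) * (\<integral>\<^sup>+u. ennreal (F u powr r * (1 + norm (z - u)) powr (- (N * r))) \<partial>lborel)"
proof -
  define J where "J N z = (\<integral>\<^sup>+u. ennreal (F u powr r * (1 + norm (z - u)) powr (- (N * r))) \<partial>lborel)" for N z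
  define L where "L = max N K"
  have L: "0 \<le> L" "N \<le> L" "K \<le> L" using N by (auto simp: L_def)
  have "0 \<le> A * (1 + norm (0::'a)) powr K" using grow[of 0] F0[of 0] by linarith
  then have A0: "0 \<le> A" by simp
  have bddL: "bdd_above (range (\<lambda>w. F w * (1 + norm (z - w)) powr (-L)))" for z
  proof (rule bdd_aboveI2)
    fix w
    have "F w \<le> A * (1 + norm w) powr L"
      by (rule order_trans[OF grow]) (use A0 L in \<open>auto intro!: mult_left_mono powr_mono\<close>)
    then have "F w * (1 + norm (z - w)) powr (-L) \<le> (A * (1 + norm w) powr L) * (1 + norm (z - w)) powr (-L)"
      by (intro mult_right_mono) auto
    also have "\<dots> \<le> (A * (1 + norm w) powr L) * ((1 + norm w) powr (-L) * (1 + norm (z - w - (- w))) powr L)"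
      using peetre[OF L(1), of "z - w" "- w"] A0 by (intro mult_left_mono) auto
    also have "\<dots> = A * ((1 + norm w) powr L * (1 + norm w) powr (-L)) * (1 + norm z) powr L"
      by (simp add: ac_simps)
    also have "(1 + norm w) powr L * (1 + norm w) powr (-L) = 1"
      unfolding weight_powr_add by (simp add: add_nonneg_eq_0_iff)
    finally show "F w * (1 + norm (z - w)) powr (-L) \<le> A * 1 * (1 + norm z) powr L" .
  qed
  have JL: "ennreal (F z powr r) \<le> ennreal (C L) * J L z" for z
    unfolding J_def by (rule maximal_inequality_aux[OF Fm F0 bddL rep[OF L(1)] C L(1) r])
  show ?thesis
  proof (cases "J N z = \<infinity>")
    case True
    then show ?thesis using C[of N] by (simp add: J_def[symmetric] ennreal_mult_top)
  next
    case False
    then obtain j where j: "J N z = ennreal j" "0 \<le> j" by (cases "J N z") auto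
    have bddN: "bdd_above (range (\<lambda>w. F w * (1 + norm (z - w)) powr (-N)))"
    proof (rule bdd_aboveI2)
      fix w
      have "ennreal (F w powr r * (1 + norm (z - w)) powr (- (N * r))) \<le> (ennreal (C L) * J L w) * ennreal ((1 + norm (z - w)) powr (- (N * r)))"
        using JL[of w] by (simp add: ennreal_mult mult_right_mono)
      also have "\<dots> = ennreal (C L) * (\<integral>\<^sup>+u. ennreal (F u powr r * (1 + norm (w - u)) powr (- (L * r)) * (1 + norm (z - w)) powr (- (N * r))) \<partial>lborel)"
        unfolding J_def by (simp add: mult.assoc nn_integral_multc[symmetric] ennreal_mult[symmetric])
      also have "\<dots> \<le> ennreal (C L) * J N z" unfolding J_def
      proof (intro mult_left_mono nn_integral_mono ennreal_leI)
        fix u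
        have "(1 + norm (w - u)) powr (- (L * r)) * (1 + norm (z - w)) powr (- (N * r)) \<le> (1 + norm (w - u)) powr (- (N * r)) * (1 + norm (z - w)) powr (- (N * r))"
          using L r by (intro mult_right_mono powr_weight_antimono) auto
        also have "\<dots> \<le> (1 + norm (z - u)) powr (- (N * r))"
          using powr_weight_sum_le[of "N * r" "w - u" "z - w"] N r by simp
        finally show "F u powr r * (1 + norm (w - u)) powr (- (L * r)) * (1 + norm (z - w)) powr (- (N * r)) \<le> F u powr r * (1 + norm (z - u)) powr (- (N * r))"
          by (simp add: mult.assoc mult_left_mono)
      qed simp
      also have "\<dots> = ennreal (C L * j)" using C[of L] j by (simp add: ennreal_mult)
      finally have "F w powr r * (1 + norm (z - w)) powr (- (N * r)) \<le> C L * j"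
        using C[of L] j by (subst (asm) ennreal_le_iff) auto
      then have "(F w * (1 + norm (z - w)) powr (-N)) powr r \<le> C L * j"
        by (simp add: powr_mult powr_powr)
      then have "((F w * (1 + norm (z - w)) powr (-N)) powr r) powr (1 / r) \<le> (C L * j) powr (1 / r)"
        using r by (intro powr_mono2) auto
      then show "F w * (1 + norm (z - w)) powr (-N) \<le> (C L * j) powr (1 / r)"
        using r F0[of w] by (simp add: powr_powr)
    qed
    show ?thesis by (rule maximal_inequality_aux[OF Fm F0 bddN rep[OF N] C N r])
  qed
qed

section \<open>Local averages in mixed norms\<close>

definition locavg :: "real \<Rightarrow> real \<Rightarrow> ('a::euclidean_space \<Rightarrow> real) \<Rightarrow> 'a \<Rightarrow> ennreal" where
  "locavg r K F z = enn_powr (\<integral>\<^sup>+u. ennreal (F u powr r * (1 + norm (z - u)) powr (- K)) \<partial>lborel) (1 / r)"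

lemma locavg_measurable:
  assumes [measurable]: "F \<in> borel_measurable borel"
  shows "locavg r K F \<in> borel_measurable borel"
proof -
  have "(\<lambda>(z, u). ennreal (F u powr r * (1 + norm (z - u)) powr (- K))) \<in> borel_measurable (borel \<Otimes>\<^sub>M lborel)"
    by measurable
  from lborel.borel_measurable_nn_integral_fst[OF this]
  show ?thesis unfolding locavg_def[abs_def] by (intro enn_powr_measurable) simp
qed

text \<open>Peetre's inequality under the integral; the outer root divides the exponent by
  \<open>r\<close>.\<close>

lemma moderate_locavg:
  assumes [measurable]: "F \<in> borel_measurable borel" and r: "0 < r" and K: "0 \<le> K"
  shows "moderate (K / r) (locavg r K F)"
  unfolding moderate_def
proof (intro allI)
  fix x v
  have "(\<integral>\<^sup>+u. ennreal (F u powr r * (1 + norm (x + v - u)) powr (- K)) \<partial>lborel)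
     \<le> (\<integral>\<^sup>+u. ennreal ((1 + norm v) powr K) * ennreal (F u powr r * (1 + norm (x - u)) powr (- K)) \<partial>lborel)"
  proof (rule nn_integral_mono)
    fix u
    have "(1 + norm (x + v - u)) powr (- K) \<le> (1 + norm (x - u)) powr (- K) * (1 + norm v) powr K"
      using peetre[OF K, of "x + v - u" "x - u"] by simp
    then have "F u powr r * (1 + norm (x + v - u)) powr (- K) \<le> F u powr r * ((1 + norm (x - u)) powr (- K) * (1 + norm v) powr K)"
      by (intro mult_left_mono) auto
    then show "ennreal (F u powr r * (1 + norm (x + v - u)) powr (- K)) \<le> ennreal ((1 + norm v) powr K) * ennreal (F u powr r * (1 + norm (x - u)) powr (- K))"
      by (simp add: ennreal_mult[symmetric] ac_simps ennreal_leI)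
  qed
  also have "\<dots> = ennreal ((1 + norm v) powr K) * (\<integral>\<^sup>+u. ennreal (F u powr r * (1 + norm (x - u)) powr (- K)) \<partial>lborel)"
    by (rule nn_integral_cmult) measurable
  finally have "locavg r K F (x + v) \<le> enn_powr (ennreal ((1 + norm v) powr K) * (\<integral>\<^sup>+u. ennreal (F u powr r * (1 + norm (x - u)) powr (- K)) \<partial>lborel)) (1 / r)"
    unfolding locavg_def using r by (intro enn_powr_mono) auto
  also have "\<dots> = ennreal ((1 + norm v) powr (K / r)) * locavg r K F x"
    unfolding locavg_def using r by (simp add: enn_powr_mult enn_powr_ennreal powr_powr)
  finally show "locavg r K F (x + v) \<le> ennreal ((1 + norm v) powr (K / r)) * locavg r K F x" .
qed

lemma LpN_moderate:
  fixes G :: "(real^'n::finite) \<times> (real^'n) \<Rightarrow> ennreal"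
  assumes [measurable]: "G \<in> borel_measurable borel" and mod: "moderate K G" and p: "0 < p"
  shows "moderate K (\<lambda>x. G (x, \<xi>))" "moderate K (\<lambda>\<xi>. LpN p (\<lambda>x. G (x, \<xi>)))"
proof -
  have [measurable]: "(\<lambda>x. G (x, \<xi>)) \<in> borel_measurable borel" for \<xi> by measurable
  show "moderate K (\<lambda>x. G (x, \<xi>))"
    unfolding moderate_def
  proof (intro allI)
    fix x v show "G (x + v, \<xi>) \<le> ennreal ((1 + norm v) powr K) * G (x, \<xi>)"
      using mod[unfolded moderate_def, rule_format, of "(x, \<xi>)" "(v, 0)"] by (simp add: norm_Pair)
  qed
  show "moderate K (\<lambda>\<xi>. LpN p (\<lambda>x. G (x, \<xi>)))"
    unfolding moderate_def
  proof (intro allI)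
    fix \<xi> v
    have "LpN p (\<lambda>x. G (x, \<xi> + v)) \<le> LpN p (\<lambda>x. ennreal ((1 + norm v) powr K) * G (x, \<xi>))"
    proof (rule LpN_mono)
      show "G (x, \<xi> + v) \<le> ennreal ((1 + norm v) powr K) * G (x, \<xi>)" for x
        using mod[unfolded moderate_def, rule_format, of "(x, \<xi>)" "(0, v)"] by (simp add: norm_Pair)
    qed (use p in auto)
    also have "\<dots> \<le> ennreal ((1 + norm v) powr K) * LpN p (\<lambda>x. G (x, \<xi>))"
      by (rule LpN_cmult_le) (use p in auto)
    finally show "LpN p (\<lambda>x. G (x, \<xi> + v)) \<le> ennreal ((1 + norm v) powr K) * LpN p (\<lambda>x. G (x, \<xi>))" .
  qed
qed

text \<open>The average superposes translates of \<open>F\<close> against a finite measure of mass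
  \<open>c\<close>. Since \<open>r\<close> is at most \<open>p\<close> and \<open>q\<close>,
  \<open>Minkowski_LpN\<close> moves the norms inside, first in x and then in \<xi>, and
  translations do not increase them.\<close>

lemma locavg_norm:
  fixes F :: "(real^'n::finite) \<times> (real^'n) \<Rightarrow> real"
  assumes Fm [measurable]: "F \<in> borel_measurable borel" and F0: "\<And>z. 0 \<le> F z"
    and r: "0 < r" "ennreal r \<le> p" "ennreal r \<le> q" and K: "0 < c" "(\<integral>\<^sup>+u. ennreal ((1 + norm (u::(real^'n) \<times> (real^'n))) powr (-K)) \<partial>lborel) = ennreal c"
  shows "LpN q (\<lambda>\<xi>. LpN p (\<lambda>x. locavg r K F (x, \<xi>))) \<le> ennreal (c powr (1 / r)) * LpN q (\<lambda>\<xi>. LpN p (\<lambda>x. ennreal (F (x, \<xi>))))"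
proof -
  define a where "a u = ennreal ((1 + norm u) powr (-K))" for u :: "(real^'n) \<times> (real^'n)"
  have am [measurable]: "a \<in> borel_measurable borel" unfolding a_def by measurable
  define M where "M = density lborel a"
  have setsM: "sets M = sets borel" by (simp add: M_def)
  have MS: "emeasure M (space M) = ennreal c"
    unfolding M_def by (subst emeasure_density) (auto simp: a_def K)
  have Mfin: "emeasure M (space M) < \<infinity>" by (simp add: MS)
  have pq: "0 < p" "0 < q" using r by (metis ennreal_less_zero_iff less_le_trans)+
  have setsP: "sets (lborel \<Otimes>\<^sub>M M) = sets (borel :: ((real^'n) \<times> (real^'n) \<times> (real^'n)) measure)"
    by (rule trans[OF sets_pair_measure_cong[OF sets_lborel setsM] arg_cong[where f=sets, OF borel_prod]])
  have measP: "f \<in> borel_measurable (lborel \<Otimes>\<^sub>M M)" if "f \<in> borel_measurable borel" for f :: "(real^'n) \<times> (real^'n) \<times> (real^'n) \<Rightarrow> ennreal"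
    using that by (simp add: measurable_cong_sets[OF setsP refl])
  have G: "locavg r K F (x, \<xi>) = enn_powr (\<integral>\<^sup>+u. enn_powr (ennreal (F (x - fst u, \<xi> - snd u))) r \<partial>M) (1 / r)" for x \<xi>
  proof -
    have "(\<integral>\<^sup>+u. ennreal (F u powr r * (1 + norm ((x, \<xi>) - u)) powr (- K)) \<partial>lborel)
       = (\<integral>\<^sup>+u. ennreal (F ((x, \<xi>) - u) powr r * (1 + norm ((x, \<xi>) - ((x, \<xi>) - u))) powr (- K)) \<partial>lborel)"
      by (rule lborel_nn_integral_minus[symmetric]) measurable
    have [measurable, simp]: "(\<lambda>u. F (x - fst u, \<xi> - snd u)) \<in> borel_measurable borel"
      by (rule measurable_compose[OF borel_measurable_continuous_onI Fm]) (intro continuous_intros)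
    have [simp]: "(\<lambda>u. F (x - fst u, \<xi> - snd u) powr r) \<in> borel_measurable borel" by measurable
    note \<open>(\<integral>\<^sup>+u. ennreal (F u powr r * (1 + norm ((x, \<xi>) - u)) powr (- K)) \<partial>lborel) = _\<close>
    also have "(\<integral>\<^sup>+u. ennreal (F ((x, \<xi>) - u) powr r * (1 + norm ((x, \<xi>) - ((x, \<xi>) - u))) powr (- K)) \<partial>lborel)
       = (\<integral>\<^sup>+u. enn_powr (ennreal (F (x - fst u, \<xi> - snd u))) r \<partial>M)"
      unfolding M_def a_def using F0
      by (subst nn_integral_density) (auto simp: enn_powr_ennreal ennreal_mult[symmetric] mult.commute minus_prod_def)
    finally show ?thesis by (simp add: locavg_def)
  qed
  define \<Psi> where "\<Psi> \<eta> = LpN p (\<lambda>x. ennreal (F (x, \<eta>)))" for \<eta>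
  have \<Psi>m [measurable]: "\<Psi> \<in> borel_measurable borel"
    unfolding \<Psi>_def by (rule LpN_measurable[where G="\<lambda>\<eta> x. ennreal (F (x, \<eta>))"]) measurable
  have sub_le: "LpN p (\<lambda>x. ennreal (F (x - a, \<eta>))) \<le> \<Psi> \<eta>" for a \<eta>
    unfolding \<Psi>_def by (rule LpN_translate_le[where G="\<lambda>x. ennreal (F (x, \<eta>))"]) measurable
  have inner: "LpN p (\<lambda>x. locavg r K F (x, \<xi>)) \<le> enn_powr (\<integral>\<^sup>+u. enn_powr (\<Psi> (\<xi> - snd u)) r \<partial>M) (1 / r)" for \<xi>
  proof -
    have "LpN p (\<lambda>x. enn_powr (\<integral>\<^sup>+u. enn_powr (ennreal (F (x - fst u, \<xi> - snd u))) r \<partial>M) (1 / r))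
      \<le> enn_powr (\<integral>\<^sup>+u. enn_powr (LpN p (\<lambda>x. ennreal (F (x - fst u, \<xi> - snd u)))) r \<partial>M) (1 / r)"
    proof (rule Minkowski_LpN[where F="\<lambda>x u. ennreal (F (x - fst u, \<xi> - snd u))", OF _ Mfin r(1,2)])
      have [measurable]: "(\<lambda>z. F (fst z - fst (snd z), \<xi> - snd (snd z))) \<in> borel_measurable borel"
        by (rule measurable_compose[OF borel_measurable_continuous_onI Fm]) (intro continuous_intros)
      show "(\<lambda>z. ennreal (F (fst z - fst (snd z), \<xi> - snd (snd z)))) \<in> borel_measurable (lborel \<Otimes>\<^sub>M M)"
        by (rule measP) measurable
      have "(\<lambda>u. LpN p (\<lambda>x. ennreal (F (x - fst u, \<xi> - snd u)))) \<in> borel_measurable borel"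
      proof (rule LpN_measurable[where G="\<lambda>u x. ennreal (F (x - fst u, \<xi> - snd u))"])
        have [measurable]: "(\<lambda>z. F (snd z - fst (fst z), \<xi> - snd (fst z))) \<in> borel_measurable borel"
          by (rule measurable_compose[OF borel_measurable_continuous_onI Fm]) (intro continuous_intros)
        show "(\<lambda>z. ennreal (F (snd z - fst (fst z), \<xi> - snd (fst z)))) \<in> borel_measurable (borel \<Otimes>\<^sub>M borel)"
          unfolding borel_prod by measurable
      qed
      then show "(\<lambda>u. LpN p (\<lambda>x. ennreal (F (x - fst u, \<xi> - snd u)))) \<in> borel_measurable M"
        by (simp add: M_def)
    qed
    also have "\<dots> \<le> enn_powr (\<integral>\<^sup>+u. enn_powr (\<Psi> (\<xi> - snd u)) r \<partial>M) (1 / r)"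
      using r by (intro enn_powr_mono nn_integral_mono sub_le) auto
    finally show ?thesis unfolding G .
  qed
  have "LpN q (\<lambda>\<xi>. LpN p (\<lambda>x. locavg r K F (x, \<xi>))) \<le> LpN q (\<lambda>\<xi>. enn_powr (\<integral>\<^sup>+u. enn_powr (\<Psi> (\<xi> - snd u)) r \<partial>M) (1 / r))"
  proof (rule LpN_mono[OF _ inner pq(2)])
    have [measurable]: "locavg r K F \<in> borel_measurable borel" by (rule locavg_measurable[OF Fm])
    show "(\<lambda>\<xi>. LpN p (\<lambda>x. locavg r K F (x, \<xi>))) \<in> borel_measurable borel"
      by (rule LpN_measurable[where G="\<lambda>\<xi> x. locavg r K F (x, \<xi>)"]) measurable
  qed
  also have "\<dots> \<le> enn_powr (\<integral>\<^sup>+u. enn_powr (LpN q (\<lambda>\<xi>. \<Psi> (\<xi> - snd u))) r \<partial>M) (1 / r)"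
  proof (rule Minkowski_LpN[where F="\<lambda>\<xi> u. \<Psi> (\<xi> - snd u)", OF _ Mfin r(1,3)])
    show "(\<lambda>z. \<Psi> (fst z - snd (snd z))) \<in> borel_measurable (lborel \<Otimes>\<^sub>M M)"
      by (rule measP, rule measurable_compose[OF borel_measurable_continuous_onI \<Psi>m]) (intro continuous_intros)
    have "(\<lambda>u. LpN q (\<lambda>\<xi>. \<Psi> (\<xi> - snd (u::(real^'n) \<times> (real^'n))))) \<in> borel_measurable borel"
    proof (rule LpN_measurable[where G="\<lambda>u \<xi>. \<Psi> (\<xi> - snd u)"])
      show "(\<lambda>z. \<Psi> (snd z - snd (fst z :: (real^'n) \<times> (real^'n)))) \<in> borel_measurable (borel \<Otimes>\<^sub>M borel)"
        unfolding borel_prod by (rule measurable_compose[OF borel_measurable_continuous_onI \<Psi>m]) (intro continuous_intros)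
    qed
    then show "(\<lambda>u. LpN q (\<lambda>\<xi>. \<Psi> (\<xi> - snd u))) \<in> borel_measurable M" by (simp add: M_def)
  qed
  also have "\<dots> \<le> enn_powr (\<integral>\<^sup>+u. enn_powr (LpN q \<Psi>) r \<partial>M) (1 / r)"
    using r by (intro enn_powr_mono nn_integral_mono LpN_translate_le) auto
  also have "\<dots> = ennreal (c powr (1 / r)) * LpN q \<Psi>"
    using r K(1) by (simp add: MS enn_powr_mult enn_powr_inverse enn_powr_ennreal mult.commute)
  finally show ?thesis by (simp add: \<Psi>_def[abs_def])
qed

text \<open>The maximal inequality at \<open>w\<close>, then slow variation of the average to pass
  from \<open>w\<close> to \<open>z\<close>.\<close>

lemma locavg_dominates:
  fixes F :: "'a::euclidean_space \<Rightarrow> real"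
  assumes Fm: "F \<in> borel_measurable borel" and F0: "\<And>z. 0 \<le> F z"
    and grow: "\<And>z. F z \<le> A * (1 + norm z) powr K"
    and rep: "\<And>n z. 0 \<le> n \<Longrightarrow> ennreal (F z) \<le> ennreal (C n) * (\<integral>\<^sup>+w. ennreal (F w * (1 + norm (z - w)) powr (-n)) \<partial>lborel)"
    and C: "\<And>n. 1 \<le> C n" and N: "0 \<le> N" and r: "0 < r" "r \<le> 1"
  shows "ennreal (F w) \<le> ennreal (C N powr (1 / r) * (1 + norm (z - w)) powr N) * locavg r (N * r) F z"
proof -
  have "ennreal (F w) = enn_powr (ennreal (F w powr r)) (1 / r)"
    using F0[of w] r by (simp add: enn_powr_ennreal powr_powr)
  also have "\<dots> \<le> enn_powr (ennreal (C N) * (\<integral>\<^sup>+u. ennreal (F u powr r * (1 + norm (w - u)) powr (- (N * r))) \<partial>lborel)) (1 / r)"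
    using r by (intro enn_powr_mono maximal_inequality[OF Fm F0 grow rep C N r]) auto
  also have "\<dots> = ennreal (C N powr (1 / r)) * locavg r (N * r) F w"
    using r C[of N] by (simp add: enn_powr_mult enn_powr_ennreal locavg_def)
  also have "\<dots> \<le> ennreal (C N powr (1 / r)) * (ennreal ((1 + norm (w - z)) powr (N * r / r)) * locavg r (N * r) F z)"
    using moderate_locavg[OF Fm r(1), of "N * r", unfolded moderate_def, rule_format, of z "w - z"] N r
    by (intro mult_left_mono) auto
  also have "\<dots> = ennreal (C N powr (1 / r) * (1 + norm (z - w)) powr N) * locavg r (N * r) F z"
    using r by (simp add: ennreal_mult mult.assoc norm_minus_commute)
  finally show ?thesis .
qed

text \<open>The order of quantifiers matters: the decay exponents depend only on the Lebesgue
  exponents and the dimension, so they can be fixed before the kernel estimates supply the other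
  data, and \<open>D\<close> is uniform in \<open>F\<close>, \<open>H\<close>, \<open>c\<close> and
  \<open>s\<close>.\<close>

lemma mixed_norm_estimate:
  fixes p1 p2 q1 q2 :: ennreal
  assumes pos: "0 < p1" "0 < p2" "0 < q1" "0 < q2"
  shows "\<exists>M\<ge>0. \<exists>N\<ge>0. \<forall>C. (\<forall>n. 1 \<le> C n) \<longrightarrow> (\<exists>D>0. \<forall>F H c s.
     F \<in> borel_measurable borel \<longrightarrow> (\<forall>z. 0 \<le> F z) \<longrightarrow> (\<exists>A K. \<forall>z. F z \<le> A * (1 + norm z) powr K) \<longrightarrow>
     (\<forall>n\<ge>0. \<forall>z. ennreal (F z) \<le> ennreal (C n) * (\<integral>\<^sup>+w. ennreal (F w * (1 + norm (z - w)) powr (-n)) \<partial>lborel)) \<longrightarrow>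
     H \<in> borel_measurable borel \<longrightarrow> 0 < s \<longrightarrow> 0 \<le> c \<longrightarrow>
     (\<forall>z. ennreal (H z) \<le> ennreal (c * (1 + s * norm z) powr (-M)) * (\<integral>\<^sup>+w. ennreal (F w * (1 + norm (z - w)) powr (-N)) \<partial>lborel)) \<longrightarrow>
     LpN q2 (\<lambda>\<xi>. LpN p2 (\<lambda>x. ennreal (H (x, \<xi>))))
       \<le> ennreal (D * c * s powr (- (real CARD('n) * (max (inv_exp p2 - inv_exp p1) 0 + max (inv_exp q2 - inv_exp q1) 0))))
          * LpN q1 (\<lambda>\<xi>. LpN p1 (\<lambda>x. ennreal (F (x :: real^'n::finite, \<xi> :: real^'n)))))"
proof -
  define fin where "fin p = (if p = \<infinity> then 1 else enn2real p)" for p :: ennreal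
  have fin0: "0 < fin p" if "0 < p" for p using that enn2real_pos[of p] by (auto simp: fin_def)
  \<comment> \<open>At most 1 for the maximal inequality, at most p1 and q1 for Minkowski.\<close>
  define r where "r = min 1 (min (fin p1) (fin q1))"
  have r: "0 < r" "r \<le> 1" using fin0 pos by (auto simp: r_def)
  have finle: "ennreal (fin p) \<le> p" if "0 < p" for p by (cases p) (auto simp: fin_def)
  have rp: "ennreal r \<le> p1" "ennreal r \<le> q1"
    by (rule order_trans[OF ennreal_leI finle[OF pos(1)]], simp add: r_def)
      (rule order_trans[OF ennreal_leI finle[OF pos(3)]], simp add: r_def)
  define d where "d = real CARD('n)"
  have d0: "0 \<le> d" by (simp add: d_def)
  \<comment> \<open>Large enough for the p2-th and q2-th powers of the one-variable cutoff to be
    integrable in dimension d.\<close>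
  define m where "m = 2 * d / fin p2 + 2 * d / fin q2"
  have m0: "0 \<le> m" using d0 fin0[OF pos(2)] fin0[OF pos(4)] by (auto simp: m_def)
  have mp: "p2 \<noteq> \<infinity> \<Longrightarrow> 2 * d \<le> m * enn2real p2" and mq: "q2 \<noteq> \<infinity> \<Longrightarrow> 2 * d \<le> m * enn2real q2"
  proof -
    have "2 * d / fin p2 \<le> m" "2 * d / fin q2 \<le> m" using d0 fin0[OF pos(2)] fin0[OF pos(4)] by (auto simp: m_def)
    then have "2 * d \<le> m * fin p2" "2 * d \<le> m * fin q2" using fin0[OF pos(2)] fin0[OF pos(4)] by (auto simp: pos_divide_le_eq)
    then show "p2 \<noteq> \<infinity> \<Longrightarrow> 2 * d \<le> m * enn2real p2" "q2 \<noteq> \<infinity> \<Longrightarrow> 2 * d \<le> m * enn2real q2"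
      by (auto simp: fin_def)
  qed
  \<comment> \<open>Twice the dimension 2 d of phase space, the threshold of
    \<open>nn_integral_weight\<close>; \<open>N\<close> is chosen so that the r-th power of its
    weight has order \<open>K\<close>.\<close>
  define K where "K = 4 * d"
  define N where "N = K / r"
  have NK: "N * r = K" using r by (simp add: N_def)
  have N0: "0 \<le> N" using d0 r by (simp add: N_def K_def)
  have K0: "0 \<le> K" using d0 by (simp add: K_def)
  have DZ: "2 * real DIM((real^'n) \<times> (real^'n)) \<le> K" by (simp add: K_def d_def)
  obtain ck where ck: "0 < ck" "(\<integral>\<^sup>+x. ennreal ((1 + norm (x::(real^'n) \<times> (real^'n))) powr (-K)) \<partial>lborel) = ennreal ck"
    using nn_integral_weight[OF DZ] by blast
  obtain C1 where C1: "0 < C1" "\<And>s (\<Phi> :: real^'n \<Rightarrow> ennreal). 0 < s \<Longrightarrow> \<Phi> \<in> borel_measurable borel \<Longrightarrow> moderate (K / r) \<Phi> \<Longrightarrow>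
     LpN p2 (\<lambda>x. ennreal ((1 + s * norm x) powr (-m)) * \<Phi> x)
       \<le> ennreal (C1 * s powr (- (d * max (inv_exp p2 - inv_exp p1) 0))) * LpN p1 \<Phi>"
    using weighted_LpN_bound[OF pos(1,2) _ m0 mp[unfolded d_def], of "K / r"] K0 r unfolding d_def by auto
  obtain C2 where C2: "0 < C2" "\<And>s (\<Phi> :: real^'n \<Rightarrow> ennreal). 0 < s \<Longrightarrow> \<Phi> \<in> borel_measurable borel \<Longrightarrow> moderate (K / r) \<Phi> \<Longrightarrow>
     LpN q2 (\<lambda>x. ennreal ((1 + s * norm x) powr (-m)) * \<Phi> x)
       \<le> ennreal (C2 * s powr (- (d * max (inv_exp q2 - inv_exp q1) 0))) * LpN q1 \<Phi>"
    using weighted_LpN_bound[OF pos(3,4) _ m0 mq[unfolded d_def], of "K / r"] K0 r unfolding d_def by auto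
  show ?thesis
  proof (rule exI[of _ "2 * m"], rule conjI, simp add: m0, rule exI[of _ "N + K"], rule conjI, simp add: N0 K0, rule allI, rule impI)
    fix C :: "real \<Rightarrow> real" assume C: "\<forall>n. 1 \<le> C n"
    then have C': "1 \<le> C n" for n by blast
    define D0 where "D0 = C N powr (1 / r) * ck"
    define D where "D = D0 * C1 * C2 * ck powr (1 / r)"
    have D0: "0 < D0" using C'[of N] ck(1) by (simp add: D0_def)
    have D: "0 < D" using D0 C1(1) C2(1) ck(1) by (simp add: D_def)
    have main: "LpN q2 (\<lambda>\<xi>. LpN p2 (\<lambda>x. ennreal (H (x, \<xi>))))
       \<le> ennreal (D * c * s powr (- (d * (max (inv_exp p2 - inv_exp p1) 0 + max (inv_exp q2 - inv_exp q1) 0))))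
          * LpN q1 (\<lambda>\<xi>. LpN p1 (\<lambda>x. ennreal (F (x, \<xi>))))"
      if Fm [measurable]: "F \<in> borel_measurable borel" and F0: "\<And>z. 0 \<le> F z" and gr: "\<exists>A K. \<forall>z. F z \<le> A * (1 + norm z) powr K"
        and rep: "\<And>n z. 0 \<le> n \<Longrightarrow> ennreal (F z) \<le> ennreal (C n) * (\<integral>\<^sup>+w. ennreal (F w * (1 + norm (z - w)) powr (-n)) \<partial>lborel)"
        and Hm [measurable]: "H \<in> borel_measurable borel" and s: "0 < s" and c: "0 \<le> c"
        and H: "\<And>z. ennreal (H z) \<le> ennreal (c * (1 + s * norm z) powr (- (2 * m))) * (\<integral>\<^sup>+w. ennreal (F w * (1 + norm (z - w)) powr (- (N + K))) \<partial>lborel)"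
      for F H :: "(real^'n) \<times> (real^'n) \<Rightarrow> real" and c s
    proof -
      obtain A L where AL: "\<And>z. F z \<le> A * (1 + norm z) powr L" using gr by blast
      define G where "G = locavg r K F"
      have Gm [measurable]: "G \<in> borel_measurable borel" unfolding G_def by (rule locavg_measurable[OF Fm])
      have Gmod: "moderate (K / r) G" unfolding G_def by (rule moderate_locavg[OF Fm r(1) K0])
      have FG: "ennreal (F w) \<le> ennreal (C N powr (1 / r) * (1 + norm (z - w)) powr N) * G z" for w z
        using locavg_dominates[OF Fm F0 AL rep C' N0 r, of w z] by (simp add: NK G_def)
      have FI: "(\<integral>\<^sup>+w. ennreal (F w * (1 + norm (z - w)) powr (- (N + K))) \<partial>lborel) \<le> ennreal D0 * G z" for z
      proof -
        have "(\<integral>\<^sup>+w. ennreal (F w * (1 + norm (z - w)) powr (- (N + K))) \<partial>lborel)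
          \<le> (\<integral>\<^sup>+w. ennreal (C N powr (1 / r)) * G z * ennreal ((1 + norm (z - w)) powr (- K)) \<partial>lborel)"
        proof (rule nn_integral_mono)
          fix w
          have "ennreal (F w * (1 + norm (z - w)) powr (- (N + K))) = ennreal (F w) * ennreal ((1 + norm (z - w)) powr (- (N + K)))"
            using F0 by (simp add: ennreal_mult)
          also have "\<dots> \<le> (ennreal (C N powr (1 / r) * (1 + norm (z - w)) powr N) * G z) * ennreal ((1 + norm (z - w)) powr (- (N + K)))"
            by (intro mult_right_mono FG) auto
          also have "\<dots> = ennreal (C N powr (1 / r) * ((1 + norm (z - w)) powr N * (1 + norm (z - w)) powr (- (N + K)))) * G z"
            by (simp add: ennreal_mult ac_simps)
          also have "(1 + norm (z - w)) powr N * (1 + norm (z - w)) powr (- (N + K)) = (1 + norm (z - w)) powr (- K)"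
            unfolding weight_powr_add by simp
          finally show "ennreal (F w * (1 + norm (z - w)) powr (- (N + K))) \<le> ennreal (C N powr (1 / r)) * G z * ennreal ((1 + norm (z - w)) powr (- K))"
            by (simp add: ennreal_mult ac_simps)
        qed
        also have "\<dots> = ennreal (C N powr (1 / r)) * G z * (\<integral>\<^sup>+w. ennreal ((1 + norm (z - w)) powr (- K)) \<partial>lborel)"
          by (rule nn_integral_cmult) measurable
        also have "(\<integral>\<^sup>+w. ennreal ((1 + norm (z - w)) powr (- K)) \<partial>lborel) = ennreal ck"
          using lborel_nn_integral_minus[of "\<lambda>w. ennreal ((1 + norm w) powr (- K))" z] ck(2) by simp
        finally show ?thesis using ck(1) by (simp add: D0_def ennreal_mult ac_simps)
      qed
      define W where "W x = ennreal ((1 + s * norm x) powr (- m))" for x :: "real^'n"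
      have Wm [measurable]: "W \<in> borel_measurable borel" unfolding W_def by measurable
      \<comment> \<open>The cutoff of order 2 m is split into one of order m in each variable, so
        that the two one-variable estimates can be used in turn.\<close>
      have HW: "ennreal (H (x, \<xi>)) \<le> ennreal (c * D0) * W \<xi> * (W x * G (x, \<xi>))" for x \<xi>
      proof -
        have n: "norm x \<le> norm (x, \<xi>)" "norm \<xi> \<le> norm (x, \<xi>)" by (auto simp: norm_Pair intro!: real_le_rsqrt)
        have pp: "0 < 1 + s * norm x" "0 < 1 + s * norm \<xi>" using s by (auto intro!: add_pos_nonneg)
        have "(1 + s * norm (x, \<xi>)) powr (- (2 * m)) = (1 + s * norm (x, \<xi>)) powr (- m) * (1 + s * norm (x, \<xi>)) powr (- m)"
          by (simp add: powr_add[symmetric])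
        also have "\<dots> \<le> (1 + s * norm x) powr (- m) * (1 + s * norm \<xi>) powr (- m)"
          using s m0 n pp by (intro mult_mono powr_mono2') (auto intro: mult_left_mono)
        finally have w: "(1 + s * norm (x, \<xi>)) powr (- (2 * m)) \<le> (1 + s * norm x) powr (- m) * (1 + s * norm \<xi>) powr (- m)" .
        have "ennreal (H (x, \<xi>)) \<le> ennreal (c * (1 + s * norm (x, \<xi>)) powr (- (2 * m))) * (ennreal D0 * G (x, \<xi>))"
          by (rule order_trans[OF H mult_left_mono[OF FI]]) simp
        also have "\<dots> \<le> ennreal (c * ((1 + s * norm x) powr (- m) * (1 + s * norm \<xi>) powr (- m))) * (ennreal D0 * G (x, \<xi>))"
          using w c by (intro mult_right_mono ennreal_leI mult_left_mono) auto
        also have "\<dots> = ennreal (c * D0) * W \<xi> * (W x * G (x, \<xi>))"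
          using c D0 by (simp add: W_def ennreal_mult ac_simps)
        finally show ?thesis .
      qed
      define e1 where "e1 = s powr (- (d * max (inv_exp p2 - inv_exp p1) 0))"
      define e2 where "e2 = s powr (- (d * max (inv_exp q2 - inv_exp q1) 0))"
      have e12: "s powr (- (d * (max (inv_exp p2 - inv_exp p1) 0 + max (inv_exp q2 - inv_exp q1) 0))) = e1 * e2"
        unfolding e1_def e2_def powr_add[symmetric] by (simp add: algebra_simps)
      define \<Psi> where "\<Psi> \<xi> = LpN p1 (\<lambda>x. G (x, \<xi>))" for \<xi>
      have \<Psi>m [measurable]: "\<Psi> \<in> borel_measurable borel"
        unfolding \<Psi>_def by (rule LpN_measurable[where G="\<lambda>\<xi> x. G (x, \<xi>)"]) measurable
      have \<Psi>mod: "moderate (K / r) \<Psi>" unfolding \<Psi>_def by (rule LpN_moderate[OF Gm Gmod pos(1)])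
      have in_le: "LpN p2 (\<lambda>x. ennreal (H (x, \<xi>))) \<le> ennreal (c * D0 * C1 * e1) * (W \<xi> * \<Psi> \<xi>)" for \<xi>
      proof -
        have "LpN p2 (\<lambda>x. ennreal (H (x, \<xi>))) \<le> LpN p2 (\<lambda>x. ennreal (c * D0) * W \<xi> * (W x * G (x, \<xi>)))"
          by (rule LpN_mono[OF _ HW pos(2)]) measurable
        also have "\<dots> \<le> ennreal (c * D0) * W \<xi> * LpN p2 (\<lambda>x. W x * G (x, \<xi>))"
          by (rule LpN_cmult_le[OF _ pos(2)]) measurable
        also have "\<dots> \<le> ennreal (c * D0) * W \<xi> * (ennreal (C1 * e1) * \<Psi> \<xi>)"
          unfolding W_def \<Psi>_def e1_def
          by (intro mult_left_mono C1(2) s LpN_moderate[OF Gm Gmod pos(1)]) auto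
        also have "\<dots> = ennreal (c * D0 * C1 * e1) * (W \<xi> * \<Psi> \<xi>)"
          using c D0 C1(1) by (simp add: ennreal_mult e1_def ac_simps)
        finally show ?thesis .
      qed
      have "LpN q2 (\<lambda>\<xi>. LpN p2 (\<lambda>x. ennreal (H (x, \<xi>)))) \<le> LpN q2 (\<lambda>\<xi>. ennreal (c * D0 * C1 * e1) * (W \<xi> * \<Psi> \<xi>))"
      proof (rule LpN_mono[OF _ in_le pos(4)])
        show "(\<lambda>\<xi>. LpN p2 (\<lambda>x. ennreal (H (x, \<xi>)))) \<in> borel_measurable borel"
          by (rule LpN_measurable[where G="\<lambda>\<xi> x. ennreal (H (x, \<xi>))"]) measurable
      qed
      also have "\<dots> \<le> ennreal (c * D0 * C1 * e1) * LpN q2 (\<lambda>\<xi>. W \<xi> * \<Psi> \<xi>)"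
        by (rule LpN_cmult_le[OF _ pos(4)]) measurable
      also have "\<dots> \<le> ennreal (c * D0 * C1 * e1) * (ennreal (C2 * e2) * LpN q1 \<Psi>)"
        unfolding W_def e2_def by (intro mult_left_mono C2(2) s \<Psi>m \<Psi>mod) auto
      also have "\<dots> \<le> ennreal (c * D0 * C1 * e1) * (ennreal (C2 * e2) * (ennreal (ck powr (1 / r)) * LpN q1 (\<lambda>\<xi>. LpN p1 (\<lambda>x. ennreal (F (x, \<xi>))))))"
        unfolding \<Psi>_def G_def by (intro mult_left_mono locavg_norm[OF Fm F0 r(1) rp ck]) auto
      also have "\<dots> = ennreal (D * c * (e1 * e2)) * LpN q1 (\<lambda>\<xi>. LpN p1 (\<lambda>x. ennreal (F (x, \<xi>))))"
        using c D0 C1(1) C2(1) by (simp add: D_def e1_def e2_def ennreal_mult ac_simps)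
      finally show ?thesis unfolding e12 .
    qed
    show "\<exists>D>0. \<forall>F H c s.
     F \<in> borel_measurable borel \<longrightarrow> (\<forall>z. 0 \<le> F z) \<longrightarrow> (\<exists>A K. \<forall>z. F z \<le> A * (1 + norm z) powr K) \<longrightarrow>
     (\<forall>n\<ge>0. \<forall>z. ennreal (F z) \<le> ennreal (C n) * (\<integral>\<^sup>+w. ennreal (F w * (1 + norm (z - w)) powr (-n)) \<partial>lborel)) \<longrightarrow>
     H \<in> borel_measurable borel \<longrightarrow> 0 < s \<longrightarrow> 0 \<le> c \<longrightarrow>
     (\<forall>z. ennreal (H z) \<le> ennreal (c * (1 + s * norm z) powr (- (2 * m))) * (\<integral>\<^sup>+w. ennreal (F w * (1 + norm (z - w)) powr (- (N + K))) \<partial>lborel)) \<longrightarrow>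
     LpN q2 (\<lambda>\<xi>. LpN p2 (\<lambda>x. ennreal (H (x, \<xi>))))
       \<le> ennreal (D * c * s powr (- (real CARD('n) * (max (inv_exp p2 - inv_exp p1) 0 + max (inv_exp q2 - inv_exp q1) 0))))
          * LpN q1 (\<lambda>\<xi>. LpN p1 (\<lambda>x. ennreal (F (x :: real^'n, \<xi> :: real^'n))))"
      by (intro exI[of _ D] conjI allI impI D) (rule main[unfolded d_def], blast+)
  qed
qed

section \<open>The Hermite semigroup in phase space\<close>

text \<open>Treats both time ranges at once. The scale h = t^(1/\<beta>) of the multiplier meets
  \<open>s\<close>, which is quadratic in phase space, so \<tau> is the square root of h for small
  times.\<close>

definition regime :: "real \<Rightarrow> real \<Rightarrow> real \<Rightarrow> real \<Rightarrow> real \<Rightarrow> bool" where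
  "regime \<beta> d t \<tau> c \<longleftrightarrow> (0 < t \<and> t \<le> 1 \<and> \<tau> = t powr (1 / (2 * \<beta>)) \<and> c = 1) \<or> (1 \<le> t \<and> \<tau> = 1 \<and> c = exp (- t * d powr \<beta>))"

lemma regimeD:
  assumes "regime \<beta> d t \<tau> c" "0 < \<beta>" shows "0 < t" "0 < \<tau>" "\<tau> \<le> 1" "0 \<le> c"
  using assms by (auto simp: regime_def powr_le1)

text \<open>Passes from 1 + a^2, which the quadratic kernel estimates provide, to (1 + a)^2 at the
  cost of a factor 2.\<close>

lemma one_add_even_power_le: "(1 + a) ^ (2 * N) \<le> 2 ^ N * B ^ N" if "0 \<le> a" "1 + a\<^sup>2 \<le> B" for a B :: real
proof -
  have "(1 + a)\<^sup>2 \<le> 2 * (1 + a\<^sup>2)" using zero_le_power2[of "1 - a"] by (simp add: power2_eq_square algebra_simps)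
  also have "\<dots> \<le> 2 * B" using that by (intro mult_left_mono) auto
  finally have "(1 + a)\<^sup>2 \<le> 2 * B" .
  then have "((1 + a)\<^sup>2) ^ N \<le> (2 * B) ^ N" by (intro power_mono) auto
  then show ?thesis by (simp add: power_mult power_mult_distrib)
qed

text \<open>Small times combine \<open>hmult_kernel_small\<close> with the identity for the squared
  distance. For t at least 1 decay in s alone yields both weights, since Re z is at least -s and
  hence 1 + 4 (s - Re z) is at most 2 (1 + 4 s).\<close>

lemma kernel_bound:
  assumes b: "0 < \<beta>"
  shows "\<exists>C\<ge>0. \<forall>t \<tau> c (w :: (real^'n::finite) \<times> (real^'n)) u. regime \<beta> (real CARD('n)) t \<tau> c \<longrightarrow>
    exp (- (((norm w)\<^sup>2 + (norm u)\<^sup>2) / 4)) * norm (Tser (hmult \<beta> t CARD('n)) (zcoord_inner w u)) * ((1 + norm (w - u)) ^ (2 * N) * (1 + \<tau> * norm u) ^ (2 * M)) \<le> C * c"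
proof -
  let ?d = "CARD('n)"
  have d: "1 \<le> ?d" by (simp add: Suc_leI)
  obtain C1 where C1: "0 \<le> C1" "\<And>t z s. 0 < t \<Longrightarrow> t \<le> 1 \<Longrightarrow> norm z \<le> s \<Longrightarrow>
    exp (- s) * norm (Tser (hmult \<beta> t ?d) z) * (1 + 4 * (s - Re z)) ^ N * (1 + 4 * (t powr (1 / \<beta>) * s)) ^ M \<le> C1"
    using hmult_kernel_small[OF b d, of N M] by blast
  obtain C2 where C2: "0 \<le> C2" "\<And>t z s. 1 \<le> t \<Longrightarrow> norm z \<le> s \<Longrightarrow>
    exp (- s) * norm (Tser (hmult \<beta> t ?d) z) * (1 + 4 * s) ^ (N + M) \<le> C2 * exp (- t * real ?d powr \<beta>)"
    using hmult_kernel_large[OF b d, of "N + M"] by blast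
  define C where "C = max (2 ^ N * 2 ^ M * C1) (2 ^ N * 2 ^ M * 2 ^ N * C2)"
  have "exp (- (((norm w)\<^sup>2 + (norm u)\<^sup>2) / 4)) * norm (Tser (hmult \<beta> t ?d) (zcoord_inner w u)) * ((1 + norm (w - u)) ^ (2 * N) * (1 + \<tau> * norm u) ^ (2 * M)) \<le> C * c"
    if R: "regime \<beta> (real ?d) t \<tau> c" for t \<tau> c and w u :: "(real^'n) \<times> (real^'n)"
  proof -
    define s where "s = ((norm w)\<^sup>2 + (norm u)\<^sup>2) / 4"
    define X where "X = exp (- s) * norm (Tser (hmult \<beta> t ?d) (zcoord_inner w u))"
    have X0: "0 \<le> X" by (simp add: X_def)
    have z: "norm (zcoord_inner w u) \<le> s" "4 * (s - Re (zcoord_inner w u)) = (norm (w - u))\<^sup>2" unfolding s_def by (rule zcoord_inner_bounds)+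
    have u: "(norm u)\<^sup>2 \<le> 4 * s" by (simp add: s_def)
    have s0: "0 \<le> s" by (simp add: s_def)
    have p1: "(1 + norm (w - u)) ^ (2 * N) \<le> 2 ^ N * (1 + 4 * (s - Re (zcoord_inner w u))) ^ N"
      by (rule one_add_even_power_le) (use z(2) in auto)
    consider "0 < t" "t \<le> 1" "\<tau> = t powr (1 / (2 * \<beta>))" "c = 1" | "1 \<le> t" "\<tau> = 1" "c = exp (- t * real ?d powr \<beta>)"
      using R unfolding regime_def by blast
    then have "X * ((1 + norm (w - u)) ^ (2 * N) * (1 + \<tau> * norm u) ^ (2 * M)) \<le> C * c"
    proof cases
      case 1
      have t2: "\<tau>\<^sup>2 = t powr (1 / \<beta>)" unfolding 1(3) power2_eq_square powr_add[symmetric] by simp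
      have p2: "(1 + \<tau> * norm u) ^ (2 * M) \<le> 2 ^ M * (1 + 4 * (t powr (1 / \<beta>) * s)) ^ M"
      proof (rule one_add_even_power_le)
        have "\<tau>\<^sup>2 * (norm u)\<^sup>2 \<le> \<tau>\<^sup>2 * (4 * s)" using u by (intro mult_left_mono) auto
        then show "1 + (\<tau> * norm u)\<^sup>2 \<le> 1 + 4 * (t powr (1 / \<beta>) * s)" by (simp add: power_mult_distrib t2 mult_ac)
      qed (use 1 in auto)
      have "X * ((1 + norm (w - u)) ^ (2 * N) * (1 + \<tau> * norm u) ^ (2 * M))
        \<le> X * ((2 ^ N * (1 + 4 * (s - Re (zcoord_inner w u))) ^ N) * (2 ^ M * (1 + 4 * (t powr (1 / \<beta>) * s)) ^ M))"
        using z(2) by (intro mult_left_mono[OF mult_mono[OF p1 p2] X0]) (auto simp: 1 simp del: right_diff_distrib_numeral intro!: mult_nonneg_nonneg zero_le_power)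
      also have "\<dots> = 2 ^ N * 2 ^ M * (X * (1 + 4 * (s - Re (zcoord_inner w u))) ^ N * (1 + 4 * (t powr (1 / \<beta>) * s)) ^ M)"
        by (simp only: ac_simps)
      also have "\<dots> \<le> 2 ^ N * 2 ^ M * C1" unfolding X_def by (intro mult_left_mono C1(2) 1 z(1)) auto
      finally show ?thesis by (simp add: C_def 1(4))
    next
      case 2
      have p2: "(1 + \<tau> * norm u) ^ (2 * M) \<le> 2 ^ M * (1 + 4 * s) ^ M"
        by (rule one_add_even_power_le) (use u in \<open>auto simp: 2\<close>)
      have "\<bar>Re (zcoord_inner w u)\<bar> \<le> s" using abs_Re_le_cmod[of "zcoord_inner w u"] z(1) by linarith
      then have "(1 + 4 * (s - Re (zcoord_inner w u))) ^ N \<le> (2 * (1 + 4 * s)) ^ N" by (intro power_mono) auto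
      then have p1': "(1 + norm (w - u)) ^ (2 * N) \<le> 2 ^ N * (2 ^ N * (1 + 4 * s) ^ N)"
        unfolding power_mult_distrib[of 2 "1 + 4 * s"] by (intro order_trans[OF p1] mult_left_mono) auto
      have "X * ((1 + norm (w - u)) ^ (2 * N) * (1 + \<tau> * norm u) ^ (2 * M))
        \<le> X * ((2 ^ N * (2 ^ N * (1 + 4 * s) ^ N)) * (2 ^ M * (1 + 4 * s) ^ M))"
        using s0 by (intro mult_left_mono[OF mult_mono[OF p1' p2] X0]) (auto simp: 2)
      also have "\<dots> = 2 ^ N * 2 ^ M * 2 ^ N * (X * (1 + 4 * s) ^ (N + M))"
        unfolding power_add by (simp only: ac_simps)
      also have "\<dots> \<le> 2 ^ N * 2 ^ M * 2 ^ N * (C2 * exp (- t * real ?d powr \<beta>))" unfolding X_def by (intro mult_left_mono C2(2) 2 z(1)) auto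
      also have "\<dots> = (2 ^ N * 2 ^ M * 2 ^ N * C2) * c" by (simp add: 2(3))
      also have "\<dots> \<le> C * c" unfolding C_def by (intro mult_right_mono) (auto simp: 2(3))
      finally show ?thesis .
    qed
    then show ?thesis by (simp only: X_def s_def)
  qed
  moreover have "0 \<le> C" using C1 by (simp add: C_def le_max_iff_disj)
  ultimately show ?thesis by blast
qed

section \<open>Covariance and the choice of the dual window\<close>

lemma amb_wpk_norm:
  fixes g :: "real^'n::finite \<Rightarrow> complex"
  assumes g: "schwartz g"
  shows "norm (amb (wpk g z) gauss u) = norm (amb (\<lambda>y. cnj (g y)) gauss (u - z))"
proof -
  have m: "(\<lambda>y. wpk g z y * gauss (y - fst u) * cis (snd u \<bullet> y)) \<in> borel_measurable borel"
    by (intro schwartz_measurable schwartz_ambig_integrand schwartz_wpk g schwartz_gauss)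
  have e: "wpk g z (fst z + v) * gauss (fst z + v - fst u) * cis (snd u \<bullet> (fst z + v))
     = cis ((snd u - snd z) \<bullet> fst z) * (cnj (g v) * gauss (v - fst (u - z)) * cis (snd (u - z) \<bullet> v))" for v
  proof -
    have "cis (snd z \<bullet> - (fst z + v)) * cis (snd u \<bullet> (fst z + v)) = cis ((snd u - snd z) \<bullet> fst z) * cis (snd (u - z) \<bullet> v)"
      unfolding cis_mult by (simp add: inner_add_right inner_diff_left algebra_simps)
    note c = this
    have y: "fst z + v - fst u = v - fst (u - z)" "fst z + v - fst z = v" by simp_all
    have "wpk g z (fst z + v) * gauss (fst z + v - fst u) * cis (snd u \<bullet> (fst z + v))
      = (cnj (g v) * gauss (v - fst (u - z))) * (cis (snd z \<bullet> - (fst z + v)) * cis (snd u \<bullet> (fst z + v)))"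
      unfolding wpk_eq y by (simp only: ac_simps)
    then show ?thesis unfolding c by (simp only: ac_simps)
  qed
  have "amb (wpk g z) gauss u = (\<integral>v. wpk g z (fst z + v) * gauss (fst z + v - fst u) * cis (snd u \<bullet> (fst z + v)) \<partial>lborel)"
    unfolding ambig_def by (rule lborel_integral_plus[OF m, symmetric])
  also have "\<dots> = cis ((snd u - snd z) \<bullet> fst z) * amb (\<lambda>y. cnj (g y)) gauss (u - z)"
    unfolding e ambig_def by simp
  finally show ?thesis by (simp add: norm_mult)
qed

lemma cnj_gauss: "cnj (gauss y) = gauss y"
  by (simp add: gauss_def)

lemma hermite_cfun_wpk_gauss: "(\<integral>y. hermite_cfun \<alpha> y * wpk gauss u y \<partial>lborel) = cnj (hcoef \<alpha> u)"
proof -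
  have e: "cnj (hermite_cfun \<alpha> y * gauss (y - fst u) * cis (snd u \<bullet> y)) = hermite_cfun \<alpha> y * wpk gauss u y" for y
    by (simp add: wpk_eq cis_cnj hermite_cfun_def cnj_gauss)
  have "cnj (hcoef \<alpha> u) = (\<integral>y. cnj (hermite_cfun \<alpha> y * gauss (y - fst u) * cis (snd u \<bullet> y)) \<partial>lborel)"
    unfolding hcoef_def ambig_def by (rule Bochner_Integration.integral_cnj[symmetric])
  then show ?thesis unfolding e by (rule sym)
qed

lemma gauss_pairing_nonzero: "(\<integral>u. cnj (gauss u) * gauss (u :: real^'n::finite) \<partial>lborel) \<noteq> 0"
proof -
  have "(\<integral>u. cnj (gauss u) * gauss (u :: real^'n::finite) \<partial>lborel) = amb gauss gauss (0 :: (real^'n) \<times> (real^'n))"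
    by (simp add: ambig_def cnj_gauss)
  then show ?thesis using ambig_gauss_norm[of "0 :: (real^'n) \<times> (real^'n)"] by (metis exp_not_eq_zero mult_eq_0_iff norm_eq_zero pi_neq_zero power_not_zero real_sqrt_eq_zero_cancel_iff)
qed

text \<open>The window may be orthogonal to the Gaussian itself. If it were orthogonal to all
  time-frequency shifts of the Gaussian, \<open>ambig_inversion\<close> would give g = 0.\<close>

lemma window_exists:
  fixes g :: "real^'n::finite \<Rightarrow> complex"
  assumes g: "schwartz g" "g \<noteq> (\<lambda>_. 0)"
  shows "\<exists>w. amb (\<lambda>y. cnj (g y)) gauss w \<noteq> 0"
proof (rule ccontr)
  assume "\<nexists>w. amb (\<lambda>y. cnj (g y)) gauss w \<noteq> 0"
  then have "\<And>z. amb (\<lambda>y. cnj (g y)) gauss z = 0" by blast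
  then have "cnj (g y) = 0" for y
    using ambig_inversion(2)[OF schwartz_cnj[OF g(1)] schwartz_gauss schwartz_gauss, of y] gauss_pairing_nonzero[where 'n='n] by simp
  then show False using g(2) by (auto simp: fun_eq_iff)
qed

text \<open>Shifting the analysing Gaussian by \<open>w0\<close> translates the transform up to a
  phase. The Hermite functions can therefore still be tested against the centred Gaussian, at the
  point w + w0.\<close>

lemma amb_modulated_gauss:
  fixes \<phi> :: "real^'n::finite \<Rightarrow> complex"
  defines "\<gamma> w0 y \<equiv> cis (snd w0 \<bullet> y) * gauss (y - fst w0)"
  shows "amb \<phi> (\<gamma> w0) w = cis (- (snd w0 \<bullet> fst w)) * amb \<phi> gauss (w + w0)"
proof -
  have "\<phi> y * \<gamma> w0 (y - fst w) * cis (snd w \<bullet> y) = cis (- (snd w0 \<bullet> fst w)) * (\<phi> y * gauss (y - fst (w + w0)) * cis (snd (w + w0) \<bullet> y))" for y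
  proof -
    have "cis (snd w0 \<bullet> (y - fst w)) * cis (snd w \<bullet> y) = cis (- (snd w0 \<bullet> fst w)) * cis (snd (w + w0) \<bullet> y)"
      unfolding cis_mult by (simp add: inner_diff_right inner_add_left algebra_simps)
    note c = this
    have y: "y - fst w - fst w0 = y - fst (w + w0)" by simp
    have "\<phi> y * \<gamma> w0 (y - fst w) * cis (snd w \<bullet> y) = (\<phi> y * gauss (y - fst (w + w0))) * (cis (snd w0 \<bullet> (y - fst w)) * cis (snd w \<bullet> y))"
      unfolding \<gamma>_def y by (simp only: ac_simps)
    then show ?thesis unfolding c by (simp only: ac_simps)
  qed
  then show ?thesis unfolding ambig_def by (simp only: integral_mult_right_zero)
qed

lemma schwartz_modulated_gauss: "schwartz (\<lambda>y. cis (\<eta> \<bullet> y) * gauss (y - a))"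
  by (intro schwartz_cis schwartz_shift schwartz_gauss)

lemma integral_pair_mult:
  fixes f :: "'a::euclidean_space \<Rightarrow> complex" and g :: "'b::euclidean_space \<Rightarrow> complex"
  assumes "integrable lborel f" "integrable lborel g"
  shows "(\<integral>z. f (fst z) * g (snd z) \<partial>(lborel \<Otimes>\<^sub>M lborel)) = (\<integral>x. f x \<partial>lborel) * (\<integral>y. g y \<partial>lborel)"
  using lborel_pair.integral_fst'[OF integrable_pair_mult[OF assms]] by simp

section \<open>The kernel of the semigroup\<close>

definition heat_kernel :: "real \<Rightarrow> real \<Rightarrow> (real^'n::finite) \<times> (real^'n) \<Rightarrow> (real^'n) \<times> (real^'n) \<Rightarrow> complex" where
  "heat_kernel \<beta> t w u = (amb gauss gauss w * cnj (amb gauss gauss u) / of_real (sqrt pi ^ CARD('n))) * Tser (hmult \<beta> t CARD('n)) (zcoord_inner w u)"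

lemma heat_kernel_norm:
  fixes w u :: "(real^'n::finite) \<times> (real^'n)"
  shows "norm (heat_kernel \<beta> t w u) = sqrt pi ^ CARD('n) * (exp (- (((norm w)\<^sup>2 + (norm u)\<^sup>2) / 4)) * norm (Tser (hmult \<beta> t CARD('n)) (zcoord_inner w u)))"
proof -
  have "exp (- (norm w)\<^sup>2 / 4) * exp (- (norm u)\<^sup>2 / 4) = exp (- (((norm w)\<^sup>2 + (norm u)\<^sup>2) / 4))"
    unfolding exp_add[symmetric] by (simp add: field_simps)
  then show ?thesis unfolding heat_kernel_def
    by (simp add: norm_mult norm_divide norm_power ambig_gauss_norm)
qed

text \<open>Termwise integration over two copies of phase space. The partial sums are dominated by
  the absolute kernel bound at the fixed time; its decay in w + w0 beats the polynomial growth of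
  \<open>U\<close>, while \<open>B\<close> decays by itself.\<close>

lemma heat_series:
  fixes U B :: "(real^'n::finite) \<times> (real^'n) \<Rightarrow> complex"
  assumes b: "0 < \<beta>" and t: "0 < t"
    and iU: "\<And>\<alpha>. integrable lborel (\<lambda>w. U w * hcoef \<alpha> (w + w0))"
    and iB: "\<And>\<alpha>. integrable lborel (\<lambda>u. cnj (hcoef \<alpha> u) * B u)"
    and bU: "\<And>w. norm (U w) \<le> A * (1 + norm w) ^ K"
    and bB: "\<And>u. norm (B u) \<le> D * (1 + norm u) powr (- (2 * real DIM((real^'n) \<times> (real^'n))))"
  shows "integrable (lborel \<Otimes>\<^sub>M lborel) (\<lambda>p. U (fst p) * B (snd p) * heat_kernel \<beta> t (fst p + w0) (snd p))"
    and "(\<lambda>k. of_real (hmult \<beta> t CARD('n) k) * (\<Sum>\<alpha>\<in>{\<alpha>::'n \<Rightarrow> nat. (\<Sum>i\<in>UNIV. \<alpha> i) = k}.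
       (\<integral>w. U w * hcoef \<alpha> (w + w0) \<partial>lborel) * (\<integral>u. cnj (hcoef \<alpha> u) * B u \<partial>lborel)))
      sums (\<integral>p. U (fst p) * B (snd p) * heat_kernel \<beta> t (fst p + w0) (snd p) \<partial>(lborel \<Otimes>\<^sub>M lborel))"
proof -
  let ?d = "CARD('n)" and ?I = "\<lambda>k. {\<alpha>::'n \<Rightarrow> nat. (\<Sum>i\<in>UNIV. \<alpha> i) = k}"
  let ?h = "hmult \<beta> t CARD('n)"
  define m where "m = 2 * real DIM((real^'n) \<times> (real^'n))"
  define f where "f k p = of_real (?h k) * (\<Sum>\<alpha>\<in>?I k. (U (fst p) * hcoef \<alpha> (fst p + w0)) * (cnj (hcoef \<alpha> (snd p)) * B (snd p)))" for k p
  define P where "P p = U (fst p) * B (snd p) * (amb gauss gauss (fst p + w0) * cnj (amb gauss gauss (snd p)) / of_real (sqrt pi ^ ?d))" for p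
  have d: "1 \<le> ?d" by (simp add: Suc_leI)
  have eg: "egrow ?h" using t by (intro egrow_hmult) simp
  have hp: "\<bar>?h k\<bar> = ?h k" for k using hmult_pos[of \<beta> t ?d k] by simp
  have fP: "f k p = P p * (of_real (?h k) * zcoord_inner (fst p + w0) (snd p) ^ k / fact k)" for k p
  proof -
    have "(\<Sum>\<alpha>\<in>?I k. (U (fst p) * hcoef \<alpha> (fst p + w0)) * (cnj (hcoef \<alpha> (snd p)) * B (snd p)))
      = (U (fst p) * B (snd p)) * (\<Sum>\<alpha>\<in>?I k. hcoef \<alpha> (fst p + w0) * cnj (hcoef \<alpha> (snd p)))"
      unfolding sum_distrib_left by (intro sum.cong refl) (simp only: ac_simps)
    then show ?thesis unfolding f_def hcoef_sum P_def by simp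
  qed
  have fi: "integrable (lborel \<Otimes>\<^sub>M lborel) (f k)" for k
    unfolding f_def by (intro integrable_mult_right Bochner_Integration.integrable_sum integrable_pair_mult[OF iU iB])
  have fI: "(\<integral>p. f k p \<partial>(lborel \<Otimes>\<^sub>M lborel)) = of_real (?h k) * (\<Sum>\<alpha>\<in>?I k. (\<integral>w. U w * hcoef \<alpha> (w + w0) \<partial>lborel) * (\<integral>u. cnj (hcoef \<alpha> u) * B u \<partial>lborel))" for k
    unfolding f_def integral_mult_right_zero
    by (subst Bochner_Integration.integral_sum) (auto simp: integral_pair_mult[OF iU iB] intro: integrable_pair_mult[OF iU iB])
  have fs: "(\<lambda>k. f k p) sums (U (fst p) * B (snd p) * heat_kernel \<beta> t (fst p + w0) (snd p))" for p
  proof -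
    have "(\<lambda>k. P p * (of_real (?h k) * zcoord_inner (fst p + w0) (snd p) ^ k / fact k)) sums (P p * Tser ?h (zcoord_inner (fst p + w0) (snd p)))"
      unfolding Tser_def by (intro sums_mult summable_sums summable_Tser eg)
    moreover have "P p * Tser ?h (zcoord_inner (fst p + w0) (snd p)) = U (fst p) * B (snd p) * heat_kernel \<beta> t (fst p + w0) (snd p)"
      by (simp only: P_def heat_kernel_def mult.assoc)
    ultimately show ?thesis unfolding fP[symmetric] by simp
  qed
  \<comment> \<open>Covers the growth exponent of \<open>U\<close> and leaves order \<open>m\<close>
    for integrability.\<close>
  define M where "M = K + nat \<lceil>m\<rceil>"
  have m0: "0 \<le> m" by (simp add: m_def)
  obtain C where C: "0 \<le> C" "\<And>r s. 0 \<le> r \<Longrightarrow> r \<le> s \<Longrightarrow> exp (- s) * (exp r * pois r ?h) * (1 + 4 * s) ^ M \<le> C"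
    using hmult_kernel_abs[OF b d t, of M] by blast
  have A0: "0 \<le> A" using order_trans[OF norm_ge_zero bU[of 0]] by simp
  have D0: "0 \<le> D" using order_trans[OF norm_ge_zero bB[of 0]] by simp
  define E where "E = A * (1 + norm w0) ^ K * D * sqrt pi ^ ?d * (2 ^ M * C)"
  define W where "W p = E * norm (complex_of_real ((1 + norm (fst p + w0)) powr (- m)) * complex_of_real ((1 + norm (snd p)) powr (- m)))" for p :: "((real^'n) \<times> (real^'n)) \<times> ((real^'n) \<times> (real^'n))"
  have Wi: "integrable (lborel \<Otimes>\<^sub>M lborel) W"
  proof -
    have i1: "integrable lborel (\<lambda>u :: (real^'n) \<times> (real^'n). complex_of_real ((1 + norm u) powr (- m)))"
      by (intro integrable_of_real integrable_weight) (simp add: m_def)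
    have i2: "integrable lborel (\<lambda>w :: (real^'n) \<times> (real^'n). complex_of_real ((1 + norm (w + w0)) powr (- m)))"
      using lborel_integrable_affine[OF i1, of 1 w0] by (simp add: add.commute)
    show ?thesis unfolding W_def by (intro integrable_mult_right integrable_norm integrable_pair_mult[OF i2 i1])
  qed
  have Sb: "(\<Sum>k<n. norm (f k p)) \<le> W p" for n p
  proof -
    define w where "w = fst p + w0"
    define u where "u = snd p"
    define z where "z = zcoord_inner w u"
    define s where "s = ((norm w)\<^sup>2 + (norm u)\<^sup>2) / 4"
    have z: "norm z \<le> s" unfolding z_def s_def by (rule zcoord_inner_bounds)
    have s0: "0 \<le> s" by (simp add: s_def)
    have nf: "norm (f k p) = norm (P p) * (?h k * norm z ^ k / fact k)" for k
      unfolding fP norm_mult norm_Tser_term[of ?h k, unfolded norm_mult] by (simp add: z_def w_def u_def norm_mult norm_divide norm_power hp)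
    have pw: "0 < 1 + norm w" by (simp add: add_pos_nonneg)
    have "(\<Sum>k<n. norm (f k p)) = norm (P p) * (\<Sum>k<n. ?h k * norm z ^ k / fact k)"
      unfolding nf sum_distrib_left ..
    also have "\<dots> \<le> norm (P p) * (exp (norm z) * pois (norm z) ?h)"
    proof (rule mult_left_mono)
      have "(\<Sum>k<n. \<bar>?h k\<bar> * norm z ^ k / fact k) \<le> (\<Sum>k. \<bar>?h k\<bar> * norm z ^ k / fact k)"
        using summable_norm_Tser[OF eg, of z] unfolding norm_Tser_term by (intro sum_le_suminf) auto
      then show "(\<Sum>k<n. ?h k * norm z ^ k / fact k) \<le> exp (norm z) * pois (norm z) ?h"
        unfolding hp suminf_norm_Tser[OF eg, of z, unfolded hp] .
    qed simp
    also have "norm (P p) = norm (U (fst p)) * norm (B u) * (sqrt pi ^ ?d * exp (- s))"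
    proof -
      have "exp (- (norm w)\<^sup>2 / 4) * exp (- (norm u)\<^sup>2 / 4) = exp (- s)"
        unfolding exp_add[symmetric] s_def by (simp add: field_simps)
      moreover have "norm (P p) = norm (U (fst p)) * norm (B u) * (norm (amb gauss gauss w) * norm (amb gauss gauss u) / sqrt pi ^ ?d)"
        by (simp add: P_def norm_mult norm_divide norm_power w_def u_def)
      ultimately show ?thesis unfolding ambig_gauss_norm by simp
    qed
    also have "norm (U (fst p)) * norm (B u) * (sqrt pi ^ ?d * exp (- s)) * (exp (norm z) * pois (norm z) ?h)
      = norm (U (fst p)) * norm (B u) * sqrt pi ^ ?d * (exp (- s) * (exp (norm z) * pois (norm z) ?h))" by (simp only: ac_simps)
    also have "\<dots> \<le> (A * (1 + norm (fst p)) ^ K) * (D * (1 + norm u) powr (- m)) * sqrt pi ^ ?d * (2 ^ M * C * (1 + norm w) powr (- (real K + m)))"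
    proof (rule mult_mono[OF mult_mono[OF mult_mono]])
      have "(1 + norm w) powr (real K + m) \<le> (1 + norm w) powr real (2 * M)"
      proof (rule powr_mono)
        have "m \<le> real (nat \<lceil>m\<rceil>)" by (rule real_nat_ceiling_ge)
        then show "real K + m \<le> real (2 * M)" unfolding M_def by simp
      qed simp
      also have "\<dots> = (1 + norm w) ^ (2 * M)" using pw by (rule powr_realpow)
      also have "\<dots> \<le> 2 ^ M * (1 + 4 * s) ^ M" by (rule one_add_even_power_le) (auto simp: s_def)
      finally have le: "(1 + norm w) powr (real K + m) \<le> 2 ^ M * (1 + 4 * s) ^ M" .
      have y0: "0 \<le> exp (- s) * (exp (norm z) * pois (norm z) ?h)"
      proof -
        have "0 \<le> exp (norm z) * pois (norm z) (\<lambda>k. \<bar>?h k\<bar>)" by (rule order_trans[OF norm_ge_zero norm_Tser_le[OF eg]])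
        then show ?thesis by (simp add: hp)
      qed
      have "exp (- s) * (exp (norm z) * pois (norm z) ?h) * (1 + norm w) powr (real K + m) \<le> exp (- s) * (exp (norm z) * pois (norm z) ?h) * (2 ^ M * (1 + 4 * s) ^ M)"
        by (rule mult_left_mono[OF le y0])
      also have "\<dots> = 2 ^ M * (exp (- s) * (exp (norm z) * pois (norm z) ?h) * (1 + 4 * s) ^ M)" by (simp only: ac_simps)
      also have "\<dots> \<le> 2 ^ M * C" by (intro mult_left_mono C(2) z) auto
      finally have "exp (- s) * (exp (norm z) * pois (norm z) ?h) \<le> 2 ^ M * C / (1 + norm w) powr (real K + m)"
        using pw by (subst pos_le_divide_eq) auto
      then show "exp (- s) * (exp (norm z) * pois (norm z) ?h) \<le> 2 ^ M * C * (1 + norm w) powr (- (real K + m))"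
        by (simp only: powr_minus divide_inverse)
      show "0 \<le> exp (- s) * (exp (norm z) * pois (norm z) ?h)" by (rule y0)
    qed (use bU bB A0 D0 in \<open>auto simp: m_def\<close>)
    also have "\<dots> \<le> (A * ((1 + norm w0) ^ K * (1 + norm w) powr real K)) * (D * (1 + norm u) powr (- m)) * sqrt pi ^ ?d * (2 ^ M * C * (1 + norm w) powr (- (real K + m)))"
    proof (rule mult_right_mono[OF mult_right_mono[OF mult_right_mono[OF mult_left_mono[OF _ A0]]]])
      have "fst p = - w0 + w" by (simp add: w_def)
      then have "(1 + norm (fst p)) ^ K \<le> (1 + norm (- w0)) ^ K * (1 + norm w) ^ K"
        using weight_power_submult[of "- w0" w K] by simp
      then show "(1 + norm (fst p)) ^ K \<le> (1 + norm w0) ^ K * (1 + norm w) powr real K" using pw by (simp add: powr_realpow)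
    qed (use D0 C(1) in auto)
    also have "\<dots> = E * ((1 + norm w) powr real K * (1 + norm w) powr (- (real K + m))) * (1 + norm u) powr (- m)"
      unfolding E_def by (simp only: ac_simps)
    also have "(1 + norm w) powr real K * (1 + norm w) powr (- (real K + m)) = (1 + norm w) powr (- m)"
      unfolding powr_add[symmetric] by simp
    also have "E * (1 + norm w) powr (- m) * (1 + norm u) powr (- m) = W p"
      unfolding W_def by (simp add: w_def u_def norm_mult)
    finally show ?thesis .
  qed
  let ?L = "\<lambda>p. U (fst p) * B (snd p) * heat_kernel \<beta> t (fst p + w0) (snd p)"
  have lim: "AE p in lborel \<Otimes>\<^sub>M lborel. (\<lambda>n. \<Sum>k<n. f k p) \<longlonglongrightarrow> ?L p"
    using fs unfolding sums_def by (intro AE_I2) auto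
  have bnd: "AE p in lborel \<Otimes>\<^sub>M lborel. norm (\<Sum>k<n. f k p) \<le> W p" for n
    by (intro AE_I2 order_trans[OF norm_sum Sb])
  have meas: "(\<lambda>p. \<Sum>k<n. f k p) \<in> borel_measurable (lborel \<Otimes>\<^sub>M lborel)" for n
    by (intro borel_measurable_sum borel_measurable_integrable fi)
  have measL: "?L \<in> borel_measurable (lborel \<Otimes>\<^sub>M lborel)"
    by (rule borel_measurable_LIMSEQ_metric[OF meas]) (use fs in \<open>auto simp: sums_def\<close>)
  show "integrable (lborel \<Otimes>\<^sub>M lborel) ?L"
    by (rule integrable_dominated_convergence[OF measL meas Wi lim bnd])
  have "(\<lambda>n. \<integral>p. (\<Sum>k<n. f k p) \<partial>(lborel \<Otimes>\<^sub>M lborel)) \<longlonglongrightarrow> (\<integral>p. ?L p \<partial>(lborel \<Otimes>\<^sub>M lborel))"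
    by (rule integral_dominated_convergence[OF measL meas Wi lim bnd])
  moreover have "(\<integral>p. (\<Sum>k<n. f k p) \<partial>(lborel \<Otimes>\<^sub>M lborel)) = (\<Sum>k<n. of_real (?h k) * (\<Sum>\<alpha>\<in>?I k. (\<integral>w. U w * hcoef \<alpha> (w + w0) \<partial>lborel) * (\<integral>u. cnj (hcoef \<alpha> u) * B u \<partial>lborel)))" for n
    unfolding fI[symmetric] by (rule Bochner_Integration.integral_sum) (rule fi)
  ultimately show "(\<lambda>k. of_real (?h k) * (\<Sum>\<alpha>\<in>?I k. (\<integral>w. U w * hcoef \<alpha> (w + w0) \<partial>lborel) * (\<integral>u. cnj (hcoef \<alpha> u) * B u \<partial>lborel)))
      sums (\<integral>p. ?L p \<partial>(lborel \<Otimes>\<^sub>M lborel))"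
    unfolding sums_def by simp
qed


text \<open>Reconstruction applied to the packet at \<open>z\<close>, with the shifted Gaussian as
  dual window. By covariance the modulus of the kernel depends on w + w0 - z only, and removing
  \<open>w0\<close> costs a constant. The lower bound 1 for \<open>C\<close> fits the hypothesis of
  \<open>mixed_norm_estimate\<close>.\<close>

lemma stft_self_bound:
  fixes g :: "real^'n::finite \<Rightarrow> complex"
  assumes g: "schwartz g" "g \<noteq> (\<lambda>_. 0)" and n: "0 \<le> n"
  shows "\<exists>C\<ge>1. \<forall>T z. tempered T \<longrightarrow>
    ennreal (norm (T (wpk g z))) \<le> ennreal C * (\<integral>\<^sup>+w. ennreal (norm (T (wpk g w)) * (1 + norm (z - w)) powr (-n)) \<partial>lborel)"
proof -
  let ?gc = "\<lambda>y. cnj (g y)"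
  obtain w0 where w0: "amb ?gc gauss w0 \<noteq> 0" using window_exists[OF g] by blast
  define \<gamma> where "\<gamma> y = cis (snd w0 \<bullet> y) * gauss (y - fst w0)" for y
  have gs: "schwartz \<gamma>" unfolding \<gamma>_def by (rule schwartz_modulated_gauss)
  define \<kappa> where "\<kappa> = of_real ((2 * pi) ^ CARD('n)) * (\<integral>u. cnj (g u) * \<gamma> u \<partial>lborel)"
  have "(\<integral>u. cnj (g u) * \<gamma> u \<partial>lborel) = amb ?gc gauss w0" unfolding ambig_def \<gamma>_def by (simp only: ac_simps)
  then have \<kappa>: "\<kappa> \<noteq> 0" using w0 by (simp add: \<kappa>_def)
  obtain D where D: "0 \<le> D" "\<And>z. norm (amb ?gc gauss z) \<le> D * (1 + norm z) powr (-n)"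
    using ambig_decay_pair[OF schwartz_cnj[OF g(1)] schwartz_gauss n] by blast
  define C where "C = D * (1 + norm w0) powr n / norm \<kappa>"
  have C0: "0 \<le> C" using D by (simp add: C_def)
  have "ennreal (norm (T (wpk g z))) \<le> ennreal (max 1 C) * (\<integral>\<^sup>+w. ennreal (norm (T (wpk g w)) * (1 + norm (z - w)) powr (-n)) \<partial>lborel)"
    if T: "tempered T" for T z
  proof -
    let ?V = "\<lambda>w. T (wpk g w)"
    note rec = stft_reconstruction[OF T g(1) schwartz_wpk[OF g(1), of z] gs, folded \<kappa>_def]
    have bnd: "norm (?V w * amb (wpk g z) \<gamma> w) \<le> norm \<kappa> * C * (norm (?V w) * (1 + norm (z - w)) powr (-n))" for w
    proof -
      have a: "norm (amb (wpk g z) \<gamma> w) = norm (amb ?gc gauss (w + w0 - z))"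
        unfolding \<gamma>_def amb_modulated_gauss amb_wpk_norm[OF g(1), symmetric] by (simp add: norm_mult)
      have "(1 + norm (z - w)) powr n \<le> ((1 + norm w0) * (1 + norm (w + w0 - z))) powr n"
        using weight_submult[of w0 "- (w + w0 - z)"] n by (intro powr_mono2) (auto simp: norm_minus_commute algebra_simps)
      then have "(1 + norm (w + w0 - z)) powr (-n) \<le> (1 + norm w0) powr n * (1 + norm (z - w)) powr (-n)"
      proof -
        have "R powr n \<le> (P * Q) powr n \<Longrightarrow> Q powr (-n) \<le> P powr n * R powr (-n)" if "0 < P" "0 < Q" "0 < R" for P Q R :: real
          using that by (simp add: powr_mult powr_minus field_simps)
        moreover assume "(1 + norm (z - w)) powr n \<le> ((1 + norm w0) * (1 + norm (w + w0 - z))) powr n"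
        ultimately show ?thesis by (simp add: add_pos_nonneg)
      qed
      then have "D * (1 + norm (w + w0 - z)) powr (-n) \<le> D * ((1 + norm w0) powr n * (1 + norm (z - w)) powr (-n))"
        using D(1) by (rule mult_left_mono)
      then have "norm (amb (wpk g z) \<gamma> w) \<le> norm \<kappa> * C * (1 + norm (z - w)) powr (-n)"
        unfolding a using D(2)[of "w + w0 - z"] \<kappa> by (simp add: C_def mult.assoc)
      from mult_left_mono[OF this norm_ge_zero[of "?V w"]] show ?thesis by (simp add: norm_mult mult_ac)
    qed
    have "ennreal (norm \<kappa>) * ennreal (norm (?V z)) = ennreal (norm (\<integral>w. ?V w * amb (wpk g z) \<gamma> w \<partial>lborel))"
      unfolding rec(2)[symmetric] by (simp add: norm_mult ennreal_mult)
    also have "\<dots> \<le> (\<integral>\<^sup>+w. ennreal (norm (?V w * amb (wpk g z) \<gamma> w)) \<partial>lborel)"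
      by (rule integral_norm_bound_ennreal[OF rec(1)])
    also have "\<dots> \<le> (\<integral>\<^sup>+w. ennreal (norm \<kappa> * C) * ennreal (norm (?V w) * (1 + norm (z - w)) powr (-n)) \<partial>lborel)"
      using C0 by (intro nn_integral_mono) (simp add: bnd flip: ennreal_mult)
    also have "\<dots> = ennreal (norm \<kappa> * C) * (\<integral>\<^sup>+w. ennreal (norm (?V w) * (1 + norm (z - w)) powr (-n)) \<partial>lborel)"
    proof (rule nn_integral_cmult)
      have [measurable]: "?V \<in> borel_measurable borel" by (intro borel_measurable_continuous_onI wpk_tempered g T)
      show "(\<lambda>w. ennreal (norm (?V w) * (1 + norm (z - w)) powr (-n))) \<in> borel_measurable lborel" by measurable
    qed
    finally have "ennreal (norm \<kappa>) * ennreal (norm (?V z)) \<le> ennreal (norm \<kappa>) * (ennreal C * (\<integral>\<^sup>+w. ennreal (norm (?V w) * (1 + norm (z - w)) powr (-n)) \<partial>lborel))"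
      using C0 by (simp add: ennreal_mult mult.assoc)
    then have "ennreal (norm (?V z)) \<le> ennreal C * (\<integral>\<^sup>+w. ennreal (norm (?V w) * (1 + norm (z - w)) powr (-n)) \<partial>lborel)"
      using \<kappa> by (subst (asm) ennreal_mult_le_mult_iff) (auto simp: top_unique)
    also have "\<dots> \<le> ennreal (max 1 C) * (\<integral>\<^sup>+w. ennreal (norm (?V w) * (1 + norm (z - w)) powr (-n)) \<partial>lborel)"
      by (intro mult_right_mono ennreal_leI) auto
    finally show ?thesis .
  qed
  then show ?thesis by (intro exI[of _ "max 1 C"]) auto
qed

text \<open>Transfers the weights from the kernel variables to the packet centre \<open>z\<close>.
  Of the decay exponent 2 N + 2 M + m in u - z, the part 2 N pays for passing from w + w0 - u to z -
  w, the part 2 M for passing from u to z, where \<tau> at most 1 enters, and m remains for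
  integrating over u.\<close>

lemma kernel_weights:
  fixes w w0 u z :: "'z::real_normed_vector"
  assumes \<tau>: "0 \<le> \<tau>" "\<tau> \<le> 1" and X: "X * ((1 + norm (w + w0 - u)) ^ (2 * N) * (1 + \<tau> * norm u) ^ (2 * M)) \<le> C" "0 \<le> X"
  shows "X * (1 + norm (u - z)) powr (- (real (2 * N + 2 * M) + m)) \<le>
    C * (1 + norm w0) ^ (2 * N) * (1 + \<tau> * norm z) powr (- real (2 * M)) * (1 + norm (z - w)) powr (- real (2 * N)) * (1 + norm (u - z)) powr (- m)"
proof -
  define a where "a = 1 + norm (u - z)"
  define b where "b = 1 + norm (w + w0 - u)"
  define e where "e = 1 + \<tau> * norm u"
  define W where "W = 1 + norm w0"
  define p where "p = 1 + norm (z - w)"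
  define q where "q = 1 + \<tau> * norm z"
  have pos: "0 < a" "0 < b" "0 < e" "0 < W" "0 < p" "0 < q"
    using \<tau> by (simp_all add: a_def b_def e_def W_def p_def q_def add_pos_nonneg)
  have pb: "p \<le> W * (a * b)"
  proof -
    have "z - w = w0 + ((z - u) - (w + w0 - u))" by simp
    then have "p \<le> W * (1 + norm ((z - u) - (w + w0 - u)))" unfolding p_def W_def using weight_submult[of w0 "(z - u) - (w + w0 - u)"] by simp
    also have "1 + norm ((z - u) - (w + w0 - u)) \<le> a * b"
      using weight_submult[of "z - u" "- (w + w0 - u)"]
      unfolding a_def b_def norm_minus_cancel norm_minus_commute[of u z] by (simp only: diff_conv_add_uminus)
    finally show ?thesis using pos by simp
  qed
  have qb: "q \<le> e * a"
  proof -
    have "\<tau> * norm z \<le> \<tau> * (norm u + norm (u - z))"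
      using norm_triangle_ineq[of u "z - u"] \<tau> by (intro mult_left_mono) (auto simp: norm_minus_commute)
    also have "\<dots> \<le> \<tau> * norm u + norm (u - z) + (\<tau> * norm u) * norm (u - z)"
      using mult_right_mono[OF \<tau>(2), of "norm (u - z)"] \<tau>(1) by (simp add: distrib_left add_increasing2)
    finally show ?thesis by (simp add: q_def e_def a_def algebra_simps)
  qed
  have C0: "0 \<le> C" using order_trans[OF _ X(1)] X(2) pos by (simp add: b_def e_def)
  have "X * (p ^ (2 * N) * q ^ (2 * M)) \<le> X * ((W * (a * b)) ^ (2 * N) * (e * a) ^ (2 * M))"
    using pos pb qb by (intro mult_left_mono[OF mult_mono X(2)] power_mono) auto
  also have "\<dots> = (X * (b ^ (2 * N) * e ^ (2 * M))) * (W ^ (2 * N) * a ^ (2 * N + 2 * M))"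
    unfolding power_mult_distrib power_add by (simp only: ac_simps)
  also have "\<dots> \<le> C * (W ^ (2 * N) * a ^ (2 * N + 2 * M))"
    using X(1) pos by (intro mult_right_mono) (auto simp: b_def e_def)
  finally have le: "X * (p powr real (2 * N) * q powr real (2 * M)) \<le> C * (W ^ (2 * N) * a powr real (2 * N + 2 * M))"
    unfolding powr_realpow[OF pos(1)] powr_realpow[OF pos(5)] powr_realpow[OF pos(6)] .
  have "X * a powr (- (real (2 * N + 2 * M) + m)) = (X * (p powr real (2 * N) * q powr real (2 * M))) * (p powr (- real (2 * N)) * q powr (- real (2 * M)) * a powr (- (real (2 * N + 2 * M) + m)))"
    using pos by (simp add: powr_minus field_simps)
  also have "\<dots> \<le> (C * (W ^ (2 * N) * a powr real (2 * N + 2 * M))) * (p powr (- real (2 * N)) * q powr (- real (2 * M)) * a powr (- (real (2 * N + 2 * M) + m)))"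
    by (intro mult_right_mono le) auto
  also have "\<dots> = C * W ^ (2 * N) * q powr (- real (2 * M)) * p powr (- real (2 * N)) * (a powr real (2 * N + 2 * M) * a powr (- (real (2 * N + 2 * M) + m)))"
    by (simp only: ac_simps)
  also have "a powr real (2 * N + 2 * M) * a powr (- (real (2 * N + 2 * M) + m)) = a powr (- m)"
    unfolding powr_add[symmetric] by simp
  finally show ?thesis by (simp only: a_def W_def p_def q_def)
qed


text \<open>Two reconstructions are inserted into the series. The values of \<open>T\<close> on
  Hermite functions are expanded in packets of \<open>g\<close>, with the shifted Gaussian as dual
  window and constant \<open>\<kappa>\<close>; the Hermite coefficients of the packet are expanded
  in Gaussian packets, with constant \<open>\<kappa>0\<close>. Both then involve the explicit
  functions \<open>hcoef\<close>, which \<open>heat_series\<close> sums.\<close>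

lemma herm_semigroup_formula:
  fixes g :: "real^'n::finite \<Rightarrow> complex"
  assumes T: "tempered T" and g: "schwartz g" and b: "0 < \<beta>" and t: "0 < t"
    and c: "\<kappa> = of_real ((2 * pi) ^ CARD('n)) * amb (\<lambda>y. cnj (g y)) gauss w0" "\<kappa> \<noteq> 0"
  defines "\<kappa>0 \<equiv> complex_of_real ((2 * pi) ^ CARD('n)) * (\<integral>u. cnj (gauss u) * gauss (u :: real^'n) \<partial>lborel)"
    and "Q z p \<equiv> (T (wpk g (fst p)) * cis (- (snd w0 \<bullet> fst (fst p)))) * amb (wpk g z) gauss (snd p) * heat_kernel \<beta> t (fst p + w0) (snd p)"
  shows "integrable (lborel \<Otimes>\<^sub>M lborel) (Q z)" and "\<kappa> * \<kappa>0 * herm_semigroup \<beta> t T (wpk g z) = (\<integral>p. Q z p \<partial>(lborel \<Otimes>\<^sub>M lborel))"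
proof -
  let ?I = "\<lambda>k. {\<alpha>::'n \<Rightarrow> nat. (\<Sum>i\<in>UNIV. \<alpha> i) = k}"
  define \<gamma> where "\<gamma> y = cis (snd w0 \<bullet> y) * gauss (y - fst w0)" for y
  have gs: "schwartz \<gamma>" unfolding \<gamma>_def by (rule schwartz_modulated_gauss)
  have \<kappa>: "\<kappa> = of_real ((2 * pi) ^ CARD('n)) * (\<integral>u. cnj (g u) * \<gamma> u \<partial>lborel)"
    unfolding c(1) ambig_def \<gamma>_def by (simp only: ac_simps)
  define U where "U w = T (wpk g w) * cis (- (snd w0 \<bullet> fst w))" for w
  define B where "B = amb (wpk g z) gauss"
  have Ue: "T (wpk g w) * amb (hermite_cfun \<alpha>) \<gamma> w = U w * hcoef \<alpha> (w + w0)" for w \<alpha>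
    unfolding \<gamma>_def amb_modulated_gauss U_def hcoef_def by (simp only: ac_simps)
  have iU: "integrable lborel (\<lambda>w. U w * hcoef \<alpha> (w + w0))" and eU: "\<kappa> * T (hermite_cfun \<alpha>) = (\<integral>w. U w * hcoef \<alpha> (w + w0) \<partial>lborel)" for \<alpha>
    using stft_reconstruction[OF T g schwartz_hermite_cfun[of \<alpha>] gs, folded \<kappa>] unfolding Ue by blast+
  have iB: "integrable lborel (\<lambda>u. cnj (hcoef \<alpha> u) * B u)" and eB: "\<kappa>0 * (\<integral>y. hermite_cfun \<alpha> y * wpk g z y \<partial>lborel) = (\<integral>u. cnj (hcoef \<alpha> u) * B u \<partial>lborel)" for \<alpha>
    using stft_reconstruction[OF tempered_integral[OF schwartz_hermite_cfun[of \<alpha>]] schwartz_gauss schwartz_wpk[OF g, of z] schwartz_gauss]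
    unfolding hermite_cfun_wpk_gauss \<kappa>0_def B_def by blast+
  obtain A and K :: nat where A: "\<And>w. norm (T (wpk g w)) \<le> A * (1 + norm w) ^ K" using wpk_tempered(2)[OF g T] by blast
  have bU: "norm (U w) \<le> A * (1 + norm w) ^ K" for w unfolding U_def using A by (simp add: norm_mult)
  obtain D where D: "\<And>u. norm (B u) \<le> D * (1 + norm u) powr (- (2 * real DIM((real^'n) \<times> (real^'n))))"
    unfolding B_def using ambig_decay_pair[OF schwartz_wpk[OF g, of z] schwartz_gauss, of "2 * real DIM((real^'n) \<times> (real^'n))"] of_nat_0_le_iff mult_nonneg_nonneg[OF zero_le_numeral of_nat_0_le_iff] by blast
  have QU: "Q z = (\<lambda>p. U (fst p) * B (snd p) * heat_kernel \<beta> t (fst p + w0) (snd p))"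
    by (simp add: fun_eq_iff Q_def U_def B_def)
  note series = heat_series[OF b t iU iB bU D]
  show "integrable (lborel \<Otimes>\<^sub>M lborel) (Q z)" unfolding QU by (rule series(1))
  define a where "a k = complex_of_real (hmult \<beta> t CARD('n) k) * (\<Sum>\<alpha>\<in>?I k. T (hermite_cfun \<alpha>) * (\<integral>y. hermite_cfun \<alpha> y * wpk g z y \<partial>lborel))" for k
  have ae: "of_real (hmult \<beta> t CARD('n) k) * (\<Sum>\<alpha>\<in>?I k. (\<integral>w. U w * hcoef \<alpha> (w + w0) \<partial>lborel) * (\<integral>u. cnj (hcoef \<alpha> u) * B u \<partial>lborel)) = \<kappa> * \<kappa>0 * a k" for k
    unfolding eU[symmetric] eB[symmetric] a_def sum_distrib_left by (intro sum.cong refl) (simp only: ac_simps)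
  have k0: "\<kappa> * \<kappa>0 \<noteq> 0" using c(2) gauss_pairing_nonzero[where 'n='n] by (simp add: \<kappa>0_def)
  have "(\<lambda>k. \<kappa> * \<kappa>0 * a k) sums (\<integral>p. Q z p \<partial>(lborel \<Otimes>\<^sub>M lborel))"
    using series(2) unfolding ae QU .
  from sums_mult[OF this, of "1 / (\<kappa> * \<kappa>0)"] have "a sums ((\<integral>p. Q z p \<partial>(lborel \<Otimes>\<^sub>M lborel)) / (\<kappa> * \<kappa>0))"
    using k0 by (simp add: mult.assoc)
  moreover have "herm_semigroup \<beta> t T (wpk g z) = suminf a"
    unfolding herm_semigroup_def a_def hmult_def hermite_cfun_def ..
  ultimately have "herm_semigroup \<beta> t T (wpk g z) = (\<integral>p. Q z p \<partial>(lborel \<Otimes>\<^sub>M lborel)) / (\<kappa> * \<kappa>0)"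
    by (simp add: sums_unique[symmetric])
  then show "\<kappa> * \<kappa>0 * herm_semigroup \<beta> t T (wpk g z) = (\<integral>p. Q z p \<partial>(lborel \<Otimes>\<^sub>M lborel))"
    using k0 by simp
qed

text \<open>The integral formula is estimated in absolute value: \<open>kernel_weights\<close>
  isolates the dependence on u, which integrates to the constant \<open>j\<close>, and an average
  over w remains.\<close>

lemma herm_semigroup_bound:
  fixes g :: "real^'n::finite \<Rightarrow> complex"
  assumes g: "schwartz g" "g \<noteq> (\<lambda>_. 0)" and b: "0 < \<beta>"
  shows "\<exists>C\<ge>0. \<forall>t \<tau> c T z. regime \<beta> (real CARD('n)) t \<tau> c \<longrightarrow> tempered T \<longrightarrow>
    ennreal (norm (herm_semigroup \<beta> t T (wpk g z))) \<le> ennreal (C * c * (1 + \<tau> * norm z) powr (- real (2 * M)))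
      * (\<integral>\<^sup>+w. ennreal (norm (T (wpk g w)) * (1 + norm (z - w)) powr (- real (2 * N))) \<partial>lborel)"
proof -
  let ?d = "CARD('n)" and ?gc = "\<lambda>y. cnj (g y)"
  obtain w0 where w0: "amb ?gc gauss w0 \<noteq> 0" using window_exists[OF g] by blast
  define \<kappa> where "\<kappa> = of_real ((2 * pi) ^ ?d) * amb ?gc gauss w0"
  define \<kappa>0 where "\<kappa>0 = complex_of_real ((2 * pi) ^ ?d) * (\<integral>u. cnj (gauss u) * gauss (u :: real^'n) \<partial>lborel)"
  have \<kappa>: "\<kappa> \<noteq> 0" using w0 by (simp add: \<kappa>_def)
  have k0: "\<kappa> * \<kappa>0 \<noteq> 0" using \<kappa> gauss_pairing_nonzero[where 'n='n] by (simp add: \<kappa>0_def)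
  define m where "m = 2 * real DIM((real^'n) \<times> (real^'n))"
  \<comment> \<open>The decay order that \<open>kernel_weights\<close> consumes;
    \<open>ambig_decay_pair\<close> provides any order.\<close>
  define L where "L = real (2 * N + 2 * M) + m"
  obtain D where D: "0 \<le> D" "\<And>z. norm (amb ?gc gauss z) \<le> D * (1 + norm z) powr (-L)"
    using ambig_decay_pair[OF schwartz_cnj[OF g(1)] schwartz_gauss, of L] by (auto simp: L_def m_def)
  obtain E where E: "0 \<le> E" "\<And>t \<tau> c (w :: (real^'n) \<times> (real^'n)) u. regime \<beta> (real ?d) t \<tau> c \<Longrightarrow>
    exp (- (((norm w)\<^sup>2 + (norm u)\<^sup>2) / 4)) * norm (Tser (hmult \<beta> t ?d) (zcoord_inner w u)) * ((1 + norm (w - u)) ^ (2 * N) * (1 + \<tau> * norm u) ^ (2 * M)) \<le> E * c"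
    using kernel_bound[OF b, of N M] by blast
  define J where "J = (\<integral>\<^sup>+u. ennreal ((1 + norm (u :: (real^'n) \<times> (real^'n))) powr (- m)) \<partial>lborel)"
  have "J < \<infinity>" using integrable_weight[of m, where 'a="(real^'n) \<times> (real^'n)"] by (simp add: J_def m_def integrable_iff_bounded)
  then obtain j where j: "0 \<le> j" "J = ennreal j" by (cases J) auto
  define C where "C = D * sqrt pi ^ ?d * E * (1 + norm w0) ^ (2 * N) * j / norm (\<kappa> * \<kappa>0)"
  have C0: "0 \<le> C" using D E j by (simp add: C_def)
  have "ennreal (norm (herm_semigroup \<beta> t T (wpk g z))) \<le> ennreal (C * c * (1 + \<tau> * norm z) powr (- real (2 * M)))
      * (\<integral>\<^sup>+w. ennreal (norm (T (wpk g w)) * (1 + norm (z - w)) powr (- real (2 * N))) \<partial>lborel)"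
    if R: "regime \<beta> (real ?d) t \<tau> c" and T: "tempered T" for t \<tau> c T z
  proof -
    note r = regimeD[OF R b]
    define Q where "Q p = (T (wpk g (fst p)) * cis (- (snd w0 \<bullet> fst (fst p)))) * amb (wpk g z) gauss (snd p) * heat_kernel \<beta> t (fst p + w0) (snd p)" for p
    note form = herm_semigroup_formula[OF T g(1) b r(1) \<kappa>_def \<kappa>, of z, folded \<kappa>0_def Q_def]
    define q where "q = D * sqrt pi ^ ?d * (E * c * (1 + norm w0) ^ (2 * N) * (1 + \<tau> * norm z) powr (- real (2 * M)))"
    have q0: "0 \<le> q" unfolding q_def using D E r by (intro mult_nonneg_nonneg) auto
    define F where "F w = norm (T (wpk g w)) * (1 + norm (z - w)) powr (- real (2 * N))" for w
    have F0: "0 \<le> F w" for w by (simp add: F_def)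
    have Qb: "norm (Q p) \<le> q * F (fst p) * (1 + norm (snd p - z)) powr (- m)" for p
    proof -
      define w where "w = fst p"
      define u where "u = snd p"
      define X where "X = exp (- (((norm (w + w0))\<^sup>2 + (norm u)\<^sup>2) / 4)) * norm (Tser (hmult \<beta> t ?d) (zcoord_inner (w + w0) u))"
      have X0: "0 \<le> X" by (simp add: X_def)
      have Xk: "X * (1 + norm (u - z)) powr (- L) \<le> E * c * (1 + norm w0) ^ (2 * N) * (1 + \<tau> * norm z) powr (- real (2 * M)) * (1 + norm (z - w)) powr (- real (2 * N)) * (1 + norm (u - z)) powr (- m)"
        unfolding L_def by (rule kernel_weights[OF less_imp_le[OF r(2)] r(3) E(2)[OF R, of "w + w0" u, folded X_def] X0])
      have "norm (Q p) = norm (T (wpk g w)) * norm (amb ?gc gauss (u - z)) * (sqrt pi ^ ?d * X)"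
        unfolding Q_def norm_mult heat_kernel_norm amb_wpk_norm[OF g(1)] by (simp add: w_def u_def X_def)
      also have "\<dots> \<le> norm (T (wpk g w)) * (D * (1 + norm (u - z)) powr (- L)) * (sqrt pi ^ ?d * X)"
        using X0 by (intro mult_right_mono mult_left_mono D) auto
      also have "\<dots> = D * sqrt pi ^ ?d * norm (T (wpk g w)) * (X * (1 + norm (u - z)) powr (- L))" by (simp only: ac_simps)
      also have "\<dots> \<le> D * sqrt pi ^ ?d * norm (T (wpk g w)) * (E * c * (1 + norm w0) ^ (2 * N) * (1 + \<tau> * norm z) powr (- real (2 * M)) * (1 + norm (z - w)) powr (- real (2 * N)) * (1 + norm (u - z)) powr (- m))"
        using D(1) by (intro mult_left_mono Xk) auto
      also have "\<dots> = q * F w * (1 + norm (u - z)) powr (- m)" unfolding q_def F_def by (simp only: ac_simps)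
      finally show ?thesis by (simp only: w_def u_def)
    qed
    have [measurable]: "(\<lambda>w. T (wpk g w)) \<in> borel_measurable borel" by (intro borel_measurable_continuous_onI wpk_tempered g T)
    have Fm [measurable]: "F \<in> borel_measurable borel" unfolding F_def by measurable
    have "ennreal (norm (\<kappa> * \<kappa>0)) * ennreal (norm (herm_semigroup \<beta> t T (wpk g z))) = ennreal (norm (\<integral>p. Q p \<partial>(lborel \<Otimes>\<^sub>M lborel)))"
      unfolding form(2)[symmetric] norm_mult[of "\<kappa> * \<kappa>0"] by (simp add: ennreal_mult)
    also have "\<dots> \<le> (\<integral>\<^sup>+p. ennreal (norm (Q p)) \<partial>(lborel \<Otimes>\<^sub>M lborel))" by (rule integral_norm_bound_ennreal[OF form(1)])
    also have "\<dots> \<le> (\<integral>\<^sup>+p. ennreal (q * F (fst p)) * ennreal ((1 + norm (snd p - z)) powr (- m)) \<partial>(lborel \<Otimes>\<^sub>M lborel))"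
    proof (rule nn_integral_mono)
      fix p
      show "ennreal (norm (Q p)) \<le> ennreal (q * F (fst p)) * ennreal ((1 + norm (snd p - z)) powr (- m))"
        using ennreal_leI[OF Qb[of p]] q0 F0[of "fst p"] by (simp add: ennreal_mult)
    qed
    also have "\<dots> = (\<integral>\<^sup>+w. \<integral>\<^sup>+u. ennreal (q * F w) * ennreal ((1 + norm (u - z)) powr (- m)) \<partial>lborel \<partial>lborel)"
      by (subst lborel.nn_integral_fst[symmetric]) auto
    also have "\<dots> = (\<integral>\<^sup>+w. ennreal (q * j) * ennreal (F w) \<partial>lborel)"
    proof (rule nn_integral_cong)
      fix w
      have "(\<integral>\<^sup>+u. ennreal ((1 + norm (u - z)) powr (- m)) \<partial>lborel) = J"
        unfolding J_def using lborel_nn_integral_plus[of "\<lambda>u. ennreal ((1 + norm u) powr (- m))" "- z"] by simp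
      then have "(\<integral>\<^sup>+u. ennreal (q * F w) * ennreal ((1 + norm (u - z)) powr (- m)) \<partial>lborel) = ennreal (q * F w) * ennreal j"
        by (subst nn_integral_cmult) (auto simp: j)
      then show "(\<integral>\<^sup>+u. ennreal (q * F w) * ennreal ((1 + norm (u - z)) powr (- m)) \<partial>lborel) = ennreal (q * j) * ennreal (F w)"
        using q0 F0[of w] j(1) by (simp add: ennreal_mult mult_ac)
    qed
    also have "\<dots> = ennreal (q * j) * (\<integral>\<^sup>+w. ennreal (F w) \<partial>lborel)" by (rule nn_integral_cmult) simp
    also have "q * j = norm (\<kappa> * \<kappa>0) * (C * c * (1 + \<tau> * norm z) powr (- real (2 * M)))"
      unfolding q_def C_def using k0 by simp
    also have "ennreal (norm (\<kappa> * \<kappa>0) * (C * c * (1 + \<tau> * norm z) powr (- real (2 * M)))) = ennreal (norm (\<kappa> * \<kappa>0)) * ennreal (C * c * (1 + \<tau> * norm z) powr (- real (2 * M)))"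
      using C0 r by (intro ennreal_mult) auto
    finally have "ennreal (norm (\<kappa> * \<kappa>0)) * ennreal (norm (herm_semigroup \<beta> t T (wpk g z)))
      \<le> ennreal (norm (\<kappa> * \<kappa>0)) * (ennreal (C * c * (1 + \<tau> * norm z) powr (- real (2 * M))) * (\<integral>\<^sup>+w. ennreal (F w) \<partial>lborel))"
      by (simp only: mult.assoc)
    then show ?thesis
      using k0 by (subst (asm) ennreal_mult_le_mult_iff) (auto simp: F_def)
  qed
  then show ?thesis using C0 by blast
qed

text \<open>The Hermite coefficients of the packet depend continuously on \<open>z\<close>, and
  infinite sums of measurable functions are measurable.\<close>

lemma herm_semigroup_measurable:
  fixes g :: "real^'n::finite \<Rightarrow> complex"
  assumes g: "schwartz g"
  shows "(\<lambda>z. herm_semigroup \<beta> t T (wpk g z)) \<in> borel_measurable borel"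
proof -
  have [measurable]: "(\<lambda>z. \<integral>y. hermite_cfun \<alpha> y * wpk g z y \<partial>lborel) \<in> borel_measurable borel" for \<alpha>
    by (intro borel_measurable_continuous_onI wpk_tempered[OF g tempered_integral[OF schwartz_hermite_cfun]])
  show ?thesis unfolding herm_semigroup_def hermite_cfun_def[symmetric, THEN fun_cong, simplified]
    unfolding hermite_cfun_def[symmetric] by measurable
qed


theorem theorem1p1:
  fixes g :: "real^'n::finite \<Rightarrow> complex"
    and \<beta> :: real and p1 p2 q1 q2 :: ennreal
  assumes "schwartz g" and "g \<noteq> (\<lambda>_. 0)"
    and "\<beta> > 0"
    and "p1 > 0" and "p2 > 0" and "q1 > 0" and "q2 > 0"
  shows "\<exists>C0>0. \<forall>t>0. \<forall>f\<in>modsp g p1 q1.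
     mod_norm g p2 q2 (herm_semigroup \<beta> t f)
       \<le> ennreal (if t \<ge> 1 then C0 * exp (- t * real CARD('n) powr \<beta>)
                 else C0 * t powr (- (real CARD('n) / (2 * \<beta>) *
                        (max (inv_exp p2 - inv_exp p1) 0 + max (inv_exp q2 - inv_exp q1) 0))))
         * mod_norm g p1 q1 f"
proof -
  let ?d = "real CARD('n)"
  \<comment> \<open>Only the bracket of the exponent in the claim; the factor d / (2 \<beta>)
    appears at the end, from the power of \<tau>.\<close>
  define \<sigma> where "\<sigma> = max (inv_exp p2 - inv_exp p1) 0 + max (inv_exp q2 - inv_exp q1) 0"
  obtain M N where MN: "0 \<le> M" "0 \<le> N" and est: "\<And>C. (\<forall>n. 1 \<le> C n) \<Longrightarrow> (\<exists>D>0. \<forall>F H c s.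
     F \<in> borel_measurable borel \<longrightarrow> (\<forall>z. 0 \<le> F z) \<longrightarrow> (\<exists>A K. \<forall>z. F z \<le> A * (1 + norm z) powr K) \<longrightarrow>
     (\<forall>n\<ge>0. \<forall>z. ennreal (F z) \<le> ennreal (C n) * (\<integral>\<^sup>+w. ennreal (F w * (1 + norm (z - w)) powr (-n)) \<partial>lborel)) \<longrightarrow>
     H \<in> borel_measurable borel \<longrightarrow> 0 < s \<longrightarrow> 0 \<le> c \<longrightarrow>
     (\<forall>z. ennreal (H z) \<le> ennreal (c * (1 + s * norm z) powr (-M)) * (\<integral>\<^sup>+w. ennreal (F w * (1 + norm (z - w)) powr (-N)) \<partial>lborel)) \<longrightarrow>
     LpN q2 (\<lambda>\<xi>. LpN p2 (\<lambda>x. ennreal (H (x, \<xi>)))) \<le> ennreal (D * c * s powr (- (?d * \<sigma>)))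
          * LpN q1 (\<lambda>\<xi>. LpN p1 (\<lambda>x. ennreal (F (x :: real^'n, \<xi> :: real^'n)))))"
    using mixed_norm_estimate[OF assms(4-7), where 'n='n] unfolding \<sigma>_def by blast
  \<comment> \<open>The kernel bound takes natural exponents; rounding up is harmless because all
    weights are at least 1.\<close>
  define M' where "M' = nat \<lceil>M\<rceil>"
  define N' where "N' = nat \<lceil>N\<rceil>"
  have le: "M \<le> real (2 * M')" "N \<le> real (2 * N')"
  proof -
    have "M \<le> real M'" "N \<le> real N'" unfolding M'_def N'_def by (rule real_nat_ceiling_ge)+
    then show "M \<le> real (2 * M')" "N \<le> real (2 * N')" by simp_all
  qed
  obtain C1 where C1: "0 \<le> C1" "\<And>t \<tau> c T z. regime \<beta> ?d t \<tau> c \<Longrightarrow> tempered T \<Longrightarrow>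
    ennreal (norm (herm_semigroup \<beta> t T (wpk g z))) \<le> ennreal (C1 * c * (1 + \<tau> * norm z) powr (- real (2 * M')))
      * (\<integral>\<^sup>+w. ennreal (norm (T (wpk g w)) * (1 + norm (z - w)) powr (- real (2 * N'))) \<partial>lborel)"
    using herm_semigroup_bound[OF assms(1-3), of M' N'] by blast
  \<comment> \<open>Totalises the choice of constants: \<open>mixed_norm_estimate\<close> asks for a
    constant at least 1 at every real n, while self-domination is available for nonnegative
    n.\<close>
  define P where "P n C \<longleftrightarrow> 1 \<le> C \<and> (0 \<le> n \<longrightarrow> (\<forall>T z. tempered T \<longrightarrow>
    ennreal (norm (T (wpk g z))) \<le> ennreal C * (\<integral>\<^sup>+w. ennreal (norm (T (wpk g w)) * (1 + norm (z - w)) powr (-n)) \<partial>lborel)))" for n C :: real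
  have "\<exists>C. P n C" for n
  proof (cases "0 \<le> n")
    case True
    show ?thesis using stft_self_bound[OF assms(1,2) True] unfolding P_def by blast
  next
    case False
    then have "P n 1" by (simp add: P_def)
    then show ?thesis ..
  qed
  then obtain Cn where PC: "P n (Cn n)" for n by metis
  have Cn: "\<And>n. 1 \<le> Cn n" "\<And>n T z. 0 \<le> n \<Longrightarrow> tempered T \<Longrightarrow>
    ennreal (norm (T (wpk g z))) \<le> ennreal (Cn n) * (\<integral>\<^sup>+w. ennreal (norm (T (wpk g w)) * (1 + norm (z - w)) powr (-n)) \<partial>lborel)"
    using PC unfolding P_def by blast+
  obtain D where D0: "0 < D" and D1: "\<forall>F H c s.
     F \<in> borel_measurable borel \<longrightarrow> (\<forall>z. 0 \<le> F z) \<longrightarrow> (\<exists>A K. \<forall>z. F z \<le> A * (1 + norm z) powr K) \<longrightarrow>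
     (\<forall>n\<ge>0. \<forall>z. ennreal (F z) \<le> ennreal (Cn n) * (\<integral>\<^sup>+w. ennreal (F w * (1 + norm (z - w)) powr (-n)) \<partial>lborel)) \<longrightarrow>
     H \<in> borel_measurable borel \<longrightarrow> 0 < s \<longrightarrow> 0 \<le> c \<longrightarrow>
     (\<forall>z. ennreal (H z) \<le> ennreal (c * (1 + s * norm z) powr (-M)) * (\<integral>\<^sup>+w. ennreal (F w * (1 + norm (z - w)) powr (-N)) \<partial>lborel)) \<longrightarrow>
     LpN q2 (\<lambda>\<xi>. LpN p2 (\<lambda>x. ennreal (H (x, \<xi>)))) \<le> ennreal (D * c * s powr (- (?d * \<sigma>)))
          * LpN q1 (\<lambda>\<xi>. LpN p1 (\<lambda>x. ennreal (F (x :: real^'n, \<xi> :: real^'n))))"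
    using est[of Cn, OF allI[OF Cn(1)]] by (elim exE conjE) (rule that)
  \<comment> \<open>The summand 1 keeps \<open>C0\<close> positive even if \<open>C1\<close> is
    0.\<close>
  define C0 where "C0 = D * (C1 + 1)"
  have stft: "stft g T x \<xi> = T (wpk g (x, \<xi>))" for T x \<xi>
    by (simp add: stft_def wpk_def wpack_def[abs_def])
  have main: "mod_norm g p2 q2 (herm_semigroup \<beta> t T) \<le> ennreal (D * (C1 * c) * \<tau> powr (- (?d * \<sigma>))) * mod_norm g p1 q1 T"
    if R: "regime \<beta> ?d t \<tau> c" and T: "tempered T" for t \<tau> c T
    unfolding mod_norm_def stft
  proof (rule D1[rule_format, of "\<lambda>z. norm (T (wpk g z))" "\<lambda>z. norm (herm_semigroup \<beta> t T (wpk g z))" \<tau> "C1 * c"])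
    note r = regimeD[OF R assms(3)]
    have Vm [measurable]: "(\<lambda>w. T (wpk g w)) \<in> borel_measurable borel" by (intro borel_measurable_continuous_onI wpk_tempered assms T)
    show "(\<lambda>z. norm (T (wpk g z))) \<in> borel_measurable borel" by measurable
    show "\<exists>A K. \<forall>z. norm (T (wpk g z)) \<le> A * (1 + norm z) powr K"
    proof -
      obtain A and K :: nat where A: "\<And>z. norm (T (wpk g z)) \<le> A * (1 + norm z) ^ K" using wpk_tempered(2)[OF assms(1) T] by blast
      have "norm (T (wpk g z)) \<le> A * (1 + norm z) powr real K" for z
      proof -
        have "0 < 1 + norm z" by (simp add: add_pos_nonneg)
        from powr_realpow[OF this, of K] A[of z] show ?thesis by simp
      qed
      then show ?thesis by blast
    qed
    show "(\<lambda>z. norm (herm_semigroup \<beta> t T (wpk g z))) \<in> borel_measurable borel"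
      using herm_semigroup_measurable[OF assms(1), of \<beta> t T] by measurable
    show "0 < \<tau>" "0 \<le> C1 * c" using r C1 by auto
    show "ennreal (norm (herm_semigroup \<beta> t T (wpk g z))) \<le> ennreal (C1 * c * (1 + \<tau> * norm z) powr (-M)) * (\<integral>\<^sup>+w. ennreal (norm (T (wpk g w)) * (1 + norm (z - w)) powr (-N)) \<partial>lborel)" for z
    proof (rule order_trans[OF C1(2)[OF R T] mult_mono])
      have "(1 + \<tau> * norm z) powr (- real (2 * M')) \<le> (1 + \<tau> * norm z) powr (- M)"
        using le r by (intro powr_mono) auto
      then show "ennreal (C1 * c * (1 + \<tau> * norm z) powr (- real (2 * M'))) \<le> ennreal (C1 * c * (1 + \<tau> * norm z) powr (- M))"
        using C1 r by (intro ennreal_leI mult_left_mono) auto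
      show "(\<integral>\<^sup>+w. ennreal (norm (T (wpk g w)) * (1 + norm (z - w)) powr (- real (2 * N'))) \<partial>lborel) \<le> (\<integral>\<^sup>+w. ennreal (norm (T (wpk g w)) * (1 + norm (z - w)) powr (-N)) \<partial>lborel)"
        using le by (intro nn_integral_mono ennreal_leI mult_left_mono powr_weight_antimono) auto
    qed auto
  qed (use Cn(2)[OF _ T] in auto)
  have "mod_norm g p2 q2 (herm_semigroup \<beta> t f) \<le> ennreal (if t \<ge> 1 then C0 * exp (- t * ?d powr \<beta>) else C0 * t powr (- (?d / (2 * \<beta>) * \<sigma>))) * mod_norm g p1 q1 f"
    if t: "0 < t" and f: "f \<in> modsp g p1 q1" for t f
  proof -
    have T: "tempered f" using f by (simp add: modsp_def)
    have C01: "D * C1 \<le> C0" using D0 by (simp add: C0_def)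
    show ?thesis
    proof (cases "1 \<le> t")
      case True
      have "regime \<beta> ?d t 1 (exp (- t * ?d powr \<beta>))" using True by (simp add: regime_def)
      from main[OF this T] have "mod_norm g p2 q2 (herm_semigroup \<beta> t f) \<le> ennreal (D * C1 * exp (- t * ?d powr \<beta>)) * mod_norm g p1 q1 f"
        by (simp add: mult.assoc)
      also have "\<dots> \<le> ennreal (C0 * exp (- t * ?d powr \<beta>)) * mod_norm g p1 q1 f"
        using C01 by (intro mult_right_mono ennreal_leI) auto
      finally show ?thesis using True by simp
    next
      case False
      \<comment> \<open>With \<tau> = t^(1/(2 \<beta>)) the power of \<tau> in \<open>main\<close>
        becomes the claimed power of t.\<close>
      have "regime \<beta> ?d t (t powr (1 / (2 * \<beta>))) 1" using False t by (simp add: regime_def)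
      from main[OF this T] have "mod_norm g p2 q2 (herm_semigroup \<beta> t f) \<le> ennreal (D * C1 * t powr (- (?d / (2 * \<beta>) * \<sigma>))) * mod_norm g p1 q1 f"
        by (simp add: powr_powr)
      also have "\<dots> \<le> ennreal (C0 * t powr (- (?d / (2 * \<beta>) * \<sigma>))) * mod_norm g p1 q1 f"
        using C01 by (intro mult_right_mono ennreal_leI) auto
      finally show ?thesis using False by simp
    qed
  qed
  moreover have "0 < C0" using D0 C1(1) by (simp add: C0_def)
  ultimately show ?thesis unfolding \<sigma>_def by blast
qed

end
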